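(* Let $\ell$ be a non-degenerate left integral in the symmetrized Hopf algebroid $\mathcal A=(\mathcal A_L,\mathcal A_R,S)$. Put $\lambda^*=\ell_R^{-1}(1_A)$, $\xi(a)=S((\lambda^*\leftharpoonup\ell)\rightharpoonup a)$ (a ring anti-automorphism of $A$), $\mu=\pi_R\circ t_L:L^{op}\to R$ (a ring isomorphism) and $\kappa:R\to R$, $\kappa(r)=\lambda^*(\ell t_R(r))$ (a ring automorphism). Then $\mathcal A_{*L}^\ell=(\mathcal A_*,R,s_{*L},t_{*L},\gamma_{*L},\pi_{*L})$ with $$s_{*L}(r)(a)=\mu^{-1}(r)\pi_L(a),\qquad t_{*L}(r)(a)=\pi_L\bigl(a\,t_R(\kappa^{-1}(r))\bigr),$$ $$\gamma_{*L}(\phi)=\xi^{-2}(\ell_{(2)})\rightharpoonup\phi\otimes\ell_L^{-1}(\ell_{(1)}),\qquad\pi_{*L}(\phi)=\lambda^*(\ell\leftharpoonup\phi)$$ is a left bialgebroid, and $\mathcal A_{*L}^\ell$, the dual right bialgebroid $\mathcal A_{*R}$ over $L$, and the antipode $S_*^\ell:=\ell_L^{-1}\circ\xi\circ\ell_L:\mathcal A_*\to\mathcal A_*$ form a symmetrized Hopf algebroid $\mathcal A_*^\ell=(\mathcal A_{*L}^\ell,\mathcal A_{*R},S_*^\ell)$.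
   Context: All rings are associative and unital. A left bialgebroid $\mathcal A_L=(A,L,s_L,t_L,\gamma_L,\pi_L)$: ring homomorphisms $s_L:L\to A$, $t_L:L^{op}\to A$ with commuting images; $A$ is an $L$-$L$-bimodule via $l\cdot a\cdot l'=s_L(l)t_L(l')a$ (left and right modules ${}_LA$, $A_L$) and a comonoid in $L$-$L$-bimodules via $\gamma_L(a)=a_{(1)}\otimes a_{(2)}\in A_L\otimes{}_LA$, $\pi_L:A\to L$; moreover $a_{(1)}t_L(l)\otimes a_{(2)}=a_{(1)}\otimes a_{(2)}s_L(l)$, $\gamma_L$ is unital and multiplicative, $\pi_L(1)=1$, $\pi_L(as_L(\pi_L(b)))=\pi_L(ab)=\pi_L(at_L(\pi_L(b)))$. A right bialgebroid $\mathcal A_R=(A,R,s_R,t_R,\gamma_R,\pi_R)$: ring homomorphisms $s_R:R\to A$, $t_R:R^{op}\to A$ with commuting images; $A$ is an $R$-$R$-bimodule via $r\cdot a\cdot r'=as_R(r')t_R(r)$ (left and right modules ${}^RA$, $A^R$) and a comonoid in $R$-$R$-bimodules via $\gamma_R(a)=a^{(1)}\otimes a^{(2)}\in A^R\otimes{}^RA$, $\pi_R:A\to R$; moreover $s_R(r)a^{(1)}\otimes a^{(2)}=a^{(1)}\otimes t_R(r)a^{(2)}$, $\gamma_R$ is unital and multiplicative, $\pi_R(1)=1$, $\pi_R(s_R(\pi_R(a))b)=\pi_R(ab)=\pi_R(t_R(\pi_R(a))b)$. A symmetrized Hopf algebroid is a triple $(\mathcal A_L,\mathcal A_R,S)$ of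 a left and a right bialgebroid on the same total ring $A$ with $R\simeq L^{op}$, and a bijection $S:A\to A$ of additive groups, such that: $s_L(L)=t_R(R)$, $t_L(L)=s_R(R)$; $(\gamma_L\otimes\mathrm{id})\gamma_R=(\mathrm{id}\otimes\gamma_R)\gamma_L$, $(\gamma_R\otimes\mathrm{id})\gamma_L=(\mathrm{id}\otimes\gamma_L)\gamma_R$; $S(t_L(l)at_L(l'))=s_L(l')S(a)s_L(l)$, $S(t_R(r')at_R(r))=s_R(r)S(a)s_R(r')$; $S(a_{(1)})a_{(2)}=s_R\pi_R(a)$, $a^{(1)}S(a^{(2)})=s_L\pi_L(a)$. ($S$ is then automatically a ring anti-automorphism.) Duals: $\mathcal A^*=\mathrm{Hom}(A^R,R^R)$ and ${}^*\mathcal A=\mathrm{Hom}({}^RA,{}^RR)$ act on $A$ by $\phi\rightharpoonup a=a^{(2)}t_R(\phi(a^{(1)}))$ ($\phi\in\mathcal A^*$), $\phi\rightharpoondown a=a^{(1)}s_R(\phi(a^{(2)}))$ ($\phi\in{}^*\mathcal A$), and $(\phi\leftharpoonup a)(b)=\phi(ab)$ for $\phi\in\mathcal A^*$. A left integral is an $\ell\in A$ with $a\ell=s_L(\pi_L(a))\ell$ for all $a$; it is non-degenerate if both $\ell_R:\mathcal A^*\to A$, $\phi\mapsto\phi\rightharpoonup\ell$, and ${}_R\ell:{}^*\mathcal A\to A$, $\phi\mapsto\phi\rightharpoondown\ell$, are bijective. $\mathcal A_*=\mathrm{Hom}(A_L,L_L)$ is a ring via $(\phi\psi)(a)=\psi(s_L(\phi(a_{(1)}))a_{(2)})$,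 with $(a\rightharpoonup\phi)(b)=\phi(ba)$ and right action on $A$: $a\leftharpoonup\phi=s_L(\phi(a_{(1)}))a_{(2)}$. If $\ell$ is a non-degenerate left integral then $\ell_L:\mathcal A_*\to A$, $\phi\mapsto\ell\leftharpoonup\phi$, is bijective, $A_L$ is finitely generated projective, and $\mathcal A_*$ is the total ring of the dual right bialgebroid $\mathcal A_{*R}$ over $L$ with $s_{*R}(l)(a)=\pi_L(as_L(l))$, $t_{*R}(l)(a)=l\pi_L(a)$, $\gamma_{*R}(\phi)=\ell_{(1)}\rightharpoonup\phi\otimes\ell_L^{-1}(\ell_{(2)})$, $\pi_{*R}(\phi)=\phi(1_A)$. *)

theory Defs
  imports "HOL-Algebra.Algebra"
begin

section \<open>Opposite rings\<close>

definition opposite_ring :: "('a, 'm) ring_scheme \<Rightarrow> ('a, 'm) ring_scheme" where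
  "opposite_ring A = A\<lparr>monoid.mult := (\<lambda>x y. y \<otimes>\<^bsub>A\<^esub> x)\<rparr>"

section \<open>Tensor products over noncommutative rings\<close>

text \<open>
  The additive group of a ring or module is the one of a ring record, whose multiplication is
  irrelevant here.  A tensor product is a factor group of a free abelian group, hence it is written
  multiplicatively, and its elements are cosets of formal integer combinations of pairs (triples).
\<close>

definition tensor_relators ::
  "'b set \<Rightarrow> ('m, 'k) ring_scheme \<Rightarrow> ('m \<Rightarrow> 'b \<Rightarrow> 'm) \<Rightarrow> ('b \<Rightarrow> 'n \<Rightarrow> 'n) \<Rightarrow> ('n, 'l) ring_scheme
    \<Rightarrow> ('m \<times> 'n \<Rightarrow>\<^sub>0 int) set" where
  "tensor_relators B M ract lact N =
     {frag_of (x \<oplus>\<^bsub>M\<^esub> x', y) - frag_of (x, y) - frag_of (x', y) | x x' y.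
        x \<in> carrier M \<and> x' \<in> carrier M \<and> y \<in> carrier N} \<union>
     {frag_of (x, y \<oplus>\<^bsub>N\<^esub> y') - frag_of (x, y) - frag_of (x, y') | x y y'.
        x \<in> carrier M \<and> y \<in> carrier N \<and> y' \<in> carrier N} \<union>
     {frag_of (ract x b, y) - frag_of (x, lact b y) | x b y.
        x \<in> carrier M \<and> b \<in> B \<and> y \<in> carrier N}"

definition tensor ::
  "('b, 'j) ring_scheme \<Rightarrow> ('m, 'k) ring_scheme \<Rightarrow> ('m \<Rightarrow> 'b \<Rightarrow> 'm)
    \<Rightarrow> ('b \<Rightarrow> 'n \<Rightarrow> 'n) \<Rightarrow> ('n, 'l) ring_scheme \<Rightarrow> ('m \<times> 'n \<Rightarrow>\<^sub>0 int) set monoid" where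
  "tensor B M ract lact N =
     (let F = free_Abelian_group (carrier M \<times> carrier N)
      in F Mod generate F (tensor_relators (carrier B) M ract lact N))"

text \<open>
  The threefold product of a right B-module M, a B-C-bimodule N and a left C-module P, without
  choosing a bracketing.
\<close>

definition tensor3_relators ::
  "'b set \<Rightarrow> 'c set \<Rightarrow> ('m, 'k) ring_scheme \<Rightarrow> ('m \<Rightarrow> 'b \<Rightarrow> 'm)
    \<Rightarrow> ('b \<Rightarrow> 'n \<Rightarrow> 'n) \<Rightarrow> ('n, 'l) ring_scheme \<Rightarrow> ('n \<Rightarrow> 'c \<Rightarrow> 'n)
    \<Rightarrow> ('c \<Rightarrow> 'p \<Rightarrow> 'p) \<Rightarrow> ('p, 'o) ring_scheme \<Rightarrow> ('m \<times> 'n \<times> 'p \<Rightarrow>\<^sub>0 int) set" where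
  "tensor3_relators B C M ractM lactN N ractN lactP P =
     {frag_of (x \<oplus>\<^bsub>M\<^esub> x', y, z) - frag_of (x, y, z) - frag_of (x', y, z) | x x' y z.
        x \<in> carrier M \<and> x' \<in> carrier M \<and> y \<in> carrier N \<and> z \<in> carrier P} \<union>
     {frag_of (x, y \<oplus>\<^bsub>N\<^esub> y', z) - frag_of (x, y, z) - frag_of (x, y', z) | x y y' z.
        x \<in> carrier M \<and> y \<in> carrier N \<and> y' \<in> carrier N \<and> z \<in> carrier P} \<union>
     {frag_of (x, y, z \<oplus>\<^bsub>P\<^esub> z') - frag_of (x, y, z) - frag_of (x, y, z') | x y z z'.
        x \<in> carrier M \<and> y \<in> carrier N \<and> z \<in> carrier P \<and> z' \<in> carrier P} \<union>
     {frag_of (ractM x b, y, z) - frag_of (x, lactN b y, z) | x b y z.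
        x \<in> carrier M \<and> b \<in> B \<and> y \<in> carrier N \<and> z \<in> carrier P} \<union>
     {frag_of (x, ractN y c, z) - frag_of (x, y, lactP c z) | x y c z.
        x \<in> carrier M \<and> y \<in> carrier N \<and> c \<in> C \<and> z \<in> carrier P}"

definition tensor3 ::
  "('b, 'i) ring_scheme \<Rightarrow> ('c, 'j) ring_scheme \<Rightarrow> ('m, 'k) ring_scheme \<Rightarrow> ('m \<Rightarrow> 'b \<Rightarrow> 'm)
    \<Rightarrow> ('b \<Rightarrow> 'n \<Rightarrow> 'n) \<Rightarrow> ('n, 'l) ring_scheme \<Rightarrow> ('n \<Rightarrow> 'c \<Rightarrow> 'n)
    \<Rightarrow> ('c \<Rightarrow> 'p \<Rightarrow> 'p) \<Rightarrow> ('p, 'o) ring_scheme \<Rightarrow> ('m \<times> 'n \<times> 'p \<Rightarrow>\<^sub>0 int) set monoid" where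
  "tensor3 B C M ractM lactN N ractN lactP P =
     (let F = free_Abelian_group (carrier M \<times> carrier N \<times> carrier P)
      in F Mod generate F
           (tensor3_relators (carrier B) (carrier C) M ractM lactN N ractN lactP P))"

text \<open>
  The pure tensor of a pair or triple in T.  The unit of a factor group is the subgroup that was
  factored out, so this is the coset of the generator.
\<close>

definition tens :: "('x \<Rightarrow>\<^sub>0 int) set monoid \<Rightarrow> 'x \<Rightarrow> ('x \<Rightarrow>\<^sub>0 int) set" where
  "tens T p = r_coset (free_Abelian_group UNIV) \<one>\<^bsub>T\<^esub> (frag_of p)"

definition frag_eval :: "('g, 'm) monoid_scheme \<Rightarrow> ('x \<Rightarrow> 'g) \<Rightarrow> ('x \<Rightarrow>\<^sub>0 int) \<Rightarrow> 'g" where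
  "frag_eval G f c = finprod G (\<lambda>p. f p [^]\<^bsub>G\<^esub> Poly_Mapping.lookup c p) (Poly_Mapping.keys c)"

text \<open>
  The homomorphism to the (multiplicatively written) abelian group G induced on a tensor product by
  a balanced f, applied to a coset W.  All representatives of W are evaluated to the same element
  of G exactly when this makes sense.  This is how Sweedler's notation is rendered: an expression
  in the components of the element W is the lift, applied to W, of that expression.
\<close>

definition tlift :: "('g, 'm) monoid_scheme \<Rightarrow> ('x \<Rightarrow> 'g) \<Rightarrow> ('x \<Rightarrow>\<^sub>0 int) set \<Rightarrow> 'g" where
  "tlift G f W = the_elem (frag_eval G f ` W)"

section \<open>Comonoids in bimodules\<close>

locale bimodule = B: ring B + M: abelian_group M
  for B :: "('b, 'k) ring_scheme" and M :: "('m, 'l) ring_scheme" +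
  fixes lact :: "'b \<Rightarrow> 'm \<Rightarrow> 'm" and ract :: "'m \<Rightarrow> 'b \<Rightarrow> 'm"
  assumes lact_closed: "\<lbrakk>b \<in> carrier B; x \<in> carrier M\<rbrakk> \<Longrightarrow> lact b x \<in> carrier M"
    and ract_closed: "\<lbrakk>b \<in> carrier B; x \<in> carrier M\<rbrakk> \<Longrightarrow> ract x b \<in> carrier M"
    and lact_add: "\<lbrakk>b \<in> carrier B; x \<in> carrier M; y \<in> carrier M\<rbrakk>
          \<Longrightarrow> lact b (x \<oplus>\<^bsub>M\<^esub> y) = lact b x \<oplus>\<^bsub>M\<^esub> lact b y"
    and ract_add: "\<lbrakk>b \<in> carrier B; x \<in> carrier M; y \<in> carrier M\<rbrakk>
          \<Longrightarrow> ract (x \<oplus>\<^bsub>M\<^esub> y) b = ract x b \<oplus>\<^bsub>M\<^esub> ract y b"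
    and add_lact: "\<lbrakk>b \<in> carrier B; c \<in> carrier B; x \<in> carrier M\<rbrakk>
          \<Longrightarrow> lact (b \<oplus>\<^bsub>B\<^esub> c) x = lact b x \<oplus>\<^bsub>M\<^esub> lact c x"
    and add_ract: "\<lbrakk>b \<in> carrier B; c \<in> carrier B; x \<in> carrier M\<rbrakk>
          \<Longrightarrow> ract x (b \<oplus>\<^bsub>B\<^esub> c) = ract x b \<oplus>\<^bsub>M\<^esub> ract x c"
    and lact_assoc: "\<lbrakk>b \<in> carrier B; c \<in> carrier B; x \<in> carrier M\<rbrakk>
          \<Longrightarrow> lact (b \<otimes>\<^bsub>B\<^esub> c) x = lact b (lact c x)"
    and ract_assoc: "\<lbrakk>b \<in> carrier B; c \<in> carrier B; x \<in> carrier M\<rbrakk>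
          \<Longrightarrow> ract x (b \<otimes>\<^bsub>B\<^esub> c) = ract (ract x b) c"
    and lact_one: "x \<in> carrier M \<Longrightarrow> lact \<one>\<^bsub>B\<^esub> x = x"
    and ract_one: "x \<in> carrier M \<Longrightarrow> ract x \<one>\<^bsub>B\<^esub> = x"
    and lact_ract: "\<lbrakk>b \<in> carrier B; c \<in> carrier B; x \<in> carrier M\<rbrakk>
          \<Longrightarrow> ract (lact b x) c = lact b (ract x c)"

locale bimodule_comonoid = bimodule B M lact ract
  for B :: "('b, 'k) ring_scheme" and M :: "('m, 'l) ring_scheme"
    and lact :: "'b \<Rightarrow> 'm \<Rightarrow> 'm" and ract :: "'m \<Rightarrow> 'b \<Rightarrow> 'm" +
  fixes comul :: "'m \<Rightarrow> ('m \<times> 'm \<Rightarrow>\<^sub>0 int) set" and eps :: "'m \<Rightarrow> 'b"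
  assumes comul_hom: "comul \<in> hom (add_monoid M) (tensor B M ract lact M)"
    and comul_lact: "\<lbrakk>b \<in> carrier B; x \<in> carrier M\<rbrakk> \<Longrightarrow> comul (lact b x) =
          tlift (tensor B M ract lact M)
            (\<lambda>(u, v). tens (tensor B M ract lact M) (lact b u, v)) (comul x)"
    and comul_ract: "\<lbrakk>b \<in> carrier B; x \<in> carrier M\<rbrakk> \<Longrightarrow> comul (ract x b) =
          tlift (tensor B M ract lact M)
            (\<lambda>(u, v). tens (tensor B M ract lact M) (u, ract v b)) (comul x)"
    and coassoc: "x \<in> carrier M \<Longrightarrow>
          (let T3 = tensor3 B B M ract lact M ract lact M
           in tlift T3 (\<lambda>(u, v). tlift T3 (\<lambda>(u', u''). tens T3 (u', u'', v)) (comul u)) (comul x)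
            = tlift T3 (\<lambda>(u, v). tlift T3 (\<lambda>(v', v''). tens T3 (u, v', v'')) (comul v)) (comul x))"
    and eps_hom: "eps \<in> hom (add_monoid M) (add_monoid B)"
    and eps_lact: "\<lbrakk>b \<in> carrier B; x \<in> carrier M\<rbrakk> \<Longrightarrow> eps (lact b x) = b \<otimes>\<^bsub>B\<^esub> eps x"
    and eps_ract: "\<lbrakk>b \<in> carrier B; x \<in> carrier M\<rbrakk> \<Longrightarrow> eps (ract x b) = eps x \<otimes>\<^bsub>B\<^esub> b"
    and eps_left: "x \<in> carrier M \<Longrightarrow>
          tlift (add_monoid M) (\<lambda>(u, v). lact (eps u) v) (comul x) = x"
    and eps_right: "x \<in> carrier M \<Longrightarrow>
          tlift (add_monoid M) (\<lambda>(u, v). ract u (eps v)) (comul x) = x"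

section \<open>Bialgebroids\<close>

record ('a, 'b) bialgebroid =
  total_ring :: "'a ring"
  base_ring :: "'b ring"
  src :: "'b \<Rightarrow> 'a"
  tgt :: "'b \<Rightarrow> 'a"
  comult :: "'a \<Rightarrow> ('a \<times> 'a \<Rightarrow>\<^sub>0 int) set"
  counit :: "'a \<Rightarrow> 'b"

text \<open>
  For a left bialgebroid the bimodule structure is by left multiplication, for a right bialgebroid
  by right multiplication: the left and right actions of the base are
  \<open>l a = s(l) a\<close>, \<open>a l = t(l) a\<close> and \<open>r a = a t(r)\<close>, \<open>a r = a s(r)\<close>, respectively.
\<close>

definition mult_left :: "'a ring \<Rightarrow> ('b \<Rightarrow> 'a) \<Rightarrow> 'b \<Rightarrow> 'a \<Rightarrow> 'a" where
  "mult_left A f b a = f b \<otimes>\<^bsub>A\<^esub> a"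

definition mult_right :: "'a ring \<Rightarrow> ('b \<Rightarrow> 'a) \<Rightarrow> 'a \<Rightarrow> 'b \<Rightarrow> 'a" where
  "mult_right A f a b = a \<otimes>\<^bsub>A\<^esub> f b"

abbreviation L_lact :: "('a, 'b) bialgebroid \<Rightarrow> 'b \<Rightarrow> 'a \<Rightarrow> 'a" where
  "L_lact H \<equiv> mult_left (total_ring H) (src H)"

abbreviation L_ract :: "('a, 'b) bialgebroid \<Rightarrow> 'a \<Rightarrow> 'b \<Rightarrow> 'a" where
  "L_ract H \<equiv> (\<lambda>a b. mult_left (total_ring H) (tgt H) b a)"

abbreviation R_lact :: "('a, 'b) bialgebroid \<Rightarrow> 'b \<Rightarrow> 'a \<Rightarrow> 'a" where
  "R_lact H \<equiv> (\<lambda>b a. mult_right (total_ring H) (tgt H) a b)"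

abbreviation R_ract :: "('a, 'b) bialgebroid \<Rightarrow> 'a \<Rightarrow> 'b \<Rightarrow> 'a" where
  "R_ract H \<equiv> mult_right (total_ring H) (src H)"

definition left_tensor :: "('a, 'b) bialgebroid \<Rightarrow> ('a \<times> 'a \<Rightarrow>\<^sub>0 int) set monoid" where
  "left_tensor H = tensor (base_ring H) (total_ring H) (L_ract H) (L_lact H) (total_ring H)"

definition right_tensor :: "('a, 'b) bialgebroid \<Rightarrow> ('a \<times> 'a \<Rightarrow>\<^sub>0 int) set monoid" where
  "right_tensor H = tensor (base_ring H) (total_ring H) (R_ract H) (R_lact H) (total_ring H)"

text \<open>
  Multiplicativity of the comultiplication needs the nested lifts in the given order: the inner one
  is balanced by associativity, the outer one by the Takeuchi condition.
\<close>

locale left_bialgebroid =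
  source: ring_hom_ring "base_ring H" "total_ring H" "src H" +
  target: ring_hom_ring "opposite_ring (base_ring H)" "total_ring H" "tgt H" +
  comonoid: bimodule_comonoid "base_ring H" "total_ring H" "L_lact H" "L_ract H" "comult H" "counit H"
  for H :: "('a, 'b) bialgebroid" +
  assumes src_tgt_commute: "\<lbrakk>l \<in> carrier (base_ring H); l' \<in> carrier (base_ring H)\<rbrakk> \<Longrightarrow>
        src H l \<otimes>\<^bsub>total_ring H\<^esub> tgt H l' = tgt H l' \<otimes>\<^bsub>total_ring H\<^esub> src H l"
    and takeuchi: "\<lbrakk>l \<in> carrier (base_ring H); a \<in> carrier (total_ring H)\<rbrakk> \<Longrightarrow>
        tlift (left_tensor H)
          (\<lambda>(x, y). tens (left_tensor H) (x \<otimes>\<^bsub>total_ring H\<^esub> tgt H l, y)) (comult H a)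
      = tlift (left_tensor H)
          (\<lambda>(x, y). tens (left_tensor H) (x, y \<otimes>\<^bsub>total_ring H\<^esub> src H l)) (comult H a)"
    and comult_one: "comult H \<one>\<^bsub>total_ring H\<^esub>
      = tens (left_tensor H) (\<one>\<^bsub>total_ring H\<^esub>, \<one>\<^bsub>total_ring H\<^esub>)"
    and comult_mult: "\<lbrakk>a \<in> carrier (total_ring H); b \<in> carrier (total_ring H)\<rbrakk> \<Longrightarrow>
        comult H (a \<otimes>\<^bsub>total_ring H\<^esub> b) =
        tlift (left_tensor H) (\<lambda>(u, v). tlift (left_tensor H)
            (\<lambda>(x, y). tens (left_tensor H) (x \<otimes>\<^bsub>total_ring H\<^esub> u, y \<otimes>\<^bsub>total_ring H\<^esub> v))
          (comult H a)) (comult H b)"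
    and counit_one: "counit H \<one>\<^bsub>total_ring H\<^esub> = \<one>\<^bsub>base_ring H\<^esub>"
    and counit_src: "\<lbrakk>a \<in> carrier (total_ring H); b \<in> carrier (total_ring H)\<rbrakk> \<Longrightarrow>
        counit H (a \<otimes>\<^bsub>total_ring H\<^esub> src H (counit H b)) = counit H (a \<otimes>\<^bsub>total_ring H\<^esub> b)"
    and counit_tgt: "\<lbrakk>a \<in> carrier (total_ring H); b \<in> carrier (total_ring H)\<rbrakk> \<Longrightarrow>
        counit H (a \<otimes>\<^bsub>total_ring H\<^esub> tgt H (counit H b)) = counit H (a \<otimes>\<^bsub>total_ring H\<^esub> b)"

locale right_bialgebroid =
  source: ring_hom_ring "base_ring H" "total_ring H" "src H" +
  target: ring_hom_ring "opposite_ring (base_ring H)" "total_ring H" "tgt H" +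
  comonoid: bimodule_comonoid "base_ring H" "total_ring H" "R_lact H" "R_ract H" "comult H" "counit H"
  for H :: "('a, 'b) bialgebroid" +
  assumes src_tgt_commute: "\<lbrakk>r \<in> carrier (base_ring H); r' \<in> carrier (base_ring H)\<rbrakk> \<Longrightarrow>
        src H r \<otimes>\<^bsub>total_ring H\<^esub> tgt H r' = tgt H r' \<otimes>\<^bsub>total_ring H\<^esub> src H r"
    and takeuchi: "\<lbrakk>r \<in> carrier (base_ring H); a \<in> carrier (total_ring H)\<rbrakk> \<Longrightarrow>
        tlift (right_tensor H)
          (\<lambda>(x, y). tens (right_tensor H) (src H r \<otimes>\<^bsub>total_ring H\<^esub> x, y)) (comult H a)
      = tlift (right_tensor H)
          (\<lambda>(x, y). tens (right_tensor H) (x, tgt H r \<otimes>\<^bsub>total_ring H\<^esub> y)) (comult H a)"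
    and comult_one: "comult H \<one>\<^bsub>total_ring H\<^esub>
      = tens (right_tensor H) (\<one>\<^bsub>total_ring H\<^esub>, \<one>\<^bsub>total_ring H\<^esub>)"
    and comult_mult: "\<lbrakk>a \<in> carrier (total_ring H); b \<in> carrier (total_ring H)\<rbrakk> \<Longrightarrow>
        comult H (a \<otimes>\<^bsub>total_ring H\<^esub> b) =
        tlift (right_tensor H) (\<lambda>(x, y). tlift (right_tensor H)
            (\<lambda>(u, v). tens (right_tensor H) (x \<otimes>\<^bsub>total_ring H\<^esub> u, y \<otimes>\<^bsub>total_ring H\<^esub> v))
          (comult H b)) (comult H a)"
    and counit_one: "counit H \<one>\<^bsub>total_ring H\<^esub> = \<one>\<^bsub>base_ring H\<^esub>"
    and counit_src: "\<lbrakk>a \<in> carrier (total_ring H); b \<in> carrier (total_ring H)\<rbrakk> \<Longrightarrow>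
        counit H (src H (counit H a) \<otimes>\<^bsub>total_ring H\<^esub> b) = counit H (a \<otimes>\<^bsub>total_ring H\<^esub> b)"
    and counit_tgt: "\<lbrakk>a \<in> carrier (total_ring H); b \<in> carrier (total_ring H)\<rbrakk> \<Longrightarrow>
        counit H (tgt H (counit H a) \<otimes>\<^bsub>total_ring H\<^esub> b) = counit H (a \<otimes>\<^bsub>total_ring H\<^esub> b)"

section \<open>Symmetrized Hopf algebroids\<close>

locale symmetrized_hopf_algebroid =
  L: left_bialgebroid HL + R: right_bialgebroid HR
  for HL :: "('a, 'l) bialgebroid" and HR :: "('a, 'r) bialgebroid" +
  fixes S :: "'a \<Rightarrow> 'a"
  assumes total_eq: "total_ring HR = total_ring HL"
    and base_iso: "base_ring HR \<simeq> opposite_ring (base_ring HL)"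
    and antipode_bij: "S \<in> iso (add_monoid (total_ring HL)) (add_monoid (total_ring HL))"
    and src_L_tgt_R: "src HL ` carrier (base_ring HL) = tgt HR ` carrier (base_ring HR)"
    and tgt_L_src_R: "tgt HL ` carrier (base_ring HL) = src HR ` carrier (base_ring HR)"
    and coassoc_LR: "a \<in> carrier (total_ring HL) \<Longrightarrow>
        (let T3 = tensor3 (base_ring HL) (base_ring HR)
                    (total_ring HL) (L_ract HL) (L_lact HL)
                    (total_ring HL) (R_ract HR) (R_lact HR) (total_ring HL)
         in tlift T3 (\<lambda>(x, y). tlift T3 (\<lambda>(u, v). tens T3 (u, v, y)) (comult HL x)) (comult HR a)
          = tlift T3 (\<lambda>(x, y). tlift T3 (\<lambda>(u, v). tens T3 (x, u, v)) (comult HR y)) (comult HL a))"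
    and coassoc_RL: "a \<in> carrier (total_ring HL) \<Longrightarrow>
        (let T3 = tensor3 (base_ring HR) (base_ring HL)
                    (total_ring HL) (R_ract HR) (R_lact HR)
                    (total_ring HL) (L_ract HL) (L_lact HL) (total_ring HL)
         in tlift T3 (\<lambda>(x, y). tlift T3 (\<lambda>(u, v). tens T3 (u, v, y)) (comult HR x)) (comult HL a)
          = tlift T3 (\<lambda>(x, y). tlift T3 (\<lambda>(u, v). tens T3 (x, u, v)) (comult HL y)) (comult HR a))"
    and antipode_tgt_L: "\<lbrakk>a \<in> carrier (total_ring HL);
          l \<in> carrier (base_ring HL); l' \<in> carrier (base_ring HL)\<rbrakk> \<Longrightarrow>
        S (tgt HL l \<otimes>\<^bsub>total_ring HL\<^esub> a \<otimes>\<^bsub>total_ring HL\<^esub> tgt HL l')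
          = src HL l' \<otimes>\<^bsub>total_ring HL\<^esub> S a \<otimes>\<^bsub>total_ring HL\<^esub> src HL l"
    and antipode_tgt_R: "\<lbrakk>a \<in> carrier (total_ring HL);
          r \<in> carrier (base_ring HR); r' \<in> carrier (base_ring HR)\<rbrakk> \<Longrightarrow>
        S (tgt HR r' \<otimes>\<^bsub>total_ring HL\<^esub> a \<otimes>\<^bsub>total_ring HL\<^esub> tgt HR r)
          = src HR r \<otimes>\<^bsub>total_ring HL\<^esub> S a \<otimes>\<^bsub>total_ring HL\<^esub> src HR r'"
    and antipode_left: "a \<in> carrier (total_ring HL) \<Longrightarrow>
        tlift (add_monoid (total_ring HL)) (\<lambda>(x, y). S x \<otimes>\<^bsub>total_ring HL\<^esub> y) (comult HL a)
          = src HR (counit HR a)"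
    and antipode_right: "a \<in> carrier (total_ring HL) \<Longrightarrow>
        tlift (add_monoid (total_ring HL)) (\<lambda>(x, y). x \<otimes>\<^bsub>total_ring HL\<^esub> S y) (comult HR a)
          = src HL (counit HL a)"

section \<open>Duals\<close>

text \<open>Module homomorphisms are made extensional, so that they form a set of functions on the carrier.\<close>

definition right_dual :: "('b, 'k) ring_scheme \<Rightarrow> ('m, 'l) ring_scheme \<Rightarrow> ('m \<Rightarrow> 'b \<Rightarrow> 'm)
    \<Rightarrow> ('m \<Rightarrow> 'b) set" where
  "right_dual B M ract = {\<phi> \<in> extensional (carrier M). \<phi> \<in> hom (add_monoid M) (add_monoid B) \<and>
     (\<forall>x\<in>carrier M. \<forall>b\<in>carrier B. \<phi> (ract x b) = \<phi> x \<otimes>\<^bsub>B\<^esub> b)}"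

definition left_dual :: "('b, 'k) ring_scheme \<Rightarrow> ('m, 'l) ring_scheme \<Rightarrow> ('b \<Rightarrow> 'm \<Rightarrow> 'm)
    \<Rightarrow> ('m \<Rightarrow> 'b) set" where
  "left_dual B M lact = {\<phi> \<in> extensional (carrier M). \<phi> \<in> hom (add_monoid M) (add_monoid B) \<and>
     (\<forall>x\<in>carrier M. \<forall>b\<in>carrier B. \<phi> (lact b x) = b \<otimes>\<^bsub>B\<^esub> \<phi> x)}"

subsection \<open>The duals of a right bialgebroid\<close>

definition upper_star_right :: "('a, 'r) bialgebroid \<Rightarrow> ('a \<Rightarrow> 'r) set" where
  "upper_star_right HR = right_dual (base_ring HR) (total_ring HR) (R_ract HR)"

definition upper_star_left :: "('a, 'r) bialgebroid \<Rightarrow> ('a \<Rightarrow> 'r) set" where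
  "upper_star_left HR = left_dual (base_ring HR) (total_ring HR) (R_lact HR)"

text \<open>\<open>\<phi> \<rightharpoonup> a\<close> for \<open>\<phi>\<close> in \<open>upper_star_right\<close>.\<close>

definition harpoon_up :: "('a, 'r) bialgebroid \<Rightarrow> ('a \<Rightarrow> 'r) \<Rightarrow> 'a \<Rightarrow> 'a" where
  "harpoon_up HR \<phi> a =
     tlift (add_monoid (total_ring HR)) (\<lambda>(x, y). y \<otimes>\<^bsub>total_ring HR\<^esub> tgt HR (\<phi> x)) (comult HR a)"

text \<open>\<open>\<phi> \<rightharpoondown> a\<close> for \<open>\<phi>\<close> in \<open>upper_star_left\<close>.\<close>

definition harpoon_down :: "('a, 'r) bialgebroid \<Rightarrow> ('a \<Rightarrow> 'r) \<Rightarrow> 'a \<Rightarrow> 'a" where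
  "harpoon_down HR \<phi> a =
     tlift (add_monoid (total_ring HR)) (\<lambda>(x, y). x \<otimes>\<^bsub>total_ring HR\<^esub> src HR (\<phi> y)) (comult HR a)"

text \<open>\<open>\<phi> \<leftharpoonup> a\<close>, that is \<open>b \<mapsto> \<phi> (a b)\<close>, and \<open>a \<rightharpoonup> \<phi>\<close>, that is \<open>b \<mapsto> \<phi> (b a)\<close>.\<close>

definition fun_harpoon :: "'a ring \<Rightarrow> ('a \<Rightarrow> 'b) \<Rightarrow> 'a \<Rightarrow> 'a \<Rightarrow> 'b" where
  "fun_harpoon A \<phi> a = (\<lambda>b\<in>carrier A. \<phi> (a \<otimes>\<^bsub>A\<^esub> b))"

definition harpoon_fun :: "'a ring \<Rightarrow> 'a \<Rightarrow> ('a \<Rightarrow> 'b) \<Rightarrow> 'a \<Rightarrow> 'b" where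
  "harpoon_fun A a \<phi> = (\<lambda>b\<in>carrier A. \<phi> (b \<otimes>\<^bsub>A\<^esub> a))"

subsection \<open>The dual right bialgebroid of a left bialgebroid\<close>

text \<open>\<open>a \<leftharpoonup> \<phi>\<close> for \<open>\<phi>\<close> in the carrier of \<open>lower_star\<close>.\<close>

definition act_lower_star :: "('a, 'l) bialgebroid \<Rightarrow> 'a \<Rightarrow> ('a \<Rightarrow> 'l) \<Rightarrow> 'a" where
  "act_lower_star HL a \<phi> =
     tlift (add_monoid (total_ring HL)) (\<lambda>(x, y). src HL (\<phi> x) \<otimes>\<^bsub>total_ring HL\<^esub> y) (comult HL a)"

definition lower_star :: "('a, 'l) bialgebroid \<Rightarrow> ('a \<Rightarrow> 'l) ring" where
  "lower_star HL =
     \<lparr>carrier = right_dual (base_ring HL) (total_ring HL) (L_ract HL),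
      monoid.mult = (\<lambda>\<phi> \<psi>. \<lambda>a\<in>carrier (total_ring HL). \<psi> (act_lower_star HL a \<phi>)),
      one = restrict (counit HL) (carrier (total_ring HL)),
      ring.zero = (\<lambda>a\<in>carrier (total_ring HL). \<zero>\<^bsub>base_ring HL\<^esub>),
      ring.add = (\<lambda>\<phi> \<psi>. \<lambda>a\<in>carrier (total_ring HL). \<phi> a \<oplus>\<^bsub>base_ring HL\<^esub> \<psi> a)\<rparr>"

definition ell_L :: "('a, 'l) bialgebroid \<Rightarrow> 'a \<Rightarrow> ('a \<Rightarrow> 'l) \<Rightarrow> 'a" where
  "ell_L HL ell \<phi> = act_lower_star HL ell \<phi>"

definition ell_L_inv :: "('a, 'l) bialgebroid \<Rightarrow> 'a \<Rightarrow> 'a \<Rightarrow> ('a \<Rightarrow> 'l)" where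
  "ell_L_inv HL ell = inv_into (carrier (lower_star HL)) (ell_L HL ell)"

text \<open>
  The comultiplication takes values in the tensor product formed with the other components, which
  is why the structure is first introduced with a dummy comultiplication.
\<close>

definition dual_right_pre :: "('a, 'l) bialgebroid \<Rightarrow> ('a \<Rightarrow> 'l, 'l) bialgebroid" where
  "dual_right_pre HL =
     \<lparr>total_ring = lower_star HL,
      base_ring = base_ring HL,
      src = (\<lambda>l. \<lambda>a\<in>carrier (total_ring HL). counit HL (a \<otimes>\<^bsub>total_ring HL\<^esub> src HL l)),
      tgt = (\<lambda>l. \<lambda>a\<in>carrier (total_ring HL). l \<otimes>\<^bsub>base_ring HL\<^esub> counit HL a),
      comult = (\<lambda>_. {}),
      counit = (\<lambda>\<phi>. \<phi> \<one>\<^bsub>total_ring HL\<^esub>)\<rparr>"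

definition dual_right :: "('a, 'l) bialgebroid \<Rightarrow> 'a \<Rightarrow> ('a \<Rightarrow> 'l, 'l) bialgebroid" where
  "dual_right HL ell =
     (let T = right_tensor (dual_right_pre HL)
      in (dual_right_pre HL)\<lparr>comult := (\<lambda>\<phi>.
           tlift T (\<lambda>(x, y). tens T (harpoon_fun (total_ring HL) x \<phi>, ell_L_inv HL ell y))
             (comult HL ell))\<rparr>)"

section \<open>Integrals\<close>

definition left_integral :: "('a, 'l) bialgebroid \<Rightarrow> 'a \<Rightarrow> bool" where
  "left_integral HL ell \<longleftrightarrow> ell \<in> carrier (total_ring HL) \<and>
     (\<forall>a\<in>carrier (total_ring HL).
        a \<otimes>\<^bsub>total_ring HL\<^esub> ell = src HL (counit HL a) \<otimes>\<^bsub>total_ring HL\<^esub> ell)"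

definition nondegenerate_left_integral ::
    "('a, 'l) bialgebroid \<Rightarrow> ('a, 'r) bialgebroid \<Rightarrow> 'a \<Rightarrow> bool" where
  "nondegenerate_left_integral HL HR ell \<longleftrightarrow> left_integral HL ell \<and>
     bij_betw (\<lambda>\<phi>. harpoon_up HR \<phi> ell) (upper_star_right HR) (carrier (total_ring HR)) \<and>
     bij_betw (\<lambda>\<phi>. harpoon_down HR \<phi> ell) (upper_star_left HR) (carrier (total_ring HR))"

definition lam_star :: "('a, 'r) bialgebroid \<Rightarrow> 'a \<Rightarrow> ('a \<Rightarrow> 'r)" where
  "lam_star HR ell =
     inv_into (upper_star_right HR) (\<lambda>\<phi>. harpoon_up HR \<phi> ell) \<one>\<^bsub>total_ring HR\<^esub>"

definition xi :: "('a, 'r) bialgebroid \<Rightarrow> ('a \<Rightarrow> 'a) \<Rightarrow> 'a \<Rightarrow> 'a \<Rightarrow> 'a" where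
  "xi HR S ell a = S (harpoon_up HR (fun_harpoon (total_ring HR) (lam_star HR ell) ell) a)"

definition mu :: "('a, 'l) bialgebroid \<Rightarrow> ('a, 'r) bialgebroid \<Rightarrow> 'l \<Rightarrow> 'r" where
  "mu HL HR = counit HR \<circ> tgt HL"

definition kappa :: "('a, 'r) bialgebroid \<Rightarrow> 'a \<Rightarrow> 'r \<Rightarrow> 'r" where
  "kappa HR ell r = lam_star HR ell (ell \<otimes>\<^bsub>total_ring HR\<^esub> tgt HR r)"

section \<open>The dual left bialgebroid and antipode determined by a left integral\<close>

definition dual_left_pre :: "('a, 'l) bialgebroid \<Rightarrow> ('a, 'r) bialgebroid \<Rightarrow> 'a
    \<Rightarrow> ('a \<Rightarrow> 'l, 'r) bialgebroid" where
  "dual_left_pre HL HR ell =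
     \<lparr>total_ring = lower_star HL,
      base_ring = base_ring HR,
      src = (\<lambda>r. \<lambda>a\<in>carrier (total_ring HL).
        inv_into (carrier (base_ring HL)) (mu HL HR) r \<otimes>\<^bsub>base_ring HL\<^esub> counit HL a),
      tgt = (\<lambda>r. \<lambda>a\<in>carrier (total_ring HL).
        counit HL (a \<otimes>\<^bsub>total_ring HL\<^esub>
          tgt HR (inv_into (carrier (base_ring HR)) (kappa HR ell) r))),
      comult = (\<lambda>_. {}),
      counit = (\<lambda>\<phi>. lam_star HR ell (act_lower_star HL ell \<phi>))\<rparr>"

definition dual_left :: "('a, 'l) bialgebroid \<Rightarrow> ('a, 'r) bialgebroid \<Rightarrow> ('a \<Rightarrow> 'a) \<Rightarrow> 'a
    \<Rightarrow> ('a \<Rightarrow> 'l, 'r) bialgebroid" where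
  "dual_left HL HR S ell =
     (let T = left_tensor (dual_left_pre HL HR ell);
          xi_inv = inv_into (carrier (total_ring HL)) (xi HR S ell)
      in (dual_left_pre HL HR ell)\<lparr>comult := (\<lambda>\<phi>.
           tlift T (\<lambda>(x, y). tens T
               (harpoon_fun (total_ring HL) (xi_inv (xi_inv y)) \<phi>, ell_L_inv HL ell x))
             (comult HL ell))\<rparr>)"

definition dual_antipode :: "('a, 'l) bialgebroid \<Rightarrow> ('a, 'r) bialgebroid \<Rightarrow> ('a \<Rightarrow> 'a) \<Rightarrow> 'a
    \<Rightarrow> ('a \<Rightarrow> 'l) \<Rightarrow> ('a \<Rightarrow> 'l)" where
  "dual_antipode HL HR S ell = ell_L_inv HL ell \<circ> xi HR S ell \<circ> ell_L HL ell"

end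

theory Submission
  imports Defs
begin

text \<open>
  By non-degeneracy \<open>\<lambda>\<^sup>*\<close> is a Frobenius form: \<open>t\<^sub>R(\<lambda>\<^sup>*(_))\<close> and the right coproduct of
  the integral \<open>\<ell>\<close> recover every element of \<open>A\<close>. Hence every element of \<open>A\<^sub>*\<close> is \<open>\<phi>\<^sub>b = \<mu>\<inverse>
  \<lambda>\<^sup>*(_ b)\<close> for a unique \<open>b\<close>, and \<open>\<ell> \<leftharpoonup> \<phi>\<^sub>b = \<xi>(b)\<close>. The key identity is \<open>\<ell>\<^sub>1 c \<otimes> \<ell>\<^sub>2 = \<ell>\<^sub>1
  \<otimes> \<ell>\<^sub>2 \<xi>(c)\<close>. It shows that \<open>\<xi>\<close> is anti-multiplicative and bijective, and it gives the
  dual basis \<open>a = t\<^sub>L(\<psi>(a)) \<ell>\<^sub>1\<close> with \<open>\<psi> = \<ell>\<^sub>L\<inverse>(\<ell>\<^sub>2)\<close>. By the dual basis, tensors over the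
  dual are determined by their evaluations, where the comultiplication of the dual right
  bialgebroid becomes \<open>\<phi> \<mapsto> \<phi>(a b)\<close>; this yields its axioms. The dual left bialgebroid is
  the dual right one twisted by the anti-automorphism \<open>\<phi>\<^sub>b \<mapsto> \<phi>\<^bsub>\<xi> b\<^esub>\<close>, which is the
  antipode of the dual. In the coordinate \<open>b\<close> mixed coassociativity is the key identity
  again, and the antipode axioms follow from it together with \<open>\<lambda>\<^sup>* \<xi>\<^sup>2 = \<lambda>\<^sup>*(\<ell> S(s\<^sub>R
  \<lambda>\<^sup>*(_)))\<close>.
\<close>

section \<open>Sums over lists in commutative groups\<close>

text \<open>The obstacle is Sweedler's notation: an expression in components has a meaning only
  after it is shown to be balanced over one of the two base rings, and the axioms hold only for such
  expressions. Identities are therefore proved for all balanced functions into an arbitrary abelian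
  group, so that one lemma serves both in \<open>A\<close> and in tensor products. The axioms make
  \<open>S\<close> only additive, so its anti-multiplicativity is derived first. Each of the two
  contraction maps in the definition of non-degeneracy yields one Frobenius identity. The constants
  of the dual left bialgebroid come from transport along the antipode. The right coproduct of
  \<open>phi (\<xi> b)\<close>, sent back by the inverse antipode and flipped, carries the inverse
  of \<open>\<xi>\<close> twice on the second leg of the integral and a factor
  \<open>\<xi> b\<close> behind its first leg. The key identity moves that factor to the second leg
  as \<open>\<xi> (\<xi> b)\<close>, where the two inverses reduce it to \<open>b\<close>; this is
  the action of \<open>\<xi>\<close> inverted twice that the definition prescribes. On the base
  rings \<open>src HR\<close> after \<open>\<kappa>\<close> equals \<open>\<xi>\<close> after
  \<open>tgt HR\<close>, which is why the target map contains the inverse of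
  \<open>\<kappa>\<close>.\<close>

definition lsum :: "('g, 'm) monoid_scheme \<Rightarrow> ('x \<Rightarrow> 'g) \<Rightarrow> 'x list \<Rightarrow> 'g" where
  "lsum G f xs = foldr (\<lambda>p acc. f p \<otimes>\<^bsub>G\<^esub> acc) xs \<one>\<^bsub>G\<^esub>"

lemma lsum_Nil [simp]: "lsum G f [] = \<one>\<^bsub>G\<^esub>"
  and lsum_Cons [simp]: "lsum G f (p # xs) = f p \<otimes>\<^bsub>G\<^esub> lsum G f xs"
  by (simp_all add: lsum_def)

lemma lsum_map: "lsum G f (map h xs) = lsum G (\<lambda>p. f (h p)) xs"
  by (induction xs) simp_all

lemma lsum_cong: "(\<And>p. p \<in> set xs \<Longrightarrow> f p = g p) \<Longrightarrow> lsum G f xs = lsum G g xs"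
  by (induction xs) simp_all

context comm_group
begin

lemma lsum_closed [intro]: "(\<And>p. p \<in> set xs \<Longrightarrow> f p \<in> carrier G) \<Longrightarrow> lsum G f xs \<in> carrier G"
  by (induction xs) auto

lemma lsum_append:
  assumes "\<And>p. p \<in> set xs \<union> set ys \<Longrightarrow> f p \<in> carrier G"
  shows "lsum G f (xs @ ys) = lsum G f xs \<otimes> lsum G f ys"
  using assms by (induction xs) (auto simp: m_assoc lsum_closed)

lemma lsum_one: "lsum G (\<lambda>_. \<one>) xs = \<one>"
  by (induction xs) auto

lemma lsum_mult:
  assumes "\<And>p. p \<in> set xs \<Longrightarrow> f p \<in> carrier G" "\<And>p. p \<in> set xs \<Longrightarrow> g p \<in> carrier G"
  shows "lsum G (\<lambda>p. f p \<otimes> g p) xs = lsum G f xs \<otimes> lsum G g xs"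
  using assms
proof (induction xs)
  case (Cons p xs)
  then have "lsum G f xs \<in> carrier G" "lsum G g xs \<in> carrier G" by (auto intro!: lsum_closed)
  then show ?case using Cons by (simp add: m_ac)
qed simp

lemma lsum_inv:
  assumes "\<And>p. p \<in> set xs \<Longrightarrow> f p \<in> carrier G"
  shows "lsum G (\<lambda>p. inv (f p)) xs = inv (lsum G f xs)"
  using assms by (induction xs) (auto simp: inv_mult lsum_closed)

text \<open>Sweedler sums are computed over fixed lists of pure tensors, so every interchange of two
  of them is an instance of this rule.\<close>

lemma lsum_swap:
  assumes "\<And>p q. \<lbrakk>p \<in> set xs; q \<in> set ys\<rbrakk> \<Longrightarrow> f p q \<in> carrier G"
  shows "lsum G (\<lambda>p. lsum G (f p) ys) xs = lsum G (\<lambda>q. lsum G (\<lambda>p. f p q) xs) ys"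
  using assms
proof (induction xs)
  case Nil
  then show ?case by (simp add: lsum_one)
next
  case (Cons p xs)
  then show ?case by (simp add: lsum_mult lsum_closed)
qed

end

lemma hom_lsum:
  assumes "h \<in> hom G K" "group G" "group K" "\<And>p. p \<in> set xs \<Longrightarrow> f p \<in> carrier G"
  shows "h (lsum G f xs) = lsum K (\<lambda>p. h (f p)) xs"
proof -
  interpret G: group G by fact
  have "lsum G f xs \<in> carrier G \<and> h (lsum G f xs) = lsum K (\<lambda>p. h (f p)) xs"
    using assms(4)
    by (induction xs) (auto simp: hom_mult[OF assms(1)] hom_one[OF assms(1-3)])
  then show ?thesis ..
qed

section \<open>Groups presented by generators and relators\<close>

text \<open>Cancellation can shrink the support of a sum, so evaluations are compared over one
  common finite set of generators; the additional factors are powers with exponent zero.\<close>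

lemma frag_eval_superset:
  assumes "comm_group G" "finite K" "Poly_Mapping.keys c \<subseteq> K" "f \<in> K \<rightarrow> carrier G"
  shows "frag_eval G f c = finprod G (\<lambda>p. f p [^]\<^bsub>G\<^esub> Poly_Mapping.lookup c p) K"
proof -
  interpret comm_group G by fact
  show ?thesis unfolding frag_eval_def
    using assms by (intro finprod_mono_neutral_cong_left) (auto simp: in_keys_iff Pi_iff)
qed

lemma frag_eval_hom:
  assumes "comm_group G" "f \<in> Gens \<rightarrow> carrier G"
  shows "frag_eval G f \<in> hom (free_Abelian_group Gens) G"
proof -
  interpret G: comm_group G by fact
  show ?thesis
  proof (rule homI)
    fix x y assume "x \<in> carrier (free_Abelian_group Gens)" "y \<in> carrier (free_Abelian_group Gens)"
    then have xy: "Poly_Mapping.keys x \<subseteq> Gens" "Poly_Mapping.keys y \<subseteq> Gens" by auto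
    show "frag_eval G f x \<in> carrier G"
      unfolding frag_eval_def using xy assms(2) by (intro G.finprod_closed) auto
    let ?K = "Poly_Mapping.keys x \<union> Poly_Mapping.keys y"
    have f: "f \<in> ?K \<rightarrow> carrier G" using xy assms(2) by auto
    have "frag_eval G f (x + y) = finprod G (\<lambda>p. f p [^]\<^bsub>G\<^esub> Poly_Mapping.lookup (x + y) p) ?K"
      by (rule frag_eval_superset[OF assms(1)]) (use f Poly_Mapping.keys_add[of x y] in auto)
    also have "\<dots> = finprod G (\<lambda>p. f p [^]\<^bsub>G\<^esub> Poly_Mapping.lookup x p \<otimes>\<^bsub>G\<^esub> f p [^]\<^bsub>G\<^esub> Poly_Mapping.lookup y p) ?K"
      by (rule G.finprod_cong') (use f in \<open>simp_all add: Poly_Mapping.lookup_add G.int_pow_mult Pi_iff\<close>)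
    also have "\<dots> = frag_eval G f x \<otimes>\<^bsub>G\<^esub> frag_eval G f y"
      using f frag_eval_superset[OF assms(1), of ?K x f] frag_eval_superset[OF assms(1), of ?K y f]
      by (subst G.finprod_multf) auto
    finally show "frag_eval G f (x \<otimes>\<^bsub>free_Abelian_group Gens\<^esub> y) = frag_eval G f x \<otimes>\<^bsub>G\<^esub> frag_eval G f y"
      by simp
  qed
qed

lemma frag_eval_frag_of:
  assumes "comm_group G" "f p \<in> carrier G"
  shows "frag_eval G f (frag_of p) = f p"
proof -
  interpret comm_group G by fact
  show ?thesis using frag_eval_superset[OF assms(1), of "{p}" "frag_of p" f] assms(2)
    by (simp add: finprod_singleton)
qed

text \<open>Twofold and threefold tensor products differ only in generators and relators, so
  quotients, lifts and representation by lists are treated once for presented abelian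
  groups.\<close>

locale presented_group =
  fixes Gens :: "'x set" and Rel :: "('x \<Rightarrow>\<^sub>0 int) set"
  assumes Rel_sub: "Rel \<subseteq> carrier (free_Abelian_group Gens)"
begin

abbreviation "F \<equiv> free_Abelian_group Gens"
abbreviation "N \<equiv> generate F Rel"
abbreviation "T \<equiv> F Mod N"

sublocale F: comm_group F by (rule abelian_free_Abelian_group)

lemma N_normal: "N \<lhd> F"
  by (rule F.subgroup_imp_normal) (rule F.generate_is_subgroup[OF Rel_sub])

sublocale N: normal N F by (rule N_normal)

lemma comm_group_T: "comm_group T"
  by (rule F.abelian_FactGroup) (rule F.generate_is_subgroup[OF Rel_sub])

definition coset_of :: "('x \<Rightarrow>\<^sub>0 int) \<Rightarrow> ('x \<Rightarrow>\<^sub>0 int) set" where "coset_of c = N #>\<^bsub>F\<^esub> c"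

lemma coset_of_hom: "coset_of \<in> hom F T"
  using N.r_coset_hom_Mod unfolding coset_of_def by simp

lemma tens_eq: "tens T p = coset_of (frag_of p)"
  by (simp add: tens_def coset_of_def r_coset_def)

lemma coset_of_Rel:
  assumes "c \<in> Rel" shows "coset_of c = \<one>\<^bsub>T\<^esub>"
proof -
  have "N #>\<^bsub>F\<^esub> c = N"
    by (rule F.coset_join2[OF subsetD[OF Rel_sub assms] N.is_subgroup generate.incl[OF assms]])
  then show ?thesis by (simp add: coset_of_def)
qed

lemma carrier_T: "carrier T = coset_of ` carrier F"
  unfolding FactGroup_def RCOSETS_def coset_of_def by auto

lemma frag_eval_N:
  assumes "comm_group G" "f \<in> Gens \<rightarrow> carrier G" "\<And>c. c \<in> Rel \<Longrightarrow> frag_eval G f c = \<one>\<^bsub>G\<^esub>"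
    and "c \<in> N"
  shows "frag_eval G f c = \<one>\<^bsub>G\<^esub>"
proof -
  interpret G: comm_group G by fact
  interpret h: group_hom F G "frag_eval G f"
    by unfold_locales (rule frag_eval_hom[OF assms(1,2)])
  have "N \<subseteq> kernel F G (frag_eval G f)"
    by (rule F.generate_subgroup_incl[OF _ h.subgroup_kernel])
      (use Rel_sub assms(3) in \<open>auto simp: kernel_def simp del: carrier_free_Abelian_group_iff\<close>)
  then show ?thesis using assms(4) by (auto simp: kernel_def)
qed

text \<open>\<open>tlift\<close> takes \<open>the_elem\<close> of the set of values on all
  representatives. Two representatives differ by an element of \<open>N\<close>, which evaluates to
  the unit, so this set is a singleton.\<close>

lemma tlift_coset_of:
  assumes "comm_group G" "f \<in> Gens \<rightarrow> carrier G" "\<And>c. c \<in> Rel \<Longrightarrow> frag_eval G f c = \<one>\<^bsub>G\<^esub>"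
    and "c \<in> carrier F"
  shows "tlift G f (coset_of c) = frag_eval G f c"
proof -
  interpret G: comm_group G by fact
  interpret h: group_hom F G "frag_eval G f"
    by unfold_locales (rule frag_eval_hom[OF assms(1,2)])
  have "frag_eval G f d = frag_eval G f c" if "d \<in> coset_of c" for d
  proof -
    from that obtain n where n: "n \<in> N" "d = n \<otimes>\<^bsub>F\<^esub> c" by (auto simp: coset_of_def r_coset_def)
    have "n \<in> carrier F" using n(1) N.subset by blast
    have "frag_eval G f n = \<one>\<^bsub>G\<^esub>" using frag_eval_N[OF assms(1-3) n(1)] .
    then show ?thesis
      unfolding n(2) h.hom_mult[OF \<open>n \<in> carrier F\<close> assms(4)] using h.hom_closed[OF assms(4)] by simp
  qed
  moreover have "c \<in> coset_of c" unfolding coset_of_def by (rule F.rcos_self[OF assms(4) N.is_subgroup])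
  ultimately have "frag_eval G f ` coset_of c = {frag_eval G f c}" by blast
  then show ?thesis by (simp add: tlift_def)
qed

lemma tlift_hom:
  assumes "comm_group G" "f \<in> Gens \<rightarrow> carrier G" "\<And>c. c \<in> Rel \<Longrightarrow> frag_eval G f c = \<one>\<^bsub>G\<^esub>"
  shows "tlift G f \<in> hom T G"
proof -
  interpret h: group_hom F G "frag_eval G f"
    by (intro group_hom.intro group_hom_axioms.intro F.is_group comm_group.axioms(2)
        frag_eval_hom assms)
  show ?thesis
  proof (rule homI)
    fix x y assume "x \<in> carrier T" "y \<in> carrier T"
    then obtain c d where cd: "c \<in> carrier F" "d \<in> carrier F" "x = coset_of c" "y = coset_of d"
      by (auto simp: carrier_T)
    show "tlift G f x \<in> carrier G" using cd by (simp only: tlift_coset_of[OF assms] h.hom_closed)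
    have "x \<otimes>\<^bsub>T\<^esub> y = coset_of (c \<otimes>\<^bsub>F\<^esub> d)" using hom_mult[OF coset_of_hom cd(1,2)] cd by simp
    then show "tlift G f (x \<otimes>\<^bsub>T\<^esub> y) = tlift G f x \<otimes>\<^bsub>G\<^esub> tlift G f y"
      using cd h.hom_mult[OF cd(1,2)] F.m_closed[OF cd(1,2)] by (simp only: tlift_coset_of[OF assms])
  qed
qed

lemma tlift_tens:
  assumes "comm_group G" "f \<in> Gens \<rightarrow> carrier G" "\<And>c. c \<in> Rel \<Longrightarrow> frag_eval G f c = \<one>\<^bsub>G\<^esub>"
    and "p \<in> Gens"
  shows "tlift G f (tens T p) = f p"
  unfolding tens_eq using assms
  by (subst tlift_coset_of[OF assms(1-3)]) (auto intro!: frag_eval_frag_of)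

lemma tens_closed: "p \<in> Gens \<Longrightarrow> tens T p \<in> carrier T"
  unfolding tens_eq carrier_T by auto

lemma tlift_lsum:
  assumes "comm_group G" "f \<in> Gens \<rightarrow> carrier G" "\<And>c. c \<in> Rel \<Longrightarrow> frag_eval G f c = \<one>\<^bsub>G\<^esub>"
    and "set xs \<subseteq> Gens"
  shows "tlift G f (lsum T (tens T) xs) = lsum G f xs"
proof -
  interpret T: comm_group T by (rule comm_group_T)
  interpret G: comm_group G by fact
  have "tlift G f (lsum T (tens T) xs) = lsum G (\<lambda>p. tlift G f (tens T p)) xs"
    by (rule hom_lsum[OF tlift_hom[OF assms(1-3)]])
      (use assms in \<open>auto intro!: tens_closed T.is_group G.is_group\<close>)
  also have "\<dots> = lsum G f xs"
    by (rule lsum_cong) (use assms in \<open>auto intro!: tlift_tens\<close>)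
  finally show ?thesis .
qed

text \<open>The inverse of a generator is again the class of a generator, by \<open>neg\<close>, so
  a formal integer combination can be written as a product over a plain list.\<close>

lemma lsum_rep:
  assumes neg: "\<And>p. p \<in> Gens \<Longrightarrow> neg p \<in> Gens" "\<And>p. p \<in> Gens \<Longrightarrow> tens T (neg p) = inv\<^bsub>T\<^esub> tens T p"
    and W: "W \<in> carrier T"
  obtains xs where "set xs \<subseteq> Gens" "W = lsum T (tens T) xs"
proof -
  interpret T: comm_group T by (rule comm_group_T)
  interpret c: group_hom F T "coset_of" by unfold_locales (rule coset_of_hom)
  from W obtain c where c: "c \<in> carrier F" "W = coset_of c" by (auto simp: carrier_T)
  have "Poly_Mapping.keys c \<subseteq> Gens" using c(1) by simp
  then have "\<exists>xs. set xs \<subseteq> Gens \<and> coset_of c = lsum T (tens T) xs"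
  proof (rule free_Abelian_group_induct)
    have "coset_of 0 = \<one>\<^bsub>T\<^esub>" using c.hom_one by simp
    then show "\<exists>xs. set xs \<subseteq> Gens \<and> coset_of 0 = lsum T (tens T) xs"
      by (intro exI[of _ "[]"]) auto
  next
    fix x y
    assume 2: "Poly_Mapping.keys x \<subseteq> Gens" "Poly_Mapping.keys y \<subseteq> Gens"
      "\<exists>xs. set xs \<subseteq> Gens \<and> coset_of x = lsum T (tens T) xs"
      "\<exists>xs. set xs \<subseteq> Gens \<and> coset_of y = lsum T (tens T) xs"
    then obtain xs ys where xs: "set xs \<subseteq> Gens" "coset_of x = lsum T (tens T) xs"
      and ys: "set ys \<subseteq> Gens" "coset_of y = lsum T (tens T) ys" by auto
    have "coset_of (x - y) = coset_of (x \<otimes>\<^bsub>F\<^esub> inv\<^bsub>F\<^esub> y)" using 2 by simp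
    also have "\<dots> = coset_of x \<otimes>\<^bsub>T\<^esub> inv\<^bsub>T\<^esub> coset_of y"
    proof -
      have "x \<in> carrier F" "y \<in> carrier F" using 2(1,2) by simp_all
      then show ?thesis using c.hom_mult F.inv_closed c.hom_inv by metis
    qed
    also have "inv\<^bsub>T\<^esub> coset_of y = lsum T (tens T) (map neg ys)"
    proof -
      have "inv\<^bsub>T\<^esub> coset_of y = lsum T (\<lambda>p. inv\<^bsub>T\<^esub> tens T p) ys"
        unfolding ys(2) using ys(1) by (intro T.lsum_inv[symmetric] tens_closed) auto
      also have "\<dots> = lsum T (\<lambda>p. tens T (neg p)) ys"
        using ys(1) by (intro lsum_cong neg(2)[symmetric]) auto
      finally show ?thesis by (simp only: lsum_map)
    qed
    also have "coset_of x \<otimes>\<^bsub>T\<^esub> \<dots> = lsum T (tens T) (xs @ map neg ys)"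
      unfolding xs(2) using xs(1) ys(1) neg(1)
      by (intro T.lsum_append[symmetric] tens_closed) auto
    finally show "\<exists>xs. set xs \<subseteq> Gens \<and> coset_of (x - y) = lsum T (tens T) xs" using xs ys neg(1) by (intro exI[of _ "xs @ map neg ys"]) auto
  next
    fix a assume 3: "a \<in> Gens"
    have "coset_of (frag_of a) = tens T a \<otimes>\<^bsub>T\<^esub> \<one>\<^bsub>T\<^esub>"
      using T.r_one[OF tens_closed[OF 3]] by (simp only: tens_eq)
    then show "\<exists>xs. set xs \<subseteq> Gens \<and> coset_of (frag_of a) = lsum T (tens T) xs"
      using 3 by (intro exI[of _ "[a]"]) (simp only: lsum_Cons lsum_Nil list.set, simp)
  qed
  then show ?thesis using that c(2) by blast
qed

lemma tens_relator:
  assumes "c \<in> Rel"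
  shows "c = frag_of p - frag_of q \<Longrightarrow> p \<in> Gens \<Longrightarrow> q \<in> Gens \<Longrightarrow> tens T p = tens T q"
    and "c = frag_of p - frag_of q - frag_of r \<Longrightarrow> p \<in> Gens \<Longrightarrow> q \<in> Gens \<Longrightarrow> r \<in> Gens \<Longrightarrow>
      tens T p = tens T q \<otimes>\<^bsub>T\<^esub> tens T r"
proof -
  interpret T: comm_group T by (rule comm_group_T)
  interpret c: group_hom F T "coset_of" by unfold_locales (rule coset_of_hom)
  have *: "coset_of x = coset_of y" if "x - y \<in> Rel" "x \<in> carrier F" "y \<in> carrier F" for x y
  proof -
    have "coset_of x = coset_of ((x - y) \<otimes>\<^bsub>F\<^esub> y)" by simp
    also have "\<dots> = \<one>\<^bsub>T\<^esub> \<otimes>\<^bsub>T\<^esub> coset_of y"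
      using that Rel_sub by (subst c.hom_mult) (auto simp only: coset_of_Rel)
    also have "\<dots> = coset_of y" by (rule T.l_one[OF c.hom_closed[OF that(3)]])
    finally show ?thesis .
  qed
  show "tens T p = tens T q" if "c = frag_of p - frag_of q" "p \<in> Gens" "q \<in> Gens"
    unfolding tens_eq by (rule *) (use that assms in auto)
  show "tens T p = tens T q \<otimes>\<^bsub>T\<^esub> tens T r"
    if "c = frag_of p - frag_of q - frag_of r" "p \<in> Gens" "q \<in> Gens" "r \<in> Gens"
  proof -
    have "coset_of (frag_of p) = coset_of (frag_of q \<otimes>\<^bsub>F\<^esub> frag_of r)"
      by (rule *) (use that assms in \<open>auto simp: diff_diff_eq dest!: subsetD[OF keys_add]\<close>)
    also have "\<dots> = coset_of (frag_of q) \<otimes>\<^bsub>T\<^esub> coset_of (frag_of r)"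
      by (rule c.hom_mult) (use that in auto)
    finally show ?thesis by (simp only: tens_eq)
  qed
qed

end

section \<open>Universal properties of the tensor products\<close>

definition balanced ::
  "'b set \<Rightarrow> ('m, 'k) ring_scheme \<Rightarrow> ('m \<Rightarrow> 'b \<Rightarrow> 'm) \<Rightarrow> ('b \<Rightarrow> 'n \<Rightarrow> 'n) \<Rightarrow> ('n, 'l) ring_scheme
    \<Rightarrow> ('g, 'p) monoid_scheme \<Rightarrow> ('m \<Rightarrow> 'n \<Rightarrow> 'g) \<Rightarrow> bool" where
  "balanced B M ract lact N G f \<longleftrightarrow>
     (\<forall>x\<in>carrier M. \<forall>y\<in>carrier N. f x y \<in> carrier G) \<and>
     (\<forall>x\<in>carrier M. \<forall>x'\<in>carrier M. \<forall>y\<in>carrier N. f (x \<oplus>\<^bsub>M\<^esub> x') y = f x y \<otimes>\<^bsub>G\<^esub> f x' y) \<and>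
     (\<forall>x\<in>carrier M. \<forall>y\<in>carrier N. \<forall>y'\<in>carrier N. f x (y \<oplus>\<^bsub>N\<^esub> y') = f x y \<otimes>\<^bsub>G\<^esub> f x y') \<and>
     (\<forall>x\<in>carrier M. \<forall>b\<in>B. \<forall>y\<in>carrier N. f (ract x b) y = f x (lact b y))"

lemma balancedI:
  assumes "\<And>x y. \<lbrakk>x \<in> carrier M; y \<in> carrier N\<rbrakk> \<Longrightarrow> f x y \<in> carrier G"
    and "\<And>x x' y. \<lbrakk>x \<in> carrier M; x' \<in> carrier M; y \<in> carrier N\<rbrakk>
      \<Longrightarrow> f (x \<oplus>\<^bsub>M\<^esub> x') y = f x y \<otimes>\<^bsub>G\<^esub> f x' y"
    and "\<And>x y y'. \<lbrakk>x \<in> carrier M; y \<in> carrier N; y' \<in> carrier N\<rbrakk>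
      \<Longrightarrow> f x (y \<oplus>\<^bsub>N\<^esub> y') = f x y \<otimes>\<^bsub>G\<^esub> f x y'"
    and "\<And>x b y. \<lbrakk>x \<in> carrier M; b \<in> B; y \<in> carrier N\<rbrakk> \<Longrightarrow> f (ract x b) y = f x (lact b y)"
  shows "balanced B M ract lact N G f"
  using assms unfolding balanced_def by blast

lemma balancedD:
  assumes "balanced B M ract lact N G f"
  shows "\<lbrakk>x \<in> carrier M; y \<in> carrier N\<rbrakk> \<Longrightarrow> f x y \<in> carrier G"
    and "\<lbrakk>x \<in> carrier M; x' \<in> carrier M; y \<in> carrier N\<rbrakk>
      \<Longrightarrow> f (x \<oplus>\<^bsub>M\<^esub> x') y = f x y \<otimes>\<^bsub>G\<^esub> f x' y"
    and "\<lbrakk>x \<in> carrier M; y \<in> carrier N; y' \<in> carrier N\<rbrakk>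
      \<Longrightarrow> f x (y \<oplus>\<^bsub>N\<^esub> y') = f x y \<otimes>\<^bsub>G\<^esub> f x y'"
    and "\<lbrakk>x \<in> carrier M; b \<in> B; y \<in> carrier N\<rbrakk> \<Longrightarrow> f (ract x b) y = f x (lact b y)"
  using assms unfolding balanced_def by blast+

text \<open>Phrased through \<open>balanced\<close> in two neighbouring variables at a time, so that
  partial lifts of a function of three variables can use the twofold theory; additivity in the
  middle variable occurs in both halves.\<close>

definition balanced3 ::
  "'b set \<Rightarrow> 'c set \<Rightarrow> ('m, 'k) ring_scheme \<Rightarrow> ('m \<Rightarrow> 'b \<Rightarrow> 'm)
    \<Rightarrow> ('b \<Rightarrow> 'n \<Rightarrow> 'n) \<Rightarrow> ('n, 'l) ring_scheme \<Rightarrow> ('n \<Rightarrow> 'c \<Rightarrow> 'n)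
    \<Rightarrow> ('c \<Rightarrow> 'p \<Rightarrow> 'p) \<Rightarrow> ('p, 'o) ring_scheme \<Rightarrow> ('g, 'q) monoid_scheme
    \<Rightarrow> ('m \<Rightarrow> 'n \<Rightarrow> 'p \<Rightarrow> 'g) \<Rightarrow> bool" where
  "balanced3 B C M ractM lactN N ractN lactP P G f \<longleftrightarrow>
     (\<forall>x\<in>carrier M. balanced C N ractN lactP P G (f x)) \<and>
     (\<forall>z\<in>carrier P. balanced B M ractM lactN N G (\<lambda>x y. f x y z))"

locale tensor_setting = M: abelian_group M + N: abelian_group N
  for B :: "('b, 'j) ring_scheme" and M :: "('m, 'k) ring_scheme" and ract :: "'m \<Rightarrow> 'b \<Rightarrow> 'm"
    and lact :: "'b \<Rightarrow> 'n \<Rightarrow> 'n" and N :: "('n, 'l) ring_scheme" +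
  assumes ract_cl: "\<lbrakk>x \<in> carrier M; b \<in> carrier B\<rbrakk> \<Longrightarrow> ract x b \<in> carrier M"
    and lact_cl: "\<lbrakk>y \<in> carrier N; b \<in> carrier B\<rbrakk> \<Longrightarrow> lact b y \<in> carrier N"
begin

sublocale P: presented_group "carrier M \<times> carrier N" "tensor_relators (carrier B) M ract lact N"
proof
  have "Poly_Mapping.keys (frag_of p - frag_of q - frag_of r) \<subseteq> {p, q, r}"
    "Poly_Mapping.keys (frag_of p - frag_of q) \<subseteq> {p, q}" for p q r :: "'m \<times> 'n"
    using keys_diff[of "frag_of p - frag_of q" "frag_of r"] keys_diff[of "frag_of p" "frag_of q"]
    by auto
  note * = subset_trans[OF this(1)] subset_trans[OF this(2)]
  show "tensor_relators (carrier B) M ract lact N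
      \<subseteq> carrier (free_Abelian_group (carrier M \<times> carrier N))"
    unfolding tensor_relators_def
    by (intro Un_least subsetI; elim CollectE exE conjE; hypsubst;
        subst carrier_free_Abelian_group_iff; rule *; simp add: ract_cl lact_cl)
qed

abbreviation "T \<equiv> tensor B M ract lact N"
abbreviation "bal \<equiv> balanced (carrier B) M ract lact N"

lemma T_eq: "T = P.T"
  by (simp add: tensor_def Let_def)

lemma comm_group_T: "comm_group T"
  unfolding T_eq by (rule P.comm_group_T)

lemma tens_cl: "\<lbrakk>x \<in> carrier M; y \<in> carrier N\<rbrakk> \<Longrightarrow> tens T (x, y) \<in> carrier T"
  unfolding T_eq by (rule P.tens_closed) simp

lemma bal_tens: "bal T (\<lambda>x y. tens T (x, y))"
proof (rule balancedI)
  show "tens T (x, y) \<in> carrier T" if "x \<in> carrier M" "y \<in> carrier N" for x y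
    using that by (rule tens_cl)
  show "tens T (x \<oplus>\<^bsub>M\<^esub> x', y) = tens T (x, y) \<otimes>\<^bsub>T\<^esub> tens T (x', y)"
    if "x \<in> carrier M" "x' \<in> carrier M" "y \<in> carrier N" for x x' y
    unfolding T_eq using that
    by (intro P.tens_relator(2)[OF _ refl]) (auto simp: tensor_relators_def)
  show "tens T (x, y \<oplus>\<^bsub>N\<^esub> y') = tens T (x, y) \<otimes>\<^bsub>T\<^esub> tens T (x, y')"
    if "x \<in> carrier M" "y \<in> carrier N" "y' \<in> carrier N" for x y y'
    unfolding T_eq using that
    by (intro P.tens_relator(2)[OF _ refl]) (auto simp: tensor_relators_def)
  show "tens T (ract x b, y) = tens T (x, lact b y)"
    if "x \<in> carrier M" "b \<in> carrier B" "y \<in> carrier N" for x b y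
    unfolding T_eq using that
    by (intro P.tens_relator(1)[OF _ refl]) (auto simp: tensor_relators_def ract_cl lact_cl)
qed

lemma bal_Rel:
  assumes "comm_group G" "bal G f"
  shows "(\<lambda>(x, y). f x y) \<in> carrier M \<times> carrier N \<rightarrow> carrier G"
    and "c \<in> tensor_relators (carrier B) M ract lact N
      \<Longrightarrow> frag_eval G (\<lambda>(x, y). f x y) c = \<one>\<^bsub>G\<^esub>"
proof -
  interpret G: comm_group G by fact
  let ?f = "\<lambda>(x, y). f x y"
  show f: "?f \<in> carrier M \<times> carrier N \<rightarrow> carrier G"
    using assms(2) by (auto simp: balanced_def)
  interpret h: group_hom P.F G "frag_eval G ?f"
    by unfold_locales (rule frag_eval_hom[OF assms(1) f])
  have e: "frag_eval G ?f (frag_of p) = ?f p" if "p \<in> carrier M \<times> carrier N" for p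
    by (rule frag_eval_frag_of[where f = ?f, OF assms(1) funcset_mem[OF f that]])
  have m: "frag_eval G ?f (x - y) = frag_eval G ?f x \<otimes>\<^bsub>G\<^esub> inv\<^bsub>G\<^esub> frag_eval G ?f y"
    if "x \<in> carrier P.F" "y \<in> carrier P.F" for x y
    using h.hom_mult[of x "- y"] h.hom_inv[of y] that by simp
  have 2: "frag_eval G ?f (frag_of p - frag_of q) = ?f p \<otimes>\<^bsub>G\<^esub> inv\<^bsub>G\<^esub> ?f q"
    if "p \<in> carrier M \<times> carrier N" "q \<in> carrier M \<times> carrier N" for p q
    using that by (subst m) (simp_all only: e frag_of_in_free_Abelian_group)
  have 3: "frag_eval G ?f (frag_of p - frag_of q - frag_of r)
      = ?f p \<otimes>\<^bsub>G\<^esub> inv\<^bsub>G\<^esub> ?f q \<otimes>\<^bsub>G\<^esub> inv\<^bsub>G\<^esub> ?f r"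
    if "p \<in> carrier M \<times> carrier N" "q \<in> carrier M \<times> carrier N" "r \<in> carrier M \<times> carrier N"
    for p q r
  proof -
    have "frag_of p - frag_of q \<in> carrier P.F"
      using that keys_diff[of "frag_of p" "frag_of q"] by auto
    then show ?thesis
      using that by (subst m) (simp_all only: e 2 frag_of_in_free_Abelian_group)
  qed
  note b = balancedD[OF assms(2)]
  have i: "(u \<otimes>\<^bsub>G\<^esub> v) \<otimes>\<^bsub>G\<^esub> inv\<^bsub>G\<^esub> u \<otimes>\<^bsub>G\<^esub> inv\<^bsub>G\<^esub> v = \<one>\<^bsub>G\<^esub>"
    if "u \<in> carrier G" "v \<in> carrier G" for u v
  proof -
    have "(u \<otimes>\<^bsub>G\<^esub> v) \<otimes>\<^bsub>G\<^esub> inv\<^bsub>G\<^esub> u = v"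
      using that by (metis G.inv_closed G.inv_solve_right' G.m_closed G.m_comm)
    then show ?thesis using that by simp
  qed
  show "frag_eval G ?f c = \<one>\<^bsub>G\<^esub>" if "c \<in> tensor_relators (carrier B) M ract lact N"
    using that unfolding tensor_relators_def
    by (elim UnE CollectE exE conjE; clarsimp simp: 2 3 ract_cl lact_cl b(2,3,4) b(1) i)
qed

lemma tlift_hom:
  "\<lbrakk>comm_group G; bal G f\<rbrakk> \<Longrightarrow> tlift G (\<lambda>(x, y). f x y) \<in> hom T G"
  unfolding T_eq by (rule P.tlift_hom; (assumption | (rule bal_Rel; assumption)))

lemma tlift_lsum:
  "\<lbrakk>comm_group G; bal G f; set xs \<subseteq> carrier M \<times> carrier N\<rbrakk>
    \<Longrightarrow> tlift G (\<lambda>(x, y). f x y) (lsum T (tens T) xs) = lsum G (\<lambda>(x, y). f x y) xs"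
  unfolding T_eq by (rule P.tlift_lsum; (assumption | (rule bal_Rel; assumption)))

lemma tlift_tens:
  "\<lbrakk>comm_group G; bal G f; x \<in> carrier M; y \<in> carrier N\<rbrakk>
    \<Longrightarrow> tlift G (\<lambda>(x, y). f x y) (tens T (x, y)) = f x y"
  unfolding T_eq by (subst P.tlift_tens) (assumption | rule bal_Rel | simp)+

text \<open>Provides the map \<open>neg\<close> of \<open>lsum_rep\<close> for pure tensors: the
  sign is put into the first factor.\<close>

lemma tens_neg:
  assumes "x \<in> carrier M" "y \<in> carrier N"
  shows "tens T (\<ominus>\<^bsub>M\<^esub> x, y) = inv\<^bsub>T\<^esub> tens T (x, y)"
proof -
  interpret T: comm_group T by (rule comm_group_T)
  have z: "tens T (\<zero>\<^bsub>M\<^esub>, y) = \<one>\<^bsub>T\<^esub>"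
    using balancedD(2)[OF bal_tens, of "\<zero>\<^bsub>M\<^esub>" "\<zero>\<^bsub>M\<^esub>" y] assms tens_cl[of "\<zero>\<^bsub>M\<^esub>" y]
    by (metis M.add.one_closed M.l_zero T.l_cancel_one)
  have "tens T (\<ominus>\<^bsub>M\<^esub> x, y) \<otimes>\<^bsub>T\<^esub> tens T (x, y) = \<one>\<^bsub>T\<^esub>"
    using balancedD(2)[OF bal_tens, of "\<ominus>\<^bsub>M\<^esub> x" x y] assms z by (simp add: M.l_neg)
  then show ?thesis using assms by (metis T.inv_equality tens_cl M.a_inv_closed)
qed

lemma rep:
  assumes "W \<in> carrier T"
  obtains xs where "set xs \<subseteq> carrier M \<times> carrier N" "W = lsum T (tens T) xs"
proof (rule P.lsum_rep[where neg = "\<lambda>(x, y). (\<ominus>\<^bsub>M\<^esub> x, y)" and W = W])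
  show "(case p of (x, y) \<Rightarrow> (\<ominus>\<^bsub>M\<^esub> x, y)) \<in> carrier M \<times> carrier N"
    if "p \<in> carrier M \<times> carrier N" for p using that by auto
  show "tens P.T (case p of (x, y) \<Rightarrow> (\<ominus>\<^bsub>M\<^esub> x, y)) = inv\<^bsub>P.T\<^esub> tens P.T p"
    if "p \<in> carrier M \<times> carrier N" for p using that tens_neg unfolding T_eq by auto
  show "W \<in> carrier P.T" using assms by (simp add: T_eq)
qed (use that in \<open>auto simp: T_eq\<close>)

end

locale tensor3_setting = M: abelian_group M + N: abelian_group N + Q: abelian_group Q
  for B :: "('b, 'i) ring_scheme" and C :: "('c, 'j) ring_scheme"
    and M :: "('m, 'k) ring_scheme" and ractM :: "'m \<Rightarrow> 'b \<Rightarrow> 'm"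
    and lactN :: "'b \<Rightarrow> 'n \<Rightarrow> 'n" and N :: "('n, 'l) ring_scheme" and ractN :: "'n \<Rightarrow> 'c \<Rightarrow> 'n"
    and lactQ :: "'c \<Rightarrow> 'p \<Rightarrow> 'p" and Q :: "('p, 'o) ring_scheme" +
  assumes ractM_cl: "\<lbrakk>x \<in> carrier M; b \<in> carrier B\<rbrakk> \<Longrightarrow> ractM x b \<in> carrier M"
    and lactN_cl: "\<lbrakk>y \<in> carrier N; b \<in> carrier B\<rbrakk> \<Longrightarrow> lactN b y \<in> carrier N"
    and ractN_cl: "\<lbrakk>y \<in> carrier N; c \<in> carrier C\<rbrakk> \<Longrightarrow> ractN y c \<in> carrier N"
    and lactQ_cl: "\<lbrakk>z \<in> carrier Q; c \<in> carrier C\<rbrakk> \<Longrightarrow> lactQ c z \<in> carrier Q"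
begin

abbreviation "Gens \<equiv> carrier M \<times> carrier N \<times> carrier Q"

sublocale P: presented_group Gens
  "tensor3_relators (carrier B) (carrier C) M ractM lactN N ractN lactQ Q"
proof
  have "Poly_Mapping.keys (frag_of p - frag_of q - frag_of r) \<subseteq> {p, q, r}"
    "Poly_Mapping.keys (frag_of p - frag_of q) \<subseteq> {p, q}" for p q r :: "'m \<times> 'n \<times> 'p"
    using keys_diff[of "frag_of p - frag_of q" "frag_of r"] keys_diff[of "frag_of p" "frag_of q"]
    by auto
  note * = subset_trans[OF this(1)] subset_trans[OF this(2)]
  show "tensor3_relators (carrier B) (carrier C) M ractM lactN N ractN lactQ Q
      \<subseteq> carrier (free_Abelian_group Gens)"
    unfolding tensor3_relators_def
    by (intro Un_least subsetI; elim CollectE exE conjE; hypsubst;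
        subst carrier_free_Abelian_group_iff; rule *; simp add: ractM_cl lactN_cl ractN_cl lactQ_cl)
qed

abbreviation "T3 \<equiv> tensor3 B C M ractM lactN N ractN lactQ Q"
abbreviation "bal3 \<equiv> balanced3 (carrier B) (carrier C) M ractM lactN N ractN lactQ Q"

lemma T3_eq: "T3 = P.T"
  by (simp add: tensor3_def Let_def)

lemma comm_group_T3: "comm_group T3"
  unfolding T3_eq by (rule P.comm_group_T)

lemma tens3_cl:
  "\<lbrakk>x \<in> carrier M; y \<in> carrier N; z \<in> carrier Q\<rbrakk> \<Longrightarrow> tens T3 (x, y, z) \<in> carrier T3"
  unfolding T3_eq by (rule P.tens_closed) simp

lemma bal3_tens: "bal3 T3 (\<lambda>x y z. tens T3 (x, y, z))"
  unfolding balanced3_def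
proof (intro conjI ballI balancedI)
  note [simp] = ractM_cl lactN_cl ractN_cl lactQ_cl
  fix x assume x: "x \<in> carrier M"
  show "tens T3 (x, y, z) \<in> carrier T3" if "y \<in> carrier N" "z \<in> carrier Q" for y z
    using x that by (rule tens3_cl)
  show "tens T3 (x, y \<oplus>\<^bsub>N\<^esub> y', z) = tens T3 (x, y, z) \<otimes>\<^bsub>T3\<^esub> tens T3 (x, y', z)"
    if "y \<in> carrier N" "y' \<in> carrier N" "z \<in> carrier Q" for y y' z
    unfolding T3_eq using x that
    by (intro P.tens_relator(2)[OF _ refl]) (auto simp: tensor3_relators_def)
  show "tens T3 (x, y, z \<oplus>\<^bsub>Q\<^esub> z') = tens T3 (x, y, z) \<otimes>\<^bsub>T3\<^esub> tens T3 (x, y, z')"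
    if "y \<in> carrier N" "z \<in> carrier Q" "z' \<in> carrier Q" for y z z'
    unfolding T3_eq using x that
    by (intro P.tens_relator(2)[OF _ refl]) (auto simp: tensor3_relators_def)
  show "tens T3 (x, ractN y c, z) = tens T3 (x, y, lactQ c z)"
    if "y \<in> carrier N" "c \<in> carrier C" "z \<in> carrier Q" for y c z
    unfolding T3_eq using x that
    by (intro P.tens_relator(1)[OF _ refl]) (auto simp: tensor3_relators_def)
next
  note [simp] = ractM_cl lactN_cl ractN_cl lactQ_cl
  fix z assume z: "z \<in> carrier Q"
  show "tens T3 (x, y, z) \<in> carrier T3" if "x \<in> carrier M" "y \<in> carrier N" for x y
    using that z by (rule tens3_cl)
  show "tens T3 (x \<oplus>\<^bsub>M\<^esub> x', y, z) = tens T3 (x, y, z) \<otimes>\<^bsub>T3\<^esub> tens T3 (x', y, z)"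
    if "x \<in> carrier M" "x' \<in> carrier M" "y \<in> carrier N" for x x' y
    unfolding T3_eq using z that
    by (intro P.tens_relator(2)[OF _ refl]) (auto simp: tensor3_relators_def)
  show "tens T3 (x, y \<oplus>\<^bsub>N\<^esub> y', z) = tens T3 (x, y, z) \<otimes>\<^bsub>T3\<^esub> tens T3 (x, y', z)"
    if "x \<in> carrier M" "y \<in> carrier N" "y' \<in> carrier N" for x y y'
    unfolding T3_eq using z that
    by (intro P.tens_relator(2)[OF _ refl]) (auto simp: tensor3_relators_def)
  show "tens T3 (ractM x b, y, z) = tens T3 (x, lactN b y, z)"
    if "x \<in> carrier M" "b \<in> carrier B" "y \<in> carrier N" for x b y
    unfolding T3_eq using z that
    by (intro P.tens_relator(1)[OF _ refl]) (auto simp: tensor3_relators_def)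
qed

lemma bal3_Rel:
  assumes "comm_group G" "bal3 G f"
  shows "(\<lambda>(x, y, z). f x y z) \<in> Gens \<rightarrow> carrier G"
    and "c \<in> tensor3_relators (carrier B) (carrier C) M ractM lactN N ractN lactQ Q
      \<Longrightarrow> frag_eval G (\<lambda>(x, y, z). f x y z) c = \<one>\<^bsub>G\<^esub>"
proof -
  interpret G: comm_group G by fact
  let ?f = "\<lambda>(x, y, z). f x y z"
  have b1: "balanced (carrier C) N ractN lactQ Q G (f x)" if "x \<in> carrier M" for x
    using assms(2) that unfolding balanced3_def by blast
  have b2: "balanced (carrier B) M ractM lactN N G (\<lambda>x y. f x y z)" if "z \<in> carrier Q" for z
    using assms(2) that unfolding balanced3_def by blast
  note b = balancedD[OF b1] balancedD[OF b2]
  show f: "?f \<in> Gens \<rightarrow> carrier G"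
    using b(1) by auto
  interpret h: group_hom P.F G "frag_eval G ?f"
    by unfold_locales (rule frag_eval_hom[OF assms(1) f])
  have e: "frag_eval G ?f (frag_of p) = ?f p" if "p \<in> Gens" for p
    by (rule frag_eval_frag_of[where f = ?f, OF assms(1) funcset_mem[OF f that]])
  have m: "frag_eval G ?f (x - y) = frag_eval G ?f x \<otimes>\<^bsub>G\<^esub> inv\<^bsub>G\<^esub> frag_eval G ?f y"
    if "x \<in> carrier P.F" "y \<in> carrier P.F" for x y
    using h.hom_mult[of x "- y"] h.hom_inv[of y] that by simp
  have 2: "frag_eval G ?f (frag_of p - frag_of q) = ?f p \<otimes>\<^bsub>G\<^esub> inv\<^bsub>G\<^esub> ?f q"
    if "p \<in> Gens" "q \<in> Gens" for p q
    using that by (subst m) (simp_all only: e frag_of_in_free_Abelian_group)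
  have 3: "frag_eval G ?f (frag_of p - frag_of q - frag_of r)
      = ?f p \<otimes>\<^bsub>G\<^esub> inv\<^bsub>G\<^esub> ?f q \<otimes>\<^bsub>G\<^esub> inv\<^bsub>G\<^esub> ?f r"
    if "p \<in> Gens" "q \<in> Gens" "r \<in> Gens" for p q r
  proof -
    have "frag_of p - frag_of q \<in> carrier P.F"
      using that keys_diff[of "frag_of p" "frag_of q"] by auto
    then show ?thesis
      using that by (subst m) (simp_all only: e 2 frag_of_in_free_Abelian_group)
  qed
  have i: "(u \<otimes>\<^bsub>G\<^esub> v) \<otimes>\<^bsub>G\<^esub> inv\<^bsub>G\<^esub> u \<otimes>\<^bsub>G\<^esub> inv\<^bsub>G\<^esub> v = \<one>\<^bsub>G\<^esub>"
    if "u \<in> carrier G" "v \<in> carrier G" for u v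
  proof -
    have "(u \<otimes>\<^bsub>G\<^esub> v) \<otimes>\<^bsub>G\<^esub> inv\<^bsub>G\<^esub> u = v"
      using that by (metis G.inv_closed G.inv_solve_right' G.m_closed G.m_comm)
    then show ?thesis using that by simp
  qed
  show "frag_eval G ?f c = \<one>\<^bsub>G\<^esub>"
    if "c \<in> tensor3_relators (carrier B) (carrier C) M ractM lactN N ractN lactQ Q"
    using that unfolding tensor3_relators_def
    by (elim UnE CollectE exE conjE;
        clarsimp simp: 2 3 ractM_cl lactN_cl ractN_cl lactQ_cl b(2,3,4,6,8) b(1) i)
qed

lemma tlift3_hom:
  "\<lbrakk>comm_group G; bal3 G f\<rbrakk> \<Longrightarrow> tlift G (\<lambda>(x, y, z). f x y z) \<in> hom T3 G"
  unfolding T3_eq by (rule P.tlift_hom; (assumption | (rule bal3_Rel; assumption)))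

lemma tlift3_tens:
  "\<lbrakk>comm_group G; bal3 G f; x \<in> carrier M; y \<in> carrier N; z \<in> carrier Q\<rbrakk>
    \<Longrightarrow> tlift G (\<lambda>(x, y, z). f x y z) (tens T3 (x, y, z)) = f x y z"
  unfolding T3_eq by (subst P.tlift_tens) (assumption | rule bal3_Rel | simp)+

end

section \<open>Sweedler sums\<close>

text \<open>One choice of a representative per element of the tensor product. A sum over it may
  depend on the choice unless the summand is balanced.\<close>

definition sweedler_rep ::
  "('x \<times> 'y \<Rightarrow>\<^sub>0 int) set monoid \<Rightarrow> ('x \<times> 'y) set \<Rightarrow> ('x \<times> 'y \<Rightarrow>\<^sub>0 int) set \<Rightarrow> ('x \<times> 'y) list" where
  "sweedler_rep T Z W = (SOME xs. set xs \<subseteq> Z \<and> W = lsum T (tens T) xs)"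

context tensor_setting
begin

text \<open>
  A Sweedler sum is computed on a chosen representative, so that congruence, closure and
  interchange rules need no balancedness; it equals the lift when \<open>f\<close> is balanced.
\<close>

definition sw :: "('m \<times> 'n \<Rightarrow>\<^sub>0 int) set \<Rightarrow> ('g, 'q) monoid_scheme \<Rightarrow> ('m \<Rightarrow> 'n \<Rightarrow> 'g) \<Rightarrow> 'g" where
  "sw W G f = lsum G (\<lambda>(x, y). f x y) (sweedler_rep T (carrier M \<times> carrier N) W)"

lemma rep_props:
  assumes "W \<in> carrier T"
  shows "set (sweedler_rep T (carrier M \<times> carrier N) W) \<subseteq> carrier M \<times> carrier N"
    and "lsum T (tens T) (sweedler_rep T (carrier M \<times> carrier N) W) = W"
proof -
  have "\<exists>xs. set xs \<subseteq> carrier M \<times> carrier N \<and> W = lsum T (tens T) xs"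
  proof (rule rep[OF assms])
    fix xs assume "set xs \<subseteq> carrier M \<times> carrier N" "W = lsum T (tens T) xs"
    then show ?thesis by (intro exI[of _ xs] conjI)
  qed
  from someI_ex[OF this] show
    "set (sweedler_rep T (carrier M \<times> carrier N) W) \<subseteq> carrier M \<times> carrier N"
    "lsum T (tens T) (sweedler_rep T (carrier M \<times> carrier N) W) = W"
    unfolding sweedler_rep_def by auto
qed

lemma sw_tlift:
  assumes "comm_group G" "bal G f" "W \<in> carrier T"
  shows "tlift G (\<lambda>(x, y). f x y) W = sw W G f"
  unfolding sw_def using tlift_lsum[OF assms(1,2) rep_props(1)[OF assms(3)]]
  by (simp only: rep_props(2)[OF assms(3)])

lemma sw_hom:
  assumes "h \<in> hom G K" "comm_group G" "comm_group K" "W \<in> carrier T"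
    and "\<And>x y. \<lbrakk>x \<in> carrier M; y \<in> carrier N\<rbrakk> \<Longrightarrow> f x y \<in> carrier G"
  shows "h (sw W G f) = sw W K (\<lambda>x y. h (f x y))"
  unfolding sw_def using rep_props(1)[OF assms(4)] assms(5)
  by (subst hom_lsum[OF assms(1) comm_group.axioms(2)[OF assms(2)] comm_group.axioms(2)[OF assms(3)]])
    (auto intro!: lsum_cong)

lemma sw_cong:
  assumes "W \<in> carrier T" "\<And>x y. \<lbrakk>x \<in> carrier M; y \<in> carrier N\<rbrakk> \<Longrightarrow> f x y = g x y"
  shows "sw W G f = sw W G g"
  unfolding sw_def using rep_props(1)[OF assms(1)] assms(2) by (intro lsum_cong) auto

lemma sw_closed:
  assumes "comm_group G" "W \<in> carrier T"
    "\<And>x y. \<lbrakk>x \<in> carrier M; y \<in> carrier N\<rbrakk> \<Longrightarrow> f x y \<in> carrier G"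
  shows "sw W G f \<in> carrier G"
  unfolding sw_def using rep_props(1)[OF assms(2)] assms(3)
  by (intro comm_group.lsum_closed[OF assms(1)]) auto

lemma sw_mult:
  assumes "comm_group G" "W \<in> carrier T"
    "\<And>x y. \<lbrakk>x \<in> carrier M; y \<in> carrier N\<rbrakk> \<Longrightarrow> f x y \<in> carrier G"
    "\<And>x y. \<lbrakk>x \<in> carrier M; y \<in> carrier N\<rbrakk> \<Longrightarrow> g x y \<in> carrier G"
  shows "sw W G (\<lambda>x y. f x y \<otimes>\<^bsub>G\<^esub> g x y) = sw W G f \<otimes>\<^bsub>G\<^esub> sw W G g"
  unfolding sw_def using rep_props(1)[OF assms(2)] assms(3,4)
  by (subst comm_group.lsum_mult[OF assms(1), symmetric]) (auto intro!: lsum_cong)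

lemma sw_swap:
  assumes "comm_group G" "W \<in> carrier T"
    "\<And>x y q. \<lbrakk>x \<in> carrier M; y \<in> carrier N; q \<in> set ys\<rbrakk> \<Longrightarrow> f x y q \<in> carrier G"
  shows "sw W G (\<lambda>x y. lsum G (f x y) ys) = lsum G (\<lambda>q. sw W G (\<lambda>x y. f x y q)) ys"
  unfolding sw_def using rep_props(1)[OF assms(2)] assms(3)
  using comm_group.lsum_swap[OF assms(1), of "sweedler_rep T (carrier M \<times> carrier N) W" ys
      "\<lambda>(x, y). f x y"]
  by (auto simp: split_def subset_iff)

lemma sw_add:
  assumes "comm_group G" "bal G f" "V \<in> carrier T" "W \<in> carrier T"
  shows "sw (V \<otimes>\<^bsub>T\<^esub> W) G f = sw V G f \<otimes>\<^bsub>G\<^esub> sw W G f"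
proof -
  interpret T: comm_group T by (rule comm_group_T)
  show ?thesis using hom_mult[OF tlift_hom[OF assms(1,2)] assms(3,4)]
    by (simp only: sw_tlift[OF assms(1,2)] assms(3,4) T.m_closed)
qed

lemma sw_tens:
  assumes "comm_group G" "bal G f" "x \<in> carrier M" "y \<in> carrier N"
  shows "sw (tens T (x, y)) G f = f x y"
  using tlift_tens[OF assms] sw_tlift[OF assms(1,2) tens_cl[OF assms(3,4)]] by simp

text \<open>Turns an axiom stated as an equality of elements of the tensor product into an equality
  of sums with values in any abelian group: the lift of \<open>f\<close> is applied to both
  sides.\<close>

lemma tlift_tlift_map:
  assumes "comm_group G" "bal G f" "bal T (\<lambda>x y. tens T (g x, h y))" "W \<in> carrier T"
    and "\<And>x. x \<in> carrier M \<Longrightarrow> g x \<in> carrier M" "\<And>x. x \<in> carrier N \<Longrightarrow> h x \<in> carrier N"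
  shows "tlift G (\<lambda>(x, y). f x y) (tlift T (\<lambda>(x, y). tens T (g x, h y)) W)
    = sw W G (\<lambda>x y. f (g x) (h y))"
proof -
  have "tlift G (\<lambda>(x, y). f x y) (sw W T (\<lambda>x y. tens T (g x, h y)))
      = sw W G (\<lambda>x y. tlift G (\<lambda>(x, y). f x y) (tens T (g x, h y)))"
    by (rule sw_hom[OF tlift_hom[OF assms(1,2)] comm_group_T assms(1,4) balancedD(1)[OF assms(3)]])
  also have "\<dots> = sw W G (\<lambda>x y. f (g x) (h y))"
    by (rule sw_cong[OF assms(4)]) (simp add: tlift_tens[OF assms(1,2)] assms(5,6))
  finally show ?thesis unfolding sw_tlift[OF comm_group_T assms(3,4)] .
qed

end

section \<open>Sweedler sums over the comultiplication of a comonoid in bimodules\<close>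

context bimodule_comonoid
begin

sublocale T: tensor_setting B M ract lact M
  by unfold_locales (auto simp: ract_closed lact_closed)

sublocale T3: tensor3_setting B B M ract lact M ract lact M
  by unfold_locales (auto simp: ract_closed lact_closed)

lemma comul_cl: "a \<in> carrier M \<Longrightarrow> comul a \<in> carrier T.T"
  using hom_in_carrier[OF comul_hom] by simp

lemma comul_add: "\<lbrakk>a \<in> carrier M; b \<in> carrier M\<rbrakk> \<Longrightarrow>
    comul (a \<oplus>\<^bsub>M\<^esub> b) = comul a \<otimes>\<^bsub>T.T\<^esub> comul b"
  using hom_mult[OF comul_hom] by simp

lemma bal_map:
  assumes "T.bal G f" "\<And>x. x \<in> carrier M \<Longrightarrow> g x \<in> carrier M" "\<And>x. x \<in> carrier M \<Longrightarrow> h x \<in> carrier M"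
    "\<And>x y. \<lbrakk>x \<in> carrier M; y \<in> carrier M\<rbrakk> \<Longrightarrow> g (x \<oplus>\<^bsub>M\<^esub> y) = g x \<oplus>\<^bsub>M\<^esub> g y"
    "\<And>x y. \<lbrakk>x \<in> carrier M; y \<in> carrier M\<rbrakk> \<Longrightarrow> h (x \<oplus>\<^bsub>M\<^esub> y) = h x \<oplus>\<^bsub>M\<^esub> h y"
    "\<And>x b. \<lbrakk>x \<in> carrier M; b \<in> carrier B\<rbrakk> \<Longrightarrow> g (ract x b) = ract (g x) b"
    "\<And>x b. \<lbrakk>x \<in> carrier M; b \<in> carrier B\<rbrakk> \<Longrightarrow> h (lact b x) = lact b (h x)"
  shows "T.bal G (\<lambda>x y. f (g x) (h y))"
  by (rule balancedI) (use assms(2-) in \<open>simp_all add: balancedD[OF assms(1)]\<close>)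

lemma sw_comul_lact:
  assumes "comm_group G" "T.bal G f" "b \<in> carrier B" "a \<in> carrier M"
  shows "T.sw (comul (lact b a)) G f = T.sw (comul a) G (\<lambda>x y. f (lact b x) y)"
proof -
  have t: "T.bal T.T (\<lambda>x y. tens T.T (lact b x, y))"
    by (rule bal_map[OF T.bal_tens, where h = "\<lambda>x. x"])
      (simp_all add: assms(3) lact_closed lact_add lact_ract)
  have f: "T.bal G (\<lambda>x y. f (lact b x) y)"
    by (rule bal_map[OF assms(2), where h = "\<lambda>x. x"])
      (simp_all add: assms(3) lact_closed lact_add lact_ract)
  have "comul (lact b a) = T.sw (comul a) T.T (\<lambda>x y. tens T.T (lact b x, y))"
    using comul_lact[OF assms(3,4)] T.sw_tlift[OF T.comm_group_T t comul_cl[OF assms(4)]] by simp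
  then have "tlift G (\<lambda>(x, y). f x y) (comul (lact b a))
      = T.sw (comul a) G (\<lambda>x y. tlift G (\<lambda>(x, y). f x y) (tens T.T (lact b x, y)))"
    using T.sw_hom[OF T.tlift_hom[OF assms(1,2)] T.comm_group_T assms(1) comul_cl[OF assms(4)]]
    by (simp add: balancedD(1)[OF t])
  also have "\<dots> = T.sw (comul a) G (\<lambda>x y. f (lact b x) y)"
    by (rule T.sw_cong[OF comul_cl[OF assms(4)]])
      (simp add: T.tlift_tens[OF assms(1,2)] lact_closed assms(3))
  finally show ?thesis
    using T.sw_tlift[OF assms(1,2) comul_cl[OF lact_closed[OF assms(3,4)]]] by simp
qed

lemma sw_comul_ract:
  assumes "comm_group G" "T.bal G f" "b \<in> carrier B" "a \<in> carrier M"
  shows "T.sw (comul (ract a b)) G f = T.sw (comul a) G (\<lambda>x y. f x (ract y b))"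
proof -
  have t: "T.bal T.T (\<lambda>x y. tens T.T (x, ract y b))"
    by (rule bal_map[OF T.bal_tens, where g = "\<lambda>x. x"])
      (simp_all add: assms(3) ract_closed ract_add lact_ract)
  have "comul (ract a b) = T.sw (comul a) T.T (\<lambda>x y. tens T.T (x, ract y b))"
    using comul_ract[OF assms(3,4)] T.sw_tlift[OF T.comm_group_T t comul_cl[OF assms(4)]] by simp
  then have "tlift G (\<lambda>(x, y). f x y) (comul (ract a b))
      = T.sw (comul a) G (\<lambda>x y. tlift G (\<lambda>(x, y). f x y) (tens T.T (x, ract y b)))"
    using T.sw_hom[OF T.tlift_hom[OF assms(1,2)] T.comm_group_T assms(1) comul_cl[OF assms(4)]]
    by (simp add: balancedD(1)[OF t])
  also have "\<dots> = T.sw (comul a) G (\<lambda>x y. f x (ract y b))"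
    by (rule T.sw_cong[OF comul_cl[OF assms(4)]])
      (simp add: T.tlift_tens[OF assms(1,2)] ract_closed assms(3))
  finally show ?thesis
    using T.sw_tlift[OF assms(1,2) comul_cl[OF ract_closed[OF assms(3,4)]]] by simp
qed

lemma sw_comul_add:
  assumes "comm_group G" "T.bal G f" "a \<in> carrier M" "b \<in> carrier M"
  shows "T.sw (comul (a \<oplus>\<^bsub>M\<^esub> b)) G f = T.sw (comul a) G f \<otimes>\<^bsub>G\<^esub> T.sw (comul b) G f"
  using T.sw_add[OF assms(1,2)] comul_cl assms(3,4) by (simp add: comul_add)

text \<open>Right linearity of the comultiplication puts the scalar of \<open>ract x b\<close> on
  the second leg of \<open>x\<close>, and balancedness of \<open>f\<close> in its last two variables
  passes it on to \<open>y\<close>.\<close>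

lemma bal3_left:
  assumes "comm_group G" "T3.bal3 G f"
  shows "T.bal G (\<lambda>x y. T.sw (comul x) G (\<lambda>u v. f u v y))"
proof -
  have b1: "T.bal G (f x)" if "x \<in> carrier M" for x
    using assms(2) that unfolding balanced3_def by blast
  have b2: "T.bal G (\<lambda>x y. f x y z)" if "z \<in> carrier M" for z
    using assms(2) that unfolding balanced3_def by blast
  show ?thesis
  proof (rule balancedI)
    fix x b y assume x: "x \<in> carrier M" and y: "y \<in> carrier M" and b: "b \<in> carrier B"
    show "T.sw (comul (ract x b)) G (\<lambda>u v. f u v y) = T.sw (comul x) G (\<lambda>u v. f u v (lact b y))"
      unfolding sw_comul_ract[OF assms(1) b2[OF y] b x]
      by (rule T.sw_cong) (simp_all add: comul_cl x y b balancedD(4)[OF b1])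
  next
    fix x y y' assume x: "x \<in> carrier M" and y: "y \<in> carrier M" "y' \<in> carrier M"
    then show "T.sw (comul x) G (\<lambda>u v. f u v (y \<oplus>\<^bsub>M\<^esub> y'))
        = T.sw (comul x) G (\<lambda>u v. f u v y) \<otimes>\<^bsub>G\<^esub> T.sw (comul x) G (\<lambda>u v. f u v y')"
      by (subst T.sw_mult[OF assms(1), symmetric])
        (auto simp: comul_cl balancedD(1)[OF b1] balancedD(3)[OF b1] intro!: T.sw_cong)
  qed (auto simp: sw_comul_add assms b2 comul_cl balancedD(1)[OF b2] intro!: T.sw_closed)
qed

lemma bal3_right:
  assumes "comm_group G" "T3.bal3 G f"
  shows "T.bal G (\<lambda>x y. T.sw (comul y) G (\<lambda>u v. f x u v))"
proof -
  have b1: "T.bal G (f x)" if "x \<in> carrier M" for x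
    using assms(2) that unfolding balanced3_def by blast
  have b2: "T.bal G (\<lambda>x y. f x y z)" if "z \<in> carrier M" for z
    using assms(2) that unfolding balanced3_def by blast
  show ?thesis
  proof (rule balancedI)
    fix x b y assume x: "x \<in> carrier M" and y: "y \<in> carrier M" and b: "b \<in> carrier B"
    show "T.sw (comul y) G (\<lambda>u v. f (ract x b) u v) = T.sw (comul (lact b y)) G (\<lambda>u v. f x u v)"
      unfolding sw_comul_lact[OF assms(1) b1[OF x] b y]
      by (rule T.sw_cong) (simp_all add: comul_cl x y b balancedD(4)[OF b2])
  next
    fix x x' y assume x: "x \<in> carrier M" "x' \<in> carrier M" and y: "y \<in> carrier M"
    then show "T.sw (comul y) G (\<lambda>u v. f (x \<oplus>\<^bsub>M\<^esub> x') u v)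
        = T.sw (comul y) G (\<lambda>u v. f x u v) \<otimes>\<^bsub>G\<^esub> T.sw (comul y) G (\<lambda>u v. f x' u v)"
      by (subst T.sw_mult[OF assms(1), symmetric])
        (auto simp: comul_cl balancedD(1)[OF b1] balancedD(2)[OF b2] intro!: T.sw_cong)
  qed (auto simp: sw_comul_add assms b1 comul_cl balancedD(1)[OF b1] intro!: T.sw_closed)
qed

text \<open>Coassociativity is a single identity in the threefold tensor product; the homomorphism
  induced by \<open>f\<close> carries it to \<open>G\<close>. The work lies in reading the nested
  lifts of the axiom as nested sums.\<close>

lemma sw_coassoc:
  assumes "comm_group G" "T3.bal3 G f" "a \<in> carrier M"
  shows "T.sw (comul a) G (\<lambda>x y. T.sw (comul x) G (\<lambda>u v. f u v y))
    = T.sw (comul a) G (\<lambda>x y. T.sw (comul y) G (\<lambda>u v. f x u v))"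
proof -
  let ?T3 = T3.T3
  let ?h = "tlift G (\<lambda>(x, y, z). f x y z)"
  have b1: "T.bal ?T3 (\<lambda>y z. tens ?T3 (x, y, z))" if "x \<in> carrier M" for x
    using T3.bal3_tens that unfolding balanced3_def by blast
  have b2: "T.bal ?T3 (\<lambda>x y. tens ?T3 (x, y, z))" if "z \<in> carrier M" for z
    using T3.bal3_tens that unfolding balanced3_def by blast
  note cg = T3.comm_group_T3
  have hom: "?h \<in> hom ?T3 G" by (rule T3.tlift3_hom[OF assms(1,2)])
  note bl = bal3_left[OF cg T3.bal3_tens] and br = bal3_right[OF cg T3.bal3_tens]
  have l: "tlift ?T3 (\<lambda>(u, v). tlift ?T3 (\<lambda>(u', u''). tens ?T3 (u', u'', v)) (comul u)) (comul a)
      = T.sw (comul a) ?T3 (\<lambda>x y. T.sw (comul x) ?T3 (\<lambda>u v. tens ?T3 (u, v, y)))" (is "?l = ?l'")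
  proof -
    have e: "tlift ?T3 (\<lambda>(u', u''). tens ?T3 (u', u'', v)) (comul u)
        = T.sw (comul u) ?T3 (\<lambda>u' u''. tens ?T3 (u', u'', v))"
      if "u \<in> carrier M" "v \<in> carrier M" for u v
      by (rule T.sw_tlift[OF cg b2[OF that(2)] comul_cl[OF that(1)]])
    have "T.bal ?T3 (\<lambda>u v. tlift ?T3 (\<lambda>(u', u''). tens ?T3 (u', u'', v)) (comul u))"
      by (rule balancedI) (simp_all add: e balancedD[OF bl] ract_closed lact_closed)
    then show ?thesis
      by (subst T.sw_tlift[OF cg _ comul_cl[OF assms(3)]])
        (auto simp: e intro!: T.sw_cong comul_cl assms(3))
  qed
  have r: "tlift ?T3 (\<lambda>(u, v). tlift ?T3 (\<lambda>(v', v''). tens ?T3 (u, v', v'')) (comul v)) (comul a)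
      = T.sw (comul a) ?T3 (\<lambda>x y. T.sw (comul y) ?T3 (\<lambda>u v. tens ?T3 (x, u, v)))" (is "?r = ?r'")
  proof -
    have e: "tlift ?T3 (\<lambda>(v', v''). tens ?T3 (u, v', v'')) (comul v)
        = T.sw (comul v) ?T3 (\<lambda>v' v''. tens ?T3 (u, v', v''))"
      if "u \<in> carrier M" "v \<in> carrier M" for u v
      by (rule T.sw_tlift[OF cg b1[OF that(1)] comul_cl[OF that(2)]])
    have "T.bal ?T3 (\<lambda>u v. tlift ?T3 (\<lambda>(v', v''). tens ?T3 (u, v', v'')) (comul v))"
      by (rule balancedI) (simp_all add: e balancedD[OF br] ract_closed lact_closed)
    then show ?thesis
      by (subst T.sw_tlift[OF cg _ comul_cl[OF assms(3)]])
        (auto simp: e intro!: T.sw_cong comul_cl assms(3))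
  qed
  have t: "?h (tens ?T3 (x, y, z)) = f x y z"
    if "x \<in> carrier M" "y \<in> carrier M" "z \<in> carrier M" for x y z
    by (rule T3.tlift3_tens[OF assms(1,2) that])
  have c: "tens ?T3 (x, y, z) \<in> carrier ?T3"
    if "x \<in> carrier M" "y \<in> carrier M" "z \<in> carrier M" for x y z
    by (rule T3.tens3_cl[OF that])
  have "?h ?l' = T.sw (comul a) G (\<lambda>x y. T.sw (comul x) G (\<lambda>u v. f u v y))"
  proof -
    have "?h ?l' = T.sw (comul a) G
        (\<lambda>x y. ?h (T.sw (comul x) ?T3 (\<lambda>u v. tens ?T3 (u, v, y))))"
      by (rule T.sw_hom[OF hom cg assms(1) comul_cl[OF assms(3)]])
        (auto intro!: T.sw_closed cg comul_cl c)
    also have "\<dots> = T.sw (comul a) G (\<lambda>x y. T.sw (comul x) G (\<lambda>u v. f u v y))"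
      by (rule T.sw_cong[OF comul_cl[OF assms(3)]], subst T.sw_hom[OF hom cg assms(1)])
        (auto intro!: comul_cl c T.sw_cong simp: t)
    finally show ?thesis .
  qed
  moreover have "?h ?r' = T.sw (comul a) G (\<lambda>x y. T.sw (comul y) G (\<lambda>u v. f x u v))"
  proof -
    have "?h ?r' = T.sw (comul a) G
        (\<lambda>x y. ?h (T.sw (comul y) ?T3 (\<lambda>u v. tens ?T3 (x, u, v))))"
      by (rule T.sw_hom[OF hom cg assms(1) comul_cl[OF assms(3)]])
        (auto intro!: T.sw_closed cg comul_cl c)
    also have "\<dots> = T.sw (comul a) G (\<lambda>x y. T.sw (comul y) G (\<lambda>u v. f x u v))"
      by (rule T.sw_cong[OF comul_cl[OF assms(3)]], subst T.sw_hom[OF hom cg assms(1)])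
        (auto intro!: comul_cl c T.sw_cong simp: t)
    finally show ?thesis .
  qed
  moreover have "?l' = ?r'" using coassoc[OF assms(3)] unfolding Let_def l r .
  ultimately show ?thesis by simp
qed

end

section \<open>Sweedler calculus in bialgebroids\<close>

context left_bialgebroid
begin

abbreviation "A \<equiv> total_ring H"
abbreviation "Bs \<equiv> base_ring H"

lemma src_simps [simp]:
  "l \<in> carrier Bs \<Longrightarrow> src H l \<in> carrier A"
  "\<lbrakk>l \<in> carrier Bs; l' \<in> carrier Bs\<rbrakk> \<Longrightarrow> src H (l \<oplus>\<^bsub>Bs\<^esub> l') = src H l \<oplus>\<^bsub>A\<^esub> src H l'"
  "\<lbrakk>l \<in> carrier Bs; l' \<in> carrier Bs\<rbrakk> \<Longrightarrow> src H (l \<otimes>\<^bsub>Bs\<^esub> l') = src H l \<otimes>\<^bsub>A\<^esub> src H l'"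
  "src H \<one>\<^bsub>Bs\<^esub> = \<one>\<^bsub>A\<^esub>"
  by simp_all

lemma tgt_simps [simp]:
  "l \<in> carrier Bs \<Longrightarrow> tgt H l \<in> carrier A"
  "\<lbrakk>l \<in> carrier Bs; l' \<in> carrier Bs\<rbrakk> \<Longrightarrow> tgt H (l \<oplus>\<^bsub>Bs\<^esub> l') = tgt H l \<oplus>\<^bsub>A\<^esub> tgt H l'"
  "\<lbrakk>l \<in> carrier Bs; l' \<in> carrier Bs\<rbrakk> \<Longrightarrow> tgt H (l \<otimes>\<^bsub>Bs\<^esub> l') = tgt H l' \<otimes>\<^bsub>A\<^esub> tgt H l"
  "tgt H \<one>\<^bsub>Bs\<^esub> = \<one>\<^bsub>A\<^esub>"
  using target.hom_closed[of l] target.hom_add[of l l'] target.hom_mult[of l' l] target.hom_one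
  by (simp_all add: opposite_ring_def)

lemma counit_simps [simp]:
  "a \<in> carrier A \<Longrightarrow> counit H a \<in> carrier Bs"
  "\<lbrakk>a \<in> carrier A; b \<in> carrier A\<rbrakk> \<Longrightarrow> counit H (a \<oplus>\<^bsub>A\<^esub> b) = counit H a \<oplus>\<^bsub>Bs\<^esub> counit H b"
  using hom_in_carrier[OF comonoid.eps_hom, of a] hom_mult[OF comonoid.eps_hom, of a b] by simp_all

abbreviation "bal \<equiv> comonoid.T.bal"
abbreviation "T \<equiv> comonoid.T.T"

lemma left_tensor_eq: "left_tensor H = T"
  by (simp add: left_tensor_def)

definition SL :: "('g, 'q) monoid_scheme \<Rightarrow> 'a \<Rightarrow> ('a \<Rightarrow> 'a \<Rightarrow> 'g) \<Rightarrow> 'g" where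
  "SL G a f = comonoid.T.sw (comult H a) G f"

lemma SL_tlift:
  "\<lbrakk>comm_group G; bal G f; a \<in> carrier A\<rbrakk>
    \<Longrightarrow> tlift G (\<lambda>(x, y). f x y) (comult H a) = SL G a f"
  unfolding SL_def by (rule comonoid.T.sw_tlift[OF _ _ comonoid.comul_cl])

lemma SL_cong:
  "\<lbrakk>a \<in> carrier A; \<And>x y. \<lbrakk>x \<in> carrier A; y \<in> carrier A\<rbrakk> \<Longrightarrow> f x y = g x y\<rbrakk>
    \<Longrightarrow> SL G a f = SL G a g"
  unfolding SL_def by (rule comonoid.T.sw_cong[OF comonoid.comul_cl]) blast+

lemma SL_closed:
  "\<lbrakk>comm_group G; a \<in> carrier A; \<And>x y. \<lbrakk>x \<in> carrier A; y \<in> carrier A\<rbrakk> \<Longrightarrow> f x y \<in> carrier G\<rbrakk>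
    \<Longrightarrow> SL G a f \<in> carrier G"
  unfolding SL_def by (rule comonoid.T.sw_closed[OF _ comonoid.comul_cl]) blast+

lemma SL_hom:
  "\<lbrakk>h \<in> hom G K; comm_group G; comm_group K; a \<in> carrier A;
    \<And>x y. \<lbrakk>x \<in> carrier A; y \<in> carrier A\<rbrakk> \<Longrightarrow> f x y \<in> carrier G\<rbrakk>
    \<Longrightarrow> h (SL G a f) = SL K a (\<lambda>x y. h (f x y))"
  unfolding SL_def by (rule comonoid.T.sw_hom[OF _ _ _ comonoid.comul_cl]) blast+

lemma SL_mult:
  "\<lbrakk>comm_group G; a \<in> carrier A; \<And>x y. \<lbrakk>x \<in> carrier A; y \<in> carrier A\<rbrakk> \<Longrightarrow> f x y \<in> carrier G;
    \<And>x y. \<lbrakk>x \<in> carrier A; y \<in> carrier A\<rbrakk> \<Longrightarrow> g x y \<in> carrier G\<rbrakk>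
    \<Longrightarrow> SL G a (\<lambda>x y. f x y \<otimes>\<^bsub>G\<^esub> g x y) = SL G a f \<otimes>\<^bsub>G\<^esub> SL G a g"
  unfolding SL_def by (rule comonoid.T.sw_mult[OF _ comonoid.comul_cl]) blast+

lemma SL_lsum:
  "SL G a f = lsum G (\<lambda>(x, y). f x y) (sweedler_rep T (carrier A \<times> carrier A) (comult H a))"
  by (simp add: SL_def comonoid.T.sw_def)

lemma rep_closed:
  "a \<in> carrier A \<Longrightarrow>
    set (sweedler_rep T (carrier A \<times> carrier A) (comult H a)) \<subseteq> carrier A \<times> carrier A"
  by (rule comonoid.T.rep_props(1)[OF comonoid.comul_cl])

lemma SL_swap:
  "\<lbrakk>comm_group G; a \<in> carrier A;
    \<And>x y q. \<lbrakk>x \<in> carrier A; y \<in> carrier A; q \<in> set ys\<rbrakk> \<Longrightarrow> f x y q \<in> carrier G\<rbrakk>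
    \<Longrightarrow> SL G a (\<lambda>x y. lsum G (f x y) ys) = lsum G (\<lambda>q. SL G a (\<lambda>x y. f x y q)) ys"
  unfolding SL_def by (rule comonoid.T.sw_swap[OF _ comonoid.comul_cl]) blast+

lemma SL_SL_swap:
  assumes "comm_group G" "a \<in> carrier A" "b \<in> carrier A"
    "\<And>x y u v. \<lbrakk>x \<in> carrier A; y \<in> carrier A; u \<in> carrier A; v \<in> carrier A\<rbrakk> \<Longrightarrow> f x y u v \<in> carrier G"
  shows "SL G a (\<lambda>x y. SL G b (\<lambda>u v. f x y u v)) = SL G b (\<lambda>u v. SL G a (\<lambda>x y. f x y u v))"
  unfolding SL_lsum[of G b] using rep_closed[OF assms(3)]
  by (subst SL_swap[OF assms(1,2)]) (auto simp: split_def intro!: assms(4))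

lemma SL_add:
  "\<lbrakk>comm_group G; bal G f; a \<in> carrier A; b \<in> carrier A\<rbrakk>
    \<Longrightarrow> SL G (a \<oplus>\<^bsub>A\<^esub> b) f = SL G a f \<otimes>\<^bsub>G\<^esub> SL G b f"
  unfolding SL_def by (rule comonoid.sw_comul_add)

lemma SL_coassoc:
  "\<lbrakk>comm_group G; comonoid.T3.bal3 G f; a \<in> carrier A\<rbrakk>
    \<Longrightarrow> SL G a (\<lambda>x y. SL G x (\<lambda>u v. f u v y)) = SL G a (\<lambda>x y. SL G y (\<lambda>u v. f x u v))"
  unfolding SL_def by (rule comonoid.sw_coassoc)

lemma bal_tens_mult:
  assumes "u \<in> carrier A" "v \<in> carrier A" "bal G f"
  shows "bal G (\<lambda>x y. f (x \<otimes>\<^bsub>A\<^esub> u) (y \<otimes>\<^bsub>A\<^esub> v))"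
  by (rule comonoid.bal_map[OF assms(3)])
    (simp_all add: assms(1,2) source.S.l_distr source.S.r_distr mult_left_def mult_right_def source.S.m_assoc)

lemma bal_takeuchi1:
  "\<lbrakk>l \<in> carrier Bs; bal G f\<rbrakk> \<Longrightarrow> bal G (\<lambda>x y. f (x \<otimes>\<^bsub>A\<^esub> tgt H l) y)"
  by (rule comonoid.bal_map[where f = f and h = "\<lambda>x. x"])
    (simp_all add: source.S.l_distr source.S.r_distr mult_left_def mult_right_def source.S.m_assoc src_tgt_commute)

lemma bal_takeuchi2:
  "\<lbrakk>l \<in> carrier Bs; bal G f\<rbrakk> \<Longrightarrow> bal G (\<lambda>x y. f x (y \<otimes>\<^bsub>A\<^esub> src H l))"
  by (rule comonoid.bal_map[where f = f and g = "\<lambda>x. x"])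
    (simp_all add: source.S.l_distr source.S.r_distr mult_left_def mult_right_def source.S.m_assoc src_tgt_commute)

lemma SL_takeuchi:
  assumes "comm_group G" "bal G f" "l \<in> carrier Bs" "a \<in> carrier A"
  shows "SL G a (\<lambda>x y. f (x \<otimes>\<^bsub>A\<^esub> tgt H l) y) = SL G a (\<lambda>x y. f x (y \<otimes>\<^bsub>A\<^esub> src H l))"
proof -
  note b1 = bal_takeuchi1[OF assms(3)] and b2 = bal_takeuchi2[OF assms(3)]
  have "tlift T (\<lambda>(x, y). tens T (x \<otimes>\<^bsub>A\<^esub> tgt H l, y)) (comult H a)
      = tlift T (\<lambda>(x, y). tens T (x, y \<otimes>\<^bsub>A\<^esub> src H l)) (comult H a)"
    using takeuchi[OF assms(3,4)] by (simp only: left_tensor_eq)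
  then have "tlift G (\<lambda>(x, y). f x y) (tlift T (\<lambda>(x, y). tens T (x \<otimes>\<^bsub>A\<^esub> tgt H l, y)) (comult H a))
      = tlift G (\<lambda>(x, y). f x y) (tlift T (\<lambda>(x, y). tens T (x, y \<otimes>\<^bsub>A\<^esub> src H l)) (comult H a))"
    by (rule arg_cong)
  then show ?thesis
    unfolding SL_def
    using comonoid.T.tlift_tlift_map[OF assms(1,2) b1[OF comonoid.T.bal_tens] comonoid.comul_cl[OF assms(4)]]
      comonoid.T.tlift_tlift_map[OF assms(1,2) b2[OF comonoid.T.bal_tens] comonoid.comul_cl[OF assms(4)]]
    by (simp add: assms(3))
qed

lemma SL_one: "\<lbrakk>comm_group G; bal G f\<rbrakk> \<Longrightarrow> SL G \<one>\<^bsub>A\<^esub> f = f \<one>\<^bsub>A\<^esub> \<one>\<^bsub>A\<^esub>"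
  unfolding SL_def comult_one left_tensor_eq by (rule comonoid.T.sw_tens) simp_all

lemma SL_src:
  "\<lbrakk>comm_group G; bal G f; l \<in> carrier Bs; a \<in> carrier A\<rbrakk>
    \<Longrightarrow> SL G (src H l \<otimes>\<^bsub>A\<^esub> a) f = SL G a (\<lambda>x y. f (src H l \<otimes>\<^bsub>A\<^esub> x) y)"
  using comonoid.sw_comul_lact[of G f l a] unfolding SL_def mult_left_def mult_right_def .

lemma SL_tgt:
  "\<lbrakk>comm_group G; bal G f; l \<in> carrier Bs; a \<in> carrier A\<rbrakk>
    \<Longrightarrow> SL G (tgt H l \<otimes>\<^bsub>A\<^esub> a) f = SL G a (\<lambda>x y. f x (tgt H l \<otimes>\<^bsub>A\<^esub> y))"
  using comonoid.sw_comul_ract[of G f l a] unfolding SL_def mult_left_def mult_right_def .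

text \<open>This is where the Takeuchi condition makes the product of two coproducts well defined: a
  factor \<open>tgt H b\<close> in front of \<open>u\<close> is absorbed behind the first leg of
  \<open>a\<close>, leaves it as \<open>src H b\<close> behind the second leg, and so ends up in
  front of \<open>v\<close>.\<close>

lemma bal_SL_mult:
  assumes "comm_group G" "bal G f" "a \<in> carrier A"
  shows "bal G (\<lambda>u v. SL G a (\<lambda>x y. f (x \<otimes>\<^bsub>A\<^esub> u) (y \<otimes>\<^bsub>A\<^esub> v)))"
proof -
  have cl: "f x y \<in> carrier G" if "x \<in> carrier A" "y \<in> carrier A" for x y
    by (rule balancedD(1)[OF assms(2) that])
  show ?thesis
  proof (rule balancedI)
    fix u b v assume u: "u \<in> carrier A" and v: "v \<in> carrier A" and b: "b \<in> carrier Bs"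
    have "SL G a (\<lambda>x y. f ((x \<otimes>\<^bsub>A\<^esub> tgt H b) \<otimes>\<^bsub>A\<^esub> u) (y \<otimes>\<^bsub>A\<^esub> v)) = SL G a (\<lambda>x y. f (x \<otimes>\<^bsub>A\<^esub> u) ((y \<otimes>\<^bsub>A\<^esub> src H b) \<otimes>\<^bsub>A\<^esub> v))"
      using SL_takeuchi[OF assms(1) bal_tens_mult[OF u v assms(2)] b assms(3)] .
    then show "SL G a (\<lambda>x y. f (x \<otimes>\<^bsub>A\<^esub> mult_left A (tgt H) b u) (y \<otimes>\<^bsub>A\<^esub> v)) = SL G a (\<lambda>x y. f (x \<otimes>\<^bsub>A\<^esub> u) (y \<otimes>\<^bsub>A\<^esub> mult_left A (src H) b v))"
      by (subst (1 2) SL_cong[where a = a])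
        (auto simp: mult_left_def mult_right_def source.S.m_assoc u v b assms(3) cong: SL_cong)
  qed (auto simp: source.S.l_distr source.S.r_distr cl balancedD(2,3)[OF assms(2)] assms(3)
      SL_mult[OF assms(1,3), symmetric] intro!: SL_closed assms SL_cong)
qed

lemma SL_times:
  assumes "comm_group G" "bal G f" "a \<in> carrier A" "b \<in> carrier A"
  shows "SL G (a \<otimes>\<^bsub>A\<^esub> b) f = SL G b (\<lambda>u v. SL G a (\<lambda>x y. f (x \<otimes>\<^bsub>A\<^esub> u) (y \<otimes>\<^bsub>A\<^esub> v)))"
proof -
  let ?h = "tlift G (\<lambda>(x, y). f x y)"
  let ?in = "\<lambda>u v. SL T a (\<lambda>x y. tens T (x \<otimes>\<^bsub>A\<^esub> u, y \<otimes>\<^bsub>A\<^esub> v))"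
  have i: "tlift T (\<lambda>(x, y). tens T (x \<otimes>\<^bsub>A\<^esub> u, y \<otimes>\<^bsub>A\<^esub> v)) (comult H a) = ?in u v"
    if "u \<in> carrier A" "v \<in> carrier A" for u v
    by (rule SL_tlift[OF comonoid.T.comm_group_T bal_tens_mult[OF that comonoid.T.bal_tens] assms(3)])
  have bin: "bal T ?in"
    by (rule bal_SL_mult[OF comonoid.T.comm_group_T comonoid.T.bal_tens assms(3)])
  \<comment> \<open>The axiom is written with \<open>tlift\<close>, whose inner value agrees with
    the sum \<open>?in\<close> only for arguments in the carrier; balancedness is tested only there
    and so carries over.\<close>
  have b: "bal T (\<lambda>u v. tlift T (\<lambda>(x, y). tens T (x \<otimes>\<^bsub>A\<^esub> u, y \<otimes>\<^bsub>A\<^esub> v)) (comult H a))"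
    by (rule balancedI) (simp_all add: i balancedD[OF bin] comonoid.ract_closed comonoid.lact_closed)
  have hom: "?h \<in> hom T G" by (rule comonoid.T.tlift_hom[OF assms(1,2)])
  have "comult H (a \<otimes>\<^bsub>A\<^esub> b) = tlift T (\<lambda>(u, v). tlift T (\<lambda>(x, y). tens T (x \<otimes>\<^bsub>A\<^esub> u, y \<otimes>\<^bsub>A\<^esub> v)) (comult H a)) (comult H b)"
    using comult_mult[OF assms(3,4)] by (simp only: left_tensor_eq)
  also have "\<dots> = SL T b (\<lambda>u v. tlift T (\<lambda>(x, y). tens T (x \<otimes>\<^bsub>A\<^esub> u, y \<otimes>\<^bsub>A\<^esub> v)) (comult H a))"
    by (rule SL_tlift[OF comonoid.T.comm_group_T b assms(4)])
  also have "\<dots> = SL T b ?in"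
    by (rule SL_cong[OF assms(4) i])
  finally have c: "comult H (a \<otimes>\<^bsub>A\<^esub> b) = SL T b ?in" .
  have "SL G (a \<otimes>\<^bsub>A\<^esub> b) f = ?h (comult H (a \<otimes>\<^bsub>A\<^esub> b))"
    by (rule SL_tlift[OF assms(1,2), symmetric]) (simp add: assms)
  also have "\<dots> = SL G b (\<lambda>u v. ?h (?in u v))"
    unfolding c by (rule SL_hom[OF hom comonoid.T.comm_group_T assms(1,4) balancedD(1)[OF bin]])
  also have "\<dots> = SL G b (\<lambda>u v. SL G a (\<lambda>x y. f (x \<otimes>\<^bsub>A\<^esub> u) (y \<otimes>\<^bsub>A\<^esub> v)))"
  proof (rule SL_cong[OF assms(4)])
    fix u v assume uv: "u \<in> carrier A" "v \<in> carrier A"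
    have "?h (?in u v) = SL G a (\<lambda>x y. ?h (tens T (x \<otimes>\<^bsub>A\<^esub> u, y \<otimes>\<^bsub>A\<^esub> v)))"
      by (rule SL_hom[OF hom comonoid.T.comm_group_T assms(1,3)])
        (simp add: comonoid.T.tens_cl uv)
    also have "\<dots> = SL G a (\<lambda>x y. f (x \<otimes>\<^bsub>A\<^esub> u) (y \<otimes>\<^bsub>A\<^esub> v))"
      by (rule SL_cong[OF assms(3)]) (simp add: comonoid.T.tlift_tens[OF assms(1,2)] uv)
    finally show "?h (?in u v) = SL G a (\<lambda>x y. f (x \<otimes>\<^bsub>A\<^esub> u) (y \<otimes>\<^bsub>A\<^esub> v))" .
  qed
  finally show ?thesis .
qed

text \<open>The comonoid axioms describe multiplication by \<open>src H l\<close> from the left. For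
  multiplication from the right, the coproduct of the product is expanded over that of
  \<open>src H l\<close>, which is \<open>src H l\<close> acting on the coproduct of the
  unit.\<close>

lemma SL_src':
  assumes "comm_group G" "bal G f" "l \<in> carrier Bs" "a \<in> carrier A"
  shows "SL G (a \<otimes>\<^bsub>A\<^esub> src H l) f = SL G a (\<lambda>x y. f (x \<otimes>\<^bsub>A\<^esub> src H l) y)"
proof -
  note b = bal_SL_mult[OF assms(1,2,4)]
  have "bal G (\<lambda>u v. SL G a (\<lambda>x y. f (x \<otimes>\<^bsub>A\<^esub> (src H l \<otimes>\<^bsub>A\<^esub> u)) (y \<otimes>\<^bsub>A\<^esub> v)))"
    by (rule comonoid.bal_map[OF b, of "\<lambda>x. src H l \<otimes>\<^bsub>A\<^esub> x" "\<lambda>x. x"];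
      ((simp add: assms(3) mult_left_def source.S.r_distr source.S.m_assoc[symmetric] src_tgt_commute; fail)
        | (simp add: assms(3) mult_right_def source.S.l_distr source.S.m_assoc src_tgt_commute; fail)))
  from SL_one[OF assms(1) this] show ?thesis
    using SL_times[OF assms(1,2,4), of "src H l"] SL_src[OF assms(1) b assms(3) source.S.one_closed] assms(3,4)
    by (auto intro: SL_cong)
qed

lemma SL_tgt':
  assumes "comm_group G" "bal G f" "l \<in> carrier Bs" "a \<in> carrier A"
  shows "SL G (a \<otimes>\<^bsub>A\<^esub> tgt H l) f = SL G a (\<lambda>x y. f x (y \<otimes>\<^bsub>A\<^esub> tgt H l))"
proof -
  note b = bal_SL_mult[OF assms(1,2,4)]
  have "bal G (\<lambda>u v. SL G a (\<lambda>x y. f (x \<otimes>\<^bsub>A\<^esub> u) (y \<otimes>\<^bsub>A\<^esub> (tgt H l \<otimes>\<^bsub>A\<^esub> v))))"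
    by (rule comonoid.bal_map[OF b, of "\<lambda>x. x" "\<lambda>x. tgt H l \<otimes>\<^bsub>A\<^esub> x"];
      ((simp add: assms(3) mult_left_def source.S.r_distr source.S.m_assoc[symmetric] src_tgt_commute; fail)
        | (simp add: assms(3) mult_right_def source.S.l_distr source.S.m_assoc src_tgt_commute; fail)))
  from SL_one[OF assms(1) this] show ?thesis
    using SL_times[OF assms(1,2,4), of "tgt H l"] SL_tgt[OF assms(1) b assms(3) source.S.one_closed] assms(3,4)
    by (auto intro: SL_cong)
qed

lemma SL_counit1:
  assumes "a \<in> carrier A"
  shows "SL (add_monoid A) a (\<lambda>x y. src H (counit H x) \<otimes>\<^bsub>A\<^esub> y) = a"
proof -
  have "bal (add_monoid A) (\<lambda>x y. src H (counit H x) \<otimes>\<^bsub>A\<^esub> y)"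
    by (rule balancedI) (simp_all add: mult_left_def mult_right_def source.S.l_distr source.S.r_distr source.S.m_assoc
        comonoid.eps_lact[unfolded mult_left_def mult_right_def] comonoid.eps_ract[unfolded mult_left_def mult_right_def])
  from SL_tlift[OF source.S.a_comm_group this assms] comonoid.eps_left[OF assms]
  show ?thesis by (simp add: mult_left_def mult_right_def)
qed

lemma SL_counit2:
  assumes "a \<in> carrier A"
  shows "SL (add_monoid A) a (\<lambda>x y. tgt H (counit H y) \<otimes>\<^bsub>A\<^esub> x) = a"
proof -
  have "bal (add_monoid A) (\<lambda>x y. tgt H (counit H y) \<otimes>\<^bsub>A\<^esub> x)"
    by (rule balancedI) (simp_all add: mult_left_def mult_right_def source.S.l_distr source.S.r_distr source.S.m_assoc
        comonoid.eps_lact[unfolded mult_left_def mult_right_def] comonoid.eps_ract[unfolded mult_left_def mult_right_def])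
  from SL_tlift[OF source.S.a_comm_group this assms] comonoid.eps_right[OF assms]
  show ?thesis by (simp add: mult_left_def mult_right_def)
qed

end

context right_bialgebroid
begin

abbreviation "A \<equiv> total_ring H"
abbreviation "Bs \<equiv> base_ring H"

lemma src_simps [simp]:
  "l \<in> carrier Bs \<Longrightarrow> src H l \<in> carrier A"
  "\<lbrakk>l \<in> carrier Bs; l' \<in> carrier Bs\<rbrakk> \<Longrightarrow> src H (l \<oplus>\<^bsub>Bs\<^esub> l') = src H l \<oplus>\<^bsub>A\<^esub> src H l'"
  "\<lbrakk>l \<in> carrier Bs; l' \<in> carrier Bs\<rbrakk> \<Longrightarrow> src H (l \<otimes>\<^bsub>Bs\<^esub> l') = src H l \<otimes>\<^bsub>A\<^esub> src H l'"
  "src H \<one>\<^bsub>Bs\<^esub> = \<one>\<^bsub>A\<^esub>"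
  by simp_all

lemma tgt_simps [simp]:
  "l \<in> carrier Bs \<Longrightarrow> tgt H l \<in> carrier A"
  "\<lbrakk>l \<in> carrier Bs; l' \<in> carrier Bs\<rbrakk> \<Longrightarrow> tgt H (l \<oplus>\<^bsub>Bs\<^esub> l') = tgt H l \<oplus>\<^bsub>A\<^esub> tgt H l'"
  "\<lbrakk>l \<in> carrier Bs; l' \<in> carrier Bs\<rbrakk> \<Longrightarrow> tgt H (l \<otimes>\<^bsub>Bs\<^esub> l') = tgt H l' \<otimes>\<^bsub>A\<^esub> tgt H l"
  "tgt H \<one>\<^bsub>Bs\<^esub> = \<one>\<^bsub>A\<^esub>"
  using target.hom_closed[of l] target.hom_add[of l l'] target.hom_mult[of l' l] target.hom_one
  by (simp_all add: opposite_ring_def)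

lemma counit_simps [simp]:
  "a \<in> carrier A \<Longrightarrow> counit H a \<in> carrier Bs"
  "\<lbrakk>a \<in> carrier A; b \<in> carrier A\<rbrakk> \<Longrightarrow> counit H (a \<oplus>\<^bsub>A\<^esub> b) = counit H a \<oplus>\<^bsub>Bs\<^esub> counit H b"
  using hom_in_carrier[OF comonoid.eps_hom, of a] hom_mult[OF comonoid.eps_hom, of a b] by simp_all

abbreviation "bal \<equiv> comonoid.T.bal"
abbreviation "T \<equiv> comonoid.T.T"

lemma right_tensor_eq: "right_tensor H = T"
  by (simp add: right_tensor_def)

definition SR :: "('g, 'q) monoid_scheme \<Rightarrow> 'a \<Rightarrow> ('a \<Rightarrow> 'a \<Rightarrow> 'g) \<Rightarrow> 'g" where
  "SR G a f = comonoid.T.sw (comult H a) G f"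

lemma SR_tlift:
  "\<lbrakk>comm_group G; bal G f; a \<in> carrier A\<rbrakk>
    \<Longrightarrow> tlift G (\<lambda>(x, y). f x y) (comult H a) = SR G a f"
  unfolding SR_def by (rule comonoid.T.sw_tlift[OF _ _ comonoid.comul_cl])

lemma SR_cong:
  "\<lbrakk>a \<in> carrier A; \<And>x y. \<lbrakk>x \<in> carrier A; y \<in> carrier A\<rbrakk> \<Longrightarrow> f x y = g x y\<rbrakk>
    \<Longrightarrow> SR G a f = SR G a g"
  unfolding SR_def by (rule comonoid.T.sw_cong[OF comonoid.comul_cl]) blast+

lemma SR_closed:
  "\<lbrakk>comm_group G; a \<in> carrier A; \<And>x y. \<lbrakk>x \<in> carrier A; y \<in> carrier A\<rbrakk> \<Longrightarrow> f x y \<in> carrier G\<rbrakk>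
    \<Longrightarrow> SR G a f \<in> carrier G"
  unfolding SR_def by (rule comonoid.T.sw_closed[OF _ comonoid.comul_cl]) blast+

lemma SR_hom:
  "\<lbrakk>h \<in> hom G K; comm_group G; comm_group K; a \<in> carrier A;
    \<And>x y. \<lbrakk>x \<in> carrier A; y \<in> carrier A\<rbrakk> \<Longrightarrow> f x y \<in> carrier G\<rbrakk>
    \<Longrightarrow> h (SR G a f) = SR K a (\<lambda>x y. h (f x y))"
  unfolding SR_def by (rule comonoid.T.sw_hom[OF _ _ _ comonoid.comul_cl]) blast+

lemma SR_mult:
  "\<lbrakk>comm_group G; a \<in> carrier A; \<And>x y. \<lbrakk>x \<in> carrier A; y \<in> carrier A\<rbrakk> \<Longrightarrow> f x y \<in> carrier G;
    \<And>x y. \<lbrakk>x \<in> carrier A; y \<in> carrier A\<rbrakk> \<Longrightarrow> g x y \<in> carrier G\<rbrakk>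
    \<Longrightarrow> SR G a (\<lambda>x y. f x y \<otimes>\<^bsub>G\<^esub> g x y) = SR G a f \<otimes>\<^bsub>G\<^esub> SR G a g"
  unfolding SR_def by (rule comonoid.T.sw_mult[OF _ comonoid.comul_cl]) blast+

lemma SR_lsum:
  "SR G a f = lsum G (\<lambda>(x, y). f x y) (sweedler_rep T (carrier A \<times> carrier A) (comult H a))"
  by (simp add: SR_def comonoid.T.sw_def)

lemma rep_closed:
  "a \<in> carrier A \<Longrightarrow>
    set (sweedler_rep T (carrier A \<times> carrier A) (comult H a)) \<subseteq> carrier A \<times> carrier A"
  by (rule comonoid.T.rep_props(1)[OF comonoid.comul_cl])

lemma SR_swap:
  "\<lbrakk>comm_group G; a \<in> carrier A;
    \<And>x y q. \<lbrakk>x \<in> carrier A; y \<in> carrier A; q \<in> set ys\<rbrakk> \<Longrightarrow> f x y q \<in> carrier G\<rbrakk>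
    \<Longrightarrow> SR G a (\<lambda>x y. lsum G (f x y) ys) = lsum G (\<lambda>q. SR G a (\<lambda>x y. f x y q)) ys"
  unfolding SR_def by (rule comonoid.T.sw_swap[OF _ comonoid.comul_cl]) blast+

lemma SR_add:
  "\<lbrakk>comm_group G; bal G f; a \<in> carrier A; b \<in> carrier A\<rbrakk>
    \<Longrightarrow> SR G (a \<oplus>\<^bsub>A\<^esub> b) f = SR G a f \<otimes>\<^bsub>G\<^esub> SR G b f"
  unfolding SR_def by (rule comonoid.sw_comul_add)

lemma SR_coassoc:
  "\<lbrakk>comm_group G; comonoid.T3.bal3 G f; a \<in> carrier A\<rbrakk>
    \<Longrightarrow> SR G a (\<lambda>x y. SR G x (\<lambda>u v. f u v y)) = SR G a (\<lambda>x y. SR G y (\<lambda>u v. f x u v))"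
  unfolding SR_def by (rule comonoid.sw_coassoc)

lemma bal_tens_mult:
  assumes "u \<in> carrier A" "v \<in> carrier A" "bal G f"
  shows "bal G (\<lambda>x y. f (u \<otimes>\<^bsub>A\<^esub> x) (v \<otimes>\<^bsub>A\<^esub> y))"
  by (rule comonoid.bal_map[OF assms(3)])
    (simp_all add: assms(1,2) source.S.l_distr source.S.r_distr mult_left_def mult_right_def source.S.m_assoc)

lemma bal_takeuchi1:
  "\<lbrakk>l \<in> carrier Bs; bal G f\<rbrakk> \<Longrightarrow> bal G (\<lambda>x y. f (src H l \<otimes>\<^bsub>A\<^esub> x) y)"
  by (rule comonoid.bal_map[where f = f and h = "\<lambda>x. x"])
    (simp_all add: source.S.l_distr source.S.r_distr mult_left_def mult_right_def source.S.m_assoc src_tgt_commute)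

lemma bal_takeuchi2:
  "\<lbrakk>l \<in> carrier Bs; bal G f\<rbrakk> \<Longrightarrow> bal G (\<lambda>x y. f x (tgt H l \<otimes>\<^bsub>A\<^esub> y))"
  by (rule comonoid.bal_map[where f = f and g = "\<lambda>x. x"])
    (simp_all add: source.S.l_distr source.S.r_distr mult_left_def mult_right_def source.S.m_assoc src_tgt_commute)

lemma SR_takeuchi:
  assumes "comm_group G" "bal G f" "l \<in> carrier Bs" "a \<in> carrier A"
  shows "SR G a (\<lambda>x y. f (src H l \<otimes>\<^bsub>A\<^esub> x) y) = SR G a (\<lambda>x y. f x (tgt H l \<otimes>\<^bsub>A\<^esub> y))"
proof -
  note b1 = bal_takeuchi1[OF assms(3)] and b2 = bal_takeuchi2[OF assms(3)]
  have "tlift T (\<lambda>(x, y). tens T (src H l \<otimes>\<^bsub>A\<^esub> x, y)) (comult H a)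
      = tlift T (\<lambda>(x, y). tens T (x, tgt H l \<otimes>\<^bsub>A\<^esub> y)) (comult H a)"
    using takeuchi[OF assms(3,4)] by (simp only: right_tensor_eq)
  then have "tlift G (\<lambda>(x, y). f x y) (tlift T (\<lambda>(x, y). tens T (src H l \<otimes>\<^bsub>A\<^esub> x, y)) (comult H a))
      = tlift G (\<lambda>(x, y). f x y) (tlift T (\<lambda>(x, y). tens T (x, tgt H l \<otimes>\<^bsub>A\<^esub> y)) (comult H a))"
    by (rule arg_cong)
  then show ?thesis
    unfolding SR_def
    using comonoid.T.tlift_tlift_map[OF assms(1,2) b1[OF comonoid.T.bal_tens] comonoid.comul_cl[OF assms(4)]]
      comonoid.T.tlift_tlift_map[OF assms(1,2) b2[OF comonoid.T.bal_tens] comonoid.comul_cl[OF assms(4)]]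
    by (simp add: assms(3))
qed

lemma SR_one: "\<lbrakk>comm_group G; bal G f\<rbrakk> \<Longrightarrow> SR G \<one>\<^bsub>A\<^esub> f = f \<one>\<^bsub>A\<^esub> \<one>\<^bsub>A\<^esub>"
  unfolding SR_def comult_one right_tensor_eq by (rule comonoid.T.sw_tens) simp_all

lemma SR_src:
  "\<lbrakk>comm_group G; bal G f; l \<in> carrier Bs; a \<in> carrier A\<rbrakk>
    \<Longrightarrow> SR G (a \<otimes>\<^bsub>A\<^esub> src H l) f = SR G a (\<lambda>x y. f x (y \<otimes>\<^bsub>A\<^esub> src H l))"
  using comonoid.sw_comul_ract[of G f l a] unfolding SR_def mult_left_def mult_right_def .

lemma SR_tgt:
  "\<lbrakk>comm_group G; bal G f; l \<in> carrier Bs; a \<in> carrier A\<rbrakk>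
    \<Longrightarrow> SR G (a \<otimes>\<^bsub>A\<^esub> tgt H l) f = SR G a (\<lambda>x y. f (x \<otimes>\<^bsub>A\<^esub> tgt H l) y)"
  using comonoid.sw_comul_lact[of G f l a] unfolding SR_def mult_left_def mult_right_def .

lemma bal_SR_mult:
  assumes "comm_group G" "bal G f" "a \<in> carrier A"
  shows "bal G (\<lambda>u v. SR G a (\<lambda>x y. f (u \<otimes>\<^bsub>A\<^esub> x) (v \<otimes>\<^bsub>A\<^esub> y)))"
proof -
  have cl: "f x y \<in> carrier G" if "x \<in> carrier A" "y \<in> carrier A" for x y
    by (rule balancedD(1)[OF assms(2) that])
  show ?thesis
  proof (rule balancedI)
    fix u b v assume u: "u \<in> carrier A" and v: "v \<in> carrier A" and b: "b \<in> carrier Bs"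
    have "SR G a (\<lambda>x y. f (u \<otimes>\<^bsub>A\<^esub> (src H b \<otimes>\<^bsub>A\<^esub> x)) (v \<otimes>\<^bsub>A\<^esub> y)) = SR G a (\<lambda>x y. f (u \<otimes>\<^bsub>A\<^esub> x) (v \<otimes>\<^bsub>A\<^esub> (tgt H b \<otimes>\<^bsub>A\<^esub> y)))"
      using SR_takeuchi[OF assms(1) bal_tens_mult[OF u v assms(2)] b assms(3)] .
    then show "SR G a (\<lambda>x y. f (mult_right A (src H) u b \<otimes>\<^bsub>A\<^esub> x) (v \<otimes>\<^bsub>A\<^esub> y)) = SR G a (\<lambda>x y. f (u \<otimes>\<^bsub>A\<^esub> x) (mult_right A (tgt H) v b \<otimes>\<^bsub>A\<^esub> y))"
      by (subst (1 2) SR_cong[where a = a])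
        (auto simp: mult_left_def mult_right_def source.S.m_assoc u v b assms(3) cong: SR_cong)
  qed (auto simp: source.S.l_distr source.S.r_distr cl balancedD(2,3)[OF assms(2)] assms(3)
      SR_mult[OF assms(1,3), symmetric] intro!: SR_closed assms SR_cong)
qed

lemma SR_times:
  assumes "comm_group G" "bal G f" "a \<in> carrier A" "b \<in> carrier A"
  shows "SR G (b \<otimes>\<^bsub>A\<^esub> a) f = SR G b (\<lambda>u v. SR G a (\<lambda>x y. f (u \<otimes>\<^bsub>A\<^esub> x) (v \<otimes>\<^bsub>A\<^esub> y)))"
proof -
  let ?h = "tlift G (\<lambda>(x, y). f x y)"
  let ?in = "\<lambda>u v. SR T a (\<lambda>x y. tens T (u \<otimes>\<^bsub>A\<^esub> x, v \<otimes>\<^bsub>A\<^esub> y))"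
  have i: "tlift T (\<lambda>(x, y). tens T (u \<otimes>\<^bsub>A\<^esub> x, v \<otimes>\<^bsub>A\<^esub> y)) (comult H a) = ?in u v"
    if "u \<in> carrier A" "v \<in> carrier A" for u v
    by (rule SR_tlift[OF comonoid.T.comm_group_T bal_tens_mult[OF that comonoid.T.bal_tens] assms(3)])
  have bin: "bal T ?in"
    by (rule bal_SR_mult[OF comonoid.T.comm_group_T comonoid.T.bal_tens assms(3)])
  have b: "bal T (\<lambda>u v. tlift T (\<lambda>(x, y). tens T (u \<otimes>\<^bsub>A\<^esub> x, v \<otimes>\<^bsub>A\<^esub> y)) (comult H a))"
    by (rule balancedI) (simp_all add: i balancedD[OF bin] comonoid.ract_closed comonoid.lact_closed)
  have hom: "?h \<in> hom T G" by (rule comonoid.T.tlift_hom[OF assms(1,2)])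
  have "comult H (b \<otimes>\<^bsub>A\<^esub> a) = tlift T (\<lambda>(u, v). tlift T (\<lambda>(x, y). tens T (u \<otimes>\<^bsub>A\<^esub> x, v \<otimes>\<^bsub>A\<^esub> y)) (comult H a)) (comult H b)"
    using comult_mult[OF assms(4,3)] by (simp only: right_tensor_eq)
  also have "\<dots> = SR T b (\<lambda>u v. tlift T (\<lambda>(x, y). tens T (u \<otimes>\<^bsub>A\<^esub> x, v \<otimes>\<^bsub>A\<^esub> y)) (comult H a))"
    by (rule SR_tlift[OF comonoid.T.comm_group_T b assms(4)])
  also have "\<dots> = SR T b ?in"
    by (rule SR_cong[OF assms(4) i])
  finally have c: "comult H (b \<otimes>\<^bsub>A\<^esub> a) = SR T b ?in" .
  have "SR G (b \<otimes>\<^bsub>A\<^esub> a) f = ?h (comult H (b \<otimes>\<^bsub>A\<^esub> a))"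
    by (rule SR_tlift[OF assms(1,2), symmetric]) (simp add: assms)
  also have "\<dots> = SR G b (\<lambda>u v. ?h (?in u v))"
    unfolding c by (rule SR_hom[OF hom comonoid.T.comm_group_T assms(1,4) balancedD(1)[OF bin]])
  also have "\<dots> = SR G b (\<lambda>u v. SR G a (\<lambda>x y. f (u \<otimes>\<^bsub>A\<^esub> x) (v \<otimes>\<^bsub>A\<^esub> y)))"
  proof (rule SR_cong[OF assms(4)])
    fix u v assume uv: "u \<in> carrier A" "v \<in> carrier A"
    have "?h (?in u v) = SR G a (\<lambda>x y. ?h (tens T (u \<otimes>\<^bsub>A\<^esub> x, v \<otimes>\<^bsub>A\<^esub> y)))"
      by (rule SR_hom[OF hom comonoid.T.comm_group_T assms(1,3)])
        (simp add: comonoid.T.tens_cl uv)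
    also have "\<dots> = SR G a (\<lambda>x y. f (u \<otimes>\<^bsub>A\<^esub> x) (v \<otimes>\<^bsub>A\<^esub> y))"
      by (rule SR_cong[OF assms(3)]) (simp add: comonoid.T.tlift_tens[OF assms(1,2)] uv)
    finally show "?h (?in u v) = SR G a (\<lambda>x y. f (u \<otimes>\<^bsub>A\<^esub> x) (v \<otimes>\<^bsub>A\<^esub> y))" .
  qed
  finally show ?thesis .
qed

text \<open>Mirror image of the left case: the comonoid axioms of a right bialgebroid cover right
  multiplication by base elements, and left multiplication is derived from multiplicativity.\<close>

lemma SR_src':
  assumes "comm_group G" "bal G f" "l \<in> carrier Bs" "a \<in> carrier A"
  shows "SR G (src H l \<otimes>\<^bsub>A\<^esub> a) f = SR G a (\<lambda>x y. f x (src H l \<otimes>\<^bsub>A\<^esub> y))"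
proof -
  note b = bal_SR_mult[OF assms(1,2,4)]
  have "bal G (\<lambda>u v. SR G a (\<lambda>x y. f (u \<otimes>\<^bsub>A\<^esub> x) ((v \<otimes>\<^bsub>A\<^esub> src H l) \<otimes>\<^bsub>A\<^esub> y)))"
    by (rule comonoid.bal_map[OF b, of "\<lambda>x. x" "\<lambda>x. x \<otimes>\<^bsub>A\<^esub> src H l"];
      ((simp add: assms(3) mult_left_def source.S.r_distr source.S.m_assoc[symmetric] src_tgt_commute; fail)
        | (simp add: assms(3) mult_right_def source.S.l_distr source.S.m_assoc src_tgt_commute; fail)))
  from SR_one[OF assms(1) this] show ?thesis
    using SR_times[OF assms(1,2,4), of "src H l"] SR_src[OF assms(1) b assms(3) source.S.one_closed] assms(3,4)
    by (auto intro: SR_cong)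
qed

lemma SR_tgt':
  assumes "comm_group G" "bal G f" "l \<in> carrier Bs" "a \<in> carrier A"
  shows "SR G (tgt H l \<otimes>\<^bsub>A\<^esub> a) f = SR G a (\<lambda>x y. f (tgt H l \<otimes>\<^bsub>A\<^esub> x) y)"
proof -
  note b = bal_SR_mult[OF assms(1,2,4)]
  have "bal G (\<lambda>u v. SR G a (\<lambda>x y. f ((u \<otimes>\<^bsub>A\<^esub> tgt H l) \<otimes>\<^bsub>A\<^esub> x) (v \<otimes>\<^bsub>A\<^esub> y)))"
    by (rule comonoid.bal_map[OF b, of "\<lambda>x. x \<otimes>\<^bsub>A\<^esub> tgt H l" "\<lambda>x. x"];
      ((simp add: assms(3) mult_left_def source.S.r_distr source.S.m_assoc[symmetric] src_tgt_commute; fail)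
        | (simp add: assms(3) mult_right_def source.S.l_distr source.S.m_assoc src_tgt_commute; fail)))
  from SR_one[OF assms(1) this] show ?thesis
    using SR_times[OF assms(1,2,4), of "tgt H l"] SR_tgt[OF assms(1) b assms(3) source.S.one_closed] assms(3,4)
    by (auto intro: SR_cong)
qed

lemma SR_counit1:
  assumes "a \<in> carrier A"
  shows "SR (add_monoid A) a (\<lambda>x y. y \<otimes>\<^bsub>A\<^esub> tgt H (counit H x)) = a"
proof -
  have "bal (add_monoid A) (\<lambda>x y. y \<otimes>\<^bsub>A\<^esub> tgt H (counit H x))"
    by (rule balancedI) (simp_all add: mult_left_def mult_right_def source.S.l_distr source.S.r_distr source.S.m_assoc
        comonoid.eps_lact[unfolded mult_left_def mult_right_def] comonoid.eps_ract[unfolded mult_left_def mult_right_def])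
  from SR_tlift[OF source.S.a_comm_group this assms] comonoid.eps_left[OF assms]
  show ?thesis by (simp add: mult_left_def mult_right_def)
qed

lemma SR_counit2:
  assumes "a \<in> carrier A"
  shows "SR (add_monoid A) a (\<lambda>x y. x \<otimes>\<^bsub>A\<^esub> src H (counit H y)) = a"
proof -
  have "bal (add_monoid A) (\<lambda>x y. x \<otimes>\<^bsub>A\<^esub> src H (counit H y))"
    by (rule balancedI) (simp_all add: mult_left_def mult_right_def source.S.l_distr source.S.r_distr source.S.m_assoc
        comonoid.eps_lact[unfolded mult_left_def mult_right_def] comonoid.eps_ract[unfolded mult_left_def mult_right_def])
  from SR_tlift[OF source.S.a_comm_group this assms] comonoid.eps_right[OF assms]
  show ?thesis by (simp add: mult_left_def mult_right_def)
qed

end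

section \<open>Pairs of a left and a right bialgebroid on one ring\<close>

text \<open>Used twice: for the given Hopf algebroid, and for its dual while the remaining Hopf
  algebroid axioms are still being proved. The coincidence of the images is what makes sums over two
  different coproducts balanced.\<close>

locale bialgebroid_pair = L: left_bialgebroid HL + R: right_bialgebroid HR
  for HL :: "('a, 'l) bialgebroid" and HR :: "('a, 'r) bialgebroid" +
  assumes total_rings [simp]: "total_ring HR = total_ring HL"
    and src_L_image: "src HL ` carrier (base_ring HL) = tgt HR ` carrier (base_ring HR)"
    and tgt_L_image: "tgt HL ` carrier (base_ring HL) = src HR ` carrier (base_ring HR)"
begin

abbreviation "A \<equiv> total_ring HL"
abbreviation "BL \<equiv> base_ring HL"
abbreviation "BR \<equiv> base_ring HR"
abbreviation "SL \<equiv> L.SL"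
abbreviation "SR \<equiv> R.SR"
abbreviation "balL \<equiv> L.bal"
abbreviation "balR \<equiv> balanced (carrier BR) A (mult_right A (src HR)) (\<lambda>r a. mult_right A (tgt HR) a r) A"

lemmas R_simps [simp] = R.src_simps[unfolded total_rings] R.tgt_simps[unfolded total_rings]
  R.counit_simps[unfolded total_rings]

lemmas SL_tlift = L.SL_tlift
lemmas SR_tlift = R.SR_tlift[unfolded total_rings]
lemmas SL_cong = L.SL_cong
lemmas SR_cong = R.SR_cong[unfolded total_rings]
lemmas SL_closed = L.SL_closed
lemmas SR_closed = R.SR_closed[unfolded total_rings]
lemmas SL_hom = L.SL_hom
lemmas SR_hom = R.SR_hom[unfolded total_rings]
lemmas SL_mult = L.SL_mult
lemmas SR_mult = R.SR_mult[unfolded total_rings]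
lemmas SL_add = L.SL_add
lemmas SR_add = R.SR_add[unfolded total_rings]
lemmas SR_one = R.SR_one[unfolded total_rings]
lemmas SL_times = L.SL_times
lemmas SR_times = R.SR_times[unfolded total_rings]
lemmas bal_SL_mult = L.bal_SL_mult
lemmas bal_SR_mult = R.bal_SR_mult[unfolded total_rings]
lemmas balL_mult = L.bal_tens_mult
lemmas balR_mult = R.bal_tens_mult[unfolded total_rings]
lemmas SL_src' = L.SL_src'
lemmas SL_tgt' = L.SL_tgt'
lemmas SR_src' = R.SR_src'[unfolded total_rings]
lemmas SR_tgt' = R.SR_tgt'[unfolded total_rings]
lemmas SR_coassoc = R.SR_coassoc[unfolded total_rings]

lemmas SL_SL_swap = L.SL_SL_swap

lemma SL_SR_swap:
  assumes "comm_group G" "a \<in> carrier A" "b \<in> carrier A"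
    "\<And>x y u v. \<lbrakk>x \<in> carrier A; y \<in> carrier A; u \<in> carrier A; v \<in> carrier A\<rbrakk> \<Longrightarrow> f x y u v \<in> carrier G"
  shows "SL G a (\<lambda>x y. SR G b (\<lambda>u v. f x y u v)) = SR G b (\<lambda>u v. SL G a (\<lambda>x y. f x y u v))"
  unfolding R.SR_lsum[of G b] using R.rep_closed[unfolded total_rings, OF assms(3)]
  by (subst L.SL_swap[OF assms(1,2)]) (auto simp: split_def total_rings intro!: assms(4))

lemma SR_SR_swap:
  assumes "comm_group G" "a \<in> carrier A" "b \<in> carrier A"
    "\<And>x y u v. \<lbrakk>x \<in> carrier A; y \<in> carrier A; u \<in> carrier A; v \<in> carrier A\<rbrakk> \<Longrightarrow> f x y u v \<in> carrier G"
  shows "SR G a (\<lambda>x y. SR G b (\<lambda>u v. f x y u v)) = SR G b (\<lambda>u v. SR G a (\<lambda>x y. f x y u v))"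
  unfolding R.SR_lsum[of G b] using R.rep_closed[unfolded total_rings, OF assms(3)]
  by (subst R.SR_swap[unfolded total_rings, OF assms(1,2)])
    (auto simp: split_def total_rings intro!: assms(4))

lemma balL_cong:
  assumes "balL G g" "\<And>x y. \<lbrakk>x \<in> carrier A; y \<in> carrier A\<rbrakk> \<Longrightarrow> f x y = g x y"
  shows "balL G f"
  by (rule balancedI) (simp_all add: assms(2) balancedD[OF assms(1)] L.comonoid.lact_closed
      L.comonoid.ract_closed)

lemma balR_cong:
  assumes "balR G g" "\<And>x y. \<lbrakk>x \<in> carrier A; y \<in> carrier A\<rbrakk> \<Longrightarrow> f x y = g x y"
  shows "balR G f"
  by (rule balancedI) (simp_all add: assms(2) balancedD[OF assms(1)]
      R.comonoid.lact_closed[unfolded total_rings] R.comonoid.ract_closed[unfolded total_rings])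

section \<open>Functions of three variables balanced over the left base and then the right
  base\<close>

definition b3LR :: "('g, 'q) monoid_scheme \<Rightarrow> ('a \<Rightarrow> 'a \<Rightarrow> 'a \<Rightarrow> 'g) \<Rightarrow> bool" where
  "b3LR G f \<longleftrightarrow> (\<forall>x\<in>carrier A. balR G (f x)) \<and> (\<forall>z\<in>carrier A. balL G (\<lambda>x y. f x y z))"

sublocale T3LR: tensor3_setting BL BR A "\<lambda>a b. mult_left A (tgt HL) b a" "mult_left A (src HL)" A "mult_right A (src HR)" "\<lambda>r a. mult_right A (tgt HR) a r" A
  by unfold_locales (auto simp: mult_left_def mult_right_def)

text \<open>\<open>src HR r\<close> is also some \<open>tgt HL l\<close>, so as a right factor of
  \<open>x\<close> it moves to the second leg of the left coproduct, where balancedness over the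
  right base hands it to \<open>y\<close>.\<close>

lemma b3LRD1:
  assumes "comm_group G" "b3LR G f"
  shows "balR G (\<lambda>x y. SL G x (\<lambda>u v. f u v y))"
proof -
  have b1: "balR G (f x)" if "x \<in> carrier A" for x
    using assms(2) that unfolding b3LR_def by blast
  have b2: "balL G (\<lambda>x y. f x y z)" if "z \<in> carrier A" for z
    using assms(2) that unfolding b3LR_def by blast
  have cl: "f x y z \<in> carrier G" if "x \<in> carrier A" "y \<in> carrier A" "z \<in> carrier A" for x y z
    using balancedD(1)[OF b1] that by simp
  show ?thesis
  proof (rule balancedI)
    fix x r y assume x: "x \<in> carrier A" and r: "r \<in> carrier BR" and y: "y \<in> carrier A"
    from r obtain l where l: "l \<in> carrier BL" "src HR r = tgt HL l"
      using tgt_L_image by (metis image_eqI imageE)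
    show "SL G (mult_right A (src HR) x r) (\<lambda>u v. f u v y) = SL G x (\<lambda>u v. f u v (mult_right A (tgt HR) y r))"
      unfolding mult_right_def l(2) SL_tgt'[OF assms(1) b2[OF y] l(1) x]
      using x y r balancedD(4)[OF b1, unfolded mult_right_def]
      by (intro SL_cong) (simp_all add: l(2)[symmetric])
  next
    fix x y y' assume x: "x \<in> carrier A" and y: "y \<in> carrier A" "y' \<in> carrier A"
    then show "SL G x (\<lambda>u v. f u v (y \<oplus>\<^bsub>A\<^esub> y')) = SL G x (\<lambda>u v. f u v y) \<otimes>\<^bsub>G\<^esub> SL G x (\<lambda>u v. f u v y')"
      by (subst SL_mult[OF assms(1), symmetric]) (auto simp: cl balancedD(3)[OF b1] intro!: SL_cong)
  qed (auto simp: SL_add assms b2 cl intro!: SL_closed)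
qed

text \<open>Here \<open>src HL l\<close> is some \<open>tgt HR r\<close>, which as a left factor of
  \<open>y\<close> sits on the first leg of the right coproduct, next to \<open>x\<close>.\<close>

lemma b3LRD2:
  assumes "comm_group G" "b3LR G f"
  shows "balL G (\<lambda>x y. SR G y (f x))"
proof -
  have b1: "balR G (f x)" if "x \<in> carrier A" for x
    using assms(2) that unfolding b3LR_def by blast
  have b2: "balL G (\<lambda>x y. f x y z)" if "z \<in> carrier A" for z
    using assms(2) that unfolding b3LR_def by blast
  have cl: "f x y z \<in> carrier G" if "x \<in> carrier A" "y \<in> carrier A" "z \<in> carrier A" for x y z
    using balancedD(1)[OF b1] that by simp
  show ?thesis
  proof (rule balancedI)
    fix x l y assume x: "x \<in> carrier A" and l: "l \<in> carrier BL" and y: "y \<in> carrier A"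
    from l obtain r where r: "r \<in> carrier BR" "src HL l = tgt HR r"
      using src_L_image by (metis image_eqI imageE)
    show "SR G y (f (mult_left A (tgt HL) l x)) = SR G (mult_left A (src HL) l y) (f x)"
      unfolding mult_left_def r(2) SR_tgt'[OF assms(1) b1[OF x] r(1) y]
      using x y l r balancedD(4)[OF b2, unfolded mult_left_def] by (intro SR_cong) simp_all
  next
    fix x x' y assume x: "x \<in> carrier A" "x' \<in> carrier A" and y: "y \<in> carrier A"
    then show "SR G y (f (x \<oplus>\<^bsub>A\<^esub> x')) = SR G y (f x) \<otimes>\<^bsub>G\<^esub> SR G y (f x')"
      by (subst SR_mult[OF assms(1), symmetric]) (auto simp: cl balancedD(2)[OF b2] intro!: SR_cong)
  qed (auto simp: SR_add assms b1 cl intro!: SR_closed)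
qed

lemma b3LR_tlift:
  assumes cg: "comm_group G" and bt: "b3LR G f" and a: "a \<in> carrier A"
  shows "tlift G (\<lambda>(u, v). tlift G (\<lambda>(u', u''). f u' u'' v) (comult HL u)) (comult HR a)
      = SR G a (\<lambda>x y. SL G x (\<lambda>u v. f u v y))"
    and "tlift G (\<lambda>(u, v). tlift G (\<lambda>(v', v''). f u v' v'') (comult HR v)) (comult HL a)
      = SL G a (\<lambda>x y. SR G y (f x))"
proof -
  have b1: "balR G (f x)" if "x \<in> carrier A" for x
    using bt that unfolding b3LR_def by blast
  have b2: "balL G (\<lambda>x y. f x y z)" if "z \<in> carrier A" for z
    using bt that unfolding b3LR_def by blast
  have e: "tlift G (\<lambda>(u', u''). f u' u'' v) (comult HL u) = SL G u (\<lambda>u' u''. f u' u'' v)"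
    if "u \<in> carrier A" "v \<in> carrier A" for u v
    by (rule SL_tlift[OF cg b2[OF that(2)] that(1)])
  have "balR G (\<lambda>u v. tlift G (\<lambda>(u', u''). f u' u'' v) (comult HL u))"
    by (rule balR_cong[OF b3LRD1[OF cg bt] e])
  from SR_tlift[OF cg this a] SR_cong[OF a e]
  show "tlift G (\<lambda>(u, v). tlift G (\<lambda>(u', u''). f u' u'' v) (comult HL u)) (comult HR a)
      = SR G a (\<lambda>x y. SL G x (\<lambda>u v. f u v y))" by simp
  have e': "tlift G (\<lambda>(v', v''). f u v' v'') (comult HR v) = SR G v (f u)"
    if "u \<in> carrier A" "v \<in> carrier A" for u v
    by (rule SR_tlift[OF cg b1[OF that(1)] that(2)])
  have "balL G (\<lambda>u v. tlift G (\<lambda>(v', v''). f u v' v'') (comult HR v))"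
    by (rule balL_cong[OF b3LRD2[OF cg bt] e'])
  from SL_tlift[OF cg this a] SL_cong[OF a e']
  show "tlift G (\<lambda>(u, v). tlift G (\<lambda>(v', v''). f u v' v'') (comult HR v)) (comult HL a)
      = SL G a (\<lambda>x y. SR G y (f x))" by simp
qed

lemma b3LR_tens: "b3LR T3LR.T3 (\<lambda>x y z. tens T3LR.T3 (x, y, z))"
  using T3LR.bal3_tens unfolding b3LR_def balanced3_def by simp

text \<open>The last assumption is the universal instance, with values in the threefold tensor
  product itself; the homomorphism induced by \<open>f\<close> carries it to any other
  group.\<close>

lemma b3LR_transfer:
  assumes "comm_group G" "b3LR G f" "a \<in> carrier A"
    and "SR T3LR.T3 a (\<lambda>x y. SL T3LR.T3 x (\<lambda>u v. tens T3LR.T3 (u, v, y)))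
      = SL T3LR.T3 a (\<lambda>x y. SR T3LR.T3 y (\<lambda>u v. tens T3LR.T3 (x, u, v)))"
  shows "SR G a (\<lambda>x y. SL G x (\<lambda>u v. f u v y)) = SL G a (\<lambda>x y. SR G y (\<lambda>u v. f x u v))"
proof -
  let ?T3 = T3LR.T3
  let ?h = "tlift G (\<lambda>(x, y, z). f x y z)"
  have bf: "T3LR.bal3 G f"
    using assms(2) unfolding b3LR_def balanced3_def by simp
  note cg = T3LR.comm_group_T3
  have hom: "?h \<in> hom ?T3 G" by (rule T3LR.tlift3_hom[OF assms(1) bf])
  let ?l' = "SR ?T3 a (\<lambda>x y. SL ?T3 x (\<lambda>u v. tens ?T3 (u, v, y)))"
  let ?r' = "SL ?T3 a (\<lambda>x y. SR ?T3 y (\<lambda>u v. tens ?T3 (x, u, v)))"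
  have t: "?h (tens ?T3 (x, y, z)) = f x y z"
    if "x \<in> carrier A" "y \<in> carrier A" "z \<in> carrier A" for x y z
    by (rule T3LR.tlift3_tens[OF assms(1) bf that])
  have c: "tens ?T3 (x, y, z) \<in> carrier ?T3"
    if "x \<in> carrier A" "y \<in> carrier A" "z \<in> carrier A" for x y z
    by (rule T3LR.tens3_cl[OF that])
  have "?h ?l' = SR G a (\<lambda>x y. SL G x (\<lambda>u v. f u v y))"
  proof -
    have "?h ?l' = SR G a (\<lambda>x y. ?h (SL ?T3 x (\<lambda>u v. tens ?T3 (u, v, y))))"
      by (rule SR_hom[OF hom cg assms(1) assms(3)]) (auto intro!: SL_closed cg c)
    also have "\<dots> = SR G a (\<lambda>x y. SL G x (\<lambda>u v. f u v y))"
      by (rule SR_cong[OF assms(3)], subst SL_hom[OF hom cg assms(1)])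
        (auto intro!: c SL_cong simp: t)
    finally show ?thesis .
  qed
  moreover have "?h ?r' = SL G a (\<lambda>x y. SR G y (\<lambda>u v. f x u v))"
  proof -
    have "?h ?r' = SL G a (\<lambda>x y. ?h (SR ?T3 y (\<lambda>u v. tens ?T3 (x, u, v))))"
      by (rule SL_hom[OF hom cg assms(1) assms(3)]) (auto intro!: SR_closed cg c)
    also have "\<dots> = SL G a (\<lambda>x y. SR G y (\<lambda>u v. f x u v))"
      by (rule SL_cong[OF assms(3)], subst SR_hom[OF hom cg assms(1)])
        (auto intro!: c SR_cong simp: t)
    finally show ?thesis .
  qed
  moreover have "?l' = ?r'" by (rule assms(4))
  ultimately show ?thesis by simp
qed

section \<open>Functions of three variables balanced over the right base and then the left
  base\<close>

definition b3RL :: "('g, 'q) monoid_scheme \<Rightarrow> ('a \<Rightarrow> 'a \<Rightarrow> 'a \<Rightarrow> 'g) \<Rightarrow> bool" where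
  "b3RL G f \<longleftrightarrow> (\<forall>x\<in>carrier A. balL G (f x)) \<and> (\<forall>z\<in>carrier A. balR G (\<lambda>x y. f x y z))"

sublocale T3RL: tensor3_setting BR BL A "mult_right A (src HR)" "\<lambda>r a. mult_right A (tgt HR) a r" A "\<lambda>a b. mult_left A (tgt HL) b a" "mult_left A (src HL)" A
  by unfold_locales (auto simp: mult_left_def mult_right_def)

lemma b3RLD1:
  assumes "comm_group G" "b3RL G f"
  shows "balL G (\<lambda>x y. SR G x (\<lambda>u v. f u v y))"
proof -
  have b1: "balL G (f x)" if "x \<in> carrier A" for x
    using assms(2) that unfolding b3RL_def by blast
  have b2: "balR G (\<lambda>x y. f x y z)" if "z \<in> carrier A" for z
    using assms(2) that unfolding b3RL_def by blast
  have cl: "f x y z \<in> carrier G" if "x \<in> carrier A" "y \<in> carrier A" "z \<in> carrier A" for x y z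
    using balancedD(1)[OF b1] that by simp
  show ?thesis
  proof (rule balancedI)
    fix x r y assume x: "x \<in> carrier A" and r: "r \<in> carrier BL" and y: "y \<in> carrier A"
    from r obtain l where l: "l \<in> carrier BR" "tgt HL r = src HR l"
      using tgt_L_image by (metis image_eqI imageE)
    show "SR G (mult_left A (tgt HL) r x) (\<lambda>u v. f u v y) = SR G x (\<lambda>u v. f u v (mult_left A (src HL) r y))"
      unfolding mult_left_def l(2) SR_src'[OF assms(1) b2[OF y] l(1) x]
      using x y r balancedD(4)[OF b1, unfolded mult_left_def]
      by (intro SR_cong) (simp_all add: l(2)[symmetric])
  next
    fix x y y' assume x: "x \<in> carrier A" and y: "y \<in> carrier A" "y' \<in> carrier A"
    then show "SR G x (\<lambda>u v. f u v (y \<oplus>\<^bsub>A\<^esub> y')) = SR G x (\<lambda>u v. f u v y) \<otimes>\<^bsub>G\<^esub> SR G x (\<lambda>u v. f u v y')"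
      by (subst SR_mult[OF assms(1), symmetric]) (auto simp: cl balancedD(3)[OF b1] intro!: SR_cong)
  qed (auto simp: SR_add assms b2 cl intro!: SR_closed)
qed

lemma b3RLD2:
  assumes "comm_group G" "b3RL G f"
  shows "balR G (\<lambda>x y. SL G y (f x))"
proof -
  have b1: "balL G (f x)" if "x \<in> carrier A" for x
    using assms(2) that unfolding b3RL_def by blast
  have b2: "balR G (\<lambda>x y. f x y z)" if "z \<in> carrier A" for z
    using assms(2) that unfolding b3RL_def by blast
  have cl: "f x y z \<in> carrier G" if "x \<in> carrier A" "y \<in> carrier A" "z \<in> carrier A" for x y z
    using balancedD(1)[OF b1] that by simp
  show ?thesis
  proof (rule balancedI)
    fix x l y assume x: "x \<in> carrier A" and l: "l \<in> carrier BR" and y: "y \<in> carrier A"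
    from l obtain r where r: "r \<in> carrier BL" "tgt HR l = src HL r"
      using src_L_image by (metis image_eqI imageE)
    show "SL G y (f (mult_right A (src HR) x l)) = SL G (mult_right A (tgt HR) y l) (f x)"
      unfolding mult_right_def r(2) SL_src'[OF assms(1) b1[OF x] r(1) y]
      using x y l r balancedD(4)[OF b2, unfolded mult_right_def] by (intro SL_cong) simp_all
  next
    fix x x' y assume x: "x \<in> carrier A" "x' \<in> carrier A" and y: "y \<in> carrier A"
    then show "SL G y (f (x \<oplus>\<^bsub>A\<^esub> x')) = SL G y (f x) \<otimes>\<^bsub>G\<^esub> SL G y (f x')"
      by (subst SL_mult[OF assms(1), symmetric]) (auto simp: cl balancedD(2)[OF b2] intro!: SL_cong)
  qed (auto simp: SL_add assms b1 cl intro!: SL_closed)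
qed

lemma b3RL_tlift:
  assumes cg: "comm_group G" and bt: "b3RL G f" and a: "a \<in> carrier A"
  shows "tlift G (\<lambda>(u, v). tlift G (\<lambda>(u', u''). f u' u'' v) (comult HR u)) (comult HL a)
      = SL G a (\<lambda>x y. SR G x (\<lambda>u v. f u v y))"
    and "tlift G (\<lambda>(u, v). tlift G (\<lambda>(v', v''). f u v' v'') (comult HL v)) (comult HR a)
      = SR G a (\<lambda>x y. SL G y (f x))"
proof -
  have b1: "balL G (f x)" if "x \<in> carrier A" for x
    using bt that unfolding b3RL_def by blast
  have b2: "balR G (\<lambda>x y. f x y z)" if "z \<in> carrier A" for z
    using bt that unfolding b3RL_def by blast
  have e: "tlift G (\<lambda>(u', u''). f u' u'' v) (comult HR u) = SR G u (\<lambda>u' u''. f u' u'' v)"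
    if "u \<in> carrier A" "v \<in> carrier A" for u v
    by (rule SR_tlift[OF cg b2[OF that(2)] that(1)])
  have "balL G (\<lambda>u v. tlift G (\<lambda>(u', u''). f u' u'' v) (comult HR u))"
    by (rule balL_cong[OF b3RLD1[OF cg bt] e])
  from SL_tlift[OF cg this a] SL_cong[OF a e]
  show "tlift G (\<lambda>(u, v). tlift G (\<lambda>(u', u''). f u' u'' v) (comult HR u)) (comult HL a)
      = SL G a (\<lambda>x y. SR G x (\<lambda>u v. f u v y))" by simp
  have e': "tlift G (\<lambda>(v', v''). f u v' v'') (comult HL v) = SL G v (f u)"
    if "u \<in> carrier A" "v \<in> carrier A" for u v
    by (rule SL_tlift[OF cg b1[OF that(1)] that(2)])
  have "balR G (\<lambda>u v. tlift G (\<lambda>(v', v''). f u v' v'') (comult HL v))"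
    by (rule balR_cong[OF b3RLD2[OF cg bt] e'])
  from SR_tlift[OF cg this a] SR_cong[OF a e']
  show "tlift G (\<lambda>(u, v). tlift G (\<lambda>(v', v''). f u v' v'') (comult HL v)) (comult HR a)
      = SR G a (\<lambda>x y. SL G y (f x))" by simp
qed

lemma b3RL_tens: "b3RL T3RL.T3 (\<lambda>x y z. tens T3RL.T3 (x, y, z))"
  using T3RL.bal3_tens unfolding b3RL_def balanced3_def by simp

lemma b3RL_transfer:
  assumes "comm_group G" "b3RL G f" "a \<in> carrier A"
    and "SL T3RL.T3 a (\<lambda>x y. SR T3RL.T3 x (\<lambda>u v. tens T3RL.T3 (u, v, y)))
      = SR T3RL.T3 a (\<lambda>x y. SL T3RL.T3 y (\<lambda>u v. tens T3RL.T3 (x, u, v)))"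
  shows "SL G a (\<lambda>x y. SR G x (\<lambda>u v. f u v y)) = SR G a (\<lambda>x y. SL G y (\<lambda>u v. f x u v))"
proof -
  let ?T3 = T3RL.T3
  let ?h = "tlift G (\<lambda>(x, y, z). f x y z)"
  have bf: "T3RL.bal3 G f"
    using assms(2) unfolding b3RL_def balanced3_def by simp
  note cg = T3RL.comm_group_T3
  have hom: "?h \<in> hom ?T3 G" by (rule T3RL.tlift3_hom[OF assms(1) bf])
  let ?l' = "SL ?T3 a (\<lambda>x y. SR ?T3 x (\<lambda>u v. tens ?T3 (u, v, y)))"
  let ?r' = "SR ?T3 a (\<lambda>x y. SL ?T3 y (\<lambda>u v. tens ?T3 (x, u, v)))"
  have t: "?h (tens ?T3 (x, y, z)) = f x y z"
    if "x \<in> carrier A" "y \<in> carrier A" "z \<in> carrier A" for x y z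
    by (rule T3RL.tlift3_tens[OF assms(1) bf that])
  have c: "tens ?T3 (x, y, z) \<in> carrier ?T3"
    if "x \<in> carrier A" "y \<in> carrier A" "z \<in> carrier A" for x y z
    by (rule T3RL.tens3_cl[OF that])
  have "?h ?l' = SL G a (\<lambda>x y. SR G x (\<lambda>u v. f u v y))"
  proof -
    have "?h ?l' = SL G a (\<lambda>x y. ?h (SR ?T3 x (\<lambda>u v. tens ?T3 (u, v, y))))"
      by (rule SL_hom[OF hom cg assms(1) assms(3)]) (auto intro!: SR_closed cg c)
    also have "\<dots> = SL G a (\<lambda>x y. SR G x (\<lambda>u v. f u v y))"
      by (rule SL_cong[OF assms(3)], subst SR_hom[OF hom cg assms(1)])
        (auto intro!: c SR_cong simp: t)
    finally show ?thesis .
  qed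
  moreover have "?h ?r' = SR G a (\<lambda>x y. SL G y (\<lambda>u v. f x u v))"
  proof -
    have "?h ?r' = SR G a (\<lambda>x y. ?h (SL ?T3 y (\<lambda>u v. tens ?T3 (x, u, v))))"
      by (rule SR_hom[OF hom cg assms(1) assms(3)]) (auto intro!: SL_closed cg c)
    also have "\<dots> = SR G a (\<lambda>x y. SL G y (\<lambda>u v. f x u v))"
      by (rule SR_cong[OF assms(3)], subst SL_hom[OF hom cg assms(1)])
        (auto intro!: c SL_cong simp: t)
    finally show ?thesis .
  qed
  moreover have "?l' = ?r'" by (rule assms(4))
  ultimately show ?thesis by simp
qed

end

section \<open>Symmetrized Hopf algebroids in terms of their total ring\<close>

context symmetrized_hopf_algebroid
begin

sublocale bialgebroid_pair HL HR
  by unfold_locales (fact total_eq src_L_tgt_R tgt_L_src_R)+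

definition "AG = add_monoid A"

lemma AG_simps [simp]: "carrier AG = carrier A" "x \<otimes>\<^bsub>AG\<^esub> y = x \<oplus>\<^bsub>A\<^esub> y" "\<one>\<^bsub>AG\<^esub> = \<zero>\<^bsub>A\<^esub>"
  by (simp_all add: AG_def)

lemma cgA [simp]: "comm_group AG"
  unfolding AG_def by (rule L.source.S.a_comm_group)

text \<open>
  The two base rings enter only through the commuting subrings B, the image of the left source and
  right target maps, and C, the image of the left target and right source maps.
\<close>

definition "B = src HL ` carrier BL"
definition "C = tgt HL ` carrier BL"

lemma B_R: "B = tgt HR ` carrier BR" and C_R: "C = src HR ` carrier BR"
  using src_L_tgt_R tgt_L_src_R by (simp_all add: B_def C_def)

lemma BC_mem [simp]: "l \<in> carrier BL \<Longrightarrow> src HL l \<in> B" "l \<in> carrier BL \<Longrightarrow> tgt HL l \<in> C"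
  "r \<in> carrier BR \<Longrightarrow> src HR r \<in> C" "r \<in> carrier BR \<Longrightarrow> tgt HR r \<in> B"
  by (simp add: B_def, simp add: C_def, simp add: C_R, simp add: B_R)

lemma S_closed [simp]: "a \<in> carrier A \<Longrightarrow> S a \<in> carrier A"
  and S_add [simp]: "\<lbrakk>a \<in> carrier A; b \<in> carrier A\<rbrakk> \<Longrightarrow> S (a \<oplus>\<^bsub>A\<^esub> b) = S a \<oplus>\<^bsub>A\<^esub> S b"
  and S_bij: "bij_betw S (carrier A) (carrier A)"
  using antipode_bij by (auto simp: iso_def hom_def Pi_iff)

lemma BC_closed [simp]: "b \<in> B \<Longrightarrow> b \<in> carrier A" "c \<in> C \<Longrightarrow> c \<in> carrier A"
  by (auto simp: B_def C_def)

lemma BC_comm: "\<lbrakk>b \<in> B; c \<in> C\<rbrakk> \<Longrightarrow> b \<otimes>\<^bsub>A\<^esub> c = c \<otimes>\<^bsub>A\<^esub> b"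
  by (auto simp: B_def C_def L.src_tgt_commute)

lemma BC_comm_left: "\<lbrakk>b \<in> B; c \<in> C; x \<in> carrier A\<rbrakk>
    \<Longrightarrow> b \<otimes>\<^bsub>A\<^esub> (c \<otimes>\<^bsub>A\<^esub> x) = c \<otimes>\<^bsub>A\<^esub> (b \<otimes>\<^bsub>A\<^esub> x)"
  using BC_comm[of b c] by (simp add: L.source.S.m_assoc[symmetric])

lemmas BC_swap = BC_comm BC_comm[symmetric] BC_comm_left BC_comm_left[symmetric]

lemma S_tL: "\<lbrakk>a \<in> carrier A; l \<in> carrier BL\<rbrakk> \<Longrightarrow> S (tgt HL l \<otimes>\<^bsub>A\<^esub> a) = S a \<otimes>\<^bsub>A\<^esub> src HL l"
  "\<lbrakk>a \<in> carrier A; l \<in> carrier BL\<rbrakk> \<Longrightarrow> S (a \<otimes>\<^bsub>A\<^esub> tgt HL l) = src HL l \<otimes>\<^bsub>A\<^esub> S a"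
  using antipode_tgt_L[of a l "\<one>\<^bsub>BL\<^esub>"] antipode_tgt_L[of a "\<one>\<^bsub>BL\<^esub>" l] by simp_all

lemma S_tR: "\<lbrakk>a \<in> carrier A; r \<in> carrier BR\<rbrakk> \<Longrightarrow> S (tgt HR r \<otimes>\<^bsub>A\<^esub> a) = S a \<otimes>\<^bsub>A\<^esub> src HR r"
  "\<lbrakk>a \<in> carrier A; r \<in> carrier BR\<rbrakk> \<Longrightarrow> S (a \<otimes>\<^bsub>A\<^esub> tgt HR r) = src HR r \<otimes>\<^bsub>A\<^esub> S a"
  using antipode_tgt_R[of a r "\<one>\<^bsub>BR\<^esub>"] antipode_tgt_R[of a "\<one>\<^bsub>BR\<^esub>" r]
  by (simp_all add: total_eq)

text \<open>The left antipode axiom at the unit, whose left coproduct is the pure tensor of two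
  units.\<close>

lemma S_one [simp]: "S \<one>\<^bsub>A\<^esub> = \<one>\<^bsub>A\<^esub>"
proof -
  have b: "balL AG (\<lambda>x y. S x \<otimes>\<^bsub>A\<^esub> y)"
    by (rule balancedI) (simp_all add: mult_left_def S_tL L.source.S.l_distr L.source.S.r_distr L.source.S.m_assoc)
  have "SL AG \<one>\<^bsub>A\<^esub> (\<lambda>x y. S x \<otimes>\<^bsub>A\<^esub> y) = src HR (counit HR \<one>\<^bsub>A\<^esub>)"
    using antipode_left[of "\<one>\<^bsub>A\<^esub>", folded AG_def] L.SL_tlift[OF cgA b] by simp
  then show ?thesis
    using L.SL_one[OF cgA b] R.counit_one by (simp add: total_eq)
qed

lemma S_tL_one [simp]: "l \<in> carrier BL \<Longrightarrow> S (tgt HL l) = src HL l"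
  and S_tR_one [simp]: "r \<in> carrier BR \<Longrightarrow> S (tgt HR r) = src HR r"
  using S_tL(1)[of "\<one>\<^bsub>A\<^esub>" l] S_tR(1)[of "\<one>\<^bsub>A\<^esub>" r] by simp_all

lemma S_C [simp]: "c \<in> C \<Longrightarrow> S c \<in> B"
  by (auto simp: B_def C_def)

lemma S_B [simp]: "b \<in> B \<Longrightarrow> S b \<in> C"
  by (auto simp: B_R C_R)

lemma S_mult_C: "\<lbrakk>c \<in> C; a \<in> carrier A\<rbrakk> \<Longrightarrow> S (c \<otimes>\<^bsub>A\<^esub> a) = S a \<otimes>\<^bsub>A\<^esub> S c"
  "\<lbrakk>c \<in> C; a \<in> carrier A\<rbrakk> \<Longrightarrow> S (a \<otimes>\<^bsub>A\<^esub> c) = S c \<otimes>\<^bsub>A\<^esub> S a"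
  by (auto simp: C_def S_tL)

lemma S_mult_B: "\<lbrakk>b \<in> B; a \<in> carrier A\<rbrakk> \<Longrightarrow> S (b \<otimes>\<^bsub>A\<^esub> a) = S a \<otimes>\<^bsub>A\<^esub> S b"
  "\<lbrakk>b \<in> B; a \<in> carrier A\<rbrakk> \<Longrightarrow> S (a \<otimes>\<^bsub>A\<^esub> b) = S b \<otimes>\<^bsub>A\<^esub> S a"
  by (auto simp: B_R S_tR)

text \<open>The counits are composed with source and target maps so that all computations take place
  in \<open>A\<close>. The values of \<open>pr\<close> and \<open>qr'\<close> lie in
  \<open>B\<close>, those of \<open>pr'\<close> and \<open>qr\<close> in \<open>C\<close>.\<close>

definition "pr a = src HL (counit HL a)"
definition "pr' a = tgt HL (counit HL a)"
definition "qr a = src HR (counit HR a)"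
definition "qr' a = tgt HR (counit HR a)"

lemma pq_BC [simp]: "a \<in> carrier A \<Longrightarrow> pr a \<in> B" "a \<in> carrier A \<Longrightarrow> pr' a \<in> C"
  "a \<in> carrier A \<Longrightarrow> qr a \<in> C" "a \<in> carrier A \<Longrightarrow> qr' a \<in> B"
proof -
  assume a: "a \<in> carrier A"
  show "pr a \<in> B" "pr' a \<in> C" using a by (simp_all add: pr_def pr'_def B_def C_def)
  show "qr a \<in> C" "qr' a \<in> B" using a by (simp_all add: qr_def qr'_def B_R C_R)
qed

lemma pq_closed [simp]: "a \<in> carrier A \<Longrightarrow> pr a \<in> carrier A" "a \<in> carrier A \<Longrightarrow> pr' a \<in> carrier A"
  "a \<in> carrier A \<Longrightarrow> qr a \<in> carrier A" "a \<in> carrier A \<Longrightarrow> qr' a \<in> carrier A"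
  by (simp_all add: pq_BC BC_closed)

lemma pq_add [simp]:
  assumes "a \<in> carrier A" "b \<in> carrier A"
  shows "pr (a \<oplus>\<^bsub>A\<^esub> b) = pr a \<oplus>\<^bsub>A\<^esub> pr b" "pr' (a \<oplus>\<^bsub>A\<^esub> b) = pr' a \<oplus>\<^bsub>A\<^esub> pr' b"
    "qr (a \<oplus>\<^bsub>A\<^esub> b) = qr a \<oplus>\<^bsub>A\<^esub> qr b" "qr' (a \<oplus>\<^bsub>A\<^esub> b) = qr' a \<oplus>\<^bsub>A\<^esub> qr' b"
  using assms by (simp_all add: pr_def pr'_def qr_def qr'_def)

lemma S_pq [simp]: "a \<in> carrier A \<Longrightarrow> S (pr' a) = pr a" "a \<in> carrier A \<Longrightarrow> S (qr' a) = qr a"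
  by (simp_all add: pr_def pr'_def qr_def qr'_def)

lemma pq_one [simp]: "pr \<one>\<^bsub>A\<^esub> = \<one>\<^bsub>A\<^esub>" "pr' \<one>\<^bsub>A\<^esub> = \<one>\<^bsub>A\<^esub>" "qr \<one>\<^bsub>A\<^esub> = \<one>\<^bsub>A\<^esub>" "qr' \<one>\<^bsub>A\<^esub> = \<one>\<^bsub>A\<^esub>"
  using L.counit_one R.counit_one by (simp_all add: pr_def pr'_def qr_def qr'_def total_eq)

lemma pr_B: "\<lbrakk>b \<in> B; a \<in> carrier A\<rbrakk> \<Longrightarrow> pr (b \<otimes>\<^bsub>A\<^esub> a) = b \<otimes>\<^bsub>A\<^esub> pr a"
  and pr_C: "\<lbrakk>c \<in> C; a \<in> carrier A\<rbrakk> \<Longrightarrow> pr (c \<otimes>\<^bsub>A\<^esub> a) = pr a \<otimes>\<^bsub>A\<^esub> S c"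
  and pr'_B: "\<lbrakk>c \<in> C; a \<in> carrier A\<rbrakk> \<Longrightarrow> pr' (S c \<otimes>\<^bsub>A\<^esub> a) = pr' a \<otimes>\<^bsub>A\<^esub> c"
  and pr'_C: "\<lbrakk>c \<in> C; a \<in> carrier A\<rbrakk> \<Longrightarrow> pr' (c \<otimes>\<^bsub>A\<^esub> a) = c \<otimes>\<^bsub>A\<^esub> pr' a"
  using L.comonoid.eps_lact[unfolded mult_left_def] L.comonoid.eps_ract[unfolded mult_left_def]
  by (auto simp: B_def C_def pr_def pr'_def)

lemma qr_C: "\<lbrakk>c \<in> C; a \<in> carrier A\<rbrakk> \<Longrightarrow> qr (a \<otimes>\<^bsub>A\<^esub> c) = qr a \<otimes>\<^bsub>A\<^esub> c"
  and qr_B: "\<lbrakk>b \<in> B; a \<in> carrier A\<rbrakk> \<Longrightarrow> qr (a \<otimes>\<^bsub>A\<^esub> b) = S b \<otimes>\<^bsub>A\<^esub> qr a"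
  and qr'_B: "\<lbrakk>b \<in> B; a \<in> carrier A\<rbrakk> \<Longrightarrow> qr' (a \<otimes>\<^bsub>A\<^esub> b) = qr' a \<otimes>\<^bsub>A\<^esub> b"
  using R.comonoid.eps_lact[unfolded mult_right_def] R.comonoid.eps_ract[unfolded mult_right_def]
  by (auto simp: B_R C_R qr_def qr'_def total_eq)

lemma pr_mult: "\<lbrakk>a \<in> carrier A; b \<in> carrier A\<rbrakk> \<Longrightarrow> pr (a \<otimes>\<^bsub>A\<^esub> pr b) = pr (a \<otimes>\<^bsub>A\<^esub> b)"
  "\<lbrakk>a \<in> carrier A; b \<in> carrier A\<rbrakk> \<Longrightarrow> pr (a \<otimes>\<^bsub>A\<^esub> pr' b) = pr (a \<otimes>\<^bsub>A\<^esub> b)"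
  by (simp_all add: pr_def pr'_def L.counit_src L.counit_tgt)

lemma qr_mult: "\<lbrakk>a \<in> carrier A; b \<in> carrier A\<rbrakk> \<Longrightarrow> qr (qr a \<otimes>\<^bsub>A\<^esub> b) = qr (a \<otimes>\<^bsub>A\<^esub> b)"
  "\<lbrakk>a \<in> carrier A; b \<in> carrier A\<rbrakk> \<Longrightarrow> qr (qr' a \<otimes>\<^bsub>A\<^esub> b) = qr (a \<otimes>\<^bsub>A\<^esub> b)"
  using R.counit_src R.counit_tgt by (simp_all add: qr_def qr'_def total_eq)

text \<open>With \<open>c = tgt HL l\<close> one has \<open>src HL l = S c\<close>, so balancing
  over the left base can be stated by elements of \<open>C\<close> and the antipode. For the right
  base \<open>b = tgt HR r\<close> and \<open>S b = src HR r\<close> play these roles.\<close>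

lemma balLI:
  assumes "\<And>x y. \<lbrakk>x \<in> carrier A; y \<in> carrier A\<rbrakk> \<Longrightarrow> f x y \<in> carrier G"
    and "\<And>x x' y. \<lbrakk>x \<in> carrier A; x' \<in> carrier A; y \<in> carrier A\<rbrakk>
      \<Longrightarrow> f (x \<oplus>\<^bsub>A\<^esub> x') y = f x y \<otimes>\<^bsub>G\<^esub> f x' y"
    and "\<And>x y y'. \<lbrakk>x \<in> carrier A; y \<in> carrier A; y' \<in> carrier A\<rbrakk>
      \<Longrightarrow> f x (y \<oplus>\<^bsub>A\<^esub> y') = f x y \<otimes>\<^bsub>G\<^esub> f x y'"
    and "\<And>x c y. \<lbrakk>x \<in> carrier A; c \<in> C; y \<in> carrier A\<rbrakk> \<Longrightarrow> f (c \<otimes>\<^bsub>A\<^esub> x) y = f x (S c \<otimes>\<^bsub>A\<^esub> y)"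
  shows "balL G f"
proof (rule balancedI)
  show "f (mult_left A (tgt HL) l x) y = f x (mult_left A (src HL) l y)"
    if "x \<in> carrier A" "l \<in> carrier BL" "y \<in> carrier A" for x l y
    using assms(4)[of x "tgt HL l" y] that by (simp add: C_def mult_left_def)
qed (rule assms(1-3); assumption)+

lemma balLD:
  assumes "balL G f" "x \<in> carrier A" "c \<in> C" "y \<in> carrier A"
  shows "f (c \<otimes>\<^bsub>A\<^esub> x) y = f x (S c \<otimes>\<^bsub>A\<^esub> y)"
  using assms(3) balancedD(4)[OF assms(1,2) _ assms(4)] by (auto simp: C_def mult_left_def)

lemma balRI:
  assumes "\<And>x y. \<lbrakk>x \<in> carrier A; y \<in> carrier A\<rbrakk> \<Longrightarrow> f x y \<in> carrier G"
    and "\<And>x x' y. \<lbrakk>x \<in> carrier A; x' \<in> carrier A; y \<in> carrier A\<rbrakk>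
      \<Longrightarrow> f (x \<oplus>\<^bsub>A\<^esub> x') y = f x y \<otimes>\<^bsub>G\<^esub> f x' y"
    and "\<And>x y y'. \<lbrakk>x \<in> carrier A; y \<in> carrier A; y' \<in> carrier A\<rbrakk>
      \<Longrightarrow> f x (y \<oplus>\<^bsub>A\<^esub> y') = f x y \<otimes>\<^bsub>G\<^esub> f x y'"
    and "\<And>x b y. \<lbrakk>x \<in> carrier A; b \<in> B; y \<in> carrier A\<rbrakk> \<Longrightarrow> f (x \<otimes>\<^bsub>A\<^esub> S b) y = f x (y \<otimes>\<^bsub>A\<^esub> b)"
  shows "balR G f"
proof (rule balancedI)
  show "f (mult_right A (src HR) x r) y = f x (mult_right A (tgt HR) y r)"
    if "x \<in> carrier A" "r \<in> carrier BR" "y \<in> carrier A" for x r y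
    using assms(4)[of x "tgt HR r" y] that by (simp add: B_R mult_right_def)
qed (rule assms(1-3); assumption)+

lemma balRD:
  assumes "balR G f" "x \<in> carrier A" "b \<in> B" "y \<in> carrier A"
  shows "f (x \<otimes>\<^bsub>A\<^esub> S b) y = f x (y \<otimes>\<^bsub>A\<^esub> b)"
  using assms(3) balancedD(4)[OF assms(1,2) _ assms(4)] by (auto simp: B_R mult_right_def)

section \<open>Coproduct, counit and antipode rules stated inside the total ring\<close>

lemma SR_B': "\<lbrakk>comm_group G; balR G f; b \<in> B; a \<in> carrier A\<rbrakk>
    \<Longrightarrow> SR G (a \<otimes>\<^bsub>A\<^esub> b) f = SR G a (\<lambda>x y. f (x \<otimes>\<^bsub>A\<^esub> b) y)"
  and SR_C': "\<lbrakk>comm_group G; balR G f; c \<in> C; a \<in> carrier A\<rbrakk>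
    \<Longrightarrow> SR G (a \<otimes>\<^bsub>A\<^esub> c) f = SR G a (\<lambda>x y. f x (y \<otimes>\<^bsub>A\<^esub> c))"
  by (auto simp: B_R C_R R.SR_src[unfolded total_eq] R.SR_tgt[unfolded total_eq])

lemma SL_B': "\<lbrakk>comm_group G; balL G f; b \<in> B; a \<in> carrier A\<rbrakk>
    \<Longrightarrow> SL G (a \<otimes>\<^bsub>A\<^esub> b) f = SL G a (\<lambda>x y. f (x \<otimes>\<^bsub>A\<^esub> b) y)"
  and SL_C': "\<lbrakk>comm_group G; balL G f; c \<in> C; a \<in> carrier A\<rbrakk>
    \<Longrightarrow> SL G (a \<otimes>\<^bsub>A\<^esub> c) f = SL G a (\<lambda>x y. f x (y \<otimes>\<^bsub>A\<^esub> c))"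
  by (auto simp: B_def C_def SL_src' SL_tgt')

lemma SR_B: "\<lbrakk>comm_group G; balR G f; b \<in> B; a \<in> carrier A\<rbrakk>
    \<Longrightarrow> SR G (b \<otimes>\<^bsub>A\<^esub> a) f = SR G a (\<lambda>x y. f (b \<otimes>\<^bsub>A\<^esub> x) y)"
  by (auto simp: B_R SR_tgt')

lemma SL_takeuchi: "\<lbrakk>comm_group G; balL G f; c \<in> C; a \<in> carrier A\<rbrakk>
    \<Longrightarrow> SL G a (\<lambda>x y. f (x \<otimes>\<^bsub>A\<^esub> c) y) = SL G a (\<lambda>x y. f x (y \<otimes>\<^bsub>A\<^esub> S c))"
  by (auto simp: C_def L.SL_takeuchi)

lemma SR_takeuchi: "\<lbrakk>comm_group G; balR G f; b \<in> B; a \<in> carrier A\<rbrakk>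
    \<Longrightarrow> SR G a (\<lambda>x y. f (S b \<otimes>\<^bsub>A\<^esub> x) y) = SR G a (\<lambda>x y. f x (b \<otimes>\<^bsub>A\<^esub> y))"
  by (auto simp: B_R R.SR_takeuchi[unfolded total_eq])

lemma counits:
  assumes "a \<in> carrier A"
  shows "SL AG a (\<lambda>x y. pr x \<otimes>\<^bsub>A\<^esub> y) = a" "SL AG a (\<lambda>x y. pr' y \<otimes>\<^bsub>A\<^esub> x) = a"
    "SR AG a (\<lambda>x y. y \<otimes>\<^bsub>A\<^esub> qr' x) = a" "SR AG a (\<lambda>x y. x \<otimes>\<^bsub>A\<^esub> qr y) = a"
  using L.SL_counit1[OF assms] L.SL_counit2[OF assms]
    R.SR_counit1[unfolded total_eq, OF assms] R.SR_counit2[unfolded total_eq, OF assms]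
  unfolding AG_def[symmetric]
  by (simp_all add: pr_def pr'_def qr_def qr'_def)

lemma bal_antipode: "balL AG (\<lambda>x y. S x \<otimes>\<^bsub>A\<^esub> y)" "balR AG (\<lambda>x y. x \<otimes>\<^bsub>A\<^esub> S y)"
  by (rule balLI balRI; simp add: S_mult_C S_mult_B L.source.S.l_distr L.source.S.r_distr L.source.S.m_assoc)+

lemma antipode_SL: "a \<in> carrier A \<Longrightarrow> SL AG a (\<lambda>x y. S x \<otimes>\<^bsub>A\<^esub> y) = qr a"
  and antipode_SR: "a \<in> carrier A \<Longrightarrow> SR AG a (\<lambda>x y. x \<otimes>\<^bsub>A\<^esub> S y) = pr a"
  using antipode_left[folded AG_def] antipode_right[folded AG_def] SL_tlift[OF cgA bal_antipode(1)] SR_tlift[OF cgA bal_antipode(2)]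
  by (simp_all add: qr_def pr_def)

lemma hom_lmult: "a \<in> carrier A \<Longrightarrow> (\<lambda>z. a \<otimes>\<^bsub>A\<^esub> z) \<in> hom AG AG"
  and hom_rmult: "a \<in> carrier A \<Longrightarrow> (\<lambda>z. z \<otimes>\<^bsub>A\<^esub> a) \<in> hom AG AG"
  and hom_S: "S \<in> hom AG AG"
  by (auto simp: hom_def AG_def L.source.S.l_distr L.source.S.r_distr)

lemma SL_lmult: "\<lbrakk>z \<in> carrier A; a \<in> carrier A; \<And>x y. \<lbrakk>x \<in> carrier A; y \<in> carrier A\<rbrakk> \<Longrightarrow> f x y \<in> carrier A\<rbrakk>
    \<Longrightarrow> z \<otimes>\<^bsub>A\<^esub> SL AG a f = SL AG a (\<lambda>x y. z \<otimes>\<^bsub>A\<^esub> f x y)"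
  and SL_rmult: "\<lbrakk>z \<in> carrier A; a \<in> carrier A; \<And>x y. \<lbrakk>x \<in> carrier A; y \<in> carrier A\<rbrakk> \<Longrightarrow> f x y \<in> carrier A\<rbrakk>
    \<Longrightarrow> SL AG a f \<otimes>\<^bsub>A\<^esub> z = SL AG a (\<lambda>x y. f x y \<otimes>\<^bsub>A\<^esub> z)"
  and SL_S: "\<lbrakk>a \<in> carrier A; \<And>x y. \<lbrakk>x \<in> carrier A; y \<in> carrier A\<rbrakk> \<Longrightarrow> f x y \<in> carrier A\<rbrakk>
    \<Longrightarrow> S (SL AG a f) = SL AG a (\<lambda>x y. S (f x y))"
  using SL_hom[OF hom_lmult[of z] cgA cgA, of a f] SL_hom[OF hom_rmult[of z] cgA cgA, of a f]
    SL_hom[OF hom_S cgA cgA, of a f] by simp_all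

lemma SR_lmult: "\<lbrakk>z \<in> carrier A; a \<in> carrier A; \<And>x y. \<lbrakk>x \<in> carrier A; y \<in> carrier A\<rbrakk> \<Longrightarrow> f x y \<in> carrier A\<rbrakk>
    \<Longrightarrow> z \<otimes>\<^bsub>A\<^esub> SR AG a f = SR AG a (\<lambda>x y. z \<otimes>\<^bsub>A\<^esub> f x y)"
  and SR_rmult: "\<lbrakk>z \<in> carrier A; a \<in> carrier A; \<And>x y. \<lbrakk>x \<in> carrier A; y \<in> carrier A\<rbrakk> \<Longrightarrow> f x y \<in> carrier A\<rbrakk>
    \<Longrightarrow> SR AG a f \<otimes>\<^bsub>A\<^esub> z = SR AG a (\<lambda>x y. f x y \<otimes>\<^bsub>A\<^esub> z)"
  and SR_S: "\<lbrakk>a \<in> carrier A; \<And>x y. \<lbrakk>x \<in> carrier A; y \<in> carrier A\<rbrakk> \<Longrightarrow> f x y \<in> carrier A\<rbrakk>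
    \<Longrightarrow> S (SR AG a f) = SR AG a (\<lambda>x y. S (f x y))"
  using SR_hom[OF hom_lmult[of z] cgA cgA, of a f] SR_hom[OF hom_rmult[of z] cgA cgA, of a f]
    SR_hom[OF hom_S cgA cgA, of a f] by simp_all

lemma SL_clA [simp]: "\<lbrakk>a \<in> carrier A; \<And>x y. \<lbrakk>x \<in> carrier A; y \<in> carrier A\<rbrakk> \<Longrightarrow> f x y \<in> carrier A\<rbrakk>
    \<Longrightarrow> SL AG a f \<in> carrier A"
  and SR_clA [simp]: "\<lbrakk>a \<in> carrier A; \<And>x y. \<lbrakk>x \<in> carrier A; y \<in> carrier A\<rbrakk> \<Longrightarrow> f x y \<in> carrier A\<rbrakk>
    \<Longrightarrow> SR AG a f \<in> carrier A"
  using SL_closed[OF cgA, of a f] SR_closed[OF cgA, of a f] by simp_all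

lemmas l_distr = L.source.S.l_distr
lemmas r_distr = L.source.S.r_distr
lemmas m_assoc = L.source.S.m_assoc
lemmas distr = l_distr r_distr m_assoc

lemma coassoc_SLR:
  assumes "comm_group G" "b3LR G f" "a \<in> carrier A"
  shows "SR G a (\<lambda>x y. SL G x (\<lambda>u v. f u v y)) = SL G a (\<lambda>x y. SR G y (\<lambda>u v. f x u v))"
  by (rule b3LR_transfer[OF assms])
    (use coassoc_LR[OF assms(3)] in
      \<open>simp add: Let_def b3LR_tlift[OF T3LR.comm_group_T3 b3LR_tens assms(3)]\<close>)

lemma coassoc_SRL:
  assumes "comm_group G" "b3RL G f" "a \<in> carrier A"
  shows "SL G a (\<lambda>x y. SR G x (\<lambda>u v. f u v y)) = SR G a (\<lambda>x y. SL G y (\<lambda>u v. f x u v))"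
  by (rule b3RL_transfer[OF assms])
    (use coassoc_RL[OF assms(3)] in
      \<open>simp add: Let_def b3RL_tlift[OF T3RL.comm_group_T3 b3RL_tens assms(3)]\<close>)

text \<open>Contractions are moved into and out of Sweedler sums by additivity of \<open>h\<close>
  alone; the summand may be any function with values in \<open>A\<close>.\<close>

lemma SL_push:
  assumes "comm_group G" "a \<in> carrier A" "\<And>x y. \<lbrakk>x \<in> carrier A; y \<in> carrier A\<rbrakk> \<Longrightarrow> f x y \<in> carrier A"
    "\<And>x. x \<in> carrier A \<Longrightarrow> h x \<in> carrier G"
    "\<And>x y. \<lbrakk>x \<in> carrier A; y \<in> carrier A\<rbrakk> \<Longrightarrow> h (x \<oplus>\<^bsub>A\<^esub> y) = h x \<otimes>\<^bsub>G\<^esub> h y"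
  shows "h (SL AG a f) = SL G a (\<lambda>x y. h (f x y))"
  by (rule SL_hom[OF _ cgA assms(1,2)]) (auto simp: hom_def assms(3-5))

lemma SR_push:
  assumes "comm_group G" "a \<in> carrier A" "\<And>x y. \<lbrakk>x \<in> carrier A; y \<in> carrier A\<rbrakk> \<Longrightarrow> f x y \<in> carrier A"
    "\<And>x. x \<in> carrier A \<Longrightarrow> h x \<in> carrier G"
    "\<And>x y. \<lbrakk>x \<in> carrier A; y \<in> carrier A\<rbrakk> \<Longrightarrow> h (x \<oplus>\<^bsub>A\<^esub> y) = h x \<otimes>\<^bsub>G\<^esub> h y"
  shows "h (SR AG a f) = SR G a (\<lambda>x y. h (f x y))"
  by (rule SR_hom[OF _ cgA assms(1,2)]) (auto simp: hom_def assms(3-5))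

lemma SR_sandwich:
  assumes "u \<in> carrier A" "v \<in> carrier A" "a \<in> carrier A"
    "\<And>x y. \<lbrakk>x \<in> carrier A; y \<in> carrier A\<rbrakk> \<Longrightarrow> f x y \<in> carrier A"
  shows "SR AG a (\<lambda>x y. u \<otimes>\<^bsub>A\<^esub> (f x y \<otimes>\<^bsub>A\<^esub> v)) = u \<otimes>\<^bsub>A\<^esub> (SR AG a f \<otimes>\<^bsub>A\<^esub> v)"
  using SR_push[where f = f and G = AG and h = "\<lambda>z. u \<otimes>\<^bsub>A\<^esub> (z \<otimes>\<^bsub>A\<^esub> v)", OF cgA assms(3)] assms
  by (simp add: distr)

lemma balL_SR:
  assumes "comm_group G" "a \<in> carrier A"
    "\<And>x y. \<lbrakk>x \<in> carrier A; y \<in> carrier A\<rbrakk> \<Longrightarrow> balL G (\<lambda>u v. f u v x y)"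
  shows "balL G (\<lambda>u v. SR G a (\<lambda>x y. f u v x y))"
  by (rule balLI) (auto simp: SR_mult[OF assms(1,2), symmetric] balancedD(1)[OF assms(3)]
      balancedD(2)[OF assms(3)] balancedD(3)[OF assms(3)] balLD[OF assms(3)] assms(1,2)
      intro!: SR_closed SR_cong)

lemma balR_SL:
  assumes "comm_group G" "a \<in> carrier A"
    "\<And>x y. \<lbrakk>x \<in> carrier A; y \<in> carrier A\<rbrakk> \<Longrightarrow> balR G (\<lambda>u v. f u v x y)"
  shows "balR G (\<lambda>u v. SL G a (\<lambda>x y. f u v x y))"
  by (rule balRI) (auto simp: SL_mult[OF assms(1,2), symmetric] balancedD(1)[OF assms(3)]
      balancedD(2)[OF assms(3)] balancedD(3)[OF assms(3)] balRD[OF assms(3)] assms(1,2)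
      intro!: SL_closed SL_cong)

subsection \<open>The antipode is anti-multiplicative\<close>

lemma bal_qS: "balR AG (\<lambda>w z. qr w \<otimes>\<^bsub>A\<^esub> S z)"
  by (rule balRI) (simp_all add: qr_C S_mult_B distr)

lemma SR_qS:
  assumes "a \<in> carrier A"
  shows "SR AG a (\<lambda>w z. qr w \<otimes>\<^bsub>A\<^esub> S z) = S a"
proof -
  have "S a = S (SR AG a (\<lambda>w z. z \<otimes>\<^bsub>A\<^esub> qr' w))" by (simp only: counits[OF assms])
  also have "\<dots> = SR AG a (\<lambda>w z. S (z \<otimes>\<^bsub>A\<^esub> qr' w))"
    by (rule SR_S[OF assms]) simp
  also have "\<dots> = SR AG a (\<lambda>w z. qr w \<otimes>\<^bsub>A\<^esub> S z)"
    by (rule SR_cong[OF assms]) (simp add: S_mult_B)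
  finally show ?thesis by (rule sym)
qed

text \<open>Inside \<open>qr\<close> the factor \<open>w\<close> may be replaced by
  \<open>qr w = S (qr' w)\<close>. The Takeuchi condition moves it to the second leg as
  \<open>qr' w\<close>, and the antipode sends it out on the right.\<close>

lemma SR_q_left:
  assumes "a \<in> carrier A" "w \<in> carrier A"
  shows "SR AG a (\<lambda>w' z. qr (w \<otimes>\<^bsub>A\<^esub> w') \<otimes>\<^bsub>A\<^esub> S z) = S a \<otimes>\<^bsub>A\<^esub> qr w"
proof -
  have "SR AG a (\<lambda>w' z. qr (w \<otimes>\<^bsub>A\<^esub> w') \<otimes>\<^bsub>A\<^esub> S z)
      = SR AG a (\<lambda>w' z. qr (S (qr' w) \<otimes>\<^bsub>A\<^esub> w') \<otimes>\<^bsub>A\<^esub> S z)"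
    by (rule SR_cong[OF assms(1)]) (simp add: assms qr_mult)
  also have "\<dots> = SR AG a (\<lambda>w' z. qr w' \<otimes>\<^bsub>A\<^esub> S (qr' w \<otimes>\<^bsub>A\<^esub> z))"
    using SR_takeuchi[OF cgA bal_qS _ assms(1), of "qr' w"] assms(2) by simp
  also have "\<dots> = SR AG a (\<lambda>w' z. qr w' \<otimes>\<^bsub>A\<^esub> S z \<otimes>\<^bsub>A\<^esub> qr w)"
    by (rule SR_cong[OF assms(1)]) (simp add: assms S_mult_B distr)
  also have "\<dots> = S a \<otimes>\<^bsub>A\<^esub> qr w"
    using SR_rmult[of "qr w" a "\<lambda>w' z. qr w' \<otimes>\<^bsub>A\<^esub> S z"] assms by (simp add: SR_qS)
  finally show ?thesis .
qed

lemma SL_Sp: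
  assumes "a \<in> carrier A"
  shows "SL AG a (\<lambda>u v. S u \<otimes>\<^bsub>A\<^esub> pr v) = S a"
proof -
  have "S a = S (SL AG a (\<lambda>u v. pr' v \<otimes>\<^bsub>A\<^esub> u))" by (simp only: counits[OF assms])
  also have "\<dots> = SL AG a (\<lambda>u v. S (pr' v \<otimes>\<^bsub>A\<^esub> u))"
    by (rule SL_S[OF assms]) simp
  also have "\<dots> = SL AG a (\<lambda>u v. S u \<otimes>\<^bsub>A\<^esub> pr v)"
    by (rule SL_cong[OF assms]) (simp add: S_mult_C)
  finally show ?thesis by (rule sym)
qed

text \<open>The sum of \<open>S (x x') y y' S z' S z\<close> over threefold coproducts of
  \<open>a\<close> and \<open>b\<close> is evaluated in two ways. Contracting \<open>y' S z'\<close>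
  and then \<open>y S z\<close> by the right antipode axiom gives \<open>S (a b)\<close>. After
  regrouping by mixed coassociativity, the left antipode axiom contracts the first two legs and
  gives \<open>S b S a\<close>.\<close>

lemma S_mult:
  assumes a: "a \<in> carrier A" and b: "b \<in> carrier A"
  shows "S (a \<otimes>\<^bsub>A\<^esub> b) = S b \<otimes>\<^bsub>A\<^esub> S a"
proof -
  define F where "F x y z x' y' z' = S (x \<otimes>\<^bsub>A\<^esub> x') \<otimes>\<^bsub>A\<^esub> (y \<otimes>\<^bsub>A\<^esub> (y' \<otimes>\<^bsub>A\<^esub> (S z' \<otimes>\<^bsub>A\<^esub> S z)))"
    for x y z x' y' z'
  have Fc: "F x y z x' y' z' \<in> carrier A"
    if "x \<in> carrier A" "y \<in> carrier A" "z \<in> carrier A" "x' \<in> carrier A" "y' \<in> carrier A" "z' \<in> carrier A"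
    for x y z x' y' z'
    using that by (simp add: F_def)
  have bpr: "balR AG (\<lambda>y z. y \<otimes>\<^bsub>A\<^esub> S z)" by (rule bal_antipode)
  \<comment> \<open>The contraction of \<open>w'\<close> is \<open>pr w'\<close>, an element of
    \<open>B\<close>. It is absorbed behind the first leg of the right coproduct of
    \<open>w\<close>, so the second contraction yields
    \<open>pr (w pr w') = pr (w w')\<close>.\<close>
  have inner1: "SR AG w (\<lambda>y z. SR AG w' (\<lambda>y' z'. F x y z x' y' z')) = S (x \<otimes>\<^bsub>A\<^esub> x') \<otimes>\<^bsub>A\<^esub> pr (w \<otimes>\<^bsub>A\<^esub> w')"
    if h: "x \<in> carrier A" "x' \<in> carrier A" "w \<in> carrier A" "w' \<in> carrier A" for x x' w w'
  proof -
    have "SR AG w (\<lambda>y z. SR AG w' (\<lambda>y' z'. F x y z x' y' z'))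
        = SR AG w (\<lambda>y z. S (x \<otimes>\<^bsub>A\<^esub> x') \<otimes>\<^bsub>A\<^esub> ((y \<otimes>\<^bsub>A\<^esub> pr w') \<otimes>\<^bsub>A\<^esub> S z))"
    proof (rule SR_cong[OF h(3)])
      fix y z assume yz: "y \<in> carrier A" "z \<in> carrier A"
      have "SR AG w' (\<lambda>y' z'. F x y z x' y' z')
          = SR AG w' (\<lambda>y' z'. (S (x \<otimes>\<^bsub>A\<^esub> x') \<otimes>\<^bsub>A\<^esub> y) \<otimes>\<^bsub>A\<^esub> ((y' \<otimes>\<^bsub>A\<^esub> S z') \<otimes>\<^bsub>A\<^esub> S z))"
        by (rule SR_cong[OF h(4)]) (simp add: F_def h yz m_assoc)
      also have "\<dots> = S (x \<otimes>\<^bsub>A\<^esub> x') \<otimes>\<^bsub>A\<^esub> ((y \<otimes>\<^bsub>A\<^esub> pr w') \<otimes>\<^bsub>A\<^esub> S z)"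
        by (subst SR_sandwich) (simp_all add: h yz antipode_SR m_assoc)
      finally show "SR AG w' (\<lambda>y' z'. F x y z x' y' z')
        = S (x \<otimes>\<^bsub>A\<^esub> x') \<otimes>\<^bsub>A\<^esub> ((y \<otimes>\<^bsub>A\<^esub> pr w') \<otimes>\<^bsub>A\<^esub> S z)" .
    qed
    also have "\<dots> = S (x \<otimes>\<^bsub>A\<^esub> x') \<otimes>\<^bsub>A\<^esub> SR AG w (\<lambda>y z. (y \<otimes>\<^bsub>A\<^esub> pr w') \<otimes>\<^bsub>A\<^esub> S z)"
      by (subst SR_lmult) (simp_all add: h)
    also have "SR AG w (\<lambda>y z. (y \<otimes>\<^bsub>A\<^esub> pr w') \<otimes>\<^bsub>A\<^esub> S z) = pr (w \<otimes>\<^bsub>A\<^esub> w')"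
      using SR_B'[OF cgA bpr, of "pr w'" w] h by (simp add: antipode_SR pr_mult)
    finally show ?thesis .
  qed
  let ?E1 = "SL AG b (\<lambda>x' w'. SL AG a (\<lambda>x w. SR AG w (\<lambda>y z. SR AG w' (\<lambda>y' z'. F x y z x' y' z'))))"
  let ?E2 = "SR AG a (\<lambda>w z. SL AG b (\<lambda>x' w'. SR AG w' (\<lambda>y' z'. SL AG w (\<lambda>x y. F x y z x' y' z'))))"
  let ?E3 = "SR AG a (\<lambda>w z. SR AG b (\<lambda>w' z'. SL AG w' (\<lambda>x' y'. SL AG w (\<lambda>x y. F x y z x' y' z'))))"
  have "?E1 = SL AG b (\<lambda>x' w'. SL AG a (\<lambda>x w. S (x \<otimes>\<^bsub>A\<^esub> x') \<otimes>\<^bsub>A\<^esub> pr (w \<otimes>\<^bsub>A\<^esub> w')))"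
    by (intro SL_cong inner1 a b)
  also have "\<dots> = SL AG (a \<otimes>\<^bsub>A\<^esub> b) (\<lambda>u v. S u \<otimes>\<^bsub>A\<^esub> pr v)"
    by (rule SL_times[OF cgA _ a b, symmetric], rule balLI) (simp_all add: pr_B S_mult_C distr)
  also have "\<dots> = S (a \<otimes>\<^bsub>A\<^esub> b)" by (rule SL_Sp) (simp add: a b)
  finally have 1: "?E1 = S (a \<otimes>\<^bsub>A\<^esub> b)" .
  \<comment> \<open>Mixed coassociativity for \<open>a\<close>. The inner sum over \<open>w'\<close>
    is balanced in \<open>y\<close> and \<open>z\<close>, although \<open>y'\<close> and
    \<open>z'\<close> stand between them, because the Takeuchi condition for \<open>w'\<close>
    carries a base element across.\<close>
  have 2: "?E1 = ?E2"
  proof -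
    have "?E1 = SL AG b (\<lambda>x' w'. SR AG a (\<lambda>w z. SL AG w (\<lambda>x y. SR AG w' (\<lambda>y' z'. F x y z x' y' z'))))"
    proof (rule SL_cong[OF b], rule coassoc_SLR[OF cgA _ a, symmetric])
      fix x' w' assume h: "x' \<in> carrier A" "w' \<in> carrier A"
      have t: "SR AG w' (\<lambda>y' z'. F x (y \<otimes>\<^bsub>A\<^esub> S b0) z x' y' z') = SR AG w' (\<lambda>y' z'. F x y (z \<otimes>\<^bsub>A\<^esub> b0) x' y' z')"
        if hh: "x \<in> carrier A" "y \<in> carrier A" "z \<in> carrier A" "b0 \<in> B" for x y z b0
      proof -
        have bb: "balR AG (\<lambda>y' z'. F x y z x' y' z')"
          by (rule balRI) (simp_all add: F_def h hh distr S_mult_B)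
        have "SR AG w' (\<lambda>y' z'. F x (y \<otimes>\<^bsub>A\<^esub> S b0) z x' y' z') = SR AG w' (\<lambda>y' z'. F x y z x' (S b0 \<otimes>\<^bsub>A\<^esub> y') z')"
          by (rule SR_cong[OF h(2)]) (simp add: F_def h hh distr)
        also have "\<dots> = SR AG w' (\<lambda>y' z'. F x y z x' y' (b0 \<otimes>\<^bsub>A\<^esub> z'))"
          by (rule SR_takeuchi[OF cgA bb hh(4) h(2)])
        also have "\<dots> = SR AG w' (\<lambda>y' z'. F x y (z \<otimes>\<^bsub>A\<^esub> b0) x' y' z')"
          by (rule SR_cong[OF h(2)]) (simp add: F_def h hh distr S_mult_B)
        finally show ?thesis .
      qed
      show "b3LR AG (\<lambda>x y z. SR AG w' (F x y z x'))"
        unfolding b3LR_def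
      proof (intro conjI ballI)
        show "balR AG (\<lambda>y z. SR AG w' (F x y z x'))" if "x \<in> carrier A" for x
          by (rule balRI) (auto simp: t that Fc h SR_mult[OF cgA h(2), symmetric, simplified]
              F_def distr intro!: SR_cong)
        show "balL AG (\<lambda>x y. SR AG w' (F x y z x'))" if "z \<in> carrier A" for z
          by (rule balL_SR[OF cgA h(2)], rule balLI) (simp_all add: F_def h that distr S_mult_C)
      qed
    qed
    also have "\<dots> = SR AG a (\<lambda>w z. SL AG b (\<lambda>x' w'. SL AG w (\<lambda>x y. SR AG w' (\<lambda>y' z'. F x y z x' y' z'))))"
      by (rule SL_SR_swap[OF cgA b a]) (simp add: Fc)
    also have "\<dots> = ?E2"
      by (intro SR_cong SL_cong SL_SR_swap cgA a b) (simp_all add: Fc)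
    finally show ?thesis .
  qed
  \<comment> \<open>Mixed coassociativity for \<open>b\<close>; now the Takeuchi condition for the
    left coproduct of \<open>w\<close> gives balancedness in \<open>x'\<close> and
    \<open>y'\<close>.\<close>
  have 3: "?E2 = ?E3"
  proof (rule SR_cong[OF a], rule coassoc_SLR[OF cgA _ b, symmetric])
    fix w z assume h: "w \<in> carrier A" "z \<in> carrier A"
    have t: "SL AG w (\<lambda>x y. F x y z (c \<otimes>\<^bsub>A\<^esub> x') y' z') = SL AG w (\<lambda>x y. F x y z x' (S c \<otimes>\<^bsub>A\<^esub> y') z')"
      if hh: "x' \<in> carrier A" "y' \<in> carrier A" "z' \<in> carrier A" "c \<in> C" for x' y' z' c
    proof -
      have bb: "balL AG (\<lambda>x y. F x y z x' y' z')"
        by (rule balLI) (simp_all add: F_def h hh distr S_mult_C)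
      have "SL AG w (\<lambda>x y. F x y z (c \<otimes>\<^bsub>A\<^esub> x') y' z') = SL AG w (\<lambda>x y. F (x \<otimes>\<^bsub>A\<^esub> c) y z x' y' z')"
        by (rule SL_cong[OF h(1)]) (simp add: F_def h hh distr)
      also have "\<dots> = SL AG w (\<lambda>x y. F x (y \<otimes>\<^bsub>A\<^esub> S c) z x' y' z')"
        by (rule SL_takeuchi[OF cgA bb hh(4) h(1)])
      also have "\<dots> = SL AG w (\<lambda>x y. F x y z x' (S c \<otimes>\<^bsub>A\<^esub> y') z')"
        by (rule SL_cong[OF h(1)]) (simp add: F_def h hh distr)
      finally show ?thesis .
    qed
    show "b3LR AG (\<lambda>x' y' z'. SL AG w (\<lambda>x y. F x y z x' y' z'))"
      unfolding b3LR_def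
    proof (intro conjI ballI)
      show "balR AG (\<lambda>y' z'. SL AG w (\<lambda>x y. F x y z x' y' z'))" if "x' \<in> carrier A" for x'
        by (rule balR_SL[OF cgA h(1)], rule balRI) (simp_all add: F_def h that distr S_mult_B)
      show "balL AG (\<lambda>x' y'. SL AG w (\<lambda>x y. F x y z x' y' z'))" if "z' \<in> carrier A" for z'
      proof (rule balLI)
        show "SL AG w (\<lambda>x y. F x y z (c \<otimes>\<^bsub>A\<^esub> x') y' z') = SL AG w (\<lambda>x y. F x y z x' (S c \<otimes>\<^bsub>A\<^esub> y') z')"
          if "x' \<in> carrier A" "c \<in> C" "y' \<in> carrier A" for x' c y'
          using t that \<open>z' \<in> carrier A\<close> by simp
      qed (auto simp: that Fc h SL_mult[OF cgA h(1), symmetric, simplified]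
          F_def distr intro!: SL_cong)
    qed
  qed
  \<comment> \<open>Multiplicativity of the left coproduct collects the legs of \<open>w\<close> and
    \<open>w'\<close> into those of \<open>w w'\<close>, so the antipode axiom contributes
    \<open>qr (w w')\<close> and \<open>SR_q_left\<close> applies.\<close>
  have 4: "?E3 = S b \<otimes>\<^bsub>A\<^esub> S a"
  proof -
    have "?E3 = SR AG a (\<lambda>w z. S b \<otimes>\<^bsub>A\<^esub> (qr w \<otimes>\<^bsub>A\<^esub> S z))"
    proof (rule SR_cong[OF a])
      fix w z assume h: "w \<in> carrier A" "z \<in> carrier A"
      have "SR AG b (\<lambda>w' z'. SL AG w' (\<lambda>x' y'. SL AG w (\<lambda>x y. F x y z x' y' z')))
          = SR AG b (\<lambda>w' z'. (qr (w \<otimes>\<^bsub>A\<^esub> w') \<otimes>\<^bsub>A\<^esub> S z') \<otimes>\<^bsub>A\<^esub> S z)"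
      proof (rule SR_cong[OF b])
        fix w' z' assume h': "w' \<in> carrier A" "z' \<in> carrier A"
        have "SL AG w' (\<lambda>x' y'. SL AG w (\<lambda>x y. F x y z x' y' z'))
            = SL AG (w \<otimes>\<^bsub>A\<^esub> w') (\<lambda>u v. (S u \<otimes>\<^bsub>A\<^esub> v) \<otimes>\<^bsub>A\<^esub> (S z' \<otimes>\<^bsub>A\<^esub> S z))"
        proof (subst SL_times[OF cgA _ h(1) h'(1)])
          show "balL AG (\<lambda>u v. (S u \<otimes>\<^bsub>A\<^esub> v) \<otimes>\<^bsub>A\<^esub> (S z' \<otimes>\<^bsub>A\<^esub> S z))"
            by (rule balLI) (simp_all add: h h' distr S_mult_C)
          show "SL AG w' (\<lambda>x' y'. SL AG w (\<lambda>x y. F x y z x' y' z'))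
            = SL AG w' (\<lambda>u v. SL AG w (\<lambda>x y. (S (x \<otimes>\<^bsub>A\<^esub> u) \<otimes>\<^bsub>A\<^esub> (y \<otimes>\<^bsub>A\<^esub> v)) \<otimes>\<^bsub>A\<^esub> (S z' \<otimes>\<^bsub>A\<^esub> S z)))"
            by (intro SL_cong h h') (simp_all add: F_def h h' m_assoc)
        qed
        also have "\<dots> = qr (w \<otimes>\<^bsub>A\<^esub> w') \<otimes>\<^bsub>A\<^esub> (S z' \<otimes>\<^bsub>A\<^esub> S z)"
          by (subst SL_rmult[symmetric]) (simp_all add: h h' antipode_SL)
        finally show "SL AG w' (\<lambda>x' y'. SL AG w (\<lambda>x y. F x y z x' y' z'))
          = (qr (w \<otimes>\<^bsub>A\<^esub> w') \<otimes>\<^bsub>A\<^esub> S z') \<otimes>\<^bsub>A\<^esub> S z" by (simp add: h h' m_assoc)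
      qed
      also have "\<dots> = (S b \<otimes>\<^bsub>A\<^esub> qr w) \<otimes>\<^bsub>A\<^esub> S z"
        by (subst SR_rmult[symmetric]) (simp_all add: h b SR_q_left)
      finally show "SR AG b (\<lambda>w' z'. SL AG w' (\<lambda>x' y'. SL AG w (\<lambda>x y. F x y z x' y' z')))
        = S b \<otimes>\<^bsub>A\<^esub> (qr w \<otimes>\<^bsub>A\<^esub> S z)" by (simp add: h b m_assoc)
    qed
    also have "\<dots> = S b \<otimes>\<^bsub>A\<^esub> S a"
      by (subst SR_lmult[symmetric]) (simp_all add: a b SR_qS)
    finally show ?thesis .
  qed
  from 1 2 3 4 show ?thesis by simp
qed

lemma SR_of_SL:
  assumes "comm_group G" "balR G f" "a \<in> carrier A"
    "\<And>x y. \<lbrakk>x \<in> carrier A; y \<in> carrier A\<rbrakk> \<Longrightarrow> g x y \<in> carrier A"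
  shows "SR G (SL AG a g) f = SL G a (\<lambda>x y. SR G (g x y) f)"
  by (rule SL_push[where f = g and h = "\<lambda>w. SR G w f", OF assms(1,3)])
    (simp_all add: assms(4) SR_add[OF assms(1,2)] SR_closed[OF assms(1)] balancedD(1)[OF assms(2)])

lemma SR_of_SR:
  assumes "comm_group G" "balR G f" "a \<in> carrier A"
    "\<And>x y. \<lbrakk>x \<in> carrier A; y \<in> carrier A\<rbrakk> \<Longrightarrow> g x y \<in> carrier A"
  shows "SR G (SR AG a g) f = SR G a (\<lambda>x y. SR G (g x y) f)"
  by (rule SR_push[where f = g and h = "\<lambda>w. SR G w f", OF assms(1,3)])
    (simp_all add: assms(4) SR_add[OF assms(1,2)] SR_closed[OF assms(1)] balancedD(1)[OF assms(2)])

lemma coassoc_SRR: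
  assumes "comm_group G" "\<And>x. x \<in> carrier A \<Longrightarrow> balR G (f x)"
    "\<And>z. z \<in> carrier A \<Longrightarrow> balR G (\<lambda>x y. f x y z)" "a \<in> carrier A"
  shows "SR G a (\<lambda>x y. SR G x (\<lambda>u v. f u v y)) = SR G a (\<lambda>x y. SR G y (\<lambda>u v. f x u v))"
  by (rule SR_coassoc[OF assms(1) _ assms(4)]) (simp add: balanced3_def assms(2,3))

lemma pr_BC: "b \<in> B \<Longrightarrow> pr b = b" "c \<in> C \<Longrightarrow> pr c = S c" "c \<in> C \<Longrightarrow> pr' c = c"
  and qr_BC: "c \<in> C \<Longrightarrow> qr c = c" "b \<in> B \<Longrightarrow> qr b = S b" "b \<in> B \<Longrightarrow> qr' b = b"
  using pr_B[of b "\<one>\<^bsub>A\<^esub>"] pr_C[of c "\<one>\<^bsub>A\<^esub>"] pr'_C[of c "\<one>\<^bsub>A\<^esub>"]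
    qr_C[of c "\<one>\<^bsub>A\<^esub>"] qr_B[of b "\<one>\<^bsub>A\<^esub>"] qr'_B[of b "\<one>\<^bsub>A\<^esub>"] by simp_all

lemma S_inj: "\<lbrakk>S a = S b; a \<in> carrier A; b \<in> carrier A\<rbrakk> \<Longrightarrow> a = b"
  using S_bij by (auto simp: bij_betw_def inj_on_def)

lemma S_surj: "a \<in> carrier A \<Longrightarrow> \<exists>b\<in>carrier A. S b = a"
  by (metis S_bij bij_betw_imp_surj_on imageE)

text \<open>Apply \<open>pr'\<close> to the left antipode axiom. It fixes \<open>qr a\<close>, and
  under it \<open>y\<close> may be replaced by \<open>pr y = S (pr' y)\<close>; then
  \<open>S\<close> stands in front of a counit expansion of \<open>a\<close>.\<close>

lemma pr'_S:
  assumes "a \<in> carrier A"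
  shows "pr' (S a) = qr a"
proof -
  have m: "pr' (u \<otimes>\<^bsub>A\<^esub> pr v) = pr' (u \<otimes>\<^bsub>A\<^esub> v)" if "u \<in> carrier A" "v \<in> carrier A" for u v
    using that by (simp add: pr_def pr'_def L.counit_src)
  have "qr a = pr' (SL AG a (\<lambda>x y. S x \<otimes>\<^bsub>A\<^esub> y))"
    by (simp add: antipode_SL assms pr_BC)
  also have "\<dots> = SL AG a (\<lambda>x y. pr' (S x \<otimes>\<^bsub>A\<^esub> y))"
    by (rule SL_push[OF cgA assms]) simp_all
  also have "\<dots> = SL AG a (\<lambda>x y. pr' (S (pr' y \<otimes>\<^bsub>A\<^esub> x)))"
    by (rule SL_cong[OF assms]) (simp add: S_mult m)
  also have "\<dots> = pr' (S (SL AG a (\<lambda>x y. pr' y \<otimes>\<^bsub>A\<^esub> x)))"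
    by (rule SL_push[where h = "\<lambda>w. pr' (S w)", OF cgA assms, symmetric]) simp_all
  finally show ?thesis by (simp add: counits assms)
qed

text \<open>The same argument with \<open>qr\<close> applied to the right antipode axiom;
  \<open>qr\<close> sends \<open>pr a\<close> to \<open>S (pr a)\<close> because \<open>pr a\<close>
  lies in \<open>B\<close>.\<close>

lemma qr_S:
  assumes "a \<in> carrier A"
  shows "qr (S a) = S (pr a)"
proof -
  have "S (pr a) = qr (SR AG a (\<lambda>x y. x \<otimes>\<^bsub>A\<^esub> S y))"
    by (simp add: antipode_SR assms qr_BC)
  also have "\<dots> = SR AG a (\<lambda>x y. qr (x \<otimes>\<^bsub>A\<^esub> S y))"
    by (rule SR_push[OF cgA assms]) simp_all
  also have "\<dots> = SR AG a (\<lambda>x y. qr (S (y \<otimes>\<^bsub>A\<^esub> qr' x)))"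
    by (rule SR_cong[OF assms]) (simp add: S_mult qr_mult)
  also have "\<dots> = qr (S (SR AG a (\<lambda>x y. y \<otimes>\<^bsub>A\<^esub> qr' x)))"
    by (rule SR_push[where h = "\<lambda>w. qr (S w)", OF cgA assms, symmetric]) simp_all
  finally show ?thesis by (simp add: counits assms)
qed

end

section \<open>Non-degenerate left integrals\<close>

locale nondegenerate_integral = symmetrized_hopf_algebroid HL HR S
  for HL :: "('a, 'l) bialgebroid" and HR :: "('a, 'r) bialgebroid" and S :: "'a \<Rightarrow> 'a" +
  fixes ell :: 'a
  assumes nondegenerate: "nondegenerate_left_integral HL HR ell"
begin

section \<open>Left integrals and the Casimir identity\<close>

lemma ell_closed [simp]: "ell \<in> carrier A"
  and ell_integral: "a \<in> carrier A \<Longrightarrow> a \<otimes>\<^bsub>A\<^esub> ell = pr a \<otimes>\<^bsub>A\<^esub> ell"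
  using nondegenerate unfolding nondegenerate_left_integral_def left_integral_def pr_def by blast+

text \<open>\<open>pr (pr' a) = pr a\<close>, so the integral property gives the same result for
  \<open>a\<close> and for \<open>pr' a\<close>.\<close>

lemma integral_C:
  assumes "i \<in> carrier A" "\<And>a. a \<in> carrier A \<Longrightarrow> a \<otimes>\<^bsub>A\<^esub> i = pr a \<otimes>\<^bsub>A\<^esub> i" "a \<in> carrier A"
  shows "a \<otimes>\<^bsub>A\<^esub> i = pr' a \<otimes>\<^bsub>A\<^esub> i"
  using assms(2)[of a] assms(2)[of "pr' a"] assms(3) by (simp add: pr_BC)

text \<open>The analogue of the Casimir property of an integral in a Hopf algebra. Expand
  \<open>S y\<close> as \<open>S u pr v\<close>. In front of the integral \<open>pr v\<close> may be
  replaced by \<open>v\<close>, whose right coproduct then multiplies that of the integral. Mixed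
  coassociativity and the left antipode axiom contract \<open>S u v'\<close>, and a counit expansion
  of \<open>y\<close> remains.\<close>

lemma casimir:
  assumes G: "comm_group G" and f: "balR G f" and y: "y \<in> carrier A"
  shows "SR G ell (\<lambda>x z. f (S y \<otimes>\<^bsub>A\<^esub> x) z) = SR G ell (\<lambda>x z. f x (y \<otimes>\<^bsub>A\<^esub> z))"
proof -
  note fc = balancedD(1)[OF f] and fa = balancedD(2)[OF f] balancedD(3)[OF f]
  have "SR G ell (\<lambda>x z. f (S y \<otimes>\<^bsub>A\<^esub> x) z)
      = SR G ell (\<lambda>x z. SL G y (\<lambda>u v. f (S u \<otimes>\<^bsub>A\<^esub> (pr v \<otimes>\<^bsub>A\<^esub> x)) z))"
  proof (rule SR_cong[OF ell_closed])
    fix x z assume h: "x \<in> carrier A" "z \<in> carrier A"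
    have "f (SL AG y (\<lambda>u v. S u \<otimes>\<^bsub>A\<^esub> pr v) \<otimes>\<^bsub>A\<^esub> x) z
        = SL G y (\<lambda>u v. f (S u \<otimes>\<^bsub>A\<^esub> pr v \<otimes>\<^bsub>A\<^esub> x) z)"
      by (rule SL_push[where h = "\<lambda>w. f (w \<otimes>\<^bsub>A\<^esub> x) z", OF G y]) (simp_all add: h fc fa distr)
    also have "\<dots> = SL G y (\<lambda>u v. f (S u \<otimes>\<^bsub>A\<^esub> (pr v \<otimes>\<^bsub>A\<^esub> x)) z)"
      by (rule SL_cong[OF y]) (simp add: h m_assoc)
    finally show "f (S y \<otimes>\<^bsub>A\<^esub> x) z = SL G y (\<lambda>u v. f (S u \<otimes>\<^bsub>A\<^esub> (pr v \<otimes>\<^bsub>A\<^esub> x)) z)"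
      by (simp add: SL_Sp y)
  qed
  also have "\<dots> = SL G y (\<lambda>u v. SR G ell (\<lambda>x z. f (S u \<otimes>\<^bsub>A\<^esub> (pr v \<otimes>\<^bsub>A\<^esub> x)) z))"
    by (rule SL_SR_swap[OF G y ell_closed, symmetric]) (simp add: fc)
  also have "\<dots> = SL G y (\<lambda>u v. SR G v (\<lambda>v' v''. SR G ell
      (\<lambda>x z. f (S u \<otimes>\<^bsub>A\<^esub> (v' \<otimes>\<^bsub>A\<^esub> x)) (v'' \<otimes>\<^bsub>A\<^esub> z))))"
  proof (rule SL_cong[OF y])
    fix u v assume h: "u \<in> carrier A" "v \<in> carrier A"
    have b: "balR G (\<lambda>x z. f (S u \<otimes>\<^bsub>A\<^esub> x) z)"
      by (rule balR_cong[OF balR_mult[of "S u" "\<one>\<^bsub>A\<^esub>" G f]]) (simp_all add: h f)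
    \<comment> \<open>\<open>pr v\<close> lies in \<open>B\<close>, so as a left factor it affects
      only the first leg of the right coproduct; the integral property turns \<open>pr v ell\<close>
      into \<open>v ell\<close>.\<close>
    have "SR G ell (\<lambda>x z. f (S u \<otimes>\<^bsub>A\<^esub> (pr v \<otimes>\<^bsub>A\<^esub> x)) z)
        = SR G (v \<otimes>\<^bsub>A\<^esub> ell) (\<lambda>x z. f (S u \<otimes>\<^bsub>A\<^esub> x) z)"
      using SR_B[OF G b, of "pr v" ell] h by (simp add: ell_integral[symmetric])
    also have "\<dots> = SR G v (\<lambda>v' v''. SR G ell (\<lambda>x z. f (S u \<otimes>\<^bsub>A\<^esub> (v' \<otimes>\<^bsub>A\<^esub> x)) (v'' \<otimes>\<^bsub>A\<^esub> z)))"
      by (rule SR_times[OF G b ell_closed h(2)])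
    finally show "SR G ell (\<lambda>x z. f (S u \<otimes>\<^bsub>A\<^esub> (pr v \<otimes>\<^bsub>A\<^esub> x)) z) = \<dots>" .
  qed
  also have "\<dots> = SR G y (\<lambda>w v''. SL G w (\<lambda>u v'. SR G ell
      (\<lambda>x z. f (S u \<otimes>\<^bsub>A\<^esub> (v' \<otimes>\<^bsub>A\<^esub> x)) (v'' \<otimes>\<^bsub>A\<^esub> z))))"
  proof (rule coassoc_SLR[OF G _ y, symmetric])
    have 1: "balR G (\<lambda>v' v''. SR G ell (\<lambda>x z. f (S u \<otimes>\<^bsub>A\<^esub> (v' \<otimes>\<^bsub>A\<^esub> x)) (v'' \<otimes>\<^bsub>A\<^esub> z)))"
      if u: "u \<in> carrier A" for u
    proof -
      have b: "balR G (\<lambda>x z. f (S u \<otimes>\<^bsub>A\<^esub> x) z)"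
        by (rule balR_cong[OF balR_mult[of "S u" "\<one>\<^bsub>A\<^esub>" G f]]) (simp_all add: u f)
      show ?thesis by (rule bal_SR_mult[OF G b ell_closed])
    qed
    have 2: "balL G (\<lambda>u v'. SR G ell (\<lambda>x z. f (S u \<otimes>\<^bsub>A\<^esub> (v' \<otimes>\<^bsub>A\<^esub> x)) (v'' \<otimes>\<^bsub>A\<^esub> z)))"
      if "v'' \<in> carrier A" for v''
      by (rule balL_SR[OF G ell_closed], rule balLI) (simp_all add: that fc fa distr S_mult)
    show "b3LR G (\<lambda>u v' v''. SR G ell (\<lambda>x z. f (S u \<otimes>\<^bsub>A\<^esub> (v' \<otimes>\<^bsub>A\<^esub> x)) (v'' \<otimes>\<^bsub>A\<^esub> z)))"
      unfolding b3LR_def using 1 2 by blast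
  qed
  also have "\<dots> = SR G y (\<lambda>w v''. SR G ell (\<lambda>x z. f x (v'' \<otimes>\<^bsub>A\<^esub> (qr' w \<otimes>\<^bsub>A\<^esub> z))))"
  proof (rule SR_cong[OF y])
    fix w v'' assume h: "w \<in> carrier A" "v'' \<in> carrier A"
    have b: "balR G (\<lambda>x z. f x (v'' \<otimes>\<^bsub>A\<^esub> z))"
      by (rule balR_cong[OF balR_mult[of "\<one>\<^bsub>A\<^esub>" v'' G f]]) (simp_all add: h f)
    have "SL G w (\<lambda>u v'. SR G ell (\<lambda>x z. f (S u \<otimes>\<^bsub>A\<^esub> (v' \<otimes>\<^bsub>A\<^esub> x)) (v'' \<otimes>\<^bsub>A\<^esub> z)))
        = SR G ell (\<lambda>x z. SL G w (\<lambda>u v'. f (S u \<otimes>\<^bsub>A\<^esub> (v' \<otimes>\<^bsub>A\<^esub> x)) (v'' \<otimes>\<^bsub>A\<^esub> z)))"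
      by (rule SL_SR_swap[OF G h(1) ell_closed]) (simp add: fc h)
    also have "\<dots> = SR G ell (\<lambda>x z. f (qr w \<otimes>\<^bsub>A\<^esub> x) (v'' \<otimes>\<^bsub>A\<^esub> z))"
    proof (rule SR_cong[OF ell_closed])
      fix x z assume xz: "x \<in> carrier A" "z \<in> carrier A"
      have "f (SL AG w (\<lambda>u v'. S u \<otimes>\<^bsub>A\<^esub> v') \<otimes>\<^bsub>A\<^esub> x) (v'' \<otimes>\<^bsub>A\<^esub> z)
          = SL G w (\<lambda>u v'. f (S u \<otimes>\<^bsub>A\<^esub> v' \<otimes>\<^bsub>A\<^esub> x) (v'' \<otimes>\<^bsub>A\<^esub> z))"
        by (rule SL_push[where h = "\<lambda>w. f (w \<otimes>\<^bsub>A\<^esub> x) (v'' \<otimes>\<^bsub>A\<^esub> z)", OF G h(1)])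
          (simp_all add: h xz fc fa distr)
      also have "\<dots> = SL G w (\<lambda>u v'. f (S u \<otimes>\<^bsub>A\<^esub> (v' \<otimes>\<^bsub>A\<^esub> x)) (v'' \<otimes>\<^bsub>A\<^esub> z))"
        by (rule SL_cong[OF h(1)]) (simp add: h xz m_assoc)
      finally show "SL G w (\<lambda>u v'. f (S u \<otimes>\<^bsub>A\<^esub> (v' \<otimes>\<^bsub>A\<^esub> x)) (v'' \<otimes>\<^bsub>A\<^esub> z))
          = f (qr w \<otimes>\<^bsub>A\<^esub> x) (v'' \<otimes>\<^bsub>A\<^esub> z)" by (simp add: antipode_SL h)
    qed
    \<comment> \<open>\<open>qr w = S (qr' w)\<close> in front of the first leg becomes
      \<open>qr' w\<close> in front of the second one by the Takeuchi condition.\<close>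
    also have "\<dots> = SR G ell (\<lambda>x z. f x (v'' \<otimes>\<^bsub>A\<^esub> (qr' w \<otimes>\<^bsub>A\<^esub> z)))"
      using SR_takeuchi[OF G b, of "qr' w" ell] h by simp
    finally show "SL G w (\<lambda>u v'. SR G ell (\<lambda>x z. f (S u \<otimes>\<^bsub>A\<^esub> (v' \<otimes>\<^bsub>A\<^esub> x)) (v'' \<otimes>\<^bsub>A\<^esub> z))) = \<dots>" .
  qed
  also have "\<dots> = SR G ell (\<lambda>x z. SR G y (\<lambda>w v''. f x (v'' \<otimes>\<^bsub>A\<^esub> (qr' w \<otimes>\<^bsub>A\<^esub> z))))"
    by (rule SR_SR_swap[OF G y ell_closed]) (simp add: fc)
  also have "\<dots> = SR G ell (\<lambda>x z. f x (y \<otimes>\<^bsub>A\<^esub> z))"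
  proof (rule SR_cong[OF ell_closed])
    fix x z assume h: "x \<in> carrier A" "z \<in> carrier A"
    have "f x (SR AG y (\<lambda>w v''. v'' \<otimes>\<^bsub>A\<^esub> qr' w) \<otimes>\<^bsub>A\<^esub> z) = SR G y (\<lambda>w v''. f x (v'' \<otimes>\<^bsub>A\<^esub> qr' w \<otimes>\<^bsub>A\<^esub> z))"
      by (rule SR_push[where h = "\<lambda>w. f x (w \<otimes>\<^bsub>A\<^esub> z)", OF G y]) (simp_all add: h fc fa distr)
    also have "\<dots> = SR G y (\<lambda>w v''. f x (v'' \<otimes>\<^bsub>A\<^esub> (qr' w \<otimes>\<^bsub>A\<^esub> z)))"
      by (rule SR_cong[OF y]) (simp add: h m_assoc)
    finally show "SR G y (\<lambda>w v''. f x (v'' \<otimes>\<^bsub>A\<^esub> (qr' w \<otimes>\<^bsub>A\<^esub> z))) = f x (y \<otimes>\<^bsub>A\<^esub> z)"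
      by (simp add: counits y)
  qed
  finally show ?thesis .
qed

section \<open>The Frobenius form and the two Frobenius identities\<close>

abbreviation "lam \<equiv> lam_star HR ell"

lemma up_dualD:
  assumes "\<phi> \<in> upper_star_right HR"
  shows "x \<in> carrier A \<Longrightarrow> \<phi> x \<in> carrier BR"
    "\<lbrakk>x \<in> carrier A; y \<in> carrier A\<rbrakk> \<Longrightarrow> \<phi> (x \<oplus>\<^bsub>A\<^esub> y) = \<phi> x \<oplus>\<^bsub>BR\<^esub> \<phi> y"
    "\<lbrakk>x \<in> carrier A; r \<in> carrier BR\<rbrakk> \<Longrightarrow> \<phi> (x \<otimes>\<^bsub>A\<^esub> src HR r) = \<phi> x \<otimes>\<^bsub>BR\<^esub> r"
  using assms by (auto simp: upper_star_right_def right_dual_def hom_def mult_right_def Pi_iff)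

lemma up_dualI:
  assumes "\<And>x. x \<in> carrier A \<Longrightarrow> f x \<in> carrier BR"
    "\<And>x y. \<lbrakk>x \<in> carrier A; y \<in> carrier A\<rbrakk> \<Longrightarrow> f (x \<oplus>\<^bsub>A\<^esub> y) = f x \<oplus>\<^bsub>BR\<^esub> f y"
    "\<And>x r. \<lbrakk>x \<in> carrier A; r \<in> carrier BR\<rbrakk> \<Longrightarrow> f (x \<otimes>\<^bsub>A\<^esub> src HR r) = f x \<otimes>\<^bsub>BR\<^esub> r"
  shows "restrict f (carrier A) \<in> upper_star_right HR"
  using assms by (auto simp: upper_star_right_def right_dual_def hom_def mult_right_def Pi_iff)

lemma harpoon_up_eq:
  assumes "\<phi> \<in> upper_star_right HR" "a \<in> carrier A"
  shows "harpoon_up HR \<phi> a = SR AG a (\<lambda>x y. y \<otimes>\<^bsub>A\<^esub> tgt HR (\<phi> x))"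
proof -
  have "balR AG (\<lambda>x y. y \<otimes>\<^bsub>A\<^esub> tgt HR (\<phi> x))"
    by (rule balancedI) (simp_all add: mult_right_def up_dualD[OF assms(1)] distr)
  from SR_tlift[OF cgA this assms(2)] show ?thesis by (simp add: harpoon_up_def AG_def)
qed

lemma lam_up: "lam \<in> upper_star_right HR"
  and harpoon_lam: "harpoon_up HR lam ell = \<one>\<^bsub>A\<^esub>"
proof -
  have "(\<lambda>\<phi>. harpoon_up HR \<phi> ell) ` upper_star_right HR = carrier A"
    using nondegenerate by (auto simp: nondegenerate_left_integral_def bij_betw_def)
  then have "\<one>\<^bsub>A\<^esub> \<in> (\<lambda>\<phi>. harpoon_up HR \<phi> ell) ` upper_star_right HR" by simp
  from inv_into_into[OF this] f_inv_into_f[OF this]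
  show "lam \<in> upper_star_right HR" "harpoon_up HR lam ell = \<one>\<^bsub>A\<^esub>"
    by (simp_all add: lam_star_def)
qed

lemmas lam_simps [simp] = up_dualD[OF lam_up]

definition "Lam a = src HR (lam a)"
definition "Lam' a = tgt HR (lam a)"

lemma Lam_BC [simp]: "a \<in> carrier A \<Longrightarrow> Lam a \<in> C" "a \<in> carrier A \<Longrightarrow> Lam' a \<in> B"
  "a \<in> carrier A \<Longrightarrow> Lam a \<in> carrier A" "a \<in> carrier A \<Longrightarrow> Lam' a \<in> carrier A"
  "a \<in> carrier A \<Longrightarrow> S (Lam' a) = Lam a"
  by (simp_all add: Lam_def Lam'_def)

lemma Lam_add [simp]: "\<lbrakk>a \<in> carrier A; b \<in> carrier A\<rbrakk> \<Longrightarrow> Lam (a \<oplus>\<^bsub>A\<^esub> b) = Lam a \<oplus>\<^bsub>A\<^esub> Lam b"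
  "\<lbrakk>a \<in> carrier A; b \<in> carrier A\<rbrakk> \<Longrightarrow> Lam' (a \<oplus>\<^bsub>A\<^esub> b) = Lam' a \<oplus>\<^bsub>A\<^esub> Lam' b"
  by (simp_all add: Lam_def Lam'_def)

lemma Lam_C: "\<lbrakk>a \<in> carrier A; c \<in> C\<rbrakk> \<Longrightarrow> Lam (a \<otimes>\<^bsub>A\<^esub> c) = Lam a \<otimes>\<^bsub>A\<^esub> c"
  by (auto simp: C_R Lam_def)

lemma Lam'_SB: "\<lbrakk>a \<in> carrier A; b \<in> B\<rbrakk> \<Longrightarrow> Lam' (a \<otimes>\<^bsub>A\<^esub> S b) = b \<otimes>\<^bsub>A\<^esub> Lam' a"
  by (auto simp: B_R Lam'_def)

lemma SR_ell_Lam': "SR AG ell (\<lambda>x z. z \<otimes>\<^bsub>A\<^esub> Lam' x) = \<one>\<^bsub>A\<^esub>"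
  using harpoon_up_eq[OF lam_up ell_closed] harpoon_lam by (simp add: Lam'_def)

lemma bal_Lam': "balR AG (\<lambda>x z. z \<otimes>\<^bsub>A\<^esub> Lam' x)"
  by (rule balRI) (simp_all add: distr Lam'_SB)

text \<open>The Casimir identity turns \<open>S y\<close> on the first leg into \<open>y\<close> in
  front of the second, and what is left over is the defining equation of \<open>lam\<close>.\<close>

lemma frobenius1':
  assumes "y \<in> carrier A"
  shows "SR AG ell (\<lambda>x z. z \<otimes>\<^bsub>A\<^esub> Lam' (S y \<otimes>\<^bsub>A\<^esub> x)) = y"
proof -
  have "SR AG ell (\<lambda>x z. z \<otimes>\<^bsub>A\<^esub> Lam' (S y \<otimes>\<^bsub>A\<^esub> x)) = SR AG ell (\<lambda>x z. (y \<otimes>\<^bsub>A\<^esub> z) \<otimes>\<^bsub>A\<^esub> Lam' x)"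
    by (rule casimir[OF cgA bal_Lam' assms])
  also have "\<dots> = SR AG ell (\<lambda>x z. y \<otimes>\<^bsub>A\<^esub> (z \<otimes>\<^bsub>A\<^esub> Lam' x))"
    by (rule SR_cong) (simp_all add: m_assoc assms)
  also have "\<dots> = y"
    by (subst SR_lmult[symmetric]) (simp_all add: assms SR_ell_Lam')
  finally show ?thesis .
qed

text \<open>By \<open>frobenius1'\<close> the functional on the right and \<open>\<phi>\<close>
  contract with \<open>ell\<close> to the same element; the contraction is injective on
  \<open>upper_star_right HR\<close> by non-degeneracy.\<close>

lemma up_dual_rep:
  assumes "\<phi> \<in> upper_star_right HR" "x \<in> carrier A"
  shows "\<phi> x = lam (S (harpoon_up HR \<phi> ell) \<otimes>\<^bsub>A\<^esub> x)"
proof -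
  define y where "y = harpoon_up HR \<phi> ell"
  have y: "y \<in> carrier A" unfolding y_def harpoon_up_eq[OF assms(1) ell_closed]
    by (rule SR_clA) (simp_all add: up_dualD[OF assms(1)])
  let ?p = "restrict (\<lambda>x. lam (S y \<otimes>\<^bsub>A\<^esub> x)) (carrier A)"
  have p: "?p \<in> upper_star_right HR"
    by (rule up_dualI) (simp_all add: y distr, simp add: y m_assoc[symmetric])
  have "harpoon_up HR ?p ell = SR AG ell (\<lambda>x z. z \<otimes>\<^bsub>A\<^esub> Lam' (S y \<otimes>\<^bsub>A\<^esub> x))"
    unfolding harpoon_up_eq[OF p ell_closed] by (rule SR_cong) (simp_all add: Lam'_def)
  also have "\<dots> = harpoon_up HR \<phi> ell" by (simp add: frobenius1' y y_def[symmetric])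
  finally have "?p = \<phi>"
    using nondegenerate p assms(1)
    by (auto simp: nondegenerate_left_integral_def bij_betw_def inj_on_def)
  then show ?thesis using assms(2) y_def by (metis restrict_apply')
qed

text \<open>Membership in the dual gives right linearity only. Left linearity follows from
  \<open>up_dual_rep\<close>: the functional \<open>r lam\<close> contracts with \<open>ell\<close>
  to \<open>tgt HR r\<close>, and \<open>S (tgt HR r) = src HR r\<close>.\<close>

lemma lam_left:
  assumes "r \<in> carrier BR" "x \<in> carrier A"
  shows "lam (src HR r \<otimes>\<^bsub>A\<^esub> x) = r \<otimes>\<^bsub>BR\<^esub> lam x"
proof -
  let ?p = "restrict (\<lambda>x. r \<otimes>\<^bsub>BR\<^esub> lam x) (carrier A)"
  have p: "?p \<in> upper_star_right HR"
    by (rule up_dualI) (simp_all add: assms R.source.R.r_distr R.source.R.m_assoc)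
  have "harpoon_up HR ?p ell = SR AG ell (\<lambda>x z. (z \<otimes>\<^bsub>A\<^esub> Lam' x) \<otimes>\<^bsub>A\<^esub> tgt HR r)"
    unfolding harpoon_up_eq[OF p ell_closed]
    by (rule SR_cong) (simp_all add: Lam'_def assms m_assoc)
  also have "\<dots> = tgt HR r"
    by (subst SR_rmult[symmetric]) (simp_all add: SR_ell_Lam' assms)
  finally show ?thesis using up_dual_rep[OF p assms(2)] assms by simp
qed

lemma Lam_left: "\<lbrakk>a \<in> carrier A; c \<in> C\<rbrakk> \<Longrightarrow> Lam (c \<otimes>\<^bsub>A\<^esub> a) = c \<otimes>\<^bsub>A\<^esub> Lam a"
  by (auto simp: C_R Lam_def lam_left)

definition "BG = add_monoid BR"

lemma BG_simps [simp]: "carrier BG = carrier BR" "x \<otimes>\<^bsub>BG\<^esub> y = x \<oplus>\<^bsub>BR\<^esub> y"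
  by (simp_all add: BG_def)

lemma cgB [simp]: "comm_group BG"
  unfolding BG_def by (rule R.source.R.a_comm_group)

text \<open>
  The second Frobenius identity uses the other half of non-degeneracy: the integral is
  contracted with a functional, which is then recognised as the Frobenius form.
\<close>

lemma frobenius2:
  assumes "a \<in> carrier A"
  shows "SR AG ell (\<lambda>x z. x \<otimes>\<^bsub>A\<^esub> Lam (S z \<otimes>\<^bsub>A\<^esub> a)) = a"
proof -
  have "(\<lambda>\<phi>. harpoon_down HR \<phi> ell) ` upper_star_left HR = carrier A"
    using nondegenerate by (simp add: nondegenerate_left_integral_def bij_betw_def)
  with assms have "a \<in> (\<lambda>\<phi>. harpoon_down HR \<phi> ell) ` upper_star_left HR" by simp
  then obtain \<psi> where h: "a = harpoon_down HR \<psi> ell" and p: "\<psi> \<in> upper_star_left HR"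
    by (rule imageE)
  have psi: "x \<in> carrier A \<Longrightarrow> \<psi> x \<in> carrier BR"
    "\<lbrakk>x \<in> carrier A; y \<in> carrier A\<rbrakk> \<Longrightarrow> \<psi> (x \<oplus>\<^bsub>A\<^esub> y) = \<psi> x \<oplus>\<^bsub>BR\<^esub> \<psi> y"
    "\<lbrakk>x \<in> carrier A; r \<in> carrier BR\<rbrakk> \<Longrightarrow> \<psi> (x \<otimes>\<^bsub>A\<^esub> tgt HR r) = r \<otimes>\<^bsub>BR\<^esub> \<psi> x" for x y r
    using p by (auto simp: upper_star_left_def left_dual_def hom_def mult_right_def Pi_iff)
  have b: "balR AG (\<lambda>x y. x \<otimes>\<^bsub>A\<^esub> src HR (\<psi> y))"
    by (rule balancedI) (simp_all add: mult_right_def psi distr)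
  have a: "a = SR AG ell (\<lambda>x z. x \<otimes>\<^bsub>A\<^esub> src HR (\<psi> z))"
    using SR_tlift[OF cgA b ell_closed] h by (simp add: harpoon_down_def AG_def)
  \<comment> \<open>Expand \<open>y\<close> by \<open>frobenius1'\<close>. Left linearity of
    \<open>\<psi>\<close> releases the value of the form, right linearity of \<open>lam\<close>
    takes the value of \<open>\<psi>\<close> back in, and the sum inside \<open>lam\<close> closes
    to \<open>a\<close>.\<close>
  have e: "\<psi> y = lam (S y \<otimes>\<^bsub>A\<^esub> a)" if y: "y \<in> carrier A" for y
  proof -
    have "\<psi> y = \<psi> (SR AG ell (\<lambda>x z. z \<otimes>\<^bsub>A\<^esub> Lam' (S y \<otimes>\<^bsub>A\<^esub> x)))"
      by (simp add: frobenius1' y)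
    also have "\<dots> = SR BG ell (\<lambda>x z. \<psi> (z \<otimes>\<^bsub>A\<^esub> Lam' (S y \<otimes>\<^bsub>A\<^esub> x)))"
      by (rule SR_push[OF cgB ell_closed]) (simp_all add: psi y)
    also have "\<dots> = SR BG ell (\<lambda>x z. lam (S y \<otimes>\<^bsub>A\<^esub> (x \<otimes>\<^bsub>A\<^esub> src HR (\<psi> z))))"
    proof (rule SR_cong)
      fix x z assume h: "x \<in> carrier A" "z \<in> carrier A"
      have "lam (S y \<otimes>\<^bsub>A\<^esub> (x \<otimes>\<^bsub>A\<^esub> src HR (\<psi> z))) = lam ((S y \<otimes>\<^bsub>A\<^esub> x) \<otimes>\<^bsub>A\<^esub> src HR (\<psi> z))"
        by (simp add: h y psi m_assoc)
      then show "\<psi> (z \<otimes>\<^bsub>A\<^esub> Lam' (S y \<otimes>\<^bsub>A\<^esub> x)) = lam (S y \<otimes>\<^bsub>A\<^esub> (x \<otimes>\<^bsub>A\<^esub> src HR (\<psi> z)))"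
        by (simp add: Lam'_def psi h y)
    qed simp
    also have "\<dots> = lam (S y \<otimes>\<^bsub>A\<^esub> SR AG ell (\<lambda>x z. x \<otimes>\<^bsub>A\<^esub> src HR (\<psi> z)))"
      by (rule SR_push[where h = "\<lambda>w. lam (S y \<otimes>\<^bsub>A\<^esub> w)", OF cgB ell_closed, symmetric])
        (simp_all add: y psi distr)
    finally show ?thesis by (simp add: a[symmetric])
  qed
  have "SR AG ell (\<lambda>x z. x \<otimes>\<^bsub>A\<^esub> Lam (S z \<otimes>\<^bsub>A\<^esub> a)) = SR AG ell (\<lambda>x z. x \<otimes>\<^bsub>A\<^esub> src HR (\<psi> z))"
    by (rule SR_cong) (simp_all add: e Lam_def)
  then show ?thesis using a by simp
qed

text \<open>The image of \<open>frobenius1'\<close> under \<open>S\<close>, where \<open>a\<close>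
  is written as \<open>S y\<close>.\<close>

lemma frobenius1:
  assumes "a \<in> carrier A"
  shows "SR AG ell (\<lambda>x z. Lam (a \<otimes>\<^bsub>A\<^esub> x) \<otimes>\<^bsub>A\<^esub> S z) = a"
proof -
  obtain y where y: "y \<in> carrier A" "S y = a" using S_surj[OF assms] by blast
  have "a = S (SR AG ell (\<lambda>x z. z \<otimes>\<^bsub>A\<^esub> Lam' (S y \<otimes>\<^bsub>A\<^esub> x)))" by (rule trans[OF y(2)[symmetric]]) (simp only: frobenius1'[OF y(1)])
  also have "\<dots> = SR AG ell (\<lambda>x z. S (z \<otimes>\<^bsub>A\<^esub> Lam' (S y \<otimes>\<^bsub>A\<^esub> x)))"
    by (rule SR_S) (simp_all add: y assms)
  also have "\<dots> = SR AG ell (\<lambda>x z. Lam (a \<otimes>\<^bsub>A\<^esub> x) \<otimes>\<^bsub>A\<^esub> S z)"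
    by (rule SR_cong) (simp_all add: y S_mult assms)
  finally show ?thesis by (rule sym)
qed

section \<open>Invariance of the Frobenius form under contraction\<close>

lemma bal_SR_arg:
  assumes "a \<in> carrier A"
  shows "balR AG (\<lambda>v z. v \<otimes>\<^bsub>A\<^esub> Lam (S z \<otimes>\<^bsub>A\<^esub> a))" "balR AG (\<lambda>x z. z \<otimes>\<^bsub>A\<^esub> Lam' (S a \<otimes>\<^bsub>A\<^esub> x))"
  by (rule balRI; simp add: assms distr S_mult Lam_left;
      simp add: assms m_assoc[symmetric] Lam'_SB)+

text \<open>Contracting \<open>a\<close> with \<open>lam\<close> gives back the value of
  \<open>lam\<close>, as for an integral in the dual. Rebuild \<open>a\<close> by
  \<open>frobenius2\<close>; coassociativity shifts the contraction to the first leg of the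
  integral, where it produces the unit, and \<open>k\<close> at the unit is
  \<open>Lam a\<close>.\<close>

lemma lam_invariant:
  assumes a: "a \<in> carrier A"
  shows "SR AG a (\<lambda>x z. z \<otimes>\<^bsub>A\<^esub> Lam' x) = Lam a"
proof -
  define k where "k w = SR AG w (\<lambda>v z. v \<otimes>\<^bsub>A\<^esub> Lam (S z \<otimes>\<^bsub>A\<^esub> a))" for w
  note bk = bal_SR_arg(1)[OF a]
  \<comment> \<open>Linearity of \<open>k\<close> over \<open>B\<close> lets the factor
    \<open>Lam' u\<close> be collected inside the argument of \<open>k\<close>, so that the
    contraction of the integral is completed there.\<close>
  have kB: "k (w \<otimes>\<^bsub>A\<^esub> b) = k w \<otimes>\<^bsub>A\<^esub> b" if h: "w \<in> carrier A" "b \<in> B" for w b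
  proof -
    have "k (w \<otimes>\<^bsub>A\<^esub> b) = SR AG w (\<lambda>v z. (v \<otimes>\<^bsub>A\<^esub> b) \<otimes>\<^bsub>A\<^esub> Lam (S z \<otimes>\<^bsub>A\<^esub> a))"
      unfolding k_def by (rule SR_B'[OF cgA bk h(2,1)])
    also have "\<dots> = SR AG w (\<lambda>v z. (v \<otimes>\<^bsub>A\<^esub> Lam (S z \<otimes>\<^bsub>A\<^esub> a)) \<otimes>\<^bsub>A\<^esub> b)"
      by (rule SR_cong) (simp_all add: h a m_assoc BC_comm[of b])
    finally show ?thesis unfolding k_def by (subst SR_rmult) (simp_all add: h a)
  qed
  let ?F = "\<lambda>u v z. (v \<otimes>\<^bsub>A\<^esub> Lam (S z \<otimes>\<^bsub>A\<^esub> a)) \<otimes>\<^bsub>A\<^esub> Lam' u"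
  have "SR AG a (\<lambda>x z. z \<otimes>\<^bsub>A\<^esub> Lam' x)
      = SR AG (SR AG ell (\<lambda>x z. x \<otimes>\<^bsub>A\<^esub> Lam (S z \<otimes>\<^bsub>A\<^esub> a))) (\<lambda>x z. z \<otimes>\<^bsub>A\<^esub> Lam' x)"
    by (simp add: frobenius2 a)
  also have "\<dots> = SR AG ell (\<lambda>x z. SR AG (x \<otimes>\<^bsub>A\<^esub> Lam (S z \<otimes>\<^bsub>A\<^esub> a)) (\<lambda>x z. z \<otimes>\<^bsub>A\<^esub> Lam' x))"
    by (rule SR_of_SR[OF cgA bal_Lam' ell_closed]) (simp add: a)
  also have "\<dots> = SR AG ell (\<lambda>x z. SR AG x (\<lambda>u v. ?F u v z))"
    by (intro SR_cong SR_C' cgA bal_Lam') (simp_all add: a)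
  also have "\<dots> = SR AG ell (\<lambda>u w. SR AG w (\<lambda>v z. ?F u v z))"
  proof (rule coassoc_SRR[OF cgA _ _ ell_closed])
    show "balR AG (\<lambda>v z. ?F u v z)" if "u \<in> carrier A" for u
      by (rule balRI) (simp_all add: that a distr S_mult Lam_left)
    show "balR AG (\<lambda>u v. ?F u v z)" if "z \<in> carrier A" for z
      by (rule balRI) (simp_all add: that a distr Lam'_SB BC_swap)
  qed
  also have "\<dots> = SR AG ell (\<lambda>u w. k (w \<otimes>\<^bsub>A\<^esub> Lam' u))"
    by (rule SR_cong) (simp_all add: kB a, simp add: k_def a SR_rmult)
  also have "\<dots> = k (SR AG ell (\<lambda>u w. w \<otimes>\<^bsub>A\<^esub> Lam' u))"
    by (rule SR_push[where h = k, OF cgA ell_closed, symmetric])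
      (simp_all add: k_def a SR_add[OF cgA bk, simplified])
  also have "\<dots> = Lam a"
    using SR_one[OF cgA bk] by (simp add: SR_ell_Lam' k_def a)
  finally show ?thesis .
qed

text \<open>The counterpart for \<open>lam\<close> after the antipode, obtained by the same method
  from \<open>frobenius1'\<close>; the auxiliary function \<open>m\<close> is linear over
  \<open>C\<close> instead of \<open>B\<close>.\<close>

lemma lam_S_invariant:
  assumes a: "a \<in> carrier A"
  shows "SR AG a (\<lambda>x z. x \<otimes>\<^bsub>A\<^esub> Lam (S z)) = Lam' (S a)"
proof -
  define m where "m w = SR AG w (\<lambda>x u. u \<otimes>\<^bsub>A\<^esub> Lam' (S a \<otimes>\<^bsub>A\<^esub> x))" for w
  note bm = bal_SR_arg(2)[OF a]
  have bk: "balR AG (\<lambda>x z. x \<otimes>\<^bsub>A\<^esub> Lam (S z))"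
    by (rule balRI) (simp_all add: distr S_mult Lam_left)
  have mC: "m (w \<otimes>\<^bsub>A\<^esub> c) = m w \<otimes>\<^bsub>A\<^esub> c" if h: "w \<in> carrier A" "c \<in> C" for w c
  proof -
    have "m (w \<otimes>\<^bsub>A\<^esub> c) = SR AG w (\<lambda>x u. (u \<otimes>\<^bsub>A\<^esub> c) \<otimes>\<^bsub>A\<^esub> Lam' (S a \<otimes>\<^bsub>A\<^esub> x))"
      unfolding m_def by (rule SR_C'[OF cgA bm h(2,1)])
    also have "\<dots> = SR AG w (\<lambda>x u. (u \<otimes>\<^bsub>A\<^esub> Lam' (S a \<otimes>\<^bsub>A\<^esub> x)) \<otimes>\<^bsub>A\<^esub> c)"
      by (rule SR_cong) (simp_all add: h a m_assoc BC_comm[of _ c])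
    finally show ?thesis unfolding m_def by (subst SR_rmult) (simp_all add: h a)
  qed
  let ?F = "\<lambda>x u v. (u \<otimes>\<^bsub>A\<^esub> Lam' (S a \<otimes>\<^bsub>A\<^esub> x)) \<otimes>\<^bsub>A\<^esub> Lam (S v)"
  have "SR AG a (\<lambda>x z. x \<otimes>\<^bsub>A\<^esub> Lam (S z))
      = SR AG (SR AG ell (\<lambda>x z. z \<otimes>\<^bsub>A\<^esub> Lam' (S a \<otimes>\<^bsub>A\<^esub> x))) (\<lambda>x z. x \<otimes>\<^bsub>A\<^esub> Lam (S z))"
    by (simp add: frobenius1' a)
  also have "\<dots> = SR AG ell (\<lambda>x w. SR AG (w \<otimes>\<^bsub>A\<^esub> Lam' (S a \<otimes>\<^bsub>A\<^esub> x)) (\<lambda>x z. x \<otimes>\<^bsub>A\<^esub> Lam (S z)))"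
    by (rule SR_of_SR[OF cgA bk ell_closed]) (simp add: a)
  also have "\<dots> = SR AG ell (\<lambda>x w. SR AG w (\<lambda>u v. ?F x u v))"
    by (intro SR_cong SR_B' cgA bk) (simp_all add: a)
  also have "\<dots> = SR AG ell (\<lambda>w v. SR AG w (\<lambda>x u. ?F x u v))"
  proof (rule coassoc_SRR[OF cgA _ _ ell_closed, symmetric])
    show "balR AG (\<lambda>u v. ?F x u v)" if "x \<in> carrier A" for x
      by (rule balRI) (simp_all add: that a distr S_mult Lam_left BC_swap)
    show "balR AG (\<lambda>x u. ?F x u v)" if "v \<in> carrier A" for v
      by (rule balRI) (simp_all add: that a distr, simp add: that a m_assoc[symmetric] Lam'_SB)
  qed
  also have "\<dots> = SR AG ell (\<lambda>w v. m (w \<otimes>\<^bsub>A\<^esub> Lam (S v)))"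
    by (rule SR_cong) (simp_all add: mC a, simp add: m_def a SR_rmult)
  also have "\<dots> = m (SR AG ell (\<lambda>w v. w \<otimes>\<^bsub>A\<^esub> Lam (S v)))"
    by (rule SR_push[where h = m, OF cgA ell_closed, symmetric])
      (simp_all add: m_def a SR_add[OF cgA bm, simplified])
  also have "SR AG ell (\<lambda>w v. w \<otimes>\<^bsub>A\<^esub> Lam (S v)) = \<one>\<^bsub>A\<^esub>"
  proof -
    have "SR AG ell (\<lambda>w v. w \<otimes>\<^bsub>A\<^esub> Lam (S v)) = SR AG ell (\<lambda>x z. x \<otimes>\<^bsub>A\<^esub> Lam (S z \<otimes>\<^bsub>A\<^esub> \<one>\<^bsub>A\<^esub>))"
      by (rule SR_cong) simp_all
    also have "\<dots> = \<one>\<^bsub>A\<^esub>" by (rule frobenius2) simp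
    finally show ?thesis .
  qed
  also have "m \<one>\<^bsub>A\<^esub> = Lam' (S a)"
    using SR_one[OF cgA bm] by (simp add: m_def a)
  finally show ?thesis .
qed

section \<open>Left integrals as right multiples of \<open>ell\<close>\<close>

lemma Lam_ell [simp]: "Lam ell = \<one>\<^bsub>A\<^esub>"
  using lam_invariant[of ell] by (simp add: SR_ell_Lam')

text \<open>\<open>S z\<close> acts on an integral as \<open>qr z\<close>, by
  \<open>integral_C\<close> and \<open>pr'_S\<close>. Left linearity of the form over
  \<open>C\<close> then reduces \<open>frobenius2\<close> to a counit expansion of
  \<open>ell\<close>.\<close>

lemma integral_Lam:
  assumes i: "i \<in> carrier A" and int: "\<And>a. a \<in> carrier A \<Longrightarrow> a \<otimes>\<^bsub>A\<^esub> i = pr a \<otimes>\<^bsub>A\<^esub> i"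
  shows "i = ell \<otimes>\<^bsub>A\<^esub> Lam i"
proof -
  have "i = SR AG ell (\<lambda>x z. x \<otimes>\<^bsub>A\<^esub> Lam (S z \<otimes>\<^bsub>A\<^esub> i))" by (rule frobenius2[OF i, symmetric])
  also have "\<dots> = SR AG ell (\<lambda>x z. (x \<otimes>\<^bsub>A\<^esub> qr z) \<otimes>\<^bsub>A\<^esub> Lam i)"
  proof (rule SR_cong)
    fix x z assume h: "x \<in> carrier A" "z \<in> carrier A"
    have "S z \<otimes>\<^bsub>A\<^esub> i = qr z \<otimes>\<^bsub>A\<^esub> i" using integral_C[OF i int, of "S z"] h by (simp add: pr'_S)
    then show "x \<otimes>\<^bsub>A\<^esub> Lam (S z \<otimes>\<^bsub>A\<^esub> i) = (x \<otimes>\<^bsub>A\<^esub> qr z) \<otimes>\<^bsub>A\<^esub> Lam i"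
      using h i by (simp add: Lam_left m_assoc)
  qed simp
  also have "\<dots> = ell \<otimes>\<^bsub>A\<^esub> Lam i"
    by (subst SR_rmult[symmetric]) (simp_all add: i counits)
  finally show ?thesis .
qed

lemma integral_Lam':
  assumes i: "i \<in> carrier A" and int: "\<And>a. a \<in> carrier A \<Longrightarrow> a \<otimes>\<^bsub>A\<^esub> i = pr a \<otimes>\<^bsub>A\<^esub> i"
  shows "i = ell \<otimes>\<^bsub>A\<^esub> Lam' (S i)"
proof -
  have "i = SR AG ell (\<lambda>x z. z \<otimes>\<^bsub>A\<^esub> Lam' (S i \<otimes>\<^bsub>A\<^esub> x))" by (rule frobenius1'[OF i, symmetric])
  also have "\<dots> = SR AG ell (\<lambda>x z. (z \<otimes>\<^bsub>A\<^esub> qr' x) \<otimes>\<^bsub>A\<^esub> Lam' (S i))"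
  proof (rule SR_cong)
    fix x z assume h: "x \<in> carrier A" "z \<in> carrier A"
    \<comment> \<open>\<open>x\<close> stands to the right of \<open>S i\<close>; written as
      \<open>S u\<close> it makes the product the antipode of \<open>u i\<close>, to which the
      integral property applies.\<close>
    obtain u where u: "u \<in> carrier A" "S u = x" using S_surj[OF h(1)] by blast
    have "S i \<otimes>\<^bsub>A\<^esub> x = S (u \<otimes>\<^bsub>A\<^esub> i)" using u i by (simp add: S_mult)
    also have "u \<otimes>\<^bsub>A\<^esub> i = pr u \<otimes>\<^bsub>A\<^esub> i" by (rule int[OF u(1)])
    also have "S (pr u \<otimes>\<^bsub>A\<^esub> i) = S i \<otimes>\<^bsub>A\<^esub> S (qr' x)"
      using u i h qr_S[of u] by (simp add: S_mult)
    finally show "z \<otimes>\<^bsub>A\<^esub> Lam' (S i \<otimes>\<^bsub>A\<^esub> x) = (z \<otimes>\<^bsub>A\<^esub> qr' x) \<otimes>\<^bsub>A\<^esub> Lam' (S i)"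
      using h i Lam'_SB[of "S i" "qr' x"] by (simp add: m_assoc)
  qed simp
  also have "\<dots> = ell \<otimes>\<^bsub>A\<^esub> Lam' (S i)"
    by (subst SR_rmult[symmetric]) (simp_all add: i counits)
  finally show ?thesis .
qed

lemma ell_mult_integral:
  assumes "b \<in> carrier A" "a \<in> carrier A"
  shows "a \<otimes>\<^bsub>A\<^esub> (ell \<otimes>\<^bsub>A\<^esub> b) = pr a \<otimes>\<^bsub>A\<^esub> (ell \<otimes>\<^bsub>A\<^esub> b)"
  using assms ell_integral[of a] by (simp add: m_assoc[symmetric])

text \<open>\<open>ell b\<close> is again a left integral. So multiplying \<open>ell\<close> by an
  arbitrary \<open>b\<close> can be replaced by multiplying it by an element of \<open>C\<close>,
  and in \<open>ell_Lam'\<close> by one of \<open>B\<close>.\<close>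

lemma ell_Lam: "b \<in> carrier A \<Longrightarrow> ell \<otimes>\<^bsub>A\<^esub> Lam (ell \<otimes>\<^bsub>A\<^esub> b) = ell \<otimes>\<^bsub>A\<^esub> b"
  by (rule integral_Lam[symmetric, OF _ ell_mult_integral]) simp_all

lemma ell_Lam': "b \<in> carrier A \<Longrightarrow> ell \<otimes>\<^bsub>A\<^esub> Lam' (S (ell \<otimes>\<^bsub>A\<^esub> b)) = ell \<otimes>\<^bsub>A\<^esub> b"
  by (rule integral_Lam'[symmetric, OF _ ell_mult_integral]) simp_all

lemma ell_C_inj: "c \<in> C \<Longrightarrow> Lam (ell \<otimes>\<^bsub>A\<^esub> c) = c"
  by (simp add: Lam_C)

subsection \<open>The Nakayama-type anti-automorphism\<close>

abbreviation "\<xi> \<equiv> xi HR S ell"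

lemma xi_eq:
  assumes "a \<in> carrier A"
  shows "\<xi> a = SR AG a (\<lambda>x z. Lam (ell \<otimes>\<^bsub>A\<^esub> x) \<otimes>\<^bsub>A\<^esub> S z)"
proof -
  have p: "fun_harpoon A lam ell \<in> upper_star_right HR"
    unfolding fun_harpoon_def
    by (rule up_dualI) (simp_all add: distr, simp add: m_assoc[symmetric])
  have "\<xi> a = S (SR AG a (\<lambda>x z. z \<otimes>\<^bsub>A\<^esub> tgt HR (fun_harpoon A lam ell x)))"
    unfolding xi_def using harpoon_up_eq[OF p assms] by simp
  also have "\<dots> = SR AG a (\<lambda>x z. S (z \<otimes>\<^bsub>A\<^esub> tgt HR (fun_harpoon A lam ell x)))"
    by (rule SR_S[OF assms]) (simp add: fun_harpoon_def)
  also have "\<dots> = SR AG a (\<lambda>x z. Lam (ell \<otimes>\<^bsub>A\<^esub> x) \<otimes>\<^bsub>A\<^esub> S z)"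
    by (rule SR_cong[OF assms]) (simp add: fun_harpoon_def S_mult Lam_def)
  finally show ?thesis .
qed

lemma bal_Lam_S: "w \<in> carrier A \<Longrightarrow> balR AG (\<lambda>x z. Lam (w \<otimes>\<^bsub>A\<^esub> x) \<otimes>\<^bsub>A\<^esub> S z)"
  by (rule balRI; simp add: distr S_mult; simp add: m_assoc[symmetric] Lam_C)

lemma xi_closed [simp]: "a \<in> carrier A \<Longrightarrow> \<xi> a \<in> carrier A"
  by (simp add: xi_eq)

lemma xi_add [simp]: "\<lbrakk>a \<in> carrier A; b \<in> carrier A\<rbrakk> \<Longrightarrow> \<xi> (a \<oplus>\<^bsub>A\<^esub> b) = \<xi> a \<oplus>\<^bsub>A\<^esub> \<xi> b"
  using SR_add[OF cgA bal_Lam_S[OF ell_closed], of a b] by (simp add: xi_eq)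

text \<open>\<open>act w c\<close> is the action on \<open>w\<close> of the functional \<open>\<mu>\<inverse> (\<lambda>\<^sup>* (_ c))\<close> of the lower dual, called \<open>phi c\<close> below.\<close>

definition act :: "'a \<Rightarrow> 'a \<Rightarrow> 'a" where
  "act w c = SL AG w (\<lambda>x y. S (Lam (x \<otimes>\<^bsub>A\<^esub> c)) \<otimes>\<^bsub>A\<^esub> y)"

lemma bal_act: "c \<in> carrier A \<Longrightarrow> balL AG (\<lambda>x y. S (Lam (x \<otimes>\<^bsub>A\<^esub> c)) \<otimes>\<^bsub>A\<^esub> y)"
  by (rule balLI) (simp_all add: distr S_mult Lam_left)

lemma act_closed [simp]: "\<lbrakk>w \<in> carrier A; c \<in> carrier A\<rbrakk> \<Longrightarrow> act w c \<in> carrier A"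
  by (simp add: act_def)

lemma act_add: "\<lbrakk>w \<in> carrier A; v \<in> carrier A; c \<in> carrier A\<rbrakk> \<Longrightarrow> act (w \<oplus>\<^bsub>A\<^esub> v) c = act w c \<oplus>\<^bsub>A\<^esub> act v c"
  using SL_add[OF cgA bal_act] by (simp add: act_def)

text \<open>Trades the left coproduct of \<open>w\<close> for the right coproduct of
  \<open>a\<close>. Expand \<open>Lam (x a)\<close> by \<open>lam_invariant\<close>; mixed
  coassociativity on \<open>w\<close> brings \<open>S x''\<close> next to \<open>y\<close>, the left
  antipode axiom contracts them, and the remaining two legs of \<open>w\<close> form a counit
  expansion. For \<open>w = ell\<close> this makes \<open>\<xi>\<close> the map
  \<open>act ell\<close>.\<close>

lemma act_eq:
  assumes w: "w \<in> carrier A" and a: "a \<in> carrier A"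
  shows "act w a = SR AG a (\<lambda>x z. Lam (w \<otimes>\<^bsub>A\<^esub> x) \<otimes>\<^bsub>A\<^esub> S z)"
proof -
  let ?F = "\<lambda>x' x'' y. SR AG a (\<lambda>u v. Lam (x' \<otimes>\<^bsub>A\<^esub> u) \<otimes>\<^bsub>A\<^esub> (S v \<otimes>\<^bsub>A\<^esub> (S x'' \<otimes>\<^bsub>A\<^esub> y)))"
  have "act w a = SL AG w (\<lambda>x y. SR AG x (\<lambda>x' x''. ?F x' x'' y))"
    unfolding act_def
  proof (rule SL_cong[OF w])
    fix x y assume h: "x \<in> carrier A" "y \<in> carrier A"
    have "Lam (x \<otimes>\<^bsub>A\<^esub> a) = SR AG (x \<otimes>\<^bsub>A\<^esub> a) (\<lambda>u v. v \<otimes>\<^bsub>A\<^esub> Lam' u)"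
      by (simp add: lam_invariant h a)
    also have "\<dots> = SR AG x (\<lambda>x' x''. SR AG a (\<lambda>u v. (x'' \<otimes>\<^bsub>A\<^esub> v) \<otimes>\<^bsub>A\<^esub> Lam' (x' \<otimes>\<^bsub>A\<^esub> u)))"
      by (rule SR_times[OF cgA bal_Lam' a h(1)])
    finally have "S (Lam (x \<otimes>\<^bsub>A\<^esub> a)) \<otimes>\<^bsub>A\<^esub> y
        = S (SR AG x (\<lambda>x' x''. SR AG a (\<lambda>u v. (x'' \<otimes>\<^bsub>A\<^esub> v) \<otimes>\<^bsub>A\<^esub> Lam' (x' \<otimes>\<^bsub>A\<^esub> u)))) \<otimes>\<^bsub>A\<^esub> y"
      by simp
    also have "\<dots> = SR AG x (\<lambda>x' x''. S (SR AG a (\<lambda>u v. (x'' \<otimes>\<^bsub>A\<^esub> v) \<otimes>\<^bsub>A\<^esub> Lam' (x' \<otimes>\<^bsub>A\<^esub> u))) \<otimes>\<^bsub>A\<^esub> y)"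
      by (rule SR_push[where h = "\<lambda>w. S w \<otimes>\<^bsub>A\<^esub> y", OF cgA h(1)]) (simp_all add: h a distr)
    also have "\<dots> = SR AG x (\<lambda>x' x''. ?F x' x'' y)"
    proof (rule SR_cong[OF h(1)])
      fix x' x'' assume h': "x' \<in> carrier A" "x'' \<in> carrier A"
      have "S (SR AG a (\<lambda>u v. (x'' \<otimes>\<^bsub>A\<^esub> v) \<otimes>\<^bsub>A\<^esub> Lam' (x' \<otimes>\<^bsub>A\<^esub> u))) \<otimes>\<^bsub>A\<^esub> y
          = SR AG a (\<lambda>u v. S ((x'' \<otimes>\<^bsub>A\<^esub> v) \<otimes>\<^bsub>A\<^esub> Lam' (x' \<otimes>\<^bsub>A\<^esub> u)) \<otimes>\<^bsub>A\<^esub> y)"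
        by (rule SR_push[where h = "\<lambda>w. S w \<otimes>\<^bsub>A\<^esub> y", OF cgA a]) (simp_all add: h h' distr)
      also have "\<dots> = ?F x' x'' y"
        by (rule SR_cong[OF a]) (simp add: h h' S_mult m_assoc)
      finally show "S (SR AG a (\<lambda>u v. (x'' \<otimes>\<^bsub>A\<^esub> v) \<otimes>\<^bsub>A\<^esub> Lam' (x' \<otimes>\<^bsub>A\<^esub> u))) \<otimes>\<^bsub>A\<^esub> y = ?F x' x'' y" .
    qed
    finally show "S (Lam (x \<otimes>\<^bsub>A\<^esub> a)) \<otimes>\<^bsub>A\<^esub> y = SR AG x (\<lambda>x' x''. ?F x' x'' y)" .
  qed
  also have "\<dots> = SR AG w (\<lambda>x' y'. SL AG y' (\<lambda>x'' y. ?F x' x'' y))"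
  proof (rule coassoc_SRL[OF cgA _ w])
    have 1: "balL AG (?F x')" if "x' \<in> carrier A" for x'
      by (rule balL_SR[OF cgA a], rule balLI) (simp_all add: that distr S_mult)
    have 2: "balR AG (\<lambda>x' x''. ?F x' x'' y)" if y: "y \<in> carrier A" for y
    proof (rule balRI)
      fix x b x'' assume h: "x \<in> carrier A" "b \<in> B" "x'' \<in> carrier A"
      have bb: "balR AG (\<lambda>u v. Lam (x \<otimes>\<^bsub>A\<^esub> u) \<otimes>\<^bsub>A\<^esub> (S v \<otimes>\<^bsub>A\<^esub> (S x'' \<otimes>\<^bsub>A\<^esub> y)))"
        by (rule balRI; simp add: h y distr S_mult; simp add: h y m_assoc[symmetric] Lam_C)
      have "?F (x \<otimes>\<^bsub>A\<^esub> S b) x'' y = SR AG a (\<lambda>u v. Lam (x \<otimes>\<^bsub>A\<^esub> (S b \<otimes>\<^bsub>A\<^esub> u)) \<otimes>\<^bsub>A\<^esub> (S v \<otimes>\<^bsub>A\<^esub> (S x'' \<otimes>\<^bsub>A\<^esub> y)))"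
        by (rule SR_cong[OF a]) (simp add: h y m_assoc)
      also have "\<dots> = SR AG a (\<lambda>u v. Lam (x \<otimes>\<^bsub>A\<^esub> u) \<otimes>\<^bsub>A\<^esub> (S (b \<otimes>\<^bsub>A\<^esub> v) \<otimes>\<^bsub>A\<^esub> (S x'' \<otimes>\<^bsub>A\<^esub> y)))"
        by (rule SR_takeuchi[OF cgA bb h(2) a])
      also have "\<dots> = ?F x (x'' \<otimes>\<^bsub>A\<^esub> b) y"
        by (rule SR_cong[OF a]) (simp add: h y S_mult m_assoc)
      finally show "?F (x \<otimes>\<^bsub>A\<^esub> S b) x'' y = ?F x (x'' \<otimes>\<^bsub>A\<^esub> b) y" .
    qed (auto simp: y a distr SR_mult[OF cgA a, symmetric, simplified] intro!: SR_cong)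
    show "b3RL AG (\<lambda>x' x'' y. ?F x' x'' y)" unfolding b3RL_def using 1 2 by blast
  qed
  also have "\<dots> = SR AG w (\<lambda>x' y'. SR AG a (\<lambda>u v. Lam (x' \<otimes>\<^bsub>A\<^esub> (qr y' \<otimes>\<^bsub>A\<^esub> u)) \<otimes>\<^bsub>A\<^esub> S v))"
  proof (rule SR_cong[OF w])
    fix x' y' assume h: "x' \<in> carrier A" "y' \<in> carrier A"
    have bb: "balR AG (\<lambda>u v. Lam (x' \<otimes>\<^bsub>A\<^esub> u) \<otimes>\<^bsub>A\<^esub> S v)" by (rule bal_Lam_S[OF h(1)])
    have "SL AG y' (\<lambda>x'' y. ?F x' x'' y)
        = SR AG a (\<lambda>u v. SL AG y' (\<lambda>x'' y. Lam (x' \<otimes>\<^bsub>A\<^esub> u) \<otimes>\<^bsub>A\<^esub> (S v \<otimes>\<^bsub>A\<^esub> (S x'' \<otimes>\<^bsub>A\<^esub> y))))"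
      by (rule SL_SR_swap[OF cgA h(2) a]) (simp add: h)
    also have "\<dots> = SR AG a (\<lambda>u v. Lam (x' \<otimes>\<^bsub>A\<^esub> u) \<otimes>\<^bsub>A\<^esub> S (qr' y' \<otimes>\<^bsub>A\<^esub> v))"
    proof (rule SR_cong[OF a])
      fix u v assume uv: "u \<in> carrier A" "v \<in> carrier A"
      have "SL AG y' (\<lambda>x'' y. Lam (x' \<otimes>\<^bsub>A\<^esub> u) \<otimes>\<^bsub>A\<^esub> (S v \<otimes>\<^bsub>A\<^esub> (S x'' \<otimes>\<^bsub>A\<^esub> y)))
          = Lam (x' \<otimes>\<^bsub>A\<^esub> u) \<otimes>\<^bsub>A\<^esub> (S v \<otimes>\<^bsub>A\<^esub> SL AG y' (\<lambda>x'' y. S x'' \<otimes>\<^bsub>A\<^esub> y))"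
        by (rule SL_push[where h = "\<lambda>w. Lam (x' \<otimes>\<^bsub>A\<^esub> u) \<otimes>\<^bsub>A\<^esub> (S v \<otimes>\<^bsub>A\<^esub> w)", OF cgA h(2), symmetric])
          (simp_all add: h uv distr)
      then show "SL AG y' (\<lambda>x'' y. Lam (x' \<otimes>\<^bsub>A\<^esub> u) \<otimes>\<^bsub>A\<^esub> (S v \<otimes>\<^bsub>A\<^esub> (S x'' \<otimes>\<^bsub>A\<^esub> y)))
          = Lam (x' \<otimes>\<^bsub>A\<^esub> u) \<otimes>\<^bsub>A\<^esub> S (qr' y' \<otimes>\<^bsub>A\<^esub> v)"
        by (simp add: antipode_SL h uv S_mult)
    qed
    \<comment> \<open>The contracted legs leave \<open>qr' y'\<close> next to \<open>v\<close>. The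
      Takeuchi condition returns it as \<open>qr y'\<close> next to \<open>x'\<close>, ready for the
      counit axiom.\<close>
    also have "\<dots> = SR AG a (\<lambda>u v. Lam (x' \<otimes>\<^bsub>A\<^esub> (qr y' \<otimes>\<^bsub>A\<^esub> u)) \<otimes>\<^bsub>A\<^esub> S v)"
      using SR_takeuchi[OF cgA bb _ a, of "qr' y'"] h by simp
    finally show "SL AG y' (\<lambda>x'' y. ?F x' x'' y) = \<dots>" .
  qed
  also have "\<dots> = SR AG a (\<lambda>u v. SR AG w (\<lambda>x' y'. Lam (x' \<otimes>\<^bsub>A\<^esub> (qr y' \<otimes>\<^bsub>A\<^esub> u)) \<otimes>\<^bsub>A\<^esub> S v))"
    by (rule SR_SR_swap[OF cgA w a]) simp
  also have "\<dots> = SR AG a (\<lambda>x z. Lam (w \<otimes>\<^bsub>A\<^esub> x) \<otimes>\<^bsub>A\<^esub> S z)"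
  proof (rule SR_cong[OF a])
    fix u v assume uv: "u \<in> carrier A" "v \<in> carrier A"
    have "Lam (SR AG w (\<lambda>x' y'. x' \<otimes>\<^bsub>A\<^esub> qr y') \<otimes>\<^bsub>A\<^esub> u) \<otimes>\<^bsub>A\<^esub> S v
        = SR AG w (\<lambda>x' y'. Lam (x' \<otimes>\<^bsub>A\<^esub> qr y' \<otimes>\<^bsub>A\<^esub> u) \<otimes>\<^bsub>A\<^esub> S v)"
      by (rule SR_push[where h = "\<lambda>w. Lam (w \<otimes>\<^bsub>A\<^esub> u) \<otimes>\<^bsub>A\<^esub> S v", OF cgA w]) (simp_all add: uv distr)
    also have "\<dots> = SR AG w (\<lambda>x' y'. Lam (x' \<otimes>\<^bsub>A\<^esub> (qr y' \<otimes>\<^bsub>A\<^esub> u)) \<otimes>\<^bsub>A\<^esub> S v)"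
      by (rule SR_cong[OF w]) (simp add: uv m_assoc)
    finally show "SR AG w (\<lambda>x' y'. Lam (x' \<otimes>\<^bsub>A\<^esub> (qr y' \<otimes>\<^bsub>A\<^esub> u)) \<otimes>\<^bsub>A\<^esub> S v) = Lam (w \<otimes>\<^bsub>A\<^esub> u) \<otimes>\<^bsub>A\<^esub> S v"
      by (simp add: counits w)
  qed
  finally show ?thesis .
qed

section \<open>The key identity and anti-multiplicativity of \<open>\<xi>\<close>\<close>

lemma xi_act: "b \<in> carrier A \<Longrightarrow> \<xi> b = act ell b"
  by (simp add: xi_eq act_eq)

text \<open>Expand \<open>\<xi> c\<close> as the sum of \<open>Lam (ell u) S v\<close>. The factor
  \<open>Lam (ell u)\<close> is absorbed because \<open>ell Lam (ell u) = ell u\<close>, and the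
  left coproduct of \<open>ell u\<close> splits into products of legs. The right antipode axiom
  contracts \<open>S v\<close> with the second leg of \<open>u\<close>, and the counit axiom
  rebuilds \<open>c\<close> behind the first leg of \<open>ell\<close>.\<close>

lemma ell_right_xi:
  assumes G: "comm_group G" and f: "balL G f" and c: "c \<in> carrier A"
  shows "SL G ell (\<lambda>x y. f (x \<otimes>\<^bsub>A\<^esub> c) y) = SL G ell (\<lambda>x y. f x (y \<otimes>\<^bsub>A\<^esub> \<xi> c))"
proof -
  note fc = balancedD(1)[OF f] and fa = balancedD(2)[OF f] balancedD(3)[OF f]
  let ?H = "\<lambda>u' u'' v. SL G ell (\<lambda>x y. f (x \<otimes>\<^bsub>A\<^esub> u') (y \<otimes>\<^bsub>A\<^esub> (u'' \<otimes>\<^bsub>A\<^esub> S v)))"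
  have bm: "balL G (\<lambda>x y. f (x \<otimes>\<^bsub>A\<^esub> u) (y \<otimes>\<^bsub>A\<^esub> v))" if "u \<in> carrier A" "v \<in> carrier A" for u v
    by (rule balL_mult[OF that f])
  have bm1: "balL G (\<lambda>x y. f x (y \<otimes>\<^bsub>A\<^esub> v))" if "v \<in> carrier A" for v
    by (rule balL_cong[OF bm[of "\<one>\<^bsub>A\<^esub>" v]]) (simp_all add: that)
  have "SL G ell (\<lambda>x y. f x (y \<otimes>\<^bsub>A\<^esub> \<xi> c))
      = SL G ell (\<lambda>x y. SR G c (\<lambda>u v. f x (y \<otimes>\<^bsub>A\<^esub> (Lam (ell \<otimes>\<^bsub>A\<^esub> u) \<otimes>\<^bsub>A\<^esub> S v))))"
  proof (rule SL_cong[OF ell_closed])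
    fix x y assume h: "x \<in> carrier A" "y \<in> carrier A"
    show "f x (y \<otimes>\<^bsub>A\<^esub> \<xi> c) = SR G c (\<lambda>u v. f x (y \<otimes>\<^bsub>A\<^esub> (Lam (ell \<otimes>\<^bsub>A\<^esub> u) \<otimes>\<^bsub>A\<^esub> S v)))"
      unfolding xi_eq[OF c]
      by (rule SR_push[where h = "\<lambda>w. f x (y \<otimes>\<^bsub>A\<^esub> w)", OF G c]) (simp_all add: h fc fa distr)
  qed
  also have "\<dots> = SR G c (\<lambda>u v. SL G ell (\<lambda>x y. f x (y \<otimes>\<^bsub>A\<^esub> (Lam (ell \<otimes>\<^bsub>A\<^esub> u) \<otimes>\<^bsub>A\<^esub> S v))))"
    by (rule SL_SR_swap[OF G ell_closed c]) (simp add: fc)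
  also have "\<dots> = SR G c (\<lambda>u v. SL G u (\<lambda>u' u''. ?H u' u'' v))"
  proof (rule SR_cong[OF c])
    fix u v assume h: "u \<in> carrier A" "v \<in> carrier A"
    have "SL G ell (\<lambda>x y. f x (y \<otimes>\<^bsub>A\<^esub> (Lam (ell \<otimes>\<^bsub>A\<^esub> u) \<otimes>\<^bsub>A\<^esub> S v)))
        = SL G ell (\<lambda>x y. f x ((y \<otimes>\<^bsub>A\<^esub> Lam (ell \<otimes>\<^bsub>A\<^esub> u)) \<otimes>\<^bsub>A\<^esub> S v))"
      by (rule SL_cong) (simp_all add: h m_assoc)
    \<comment> \<open>\<open>Lam (ell u)\<close> lies in \<open>C\<close>, and right multiplication
      by elements of \<open>C\<close> acts on the second leg of a left coproduct.\<close>
    also have "\<dots> = SL G (ell \<otimes>\<^bsub>A\<^esub> u) (\<lambda>x y. f x (y \<otimes>\<^bsub>A\<^esub> S v))"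
      using SL_C'[OF G bm1[of "S v"], of "Lam (ell \<otimes>\<^bsub>A\<^esub> u)" ell] h by (simp add: ell_Lam)
    also have "\<dots> = SL G u (\<lambda>u' u''. SL G ell (\<lambda>x y. f (x \<otimes>\<^bsub>A\<^esub> u') ((y \<otimes>\<^bsub>A\<^esub> u'') \<otimes>\<^bsub>A\<^esub> S v)))"
      by (rule SL_times[OF G bm1 ell_closed h(1)]) (simp add: h)
    also have "\<dots> = SL G u (\<lambda>u' u''. ?H u' u'' v)"
      by (intro SL_cong ell_closed h) (simp_all add: h m_assoc)
    finally show "SL G ell (\<lambda>x y. f x (y \<otimes>\<^bsub>A\<^esub> (Lam (ell \<otimes>\<^bsub>A\<^esub> u) \<otimes>\<^bsub>A\<^esub> S v))) = \<dots>" .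
  qed
  also have "\<dots> = SL G c (\<lambda>u' w. SR G w (\<lambda>u'' v. ?H u' u'' v))"
  proof (rule coassoc_SLR[OF G _ c])
    have 1: "balR G (?H u')" if "u' \<in> carrier A" for u'
      by (rule balR_SL[OF G ell_closed], rule balRI) (simp_all add: that fc fa distr S_mult)
    have 2: "balL G (\<lambda>u' u''. ?H u' u'' v)" if v: "v \<in> carrier A" for v
      by (rule balL_cong[OF bal_SL_mult[OF G bm1[of "S v"] ell_closed]])
        (auto simp: v m_assoc intro!: SL_cong)
    show "b3LR G (\<lambda>u' u'' v. ?H u' u'' v)" unfolding b3LR_def using 1 2 by blast
  qed
  also have "\<dots> = SL G c (\<lambda>u' w. SL G ell (\<lambda>x y. f (x \<otimes>\<^bsub>A\<^esub> (pr' w \<otimes>\<^bsub>A\<^esub> u')) y))"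
  proof (rule SL_cong[OF c])
    fix u' w assume h: "u' \<in> carrier A" "w \<in> carrier A"
    have "SR G w (\<lambda>u'' v. ?H u' u'' v)
        = SL G ell (\<lambda>x y. SR G w (\<lambda>u'' v. f (x \<otimes>\<^bsub>A\<^esub> u') (y \<otimes>\<^bsub>A\<^esub> (u'' \<otimes>\<^bsub>A\<^esub> S v))))"
      by (rule SL_SR_swap[OF G ell_closed h(2), symmetric]) (simp add: fc h)
    also have "\<dots> = SL G ell (\<lambda>x y. f (x \<otimes>\<^bsub>A\<^esub> u') (y \<otimes>\<^bsub>A\<^esub> S (pr' w)))"
    proof (rule SL_cong[OF ell_closed])
      fix x y assume xy: "x \<in> carrier A" "y \<in> carrier A"
      have "f (x \<otimes>\<^bsub>A\<^esub> u') (y \<otimes>\<^bsub>A\<^esub> SR AG w (\<lambda>u'' v. u'' \<otimes>\<^bsub>A\<^esub> S v))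
          = SR G w (\<lambda>u'' v. f (x \<otimes>\<^bsub>A\<^esub> u') (y \<otimes>\<^bsub>A\<^esub> (u'' \<otimes>\<^bsub>A\<^esub> S v)))"
        by (rule SR_push[where h = "\<lambda>w. f (x \<otimes>\<^bsub>A\<^esub> u') (y \<otimes>\<^bsub>A\<^esub> w)", OF G h(2)])
          (simp_all add: h xy fc fa distr)
      then show "SR G w (\<lambda>u'' v. f (x \<otimes>\<^bsub>A\<^esub> u') (y \<otimes>\<^bsub>A\<^esub> (u'' \<otimes>\<^bsub>A\<^esub> S v))) = f (x \<otimes>\<^bsub>A\<^esub> u') (y \<otimes>\<^bsub>A\<^esub> S (pr' w))"
        by (simp add: antipode_SR h)
    qed
    \<comment> \<open>The contraction is \<open>pr w = S (pr' w)\<close>; behind the second leg of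
      \<open>ell\<close> it equals \<open>pr' w\<close> behind the first leg.\<close>
    also have "\<dots> = SL G ell (\<lambda>x y. f ((x \<otimes>\<^bsub>A\<^esub> pr' w) \<otimes>\<^bsub>A\<^esub> u') y)"
      using SL_takeuchi[OF G balL_cong[OF bm[of u' "\<one>\<^bsub>A\<^esub>"], of "\<lambda>x y. f (x \<otimes>\<^bsub>A\<^esub> u') y"], of "pr' w" ell] h
      by simp
    also have "\<dots> = SL G ell (\<lambda>x y. f (x \<otimes>\<^bsub>A\<^esub> (pr' w \<otimes>\<^bsub>A\<^esub> u')) y)"
      by (rule SL_cong) (simp_all add: h m_assoc)
    finally show "SR G w (\<lambda>u'' v. ?H u' u'' v) = \<dots>" .
  qed
  also have "\<dots> = SL G ell (\<lambda>x y. SL G c (\<lambda>u' w. f (x \<otimes>\<^bsub>A\<^esub> (pr' w \<otimes>\<^bsub>A\<^esub> u')) y))"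
    by (rule SL_SL_swap[OF G c ell_closed]) (simp add: fc)
  also have "\<dots> = SL G ell (\<lambda>x y. f (x \<otimes>\<^bsub>A\<^esub> c) y)"
  proof (rule SL_cong[OF ell_closed])
    fix x y assume h: "x \<in> carrier A" "y \<in> carrier A"
    have "f (x \<otimes>\<^bsub>A\<^esub> SL AG c (\<lambda>u' w. pr' w \<otimes>\<^bsub>A\<^esub> u')) y = SL G c (\<lambda>u' w. f (x \<otimes>\<^bsub>A\<^esub> (pr' w \<otimes>\<^bsub>A\<^esub> u')) y)"
      by (rule SL_push[where h = "\<lambda>w. f (x \<otimes>\<^bsub>A\<^esub> w) y", OF G c]) (simp_all add: h fc fa distr)
    then show "SL G c (\<lambda>u' w. f (x \<otimes>\<^bsub>A\<^esub> (pr' w \<otimes>\<^bsub>A\<^esub> u')) y) = f (x \<otimes>\<^bsub>A\<^esub> c) y"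
      by (simp add: counits c)
  qed
  finally show ?thesis by (rule sym)
qed

text \<open>In \<open>\<xi> = act ell\<close> the argument stands behind the first leg of
  \<open>ell\<close>, so the key identity moves \<open>c\<close> to the far right as
  \<open>\<xi> c\<close>.\<close>

lemma xi_mult:
  assumes c: "c \<in> carrier A" and b: "b \<in> carrier A"
  shows "\<xi> (c \<otimes>\<^bsub>A\<^esub> b) = \<xi> b \<otimes>\<^bsub>A\<^esub> \<xi> c"
proof -
  have "\<xi> (c \<otimes>\<^bsub>A\<^esub> b) = SL AG ell (\<lambda>x y. S (Lam ((x \<otimes>\<^bsub>A\<^esub> c) \<otimes>\<^bsub>A\<^esub> b)) \<otimes>\<^bsub>A\<^esub> y)"
    unfolding xi_act[OF L.source.S.m_closed[OF c b]] act_def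
    by (rule SL_cong) (simp_all add: m_assoc b c)
  also have "\<dots> = SL AG ell (\<lambda>x y. S (Lam (x \<otimes>\<^bsub>A\<^esub> b)) \<otimes>\<^bsub>A\<^esub> (y \<otimes>\<^bsub>A\<^esub> \<xi> c))"
    by (rule ell_right_xi[OF cgA bal_act[OF b] c])
  also have "\<dots> = SL AG ell (\<lambda>x y. S (Lam (x \<otimes>\<^bsub>A\<^esub> b)) \<otimes>\<^bsub>A\<^esub> y \<otimes>\<^bsub>A\<^esub> \<xi> c)"
    by (rule SL_cong) (simp_all add: m_assoc b c)
  also have "\<dots> = \<xi> b \<otimes>\<^bsub>A\<^esub> \<xi> c"
    unfolding xi_act[OF b] act_def using b c by (intro SL_rmult[symmetric]) simp_all
  finally show ?thesis .
qed

section \<open>Special values and bijectivity of \<open>\<xi>\<close>, and the dual basis\<close>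

lemma xi_ell: "\<xi> ell = ell"
  by (simp add: xi_eq frobenius1)

lemma xi_one [simp]: "\<xi> \<one>\<^bsub>A\<^esub> = \<one>\<^bsub>A\<^esub>"
  using SR_one[OF cgA bal_Lam_S[OF ell_closed]] by (simp add: xi_eq)

lemma xi_C:
  assumes "c \<in> C"
  shows "\<xi> c = S c"
proof -
  have "\<xi> c = SL AG ell (\<lambda>x y. S c \<otimes>\<^bsub>A\<^esub> (S (Lam (x \<otimes>\<^bsub>A\<^esub> \<one>\<^bsub>A\<^esub>)) \<otimes>\<^bsub>A\<^esub> y))"
    unfolding xi_act[OF BC_closed(2)[OF assms]] act_def
    by (rule SL_cong) (simp_all add: assms Lam_C S_mult m_assoc)
  also have "\<dots> = S c \<otimes>\<^bsub>A\<^esub> \<xi> \<one>\<^bsub>A\<^esub>"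
    unfolding xi_act[OF L.source.S.one_closed] act_def by (rule SL_lmult[symmetric]) (simp_all add: assms)
  finally show ?thesis using assms by simp
qed

lemma xi_B:
  assumes "b \<in> B"
  shows "\<xi> b = Lam (ell \<otimes>\<^bsub>A\<^esub> b)"
proof -
  have bb: "balR AG (\<lambda>x z. Lam (ell \<otimes>\<^bsub>A\<^esub> (b \<otimes>\<^bsub>A\<^esub> x)) \<otimes>\<^bsub>A\<^esub> S z)"
    by (rule balR_cong[OF bal_Lam_S[of "ell \<otimes>\<^bsub>A\<^esub> b"]]) (simp_all add: assms m_assoc)
  have "\<xi> b = SR AG (b \<otimes>\<^bsub>A\<^esub> \<one>\<^bsub>A\<^esub>) (\<lambda>x z. Lam (ell \<otimes>\<^bsub>A\<^esub> x) \<otimes>\<^bsub>A\<^esub> S z)"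
    using assms by (simp add: xi_eq)
  also have "\<dots> = Lam (ell \<otimes>\<^bsub>A\<^esub> b)"
    using SR_B[OF cgA bal_Lam_S[OF ell_closed] assms L.source.S.one_closed] SR_one[OF cgA bb] assms
    by simp
  finally show ?thesis .
qed

text \<open>The proof of the key identity run with the roles of the two legs exchanged: an element
  \<open>e\<close> is built such that \<open>e\<close> behind the first leg of \<open>ell\<close>
  equals \<open>c\<close> behind the second. Evaluating this with the function that defines
  \<open>\<xi>\<close> gives \<open>\<xi> e = \<xi> 1 c\<close>.\<close>

lemma xi_surj:
  assumes c: "c \<in> carrier A"
  shows "\<exists>e\<in>carrier A. \<xi> e = c"
proof -
  define T where "T = inv_into (carrier A) S"
  have T [simp]: "a \<in> carrier A \<Longrightarrow> T a \<in> carrier A" "a \<in> carrier A \<Longrightarrow> S (T a) = a" for a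
    using S_bij unfolding T_def bij_betw_def by (auto intro: inv_into_into f_inv_into_f)
  have T_S [simp]: "T (S a) = a" if "a \<in> carrier A" for a
    by (rule S_inj) (use that in simp_all)
  have T_add [simp]: "T (a \<oplus>\<^bsub>A\<^esub> b) = T a \<oplus>\<^bsub>A\<^esub> T b" if "a \<in> carrier A" "b \<in> carrier A" for a b
    by (rule S_inj) (use that in simp_all)
  have T_mult: "T (a \<otimes>\<^bsub>A\<^esub> b) = T b \<otimes>\<^bsub>A\<^esub> T a" if "a \<in> carrier A" "b \<in> carrier A" for a b
    by (rule S_inj) (use that in \<open>simp_all add: S_mult\<close>)
  define rho where "rho a = Lam' (S (ell \<otimes>\<^bsub>A\<^esub> a))" for a
  have rho [simp]: "rho a \<in> B" "rho a \<in> carrier A" if "a \<in> carrier A" for a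
    using that by (simp_all add: rho_def)
  have rho_add [simp]: "rho (a \<oplus>\<^bsub>A\<^esub> b) = rho a \<oplus>\<^bsub>A\<^esub> rho b" if "a \<in> carrier A" "b \<in> carrier A" for a b
    using that by (simp add: rho_def distr)
  have rho_ell: "ell \<otimes>\<^bsub>A\<^esub> rho a = ell \<otimes>\<^bsub>A\<^esub> a" if "a \<in> carrier A" for a
    using that by (simp add: rho_def ell_Lam')
  \<comment> \<open>Modelled on \<open>\<xi> a\<close>, the sum of \<open>Lam (ell u) S v\<close>:
    the substitute for an element next to \<open>ell\<close> is now \<open>rho v\<close> in
    \<open>B\<close> instead of \<open>Lam (ell u)\<close> in \<open>C\<close>, the antipode is
    replaced by its inverse \<open>T\<close>, and the legs are exchanged.\<close>
  define e where "e = SR AG c (\<lambda>u v. rho v \<otimes>\<^bsub>A\<^esub> T u)"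
  have e: "e \<in> carrier A" by (simp add: e_def c)
  define f where "f x y = S (Lam x) \<otimes>\<^bsub>A\<^esub> y" for x y
  have f: "balL AG f" unfolding f_def by (rule balLI) (simp_all add: distr Lam_left S_mult)
  note fc = balancedD(1)[OF f, simplified] and fa = balancedD(2)[OF f, simplified] balancedD(3)[OF f, simplified]
  have bm: "balL AG (\<lambda>x y. f (x \<otimes>\<^bsub>A\<^esub> u) (y \<otimes>\<^bsub>A\<^esub> v))" if "u \<in> carrier A" "v \<in> carrier A" for u v
    by (rule balL_mult[OF that f])
  have bm1: "balL AG (\<lambda>x y. f (x \<otimes>\<^bsub>A\<^esub> u) y)" if "u \<in> carrier A" for u
    by (rule balL_cong[OF bm[of u "\<one>\<^bsub>A\<^esub>"]]) (simp_all add: that)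
  let ?F = "\<lambda>u v' v''. SL AG ell (\<lambda>x y. f (x \<otimes>\<^bsub>A\<^esub> (v' \<otimes>\<^bsub>A\<^esub> T u)) (y \<otimes>\<^bsub>A\<^esub> v''))"
  have "\<xi> e = SL AG ell (\<lambda>x y. f (x \<otimes>\<^bsub>A\<^esub> e) y)"
    by (simp add: xi_act e act_def f_def)
  also have "\<dots> = SL AG ell (\<lambda>x y. SR AG c (\<lambda>u v. f (x \<otimes>\<^bsub>A\<^esub> (rho v \<otimes>\<^bsub>A\<^esub> T u)) y))"
  proof (rule SL_cong[OF ell_closed])
    fix x y assume h: "x \<in> carrier A" "y \<in> carrier A"
    show "f (x \<otimes>\<^bsub>A\<^esub> e) y = SR AG c (\<lambda>u v. f (x \<otimes>\<^bsub>A\<^esub> (rho v \<otimes>\<^bsub>A\<^esub> T u)) y)"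
      unfolding e_def
      by (rule SR_push[where h = "\<lambda>w. f (x \<otimes>\<^bsub>A\<^esub> w) y", OF cgA c]) (simp_all add: h fc fa distr)
  qed
  also have "\<dots> = SR AG c (\<lambda>u v. SL AG ell (\<lambda>x y. f (x \<otimes>\<^bsub>A\<^esub> (rho v \<otimes>\<^bsub>A\<^esub> T u)) y))"
    by (rule SL_SR_swap[OF cgA ell_closed c]) (simp add: fc)
  also have "\<dots> = SR AG c (\<lambda>u v. SL AG v (\<lambda>v' v''. ?F u v' v''))"
  proof (rule SR_cong[OF c])
    fix u v assume h: "u \<in> carrier A" "v \<in> carrier A"
    have "SL AG ell (\<lambda>x y. f (x \<otimes>\<^bsub>A\<^esub> (rho v \<otimes>\<^bsub>A\<^esub> T u)) y)
        = SL AG ell (\<lambda>x y. f ((x \<otimes>\<^bsub>A\<^esub> rho v) \<otimes>\<^bsub>A\<^esub> T u) y)"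
      by (rule SL_cong) (simp_all add: h m_assoc)
    also have "\<dots> = SL AG (ell \<otimes>\<^bsub>A\<^esub> v) (\<lambda>x y. f (x \<otimes>\<^bsub>A\<^esub> T u) y)"
      using SL_B'[OF cgA bm1[of "T u"], of "rho v" ell] h by (simp add: rho_ell)
    also have "\<dots> = SL AG v (\<lambda>v' v''. SL AG ell (\<lambda>x y. f ((x \<otimes>\<^bsub>A\<^esub> v') \<otimes>\<^bsub>A\<^esub> T u) (y \<otimes>\<^bsub>A\<^esub> v'')))"
      by (rule SL_times[OF cgA bm1 ell_closed h(2)]) (simp add: h)
    also have "\<dots> = SL AG v (\<lambda>v' v''. ?F u v' v'')"
      by (intro SL_cong ell_closed h) (simp_all add: h m_assoc)
    finally show "SL AG ell (\<lambda>x y. f (x \<otimes>\<^bsub>A\<^esub> (rho v \<otimes>\<^bsub>A\<^esub> T u)) y) = \<dots>" .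
  qed
  also have "\<dots> = SL AG c (\<lambda>w v''. SR AG w (\<lambda>u v'. ?F u v' v''))"
  proof (rule coassoc_SRL[OF cgA _ c, symmetric])
    have 1: "balL AG (?F u)" if u: "u \<in> carrier A" for u
      by (rule balL_cong[OF bal_SL_mult[OF cgA bm1[of "T u"] ell_closed]])
        (auto simp: u m_assoc intro!: SL_cong)
    have 2: "balR AG (\<lambda>u v'. ?F u v' v'')" if v: "v'' \<in> carrier A" for v''
      by (rule balR_SL[OF cgA ell_closed], rule balRI) (simp_all add: v fc fa distr T_mult)
    show "b3RL AG (\<lambda>u v' v''. ?F u v' v'')" unfolding b3RL_def using 1 2 by blast
  qed
  also have "\<dots> = SL AG c (\<lambda>w v''. SL AG ell (\<lambda>x y. f x (y \<otimes>\<^bsub>A\<^esub> (pr w \<otimes>\<^bsub>A\<^esub> v''))))"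
  proof (rule SL_cong[OF c])
    fix w v'' assume h: "w \<in> carrier A" "v'' \<in> carrier A"
    \<comment> \<open>The right antipode axiom, pulled back along \<open>S\<close>.\<close>
    have Tp: "SR AG w (\<lambda>u v'. v' \<otimes>\<^bsub>A\<^esub> T u) = pr' w"
    proof (rule S_inj)
      have "S (SR AG w (\<lambda>u v'. v' \<otimes>\<^bsub>A\<^esub> T u)) = SR AG w (\<lambda>u v'. S (v' \<otimes>\<^bsub>A\<^esub> T u))"
        by (rule SR_S) (simp_all add: h)
      also have "\<dots> = SR AG w (\<lambda>u v'. u \<otimes>\<^bsub>A\<^esub> S v')"
        by (rule SR_cong) (simp_all add: h S_mult)
      finally show "S (SR AG w (\<lambda>u v'. v' \<otimes>\<^bsub>A\<^esub> T u)) = S (pr' w)" by (simp add: antipode_SR h)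
    qed (simp_all add: h)
    have "SR AG w (\<lambda>u v'. ?F u v' v'')
        = SL AG ell (\<lambda>x y. SR AG w (\<lambda>u v'. f (x \<otimes>\<^bsub>A\<^esub> (v' \<otimes>\<^bsub>A\<^esub> T u)) (y \<otimes>\<^bsub>A\<^esub> v'')))"
      by (rule SL_SR_swap[OF cgA ell_closed h(1), symmetric]) (simp add: fc h)
    also have "\<dots> = SL AG ell (\<lambda>x y. f (x \<otimes>\<^bsub>A\<^esub> pr' w) (y \<otimes>\<^bsub>A\<^esub> v''))"
    proof (rule SL_cong[OF ell_closed])
      fix x y assume xy: "x \<in> carrier A" "y \<in> carrier A"
      have "f (x \<otimes>\<^bsub>A\<^esub> SR AG w (\<lambda>u v'. v' \<otimes>\<^bsub>A\<^esub> T u)) (y \<otimes>\<^bsub>A\<^esub> v'')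
          = SR AG w (\<lambda>u v'. f (x \<otimes>\<^bsub>A\<^esub> (v' \<otimes>\<^bsub>A\<^esub> T u)) (y \<otimes>\<^bsub>A\<^esub> v''))"
        by (rule SR_push[where h = "\<lambda>w. f (x \<otimes>\<^bsub>A\<^esub> w) (y \<otimes>\<^bsub>A\<^esub> v'')", OF cgA h(1)])
          (simp_all add: h xy fc fa distr)
      then show "SR AG w (\<lambda>u v'. f (x \<otimes>\<^bsub>A\<^esub> (v' \<otimes>\<^bsub>A\<^esub> T u)) (y \<otimes>\<^bsub>A\<^esub> v'')) = f (x \<otimes>\<^bsub>A\<^esub> pr' w) (y \<otimes>\<^bsub>A\<^esub> v'')"
        by (simp add: Tp)
    qed
    also have "\<dots> = SL AG ell (\<lambda>x y. f x ((y \<otimes>\<^bsub>A\<^esub> pr w) \<otimes>\<^bsub>A\<^esub> v''))"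
      using SL_takeuchi[OF cgA balL_cong[OF bm[of "\<one>\<^bsub>A\<^esub>" v''], of "\<lambda>x y. f x (y \<otimes>\<^bsub>A\<^esub> v'')"], of "pr' w" ell] h
      by simp
    also have "\<dots> = SL AG ell (\<lambda>x y. f x (y \<otimes>\<^bsub>A\<^esub> (pr w \<otimes>\<^bsub>A\<^esub> v'')))"
      by (rule SL_cong) (simp_all add: h m_assoc)
    finally show "SR AG w (\<lambda>u v'. ?F u v' v'') = \<dots>" .
  qed
  also have "\<dots> = SL AG ell (\<lambda>x y. SL AG c (\<lambda>w v''. f x (y \<otimes>\<^bsub>A\<^esub> (pr w \<otimes>\<^bsub>A\<^esub> v''))))"
    by (rule SL_SL_swap[OF cgA c ell_closed]) (simp add: fc)
  also have "\<dots> = SL AG ell (\<lambda>x y. f x (y \<otimes>\<^bsub>A\<^esub> c))"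
  proof (rule SL_cong[OF ell_closed])
    fix x y assume h: "x \<in> carrier A" "y \<in> carrier A"
    have "f x (y \<otimes>\<^bsub>A\<^esub> SL AG c (\<lambda>w v''. pr w \<otimes>\<^bsub>A\<^esub> v'')) = SL AG c (\<lambda>w v''. f x (y \<otimes>\<^bsub>A\<^esub> (pr w \<otimes>\<^bsub>A\<^esub> v'')))"
      by (rule SL_push[where h = "\<lambda>w. f x (y \<otimes>\<^bsub>A\<^esub> w)", OF cgA c]) (simp_all add: h fc fa distr)
    then show "SL AG c (\<lambda>w v''. f x (y \<otimes>\<^bsub>A\<^esub> (pr w \<otimes>\<^bsub>A\<^esub> v''))) = f x (y \<otimes>\<^bsub>A\<^esub> c)"
      by (simp add: counits c)
  qed
  also have "\<dots> = \<xi> \<one>\<^bsub>A\<^esub> \<otimes>\<^bsub>A\<^esub> c"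
    unfolding xi_act[OF L.source.S.one_closed] act_def
    by (subst SL_rmult) (auto simp: f_def c m_assoc intro!: SL_cong)
  finally have "\<xi> e = c" by (simp add: c)
  with e show ?thesis by blast
qed

text \<open>\<open>Lam' (S y)\<close> lies in \<open>B\<close>; \<open>pr'\<close> moves it to
  \<open>C\<close> by the inverse of the restriction of \<open>S\<close> to \<open>C\<close>, as
  recorded in \<open>S_sigma\<close>. This makes the value a left coefficient for first
  legs.\<close>

definition sigma :: "'a \<Rightarrow> 'a" where
  "sigma y = pr' (Lam' (S y))"

lemma sigma_C [simp]: "y \<in> carrier A \<Longrightarrow> sigma y \<in> C" "y \<in> carrier A \<Longrightarrow> sigma y \<in> carrier A"
  and S_sigma: "y \<in> carrier A \<Longrightarrow> S (sigma y) = Lam' (S y)"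
  and sigma_add [simp]: "\<lbrakk>y \<in> carrier A; z \<in> carrier A\<rbrakk> \<Longrightarrow> sigma (y \<oplus>\<^bsub>A\<^esub> z) = sigma y \<oplus>\<^bsub>A\<^esub> sigma z"
  by (simp_all add: sigma_def pr_BC)

lemma sigma_SC:
  assumes "c \<in> C" "y \<in> carrier A"
  shows "sigma (S c \<otimes>\<^bsub>A\<^esub> y) = sigma y \<otimes>\<^bsub>A\<^esub> c"
proof -
  have "Lam' (S (S c \<otimes>\<^bsub>A\<^esub> y)) = S c \<otimes>\<^bsub>A\<^esub> Lam' (S y)"
    using assms by (simp add: S_mult Lam'_SB)
  then show ?thesis using assms by (simp add: sigma_def pr'_B)
qed

lemma bal_sigma: "balL AG (\<lambda>x y. sigma y \<otimes>\<^bsub>A\<^esub> x)"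
  by (rule balLI) (simp_all add: distr sigma_SC)

text \<open>\<open>lam_S_invariant\<close> expands \<open>sigma\<close> over a right coproduct.
  After mixed coassociativity the left coproduct inside is a counit expansion, and
  \<open>frobenius2\<close> at the unit remains.\<close>

lemma SL_sigma: "SL AG ell (\<lambda>x y. sigma y \<otimes>\<^bsub>A\<^esub> x) = \<one>\<^bsub>A\<^esub>"
proof -
  let ?F = "\<lambda>x u v. pr' (u \<otimes>\<^bsub>A\<^esub> Lam (S v)) \<otimes>\<^bsub>A\<^esub> x"
  have bp: "balL AG (\<lambda>x y. pr' y \<otimes>\<^bsub>A\<^esub> x)"
    by (rule balLI) (simp_all add: distr pr'_B)
  have "SL AG ell (\<lambda>x y. sigma y \<otimes>\<^bsub>A\<^esub> x) = SL AG ell (\<lambda>x y. SR AG y (?F x))"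
  proof (rule SL_cong[OF ell_closed])
    fix x y assume h: "x \<in> carrier A" "y \<in> carrier A"
    show "sigma y \<otimes>\<^bsub>A\<^esub> x = SR AG y (?F x)"
      unfolding sigma_def lam_S_invariant[OF h(2), symmetric]
      by (rule SR_push[where h = "\<lambda>w. pr' w \<otimes>\<^bsub>A\<^esub> x", OF cgA h(2)]) (simp_all add: h distr)
  qed
  also have "\<dots> = SR AG ell (\<lambda>w v. SL AG w (\<lambda>x u. ?F x u v))"
  proof (rule coassoc_SLR[OF cgA _ ell_closed, symmetric])
    have 1: "balR AG (?F x)" if "x \<in> carrier A" for x
      by (rule balRI) (simp_all add: that distr S_mult Lam_left)
    have 2: "balL AG (\<lambda>x u. ?F x u v)" if "v \<in> carrier A" for v
      by (rule balLI) (simp_all add: that distr pr'_B)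
    show "b3LR AG (\<lambda>x u v. ?F x u v)" unfolding b3LR_def using 1 2 by blast
  qed
  also have "\<dots> = SR AG ell (\<lambda>w v. w \<otimes>\<^bsub>A\<^esub> Lam (S v \<otimes>\<^bsub>A\<^esub> \<one>\<^bsub>A\<^esub>))"
  proof (rule SR_cong[OF ell_closed])
    fix w v assume h: "w \<in> carrier A" "v \<in> carrier A"
    show "SL AG w (\<lambda>x u. ?F x u v) = w \<otimes>\<^bsub>A\<^esub> Lam (S v \<otimes>\<^bsub>A\<^esub> \<one>\<^bsub>A\<^esub>)"
      using SL_C'[OF cgA bp, of "Lam (S v)" w] h by (simp add: counits)
  qed
  also have "\<dots> = \<one>\<^bsub>A\<^esub>" by (rule frobenius2) simp
  finally show ?thesis .
qed

text \<open>The key identity moves \<open>c\<close> out of \<open>sigma\<close> to the right, where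
  \<open>SL_sigma\<close> leaves it alone. So \<open>c\<close> is determined by
  \<open>\<xi> c\<close>, which is the injectivity of \<open>\<xi>\<close>.\<close>

lemma xi_recover:
  assumes c: "c \<in> carrier A"
  shows "SL AG ell (\<lambda>x y. sigma (y \<otimes>\<^bsub>A\<^esub> \<xi> c) \<otimes>\<^bsub>A\<^esub> x) = c"
proof -
  have "SL AG ell (\<lambda>x y. sigma (y \<otimes>\<^bsub>A\<^esub> \<xi> c) \<otimes>\<^bsub>A\<^esub> x) = SL AG ell (\<lambda>x y. sigma y \<otimes>\<^bsub>A\<^esub> (x \<otimes>\<^bsub>A\<^esub> c))"
    by (rule ell_right_xi[OF cgA bal_sigma c, symmetric])
  also have "\<dots> = SL AG ell (\<lambda>x y. sigma y \<otimes>\<^bsub>A\<^esub> x \<otimes>\<^bsub>A\<^esub> c)"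
    by (rule SL_cong) (simp_all add: c m_assoc)
  also have "\<dots> = c"
    by (subst SL_rmult[symmetric]) (simp_all add: c SL_sigma)
  finally show ?thesis .
qed

lemma xi_bij: "bij_betw \<xi> (carrier A) (carrier A)"
proof (rule bij_betw_imageI)
  show "inj_on \<xi> (carrier A)"
  proof (rule inj_onI)
    fix a b assume h: "a \<in> carrier A" "b \<in> carrier A" "\<xi> a = \<xi> b"
    have "a = SL AG ell (\<lambda>x y. sigma (y \<otimes>\<^bsub>A\<^esub> \<xi> a) \<otimes>\<^bsub>A\<^esub> x)" by (rule xi_recover[OF h(1), symmetric])
    also have "\<dots> = b" unfolding h(3) by (rule xi_recover[OF h(2)])
    finally show "a = b" .
  qed
  show "\<xi> ` carrier A = carrier A"
  proof (intro equalityI subsetI)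
    fix c assume "c \<in> carrier A"
    from xi_surj[OF this] obtain e where "e \<in> carrier A" "\<xi> e = c" by blast
    then show "c \<in> \<xi> ` carrier A" by (intro image_eqI[of c \<xi> e]) simp_all
  qed (elim imageE, simp)
qed

text \<open>Apply \<open>Lam\<close> to \<open>xi_recover\<close>: linearity turns its coefficients
  into factors inside \<open>sigma\<close>, and the sum inside closes to
  \<open>\<xi> 1\<close>.\<close>

lemma sigma_xi:
  assumes "a \<in> carrier A"
  shows "sigma (\<xi> a) = Lam a"
proof -
  have "Lam a = Lam (SL AG ell (\<lambda>x y. sigma (y \<otimes>\<^bsub>A\<^esub> \<xi> a) \<otimes>\<^bsub>A\<^esub> x))"
    by (simp add: xi_recover assms)
  also have "\<dots> = SL AG ell (\<lambda>x y. Lam (sigma (y \<otimes>\<^bsub>A\<^esub> \<xi> a) \<otimes>\<^bsub>A\<^esub> x))"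
    by (rule SL_push[OF cgA ell_closed]) (simp_all add: assms)
  also have "\<dots> = SL AG ell (\<lambda>x y. sigma (S (Lam (x \<otimes>\<^bsub>A\<^esub> \<one>\<^bsub>A\<^esub>)) \<otimes>\<^bsub>A\<^esub> y \<otimes>\<^bsub>A\<^esub> \<xi> a))"
    by (rule SL_cong) (simp_all add: assms m_assoc sigma_SC Lam_left)
  also have "\<dots> = sigma (SL AG ell (\<lambda>x y. S (Lam (x \<otimes>\<^bsub>A\<^esub> \<one>\<^bsub>A\<^esub>)) \<otimes>\<^bsub>A\<^esub> y) \<otimes>\<^bsub>A\<^esub> \<xi> a)"
    by (rule SL_push[where h = "\<lambda>w. sigma (w \<otimes>\<^bsub>A\<^esub> \<xi> a)", OF cgA ell_closed, symmetric])
      (simp_all add: assms distr)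
  also have "\<dots> = sigma (\<xi> \<one>\<^bsub>A\<^esub> \<otimes>\<^bsub>A\<^esub> \<xi> a)"
    by (simp only: xi_act[OF L.source.S.one_closed] act_def)
  finally show ?thesis using assms by simp
qed

text \<open>For \<open>y = \<xi> z\<close> the coefficient \<open>sigma (y \<xi> a)\<close> of
  \<open>xi_recover\<close> is \<open>sigma (\<xi> (a z)) = Lam (a z)\<close>, a value of a
  functional of \<open>a\<close>.\<close>

lemma dual_basis:
  assumes "a \<in> carrier A"
  shows "SL AG ell (\<lambda>x y. Lam (a \<otimes>\<^bsub>A\<^esub> inv_into (carrier A) \<xi> y) \<otimes>\<^bsub>A\<^esub> x) = a"
proof -
  have "SL AG ell (\<lambda>x y. Lam (a \<otimes>\<^bsub>A\<^esub> inv_into (carrier A) \<xi> y) \<otimes>\<^bsub>A\<^esub> x)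
      = SL AG ell (\<lambda>x y. sigma (y \<otimes>\<^bsub>A\<^esub> \<xi> a) \<otimes>\<^bsub>A\<^esub> x)"
  proof (rule SL_cong[OF ell_closed])
    fix x y assume h: "x \<in> carrier A" "y \<in> carrier A"
    let ?z = "inv_into (carrier A) \<xi> y"
    have z: "?z \<in> carrier A" "\<xi> ?z = y"
      using h(2) bij_betw_imp_surj_on[OF xi_bij] inv_into_into[of y \<xi> "carrier A"]
        f_inv_into_f[of y \<xi> "carrier A"] by simp_all
    have "Lam (a \<otimes>\<^bsub>A\<^esub> ?z) = sigma (y \<otimes>\<^bsub>A\<^esub> \<xi> a)"
      using sigma_xi[of "a \<otimes>\<^bsub>A\<^esub> ?z"] z assms by (simp add: xi_mult)
    then show "Lam (a \<otimes>\<^bsub>A\<^esub> ?z) \<otimes>\<^bsub>A\<^esub> x = sigma (y \<otimes>\<^bsub>A\<^esub> \<xi> a) \<otimes>\<^bsub>A\<^esub> x" by simp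
  qed
  then show ?thesis by (simp add: xi_recover assms)
qed

section \<open>The form under \<open>\<xi>\<close>, and compatibility of \<open>\<xi>\<close> with
  the action\<close>

lemma Lam_xi:
  assumes "a \<in> carrier A"
  shows "Lam (\<xi> a) = Lam (ell \<otimes>\<^bsub>A\<^esub> Lam' (S a))"
proof -
  have "Lam (\<xi> a) = SR AG a (\<lambda>u v. Lam (Lam (ell \<otimes>\<^bsub>A\<^esub> u) \<otimes>\<^bsub>A\<^esub> S v))"
    unfolding xi_eq[OF assms] by (rule SR_push[OF cgA assms]) simp_all
  also have "\<dots> = SR AG a (\<lambda>u v. Lam (ell \<otimes>\<^bsub>A\<^esub> (u \<otimes>\<^bsub>A\<^esub> Lam (S v))))"
    by (rule SR_cong[OF assms]) (simp_all add: Lam_left m_assoc[symmetric] Lam_C)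
  also have "\<dots> = Lam (ell \<otimes>\<^bsub>A\<^esub> SR AG a (\<lambda>u v. u \<otimes>\<^bsub>A\<^esub> Lam (S v)))"
    by (rule SR_push[where h = "\<lambda>w. Lam (ell \<otimes>\<^bsub>A\<^esub> w)", OF cgA assms, symmetric]) (simp_all add: distr)
  finally show ?thesis by (simp add: lam_S_invariant assms)
qed

text \<open>Describes the form after applying \<open>\<xi>\<close> twice. In the dual, this is the
  equality of base elements that remains when the left antipode axiom is reduced to the right
  one.\<close>

lemma Lam_xi_xi:
  assumes "a \<in> carrier A"
  shows "Lam (\<xi> (\<xi> a)) = Lam (ell \<otimes>\<^bsub>A\<^esub> S (Lam a))"
  using S_sigma[of "\<xi> a"] by (simp add: Lam_xi sigma_xi assms)

lemma act_C: "\<lbrakk>w \<in> carrier A; d \<in> C; c \<in> carrier A\<rbrakk> \<Longrightarrow> act (w \<otimes>\<^bsub>A\<^esub> d) c = act w c \<otimes>\<^bsub>A\<^esub> d"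
proof -
  assume h: "w \<in> carrier A" "d \<in> C" "c \<in> carrier A"
  have "act (w \<otimes>\<^bsub>A\<^esub> d) c = SL AG w (\<lambda>x y. S (Lam (x \<otimes>\<^bsub>A\<^esub> c)) \<otimes>\<^bsub>A\<^esub> (y \<otimes>\<^bsub>A\<^esub> d))"
    unfolding act_def by (rule SL_C'[OF cgA bal_act h(2,1)]) (rule h)
  also have "\<dots> = SL AG w (\<lambda>x y. S (Lam (x \<otimes>\<^bsub>A\<^esub> c)) \<otimes>\<^bsub>A\<^esub> y \<otimes>\<^bsub>A\<^esub> d)"
    by (rule SL_cong) (simp_all add: h m_assoc)
  also have "\<dots> = act w c \<otimes>\<^bsub>A\<^esub> d"
    unfolding act_def by (rule SL_rmult[symmetric]) (simp_all add: h)
  finally show ?thesis .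
qed

text \<open>The functional is evaluated on the first leg of the left coproduct, so by mixed
  coassociativity the action affects only the first leg of the right coproduct.\<close>

lemma SR_act:
  assumes G: "comm_group G" and f: "balR G f" and w: "w \<in> carrier A" and c: "c \<in> carrier A"
  shows "SR G (act w c) f = SR G w (\<lambda>u v. f (act u c) v)"
proof -
  note fc = balancedD(1)[OF f] and fa = balancedD(2)[OF f] balancedD(3)[OF f]
  let ?F = "\<lambda>x u v. f (S (Lam (x \<otimes>\<^bsub>A\<^esub> c)) \<otimes>\<^bsub>A\<^esub> u) v"
  have "SR G (act w c) f = SL G w (\<lambda>x y. SR G (S (Lam (x \<otimes>\<^bsub>A\<^esub> c)) \<otimes>\<^bsub>A\<^esub> y) f)"
    unfolding act_def by (rule SR_of_SL[OF G f w]) (simp add: c)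
  also have "\<dots> = SL G w (\<lambda>x y. SR G y (?F x))"
    by (intro SL_cong SR_B G f w) (simp_all add: c)
  also have "\<dots> = SR G w (\<lambda>w' v. SL G w' (\<lambda>x u. ?F x u v))"
  proof (rule coassoc_SLR[OF G _ w, symmetric])
    have 1: "balR G (?F x)" if "x \<in> carrier A" for x
      by (rule balR_cong[OF balR_mult[of "S (Lam (x \<otimes>\<^bsub>A\<^esub> c))" "\<one>\<^bsub>A\<^esub>" G f]]) (simp_all add: f that c)
    have 2: "balL G (\<lambda>x u. ?F x u v)" if "v \<in> carrier A" for v
      by (rule balLI) (simp_all add: that c fc fa distr S_mult Lam_left)
    show "b3LR G (\<lambda>x u v. ?F x u v)" unfolding b3LR_def using 1 2 by blast
  qed
  also have "\<dots> = SR G w (\<lambda>u v. f (act u c) v)"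
  proof (rule SR_cong[OF w])
    fix u v assume h: "u \<in> carrier A" "v \<in> carrier A"
    show "SL G u (\<lambda>x u. ?F x u v) = f (act u c) v"
      unfolding act_def
      by (rule SL_push[where h = "\<lambda>w. f w v", OF G h(1), symmetric]) (simp_all add: h c fc fa)
  qed
  finally show ?thesis .
qed

text \<open>The action applied to the expansion \<open>frobenius2\<close> of \<open>w\<close>: with
  \<open>SR_act\<close> and linearity over \<open>C\<close> it passes under the sum.\<close>

lemma SR_xi_act:
  assumes w: "w \<in> carrier A" and c: "c \<in> carrier A"
  shows "SR AG (\<xi> c) (\<lambda>u v. u \<otimes>\<^bsub>A\<^esub> Lam (S v \<otimes>\<^bsub>A\<^esub> w)) = act w c"
proof -
  have "SR AG (\<xi> c) (\<lambda>u v. u \<otimes>\<^bsub>A\<^esub> Lam (S v \<otimes>\<^bsub>A\<^esub> w)) = SR AG ell (\<lambda>u v. act u c \<otimes>\<^bsub>A\<^esub> Lam (S v \<otimes>\<^bsub>A\<^esub> w))"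
    unfolding xi_act[OF c] by (rule SR_act[OF cgA bal_SR_arg(1)[OF w] ell_closed c])
  also have "\<dots> = SR AG ell (\<lambda>u v. act (u \<otimes>\<^bsub>A\<^esub> Lam (S v \<otimes>\<^bsub>A\<^esub> w)) c)"
    by (rule SR_cong) (simp_all add: act_C c w)
  also have "\<dots> = act (SR AG ell (\<lambda>u v. u \<otimes>\<^bsub>A\<^esub> Lam (S v \<otimes>\<^bsub>A\<^esub> w))) c"
    by (rule SR_push[where h = "\<lambda>w. act w c", OF cgA ell_closed, symmetric]) (simp_all add: c w act_add)
  finally show ?thesis by (simp add: frobenius2 w)
qed

text \<open>Insert \<open>SR_xi_act\<close> for the action; linearity of the form on both sides over
  \<open>C\<close> then exhibits the expansion of \<open>\<xi>\<close> at the point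
  \<open>\<xi> c\<close>.\<close>

lemma Lam_ell_act:
  assumes w: "w \<in> carrier A" and c: "c \<in> carrier A"
  shows "Lam (ell \<otimes>\<^bsub>A\<^esub> act w c) = Lam (\<xi> (\<xi> c) \<otimes>\<^bsub>A\<^esub> w)"
proof -
  have x: "\<xi> c \<in> carrier A" using c by simp
  have "Lam (ell \<otimes>\<^bsub>A\<^esub> act w c) = SR AG (\<xi> c) (\<lambda>u v. Lam (ell \<otimes>\<^bsub>A\<^esub> (u \<otimes>\<^bsub>A\<^esub> Lam (S v \<otimes>\<^bsub>A\<^esub> w))))"
    unfolding SR_xi_act[OF assms, symmetric]
    by (rule SR_push[where h = "\<lambda>w. Lam (ell \<otimes>\<^bsub>A\<^esub> w)", OF cgA x]) (simp_all add: w distr)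
  also have "\<dots> = SR AG (\<xi> c) (\<lambda>u v. Lam (Lam (ell \<otimes>\<^bsub>A\<^esub> u) \<otimes>\<^bsub>A\<^esub> S v \<otimes>\<^bsub>A\<^esub> w))"
  proof (rule SR_cong[OF x])
    fix u v assume h: "u \<in> carrier A" "v \<in> carrier A"
    have "Lam (ell \<otimes>\<^bsub>A\<^esub> (u \<otimes>\<^bsub>A\<^esub> Lam (S v \<otimes>\<^bsub>A\<^esub> w))) = Lam (ell \<otimes>\<^bsub>A\<^esub> u) \<otimes>\<^bsub>A\<^esub> Lam (S v \<otimes>\<^bsub>A\<^esub> w)"
      using h w by (simp add: m_assoc[symmetric] Lam_C)
    then show "Lam (ell \<otimes>\<^bsub>A\<^esub> (u \<otimes>\<^bsub>A\<^esub> Lam (S v \<otimes>\<^bsub>A\<^esub> w))) = Lam (Lam (ell \<otimes>\<^bsub>A\<^esub> u) \<otimes>\<^bsub>A\<^esub> S v \<otimes>\<^bsub>A\<^esub> w)"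
      using h w by (simp add: m_assoc Lam_left)
  qed
  also have "\<dots> = Lam (\<xi> (\<xi> c) \<otimes>\<^bsub>A\<^esub> w)"
    unfolding xi_eq[OF x]
    by (rule SR_push[where h = "\<lambda>z. Lam (z \<otimes>\<^bsub>A\<^esub> w)", OF cgA x, symmetric]) (simp_all add: w distr)
  finally show ?thesis .
qed

text \<open>Anti-multiplicativity of the antipode of the dual, in coordinates. Both sides are sums
  over the right coproduct of \<open>x\<close>, and \<open>Lam_ell_act\<close> matches the
  terms.\<close>

lemma xi_act_flip:
  assumes x: "x \<in> carrier A" and c: "c \<in> carrier A"
  shows "\<xi> (act x c) = act (\<xi> (\<xi> c)) x"
proof -
  have "\<xi> (act x c) = SR AG (act x c) (\<lambda>u v. Lam (ell \<otimes>\<^bsub>A\<^esub> u) \<otimes>\<^bsub>A\<^esub> S v)"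
    by (rule xi_eq) (simp add: x c)
  also have "\<dots> = SR AG x (\<lambda>u v. Lam (ell \<otimes>\<^bsub>A\<^esub> act u c) \<otimes>\<^bsub>A\<^esub> S v)"
    by (rule SR_act[OF cgA bal_Lam_S[OF ell_closed] x c])
  also have "\<dots> = SR AG x (\<lambda>u v. Lam (\<xi> (\<xi> c) \<otimes>\<^bsub>A\<^esub> u) \<otimes>\<^bsub>A\<^esub> S v)"
    by (rule SR_cong) (simp_all add: x c Lam_ell_act)
  also have "\<dots> = act (\<xi> (\<xi> c)) x"
    by (rule act_eq[symmetric]) (simp_all add: x c)
  finally show ?thesis .
qed

end

section \<open>Twisting a right bialgebroid by an anti-automorphism\<close>

lemma ring_opposite:
  assumes "ring R" shows "ring (opposite_ring R)"
proof -
  interpret R: ring R by fact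
  have "abelian_group (opposite_ring R)"
  proof (rule abelian_groupI)
    show "\<exists>y\<in>carrier (opposite_ring R). y \<oplus>\<^bsub>opposite_ring R\<^esub> x = \<zero>\<^bsub>opposite_ring R\<^esub>"
      if "x \<in> carrier (opposite_ring R)" for x
      using that R.l_neg[of x] by (auto simp: opposite_ring_def intro!: bexI[of _ "\<ominus>\<^bsub>R\<^esub> x"])
  qed (auto simp: opposite_ring_def R.a_ac)
  moreover have "monoid (opposite_ring R)"
    by unfold_locales (auto simp: opposite_ring_def R.m_assoc)
  ultimately show ?thesis
    by (rule ringI) (auto simp: opposite_ring_def R.l_distr R.r_distr)
qed

lemma bimodule_left:
  assumes "ring B" "ring A" "s \<in> ring_hom B A" "t \<in> ring_hom (opposite_ring B) A"
    and "\<And>l m. \<lbrakk>l \<in> carrier B; m \<in> carrier B\<rbrakk> \<Longrightarrow> s l \<otimes>\<^bsub>A\<^esub> t m = t m \<otimes>\<^bsub>A\<^esub> s l"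
  shows "bimodule B A (mult_left A s) (\<lambda>a b. mult_left A t b a)"
proof -
  interpret B: ring B by fact
  interpret A: ring A by fact
  have s [simp]: "s l \<in> carrier A" "s (l \<oplus>\<^bsub>B\<^esub> m) = s l \<oplus>\<^bsub>A\<^esub> s m" "s (l \<otimes>\<^bsub>B\<^esub> m) = s l \<otimes>\<^bsub>A\<^esub> s m"
    "s \<one>\<^bsub>B\<^esub> = \<one>\<^bsub>A\<^esub>" if "l \<in> carrier B" "m \<in> carrier B" for l m
    using assms(3) that by (auto simp: ring_hom_def)
  have t [simp]: "t l \<in> carrier A" "t (l \<oplus>\<^bsub>B\<^esub> m) = t l \<oplus>\<^bsub>A\<^esub> t m" "t (l \<otimes>\<^bsub>B\<^esub> m) = t m \<otimes>\<^bsub>A\<^esub> t l"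
    "t \<one>\<^bsub>B\<^esub> = \<one>\<^bsub>A\<^esub>" if "l \<in> carrier B" "m \<in> carrier B" for l m
    using assms(4) that by (auto simp: ring_hom_def opposite_ring_def)
  note c = s(1)[OF _ B.one_closed] t(1)[OF _ B.one_closed] s(4)[OF B.one_closed B.one_closed]
    t(4)[OF B.one_closed B.one_closed]
  have st: "t m \<otimes>\<^bsub>A\<^esub> (s l \<otimes>\<^bsub>A\<^esub> x) = s l \<otimes>\<^bsub>A\<^esub> (t m \<otimes>\<^bsub>A\<^esub> x)"
    if "l \<in> carrier B" "m \<in> carrier B" "x \<in> carrier A" for l m x
    using assms(5)[OF that(1,2)] that c by (simp add: A.m_assoc[symmetric])
  show ?thesis
    by unfold_locales (simp_all add: mult_left_def c st A.l_distr A.r_distr A.m_assoc)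
qed

lemma bimodule_right:
  assumes "ring B" "ring A" "s \<in> ring_hom B A" "t \<in> ring_hom (opposite_ring B) A"
    and "\<And>l m. \<lbrakk>l \<in> carrier B; m \<in> carrier B\<rbrakk> \<Longrightarrow> s l \<otimes>\<^bsub>A\<^esub> t m = t m \<otimes>\<^bsub>A\<^esub> s l"
  shows "bimodule B A (\<lambda>b a. mult_right A t a b) (mult_right A s)"
proof -
  interpret B: ring B by fact
  interpret A: ring A by fact
  have s [simp]: "s l \<in> carrier A" "s (l \<oplus>\<^bsub>B\<^esub> m) = s l \<oplus>\<^bsub>A\<^esub> s m" "s (l \<otimes>\<^bsub>B\<^esub> m) = s l \<otimes>\<^bsub>A\<^esub> s m"
    "s \<one>\<^bsub>B\<^esub> = \<one>\<^bsub>A\<^esub>" if "l \<in> carrier B" "m \<in> carrier B" for l m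
    using assms(3) that by (auto simp: ring_hom_def)
  have t [simp]: "t l \<in> carrier A" "t (l \<oplus>\<^bsub>B\<^esub> m) = t l \<oplus>\<^bsub>A\<^esub> t m" "t (l \<otimes>\<^bsub>B\<^esub> m) = t m \<otimes>\<^bsub>A\<^esub> t l"
    "t \<one>\<^bsub>B\<^esub> = \<one>\<^bsub>A\<^esub>" if "l \<in> carrier B" "m \<in> carrier B" for l m
    using assms(4) that by (auto simp: ring_hom_def opposite_ring_def)
  note c = s(1)[OF _ B.one_closed] t(1)[OF _ B.one_closed] s(4)[OF B.one_closed B.one_closed]
    t(4)[OF B.one_closed B.one_closed]
  show ?thesis
    by unfold_locales (simp_all add: mult_right_def c assms(5) A.l_distr A.r_distr A.m_assoc)
qed

text \<open>An anti-automorphism turns right multiplications into left ones, so transport along it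
  takes a right bialgebroid to a left one. The right action of \<open>src H\<close> becomes a left
  action of \<open>src H'\<close>, which forces the legs in \<open>comult'\<close> to be exchanged
  and the base rings to be matched by an anti-isomorphism.\<close>

locale bialgebroid_twist = right_bialgebroid H for H :: "('a, 'b) bialgebroid" +
  fixes H' :: "('a, 'c) bialgebroid" and V W :: "'a \<Rightarrow> 'a" and \<theta> :: "'b \<Rightarrow> 'c"
  assumes tot: "total_ring H' = total_ring H"
    and base: "ring (base_ring H')"
    and th_bij: "bij_betw \<theta> (carrier Bs) (carrier (base_ring H'))"
    and th_add: "\<lbrakk>l \<in> carrier Bs; m \<in> carrier Bs\<rbrakk> \<Longrightarrow> \<theta> (l \<oplus>\<^bsub>Bs\<^esub> m) = \<theta> l \<oplus>\<^bsub>base_ring H'\<^esub> \<theta> m"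
    and th_mult: "\<lbrakk>l \<in> carrier Bs; m \<in> carrier Bs\<rbrakk> \<Longrightarrow> \<theta> (l \<otimes>\<^bsub>Bs\<^esub> m) = \<theta> m \<otimes>\<^bsub>base_ring H'\<^esub> \<theta> l"
    and th_one: "\<theta> \<one>\<^bsub>Bs\<^esub> = \<one>\<^bsub>base_ring H'\<^esub>"
    and V_closed: "a \<in> carrier A \<Longrightarrow> V a \<in> carrier A"
    and V_add: "\<lbrakk>a \<in> carrier A; b \<in> carrier A\<rbrakk> \<Longrightarrow> V (a \<oplus>\<^bsub>A\<^esub> b) = V a \<oplus>\<^bsub>A\<^esub> V b"
    and V_mult: "\<lbrakk>a \<in> carrier A; b \<in> carrier A\<rbrakk> \<Longrightarrow> V (a \<otimes>\<^bsub>A\<^esub> b) = V b \<otimes>\<^bsub>A\<^esub> V a"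
    and V_one: "V \<one>\<^bsub>A\<^esub> = \<one>\<^bsub>A\<^esub>"
    and W_closed: "a \<in> carrier A \<Longrightarrow> W a \<in> carrier A"
    and VW: "a \<in> carrier A \<Longrightarrow> V (W a) = a"
    and WV: "a \<in> carrier A \<Longrightarrow> W (V a) = a"
    and src': "l \<in> carrier Bs \<Longrightarrow> src H' (\<theta> l) = W (src H l)"
    and tgt': "l \<in> carrier Bs \<Longrightarrow> tgt H' (\<theta> l) = W (tgt H l)"
    and counit': "a \<in> carrier A \<Longrightarrow> counit H' a = \<theta> (counit H (V a))"
    and comult': "a \<in> carrier A \<Longrightarrow> comult H' a
      = SR (left_tensor H') (V a) (\<lambda>x y. tens (left_tensor H') (W y, W x))"
begin

abbreviation "B' \<equiv> base_ring H'"

declare tot [simp] V_closed [simp] W_closed [simp] VW [simp] WV [simp]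

lemma W_add: "\<lbrakk>a \<in> carrier A; b \<in> carrier A\<rbrakk> \<Longrightarrow> W (a \<oplus>\<^bsub>A\<^esub> b) = W a \<oplus>\<^bsub>A\<^esub> W b"
  using V_add[of "W a" "W b"] WV[of "W a \<oplus>\<^bsub>A\<^esub> W b"] by simp

lemma W_mult: "\<lbrakk>a \<in> carrier A; b \<in> carrier A\<rbrakk> \<Longrightarrow> W (a \<otimes>\<^bsub>A\<^esub> b) = W b \<otimes>\<^bsub>A\<^esub> W a"
  using V_mult[of "W b" "W a"] WV[of "W b \<otimes>\<^bsub>A\<^esub> W a"] by simp

lemma W_one: "W \<one>\<^bsub>A\<^esub> = \<one>\<^bsub>A\<^esub>"
  using WV[of "\<one>\<^bsub>A\<^esub>"] by (simp add: V_one)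

lemma th_closed [simp]: "l \<in> carrier Bs \<Longrightarrow> \<theta> l \<in> carrier B'"
  using th_bij by (auto simp: bij_betw_def)

lemma B'_cases:
  assumes "r \<in> carrier B'"
  obtains l where "l \<in> carrier Bs" "r = \<theta> l"
  using assms th_bij by (auto simp: bij_betw_def)

lemma src'_hom: "src H' \<in> ring_hom B' A"
proof (rule ring_hom_memI)
  show "src H' r \<in> carrier A" if "r \<in> carrier B'" for r
    using that by (rule B'_cases) (simp add: src')
  show "src H' \<one>\<^bsub>B'\<^esub> = \<one>\<^bsub>A\<^esub>"
    using src'[of "\<one>\<^bsub>Bs\<^esub>"] by (simp add: th_one W_one)
  fix r r' assume h: "r \<in> carrier B'" "r' \<in> carrier B'"
  obtain l where l: "l \<in> carrier Bs" "r = \<theta> l" using h(1) by (rule B'_cases)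
  obtain l' where l': "l' \<in> carrier Bs" "r' = \<theta> l'" using h(2) by (rule B'_cases)
  show "src H' (r \<otimes>\<^bsub>B'\<^esub> r') = src H' r \<otimes>\<^bsub>A\<^esub> src H' r'"
    using l l' src'[of "l' \<otimes>\<^bsub>Bs\<^esub> l"] by (simp add: th_mult src' W_mult)
  show "src H' (r \<oplus>\<^bsub>B'\<^esub> r') = src H' r \<oplus>\<^bsub>A\<^esub> src H' r'"
    using l l' src'[of "l \<oplus>\<^bsub>Bs\<^esub> l'"] by (simp add: th_add src' W_add)
qed

lemma tgt'_hom: "tgt H' \<in> ring_hom (opposite_ring B') A"
proof (rule ring_hom_memI)
  show "tgt H' r \<in> carrier A" if "r \<in> carrier (opposite_ring B')" for r
  proof -
    have "r \<in> carrier B'" using that by (simp add: opposite_ring_def)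
    then show ?thesis by (rule B'_cases) (simp add: tgt')
  qed
  show "tgt H' \<one>\<^bsub>opposite_ring B'\<^esub> = \<one>\<^bsub>A\<^esub>"
    using tgt'[of "\<one>\<^bsub>Bs\<^esub>"] by (simp add: th_one W_one opposite_ring_def)
  fix r r' assume "r \<in> carrier (opposite_ring B')" "r' \<in> carrier (opposite_ring B')"
  then have h: "r \<in> carrier B'" "r' \<in> carrier B'" by (simp_all add: opposite_ring_def)
  obtain l where l: "l \<in> carrier Bs" "r = \<theta> l" using h(1) by (rule B'_cases)
  obtain l' where l': "l' \<in> carrier Bs" "r' = \<theta> l'" using h(2) by (rule B'_cases)
  show "tgt H' (r \<otimes>\<^bsub>opposite_ring B'\<^esub> r') = tgt H' r \<otimes>\<^bsub>A\<^esub> tgt H' r'"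
    using l l' tgt'[of "l \<otimes>\<^bsub>Bs\<^esub> l'"] by (simp add: th_mult tgt' W_mult opposite_ring_def)
  show "tgt H' (r \<oplus>\<^bsub>opposite_ring B'\<^esub> r') = tgt H' r \<oplus>\<^bsub>A\<^esub> tgt H' r'"
    using l l' tgt'[of "l \<oplus>\<^bsub>Bs\<^esub> l'"] by (simp add: th_add tgt' W_add opposite_ring_def)
qed

lemma commute': "\<lbrakk>r \<in> carrier B'; r' \<in> carrier B'\<rbrakk> \<Longrightarrow> src H' r \<otimes>\<^bsub>A\<^esub> tgt H' r' = tgt H' r' \<otimes>\<^bsub>A\<^esub> src H' r"
  by (elim B'_cases) (simp add: src' tgt' W_mult[symmetric] src_tgt_commute)

lemma bimodule': "bimodule B' A (mult_left A (src H')) (\<lambda>a b. mult_left A (tgt H') b a)"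
  by (rule bimodule_left[OF base source.S.ring_axioms src'_hom tgt'_hom commute'])

section \<open>The comonoid transported along the anti-automorphism\<close>

sublocale M': bimodule B' A "mult_left A (src H')" "\<lambda>a b. mult_left A (tgt H') b a"
  by (rule bimodule')

sublocale T2: tensor_setting B' A "\<lambda>a b. mult_left A (tgt H') b a" "mult_left A (src H')" A
  by unfold_locales (rule M'.ract_closed M'.lact_closed; assumption)+

sublocale T3: tensor3_setting B' B' A "\<lambda>a b. mult_left A (tgt H') b a" "mult_left A (src H')" A
    "\<lambda>a b. mult_left A (tgt H') b a" "mult_left A (src H')" A
  by unfold_locales (rule M'.ract_closed M'.lact_closed; assumption)+

lemma left_tensor_eq': "left_tensor H' = T2.T"
  by (simp add: left_tensor_def)

lemma bal_flip:
  assumes "T2.bal G f"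
  shows "bal G (\<lambda>x y. f (W y) (W x))"
proof (rule balancedI)
  fix x l y assume h: "x \<in> carrier A" "l \<in> carrier Bs" "y \<in> carrier A"
  show "f (W y) (W (mult_right A (src H) x l)) = f (W (mult_right A (tgt H) y l)) (W x)"
    using balancedD(4)[OF assms, of "W y" "\<theta> l" "W x"] h
    by (simp add: mult_left_def mult_right_def W_mult src' tgt')
qed (simp_all add: W_add balancedD(1-3)[OF assms])

lemma bal_flip_tens: "bal T2.T (\<lambda>x y. tens T2.T (W y, W x))"
  by (rule bal_flip[OF T2.bal_tens])

lemma comult'_eq: "a \<in> carrier A \<Longrightarrow> comult H' a = SR T2.T (V a) (\<lambda>x y. tens T2.T (W y, W x))"
  by (simp add: comult' left_tensor_eq')

lemma comult'_closed: "a \<in> carrier A \<Longrightarrow> comult H' a \<in> carrier T2.T"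
  unfolding comult'_eq by (intro SR_closed T2.comm_group_T T2.tens_cl) simp_all

lemma tlift':
  assumes "comm_group G" "T2.bal G f" "a \<in> carrier A"
  shows "tlift G (\<lambda>(x, y). f x y) (comult H' a) = SR G (V a) (\<lambda>x y. f (W y) (W x))"
proof -
  have "tlift G (\<lambda>(x, y). f x y) (comult H' a)
      = SR G (V a) (\<lambda>x y. tlift G (\<lambda>(x, y). f x y) (tens T2.T (W y, W x)))"
    unfolding comult'_eq[OF assms(3)]
    by (rule SR_hom[OF T2.tlift_hom[OF assms(1,2)] T2.comm_group_T assms(1)])
      (simp_all add: assms(3) T2.tens_cl)
  also have "\<dots> = SR G (V a) (\<lambda>x y. f (W y) (W x))"
    by (rule SR_cong) (simp_all add: assms(3) T2.tlift_tens[OF assms(1,2)])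
  finally show ?thesis .
qed

lemma bal2_cong:
  assumes "T2.bal G g" "\<And>x y. \<lbrakk>x \<in> carrier A; y \<in> carrier A\<rbrakk> \<Longrightarrow> f x y = g x y"
  shows "T2.bal G f"
  by (rule balancedI) (simp_all add: assms(2) balancedD[OF assms(1)] M'.lact_closed M'.ract_closed)

lemma bal2_map:
  assumes "T2.bal G f" "\<And>x. x \<in> carrier A \<Longrightarrow> g x \<in> carrier A" "\<And>x. x \<in> carrier A \<Longrightarrow> h x \<in> carrier A"
    "\<And>x y. \<lbrakk>x \<in> carrier A; y \<in> carrier A\<rbrakk> \<Longrightarrow> g (x \<oplus>\<^bsub>A\<^esub> y) = g x \<oplus>\<^bsub>A\<^esub> g y"
    "\<And>x y. \<lbrakk>x \<in> carrier A; y \<in> carrier A\<rbrakk> \<Longrightarrow> h (x \<oplus>\<^bsub>A\<^esub> y) = h x \<oplus>\<^bsub>A\<^esub> h y"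
    "\<And>x b. \<lbrakk>x \<in> carrier A; b \<in> carrier B'\<rbrakk> \<Longrightarrow> g (tgt H' b \<otimes>\<^bsub>A\<^esub> x) = tgt H' b \<otimes>\<^bsub>A\<^esub> g x"
    "\<And>x b. \<lbrakk>x \<in> carrier A; b \<in> carrier B'\<rbrakk> \<Longrightarrow> h (src H' b \<otimes>\<^bsub>A\<^esub> x) = src H' b \<otimes>\<^bsub>A\<^esub> h x"
  shows "T2.bal G (\<lambda>x y. f (g x) (h y))"
  by (rule balancedI)
    (use assms(2-) in \<open>simp_all add: mult_left_def balancedD(1-3)[OF assms(1)]
      balancedD(4)[OF assms(1), unfolded mult_left_def]\<close>)

lemma src'_closed [simp]: "r \<in> carrier B' \<Longrightarrow> src H' r \<in> carrier A"
  and tgt'_closed [simp]: "r \<in> carrier B' \<Longrightarrow> tgt H' r \<in> carrier A"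
  by (auto elim!: B'_cases simp: src' tgt')

lemma tgt'_src'_left: "\<lbrakk>r \<in> carrier B'; r' \<in> carrier B'; x \<in> carrier A\<rbrakk>
    \<Longrightarrow> src H' r \<otimes>\<^bsub>A\<^esub> (tgt H' r' \<otimes>\<^bsub>A\<^esub> x) = tgt H' r' \<otimes>\<^bsub>A\<^esub> (src H' r \<otimes>\<^bsub>A\<^esub> x)"
  using commute'[of r r'] by (simp add: source.S.m_assoc[symmetric])

lemma add_monoid_comult': "comult H' \<in> hom (add_monoid A) T2.T"
  by (rule homI)
    (simp_all add: comult'_closed, simp add: comult'_eq V_add SR_add[OF T2.comm_group_T bal_flip_tens])

lemma comonoid': "bimodule_comonoid B' A (mult_left A (src H')) (\<lambda>a b. mult_left A (tgt H') b a)
    (comult H') (counit H')"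
proof (intro bimodule_comonoid.intro bimodule' bimodule_comonoid_axioms.intro)
  note cg = T2.comm_group_T
  show "comult H' \<in> hom (add_monoid A) T2.T" by (rule add_monoid_comult')
  fix r a assume r: "r \<in> carrier B'" and a: "a \<in> carrier A"
  obtain l where l: "l \<in> carrier Bs" "r = \<theta> l" using r by (rule B'_cases)
  have Vs: "V (src H' r \<otimes>\<^bsub>A\<^esub> a) = V a \<otimes>\<^bsub>A\<^esub> src H l"
    and Vt: "V (tgt H' r \<otimes>\<^bsub>A\<^esub> a) = V a \<otimes>\<^bsub>A\<^esub> tgt H l"
    using l a by (simp_all add: V_mult src' tgt')
  have b: "T2.bal T2.T (\<lambda>u v. tens T2.T (mult_left A (src H') r u, v))"
    by (rule bal2_map[OF T2.bal_tens, where h = "\<lambda>x. x"])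
      (simp_all add: mult_left_def r source.S.r_distr tgt'_src'_left)
  have "comult H' (src H' r \<otimes>\<^bsub>A\<^esub> a) = SR T2.T (V a) (\<lambda>x y. tens T2.T (W (y \<otimes>\<^bsub>A\<^esub> src H l), W x))"
    using SR_src[OF cg bal_flip_tens l(1), of "V a"] a l(1) r by (simp add: comult'_eq Vs)
  also have "\<dots> = SR T2.T (V a) (\<lambda>x y. tens T2.T (mult_left A (src H') r (W y), W x))"
    by (rule SR_cong) (simp_all add: a l mult_left_def W_mult src')
  finally show "comult H' (mult_left A (src H') r a)
      = tlift T2.T (\<lambda>(u, v). tens T2.T (mult_left A (src H') r u, v)) (comult H' a)"
    using tlift'[OF cg b a] by (simp add: mult_left_def)
  have b: "T2.bal T2.T (\<lambda>u v. tens T2.T (u, mult_left A (tgt H') r v))"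
    by (rule bal2_map[OF T2.bal_tens, where g = "\<lambda>x. x"])
      (simp_all add: mult_left_def r source.S.r_distr tgt'_src'_left)
  have "comult H' (tgt H' r \<otimes>\<^bsub>A\<^esub> a) = SR T2.T (V a) (\<lambda>x y. tens T2.T (W y, W (x \<otimes>\<^bsub>A\<^esub> tgt H l)))"
    using SR_tgt[OF cg bal_flip_tens l(1), of "V a"] a l(1) r by (simp add: comult'_eq Vt)
  also have "\<dots> = SR T2.T (V a) (\<lambda>x y. tens T2.T (W y, mult_left A (tgt H') r (W x)))"
    by (rule SR_cong) (simp_all add: a l mult_left_def W_mult tgt')
  finally show "comult H' (mult_left A (tgt H') r a)
      = tlift T2.T (\<lambda>(u, v). tens T2.T (u, mult_left A (tgt H') r v)) (comult H' a)"
    using tlift'[OF cg b a] by (simp add: mult_left_def)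
  show "counit H' (mult_left A (src H') r a) = r \<otimes>\<^bsub>B'\<^esub> counit H' a"
    using comonoid.eps_ract[of l "V a"] a l r
    by (simp add: mult_left_def mult_right_def counit' Vs[unfolded l(2)] th_mult)
  show "counit H' (mult_left A (tgt H') r a) = counit H' a \<otimes>\<^bsub>B'\<^esub> r"
    using comonoid.eps_lact[of l "V a"] a l r
    by (simp add: mult_left_def mult_right_def counit' Vt[unfolded l(2)] th_mult)
next
  show "counit H' \<in> hom (add_monoid A) (add_monoid B')"
    by (rule homI) (simp_all add: counit' V_add th_add)
  fix a assume a: "a \<in> carrier A"
  have e1: "counit H' (mult_left A (src H') r x) = r \<otimes>\<^bsub>B'\<^esub> counit H' x"
    "counit H' (mult_left A (tgt H') r x) = counit H' x \<otimes>\<^bsub>B'\<^esub> r"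
    if r: "r \<in> carrier B'" and x: "x \<in> carrier A" for r x
  proof -
    obtain l where l: "l \<in> carrier Bs" "r = \<theta> l" using r by (rule B'_cases)
    show "counit H' (mult_left A (src H') r x) = r \<otimes>\<^bsub>B'\<^esub> counit H' x"
      using comonoid.eps_ract[of l "V x"] x l
      by (simp add: mult_left_def mult_right_def counit' V_mult src' th_mult)
    show "counit H' (mult_left A (tgt H') r x) = counit H' x \<otimes>\<^bsub>B'\<^esub> r"
      using comonoid.eps_lact[of l "V x"] x l
      by (simp add: mult_left_def mult_right_def counit' V_mult tgt' th_mult)
  qed
  have ec: "counit H' x \<in> carrier B'" if "x \<in> carrier A" for x using that by (simp add: counit')
  have ea: "counit H' (x \<oplus>\<^bsub>A\<^esub> y) = counit H' x \<oplus>\<^bsub>B'\<^esub> counit H' y" if "x \<in> carrier A" "y \<in> carrier A" for x y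
    using that by (simp add: counit' V_add th_add)
  have b1: "T2.bal (add_monoid A) (\<lambda>u v. mult_left A (src H') (counit H' u) v)"
    by (rule balancedI) (simp_all add: M'.lact_closed M'.lact_add M'.add_lact ec ea e1 M'.lact_assoc)
  have "tlift (add_monoid A) (\<lambda>(u, v). mult_left A (src H') (counit H' u) v) (comult H' a)
      = SR (add_monoid A) (V a) (\<lambda>x y. mult_left A (src H') (counit H' (W y)) (W x))"
    by (rule tlift'[OF source.S.a_comm_group b1 a])
  also have "\<dots> = SR (add_monoid A) (V a) (\<lambda>x y. W (x \<otimes>\<^bsub>A\<^esub> src H (counit H y)))"
    by (rule SR_cong) (simp_all add: a counit' mult_left_def src' W_mult)
  also have "\<dots> = W (SR (add_monoid A) (V a) (\<lambda>x y. x \<otimes>\<^bsub>A\<^esub> src H (counit H y)))"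
    by (rule SR_hom[where h = W, OF _ source.S.a_comm_group source.S.a_comm_group, symmetric])
      (simp_all add: a hom_def W_add Pi_iff)
  finally show "tlift (add_monoid A) (\<lambda>(u, v). mult_left A (src H') (counit H' u) v) (comult H' a) = a"
    using SR_counit2[of "V a"] a by simp
  have b2: "T2.bal (add_monoid A) (\<lambda>u v. mult_left A (tgt H') (counit H' v) u)"
    by (rule balancedI) (simp_all add: M'.ract_closed M'.ract_add M'.add_ract ec ea e1 M'.ract_assoc)
  have "tlift (add_monoid A) (\<lambda>(u, v). mult_left A (tgt H') (counit H' v) u) (comult H' a)
      = SR (add_monoid A) (V a) (\<lambda>x y. mult_left A (tgt H') (counit H' (W x)) (W y))"
    by (rule tlift'[OF source.S.a_comm_group b2 a])
  also have "\<dots> = SR (add_monoid A) (V a) (\<lambda>x y. W (y \<otimes>\<^bsub>A\<^esub> tgt H (counit H x)))"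
    by (rule SR_cong) (simp_all add: a counit' mult_left_def tgt' W_mult)
  also have "\<dots> = W (SR (add_monoid A) (V a) (\<lambda>x y. y \<otimes>\<^bsub>A\<^esub> tgt H (counit H x)))"
    by (rule SR_hom[where h = W, OF _ source.S.a_comm_group source.S.a_comm_group, symmetric])
      (simp_all add: a hom_def W_add Pi_iff)
  finally show "tlift (add_monoid A) (\<lambda>(u, v). mult_left A (tgt H') (counit H' v) u) (comult H' a) = a"
    using SR_counit1[of "V a"] a by simp
  show "let T3 = T3.T3
        in tlift T3 (\<lambda>(u, v). tlift T3 (\<lambda>(u', u''). tens T3 (u', u'', v)) (comult H' u)) (comult H' a)
         = tlift T3 (\<lambda>(u, v). tlift T3 (\<lambda>(v', v''). tens T3 (u, v', v'')) (comult H' v)) (comult H' a)"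
    unfolding Let_def
  proof -
    let ?T = T3.T3
    note cg = T3.comm_group_T3
    have t1: "T2.bal ?T (\<lambda>y z. tens ?T (x, y, z))" if "x \<in> carrier A" for x
      using T3.bal3_tens that unfolding balanced3_def by blast
    have t2: "T2.bal ?T (\<lambda>x y. tens ?T (x, y, z))" if "z \<in> carrier A" for z
      using T3.bal3_tens that unfolding balanced3_def by blast
    \<comment> \<open>Reversal of three legs exchanges the two bracketings of a double coproduct, so
      coassociativity of \<open>H\<close> for the reversed tensor is coassociativity of
      \<open>H'\<close>.\<close>
    have b3: "comonoid.T3.bal3 ?T (\<lambda>p q r. tens ?T (W r, W q, W p))"
      unfolding balanced3_def
    proof (intro conjI ballI)
      show "bal ?T (\<lambda>q r. tens ?T (W r, W q, W p))" if "p \<in> carrier A" for p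
        by (rule bal_flip[OF t2]) (simp add: that)
      show "bal ?T (\<lambda>p q. tens ?T (W r, W q, W p))" if "r \<in> carrier A" for r
        by (rule bal_flip[OF t1]) (simp add: that)
    qed
    note cl = comonoid.bal3_left[OF cg b3, folded SR_def] comonoid.bal3_right[OF cg b3, folded SR_def]
    have e1: "tlift ?T (\<lambda>(u', u''). tens ?T (u', u'', v)) (comult H' u)
        = SR ?T (V u) (\<lambda>x y. tens ?T (W y, W x, v))" if "u \<in> carrier A" "v \<in> carrier A" for u v
      by (rule tlift'[OF cg t2[OF that(2)] that(1)])
    have e2: "tlift ?T (\<lambda>(v', v''). tens ?T (u, v', v'')) (comult H' v)
        = SR ?T (V v) (\<lambda>x y. tens ?T (u, W y, W x))" if "u \<in> carrier A" "v \<in> carrier A" for u v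
      by (rule tlift'[OF cg t1[OF that(1)] that(2)])
    have B1: "T2.bal ?T (\<lambda>u v. SR ?T (V u) (\<lambda>x y. tens ?T (W y, W x, v)))"
    proof (rule balancedI)
      fix u r v assume h: "u \<in> carrier A" "r \<in> carrier B'" "v \<in> carrier A"
      obtain l where l: "l \<in> carrier Bs" "r = \<theta> l" using h(2) by (rule B'_cases)
      show "SR ?T (V (mult_left A (tgt H') r u)) (\<lambda>x y. tens ?T (W y, W x, v))
          = SR ?T (V u) (\<lambda>x y. tens ?T (W y, W x, mult_left A (src H') r v))"
        using balancedD(4)[OF cl(2), of "V v" l "V u"] h l
        by (simp add: mult_left_def mult_right_def V_mult W_mult src' tgt')
    next
      fix u v v' assume h: "u \<in> carrier A" "v \<in> carrier A" "v' \<in> carrier A"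
      show "SR ?T (V u) (\<lambda>x y. tens ?T (W y, W x, v \<oplus>\<^bsub>A\<^esub> v'))
        = SR ?T (V u) (\<lambda>x y. tens ?T (W y, W x, v)) \<otimes>\<^bsub>?T\<^esub> SR ?T (V u) (\<lambda>x y. tens ?T (W y, W x, v'))"
        using balancedD(2)[OF cl(2), of "V v" "V v'" "V u"] h by (simp add: W_add)
    next
      fix u u' v assume h: "u \<in> carrier A" "u' \<in> carrier A" "v \<in> carrier A"
      show "SR ?T (V (u \<oplus>\<^bsub>A\<^esub> u')) (\<lambda>x y. tens ?T (W y, W x, v))
        = SR ?T (V u) (\<lambda>x y. tens ?T (W y, W x, v)) \<otimes>\<^bsub>?T\<^esub> SR ?T (V u') (\<lambda>x y. tens ?T (W y, W x, v))"
        using balancedD(3)[OF cl(2), of "V v" "V u" "V u'"] h by (simp add: V_add)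
    qed (auto intro!: SR_closed cg T3.tens3_cl)
    have B2: "T2.bal ?T (\<lambda>u v. SR ?T (V v) (\<lambda>x y. tens ?T (u, W y, W x)))"
    proof (rule balancedI)
      fix u r v assume h: "u \<in> carrier A" "r \<in> carrier B'" "v \<in> carrier A"
      obtain l where l: "l \<in> carrier Bs" "r = \<theta> l" using h(2) by (rule B'_cases)
      show "SR ?T (V v) (\<lambda>x y. tens ?T (mult_left A (tgt H') r u, W y, W x))
          = SR ?T (V (mult_left A (src H') r v)) (\<lambda>x y. tens ?T (u, W y, W x))"
        using balancedD(4)[OF cl(1), of "V v" l "V u"] h l
        by (simp add: mult_left_def mult_right_def V_mult W_mult src' tgt')
    next
      fix u v v' assume h: "u \<in> carrier A" "v \<in> carrier A" "v' \<in> carrier A"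
      show "SR ?T (V (v \<oplus>\<^bsub>A\<^esub> v')) (\<lambda>x y. tens ?T (u, W y, W x))
        = SR ?T (V v) (\<lambda>x y. tens ?T (u, W y, W x)) \<otimes>\<^bsub>?T\<^esub> SR ?T (V v') (\<lambda>x y. tens ?T (u, W y, W x))"
        using balancedD(2)[OF cl(1), of "V v" "V v'" "V u"] h by (simp add: V_add)
    next
      fix u u' v assume h: "u \<in> carrier A" "u' \<in> carrier A" "v \<in> carrier A"
      show "SR ?T (V v) (\<lambda>x y. tens ?T (u \<oplus>\<^bsub>A\<^esub> u', W y, W x))
        = SR ?T (V v) (\<lambda>x y. tens ?T (u, W y, W x)) \<otimes>\<^bsub>?T\<^esub> SR ?T (V v) (\<lambda>x y. tens ?T (u', W y, W x))"
        using balancedD(3)[OF cl(1), of "V v" "V u" "V u'"] h by (simp add: W_add)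
    qed (auto intro!: SR_closed cg T3.tens3_cl)
    have "tlift ?T (\<lambda>(u, v). tlift ?T (\<lambda>(u', u''). tens ?T (u', u'', v)) (comult H' u)) (comult H' a)
        = SR ?T (V a) (\<lambda>p q. tlift ?T (\<lambda>(u', u''). tens ?T (u', u'', W p)) (comult H' (W q)))"
      by (rule tlift'[OF cg bal2_cong[OF B1 e1] a])
    also have "\<dots> = SR ?T (V a) (\<lambda>p q. SR ?T q (\<lambda>x y. tens ?T (W y, W x, W p)))"
      by (rule SR_cong) (simp_all add: a e1)
    also have "\<dots> = SR ?T (V a) (\<lambda>p q. SR ?T p (\<lambda>x y. tens ?T (W q, W y, W x)))"
      by (rule SR_coassoc[OF cg b3, symmetric]) (simp add: a)
    also have "\<dots> = SR ?T (V a) (\<lambda>p q. tlift ?T (\<lambda>(v', v''). tens ?T (W q, v', v'')) (comult H' (W p)))"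
      by (rule SR_cong) (simp_all add: a e2)
    also have "\<dots> = tlift ?T (\<lambda>(u, v). tlift ?T (\<lambda>(v', v''). tens ?T (u, v', v'')) (comult H' v)) (comult H' a)"
      by (rule tlift'[OF cg bal2_cong[OF B2 e2] a, symmetric])
    finally show "tlift ?T (\<lambda>(u, v). tlift ?T (\<lambda>(u', u''). tens ?T (u', u'', v)) (comult H' u)) (comult H' a)
      = tlift ?T (\<lambda>(u, v). tlift ?T (\<lambda>(v', v''). tens ?T (u, v', v'')) (comult H' v)) (comult H' a)" .
  qed
qed

theorem left_bialgebroid_twist: "left_bialgebroid H'"
proof (rule left_bialgebroid.intro)
  show "ring_hom_ring B' (total_ring H') (src H')"
    using ring_hom_ringI2[OF base source.S.ring_axioms src'_hom] by simp
  show "ring_hom_ring (opposite_ring B') (total_ring H') (tgt H')"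
    using ring_hom_ringI2[OF ring_opposite[OF base] source.S.ring_axioms tgt'_hom] by simp
  show "bimodule_comonoid B' (total_ring H') (L_lact H') (L_ract H') (comult H') (counit H')"
    using comonoid' by simp
  note cg = T2.comm_group_T
  show "left_bialgebroid_axioms H'"
  proof (rule left_bialgebroid_axioms.intro; unfold tot left_tensor_eq')
    show "src H' r \<otimes>\<^bsub>A\<^esub> tgt H' r' = tgt H' r' \<otimes>\<^bsub>A\<^esub> src H' r"
      if "r \<in> carrier B'" "r' \<in> carrier B'" for r r'
      by (rule commute'[OF that])
    show "comult H' \<one>\<^bsub>A\<^esub> = tens T2.T (\<one>\<^bsub>A\<^esub>, \<one>\<^bsub>A\<^esub>)"
      using SR_one[OF cg bal_flip_tens] by (simp add: comult'_eq V_one W_one)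
    show "counit H' \<one>\<^bsub>A\<^esub> = \<one>\<^bsub>B'\<^esub>" by (simp add: counit' V_one counit_one th_one)
    show "counit H' (a \<otimes>\<^bsub>A\<^esub> src H' (counit H' b)) = counit H' (a \<otimes>\<^bsub>A\<^esub> b)"
      "counit H' (a \<otimes>\<^bsub>A\<^esub> tgt H' (counit H' b)) = counit H' (a \<otimes>\<^bsub>A\<^esub> b)"
      if "a \<in> carrier A" "b \<in> carrier A" for a b
      using that counit_src[of "V b" "V a"] counit_tgt[of "V b" "V a"]
      by (simp_all add: counit' V_mult src' tgt')
    show "tlift T2.T (\<lambda>(x, y). tens T2.T (x \<otimes>\<^bsub>A\<^esub> tgt H' r, y)) (comult H' a)
        = tlift T2.T (\<lambda>(x, y). tens T2.T (x, y \<otimes>\<^bsub>A\<^esub> src H' r)) (comult H' a)"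
      if r: "r \<in> carrier B'" and a: "a \<in> carrier A" for r a
    proof -
      obtain l where l: "l \<in> carrier Bs" "r = \<theta> l" using r by (rule B'_cases)
      have b1: "T2.bal T2.T (\<lambda>x y. tens T2.T (x \<otimes>\<^bsub>A\<^esub> tgt H' r, y))"
        by (rule bal2_map[OF T2.bal_tens, where h = "\<lambda>x. x"])
          (simp_all add: r source.S.l_distr source.S.m_assoc)
      have b2: "T2.bal T2.T (\<lambda>x y. tens T2.T (x, y \<otimes>\<^bsub>A\<^esub> src H' r))"
        by (rule bal2_map[OF T2.bal_tens, where g = "\<lambda>x. x"])
          (simp_all add: r source.S.l_distr source.S.m_assoc)
      have "tlift T2.T (\<lambda>(x, y). tens T2.T (x \<otimes>\<^bsub>A\<^esub> tgt H' r, y)) (comult H' a)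
          = SR T2.T (V a) (\<lambda>x y. tens T2.T (W y \<otimes>\<^bsub>A\<^esub> tgt H' r, W x))"
        by (rule tlift'[OF cg b1 a])
      also have "\<dots> = SR T2.T (V a) (\<lambda>x y. tens T2.T (W (tgt H l \<otimes>\<^bsub>A\<^esub> y), W x))"
        by (rule SR_cong) (simp_all add: a l tgt' W_mult)
      also have "\<dots> = SR T2.T (V a) (\<lambda>x y. tens T2.T (W y, W (src H l \<otimes>\<^bsub>A\<^esub> x)))"
        by (rule SR_takeuchi[OF cg bal_flip_tens l(1), symmetric]) (simp add: a)
      also have "\<dots> = SR T2.T (V a) (\<lambda>x y. tens T2.T (W y, W x \<otimes>\<^bsub>A\<^esub> src H' r))"
        by (rule SR_cong) (simp_all add: a l src' W_mult)
      also have "\<dots> = tlift T2.T (\<lambda>(x, y). tens T2.T (x, y \<otimes>\<^bsub>A\<^esub> src H' r)) (comult H' a)"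
        by (rule tlift'[OF cg b2 a, symmetric])
      finally show ?thesis .
    qed
    show "comult H' (a \<otimes>\<^bsub>A\<^esub> b) = tlift T2.T (\<lambda>(u, v). tlift T2.T
        (\<lambda>(x, y). tens T2.T (x \<otimes>\<^bsub>A\<^esub> u, y \<otimes>\<^bsub>A\<^esub> v)) (comult H' a)) (comult H' b)"
      if a: "a \<in> carrier A" and b: "b \<in> carrier A" for a b
    proof -
      have bi: "T2.bal T2.T (\<lambda>x y. tens T2.T (x \<otimes>\<^bsub>A\<^esub> u, y \<otimes>\<^bsub>A\<^esub> v))"
        if "u \<in> carrier A" "v \<in> carrier A" for u v
        by (rule bal2_map[OF T2.bal_tens]) (simp_all add: that source.S.l_distr source.S.m_assoc)
      let ?in = "\<lambda>u v. SR T2.T (V a) (\<lambda>x y. tens T2.T (W y \<otimes>\<^bsub>A\<^esub> u, W x \<otimes>\<^bsub>A\<^esub> v))"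
      have e: "tlift T2.T (\<lambda>(x, y). tens T2.T (x \<otimes>\<^bsub>A\<^esub> u, y \<otimes>\<^bsub>A\<^esub> v)) (comult H' a) = ?in u v"
        if "u \<in> carrier A" "v \<in> carrier A" for u v
        by (rule tlift'[OF cg bi[OF that] a])
      note bm = bal_SR_mult[OF cg bal_flip_tens V_closed[OF a]]
      \<comment> \<open>Writing \<open>u\<close> as \<open>W (V u)\<close> and \<open>v\<close> as
        \<open>W (V v)\<close> exhibits the inner sum as the balanced function of
        \<open>bal_SR_mult\<close> with its two arguments exchanged.\<close>
      have e2: "?in u v = SR T2.T (V a) (\<lambda>x y. tens T2.T (W (V u \<otimes>\<^bsub>A\<^esub> y), W (V v \<otimes>\<^bsub>A\<^esub> x)))"
        if "u \<in> carrier A" "v \<in> carrier A" for u v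
        by (rule SR_cong) (simp_all add: a that W_mult)
      have bo: "T2.bal T2.T ?in"
      proof (rule balancedI)
        fix u r v assume h: "u \<in> carrier A" "r \<in> carrier B'" "v \<in> carrier A"
        obtain l where l: "l \<in> carrier Bs" "r = \<theta> l" using h(2) by (rule B'_cases)
        have c: "mult_left A (tgt H') r u \<in> carrier A" "mult_left A (src H') r v \<in> carrier A"
          using h by (simp_all add: mult_left_def)
        show "?in (mult_left A (tgt H') r u) v = ?in u (mult_left A (src H') r v)"
          unfolding e2[OF c(1) h(3)] e2[OF h(1) c(2)]
          using balancedD(4)[OF bm, of "V v" l "V u"] h l
          by (simp add: mult_left_def mult_right_def V_mult src' tgt')
      next
        fix u u' v assume h: "u \<in> carrier A" "u' \<in> carrier A" "v \<in> carrier A"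
        show "?in (u \<oplus>\<^bsub>A\<^esub> u') v = ?in u v \<otimes>\<^bsub>T2.T\<^esub> ?in u' v"
          using balancedD(3)[OF bm, of "V v" "V u" "V u'"] h by (simp add: e2 V_add)
      next
        fix u v v' assume h: "u \<in> carrier A" "v \<in> carrier A" "v' \<in> carrier A"
        show "?in u (v \<oplus>\<^bsub>A\<^esub> v') = ?in u v \<otimes>\<^bsub>T2.T\<^esub> ?in u v'"
          using balancedD(2)[OF bm, of "V v" "V v'" "V u"] h by (simp add: e2 V_add)
      qed (auto simp: a intro!: SR_closed cg T2.tens_cl)
      have "comult H' (a \<otimes>\<^bsub>A\<^esub> b) = SR T2.T (V b \<otimes>\<^bsub>A\<^esub> V a) (\<lambda>x y. tens T2.T (W y, W x))"
        by (simp add: comult'_eq a b V_mult)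
      also have "\<dots> = SR T2.T (V b) (\<lambda>u v. SR T2.T (V a) (\<lambda>x y. tens T2.T (W (v \<otimes>\<^bsub>A\<^esub> y), W (u \<otimes>\<^bsub>A\<^esub> x))))"
        by (rule SR_times[OF cg bal_flip_tens]) (simp_all add: a b)
      also have "\<dots> = SR T2.T (V b) (\<lambda>u v. ?in (W v) (W u))"
        by (intro SR_cong) (simp_all add: a b W_mult)
      also have "\<dots> = SR T2.T (V b) (\<lambda>u v. tlift T2.T
          (\<lambda>(x, y). tens T2.T (x \<otimes>\<^bsub>A\<^esub> W v, y \<otimes>\<^bsub>A\<^esub> W u)) (comult H' a))"
        by (rule SR_cong) (simp_all add: b e)
      also have "\<dots> = tlift T2.T (\<lambda>(u, v). tlift T2.T
          (\<lambda>(x, y). tens T2.T (x \<otimes>\<^bsub>A\<^esub> u, y \<otimes>\<^bsub>A\<^esub> v)) (comult H' a)) (comult H' b)"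
        by (rule tlift'[OF cg bal2_cong[OF bo e] b, symmetric])
      finally show ?thesis .
    qed
  qed
qed

end

section \<open>The dual ring of a left bialgebroid\<close>

context left_bialgebroid
begin

definition "addA = add_monoid A"
definition "addB = add_monoid Bs"

lemma add_simps [simp]: "carrier addA = carrier A" "x \<otimes>\<^bsub>addA\<^esub> y = x \<oplus>\<^bsub>A\<^esub> y"
  "carrier addB = carrier Bs" "l \<otimes>\<^bsub>addB\<^esub> m = l \<oplus>\<^bsub>Bs\<^esub> m"
  by (simp_all add: addA_def addB_def)

lemma cg_add [simp]: "comm_group addA" "comm_group addB"
  unfolding addA_def addB_def by (rule source.S.a_comm_group source.R.a_comm_group)+

lemma SL_push:
  assumes "comm_group G" "comm_group K" "a \<in> carrier A"
    "\<And>x y. \<lbrakk>x \<in> carrier A; y \<in> carrier A\<rbrakk> \<Longrightarrow> f x y \<in> carrier G"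
    "\<And>x. x \<in> carrier G \<Longrightarrow> h x \<in> carrier K"
    "\<And>x y. \<lbrakk>x \<in> carrier G; y \<in> carrier G\<rbrakk> \<Longrightarrow> h (x \<otimes>\<^bsub>G\<^esub> y) = h x \<otimes>\<^bsub>K\<^esub> h y"
  shows "h (SL G a f) = SL K a (\<lambda>x y. h (f x y))"
  by (rule SL_hom[OF _ assms(1-3)]) (auto simp: hom_def assms(4-6))

abbreviation "D \<equiv> lower_star H"
abbreviation "ac \<equiv> act_lower_star H"

lemma D_I:
  assumes "\<And>x. x \<in> carrier A \<Longrightarrow> f x \<in> carrier Bs"
    "\<And>x y. \<lbrakk>x \<in> carrier A; y \<in> carrier A\<rbrakk> \<Longrightarrow> f (x \<oplus>\<^bsub>A\<^esub> y) = f x \<oplus>\<^bsub>Bs\<^esub> f y"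
    "\<And>x l. \<lbrakk>x \<in> carrier A; l \<in> carrier Bs\<rbrakk> \<Longrightarrow> f (tgt H l \<otimes>\<^bsub>A\<^esub> x) = f x \<otimes>\<^bsub>Bs\<^esub> l"
  shows "restrict f (carrier A) \<in> carrier D"
  by (simp add: lower_star_def right_dual_def hom_def mult_left_def Pi_iff assms)

lemma D_eqI:
  assumes "\<phi> \<in> carrier D" "\<psi> \<in> carrier D" "\<And>x. x \<in> carrier A \<Longrightarrow> \<phi> x = \<psi> x"
  shows "\<phi> = \<psi>"
proof (rule extensionalityI)
  show "\<phi> \<in> extensional (carrier A)" "\<psi> \<in> extensional (carrier A)"
    using assms(1,2) by (simp_all add: lower_star_def right_dual_def)
qed (rule assms(3))

lemma D_mult_eq: "\<phi> \<otimes>\<^bsub>D\<^esub> \<psi> = (\<lambda>a\<in>carrier A. \<psi> (ac a \<phi>))"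
  and D_add_eq: "\<phi> \<oplus>\<^bsub>D\<^esub> \<psi> = (\<lambda>a\<in>carrier A. \<phi> a \<oplus>\<^bsub>Bs\<^esub> \<psi> a)"
  and D_zero_eq: "\<zero>\<^bsub>D\<^esub> = (\<lambda>a\<in>carrier A. \<zero>\<^bsub>Bs\<^esub>)"
  and D_one_eq: "\<one>\<^bsub>D\<^esub> = restrict (counit H) (carrier A)"
  by (simp_all add: lower_star_def)

lemma D_simps [simp]:
  assumes "\<phi> \<in> carrier D"
  shows "x \<in> carrier A \<Longrightarrow> \<phi> x \<in> carrier Bs"
    "\<lbrakk>x \<in> carrier A; y \<in> carrier A\<rbrakk> \<Longrightarrow> \<phi> (x \<oplus>\<^bsub>A\<^esub> y) = \<phi> x \<oplus>\<^bsub>Bs\<^esub> \<phi> y"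
    "\<lbrakk>x \<in> carrier A; l \<in> carrier Bs\<rbrakk> \<Longrightarrow> \<phi> (tgt H l \<otimes>\<^bsub>A\<^esub> x) = \<phi> x \<otimes>\<^bsub>Bs\<^esub> l"
  using assms by (simp_all add: lower_star_def right_dual_def hom_def mult_left_def Pi_iff)

lemma D_apply [simp]:
  assumes "a \<in> carrier A"
  shows "(\<phi> \<otimes>\<^bsub>D\<^esub> \<psi>) a = \<psi> (ac a \<phi>)" "(\<phi> \<oplus>\<^bsub>D\<^esub> \<psi>) a = \<phi> a \<oplus>\<^bsub>Bs\<^esub> \<psi> a" "\<zero>\<^bsub>D\<^esub> a = \<zero>\<^bsub>Bs\<^esub>" "\<one>\<^bsub>D\<^esub> a = counit H a"
  using assms by (simp_all add: D_mult_eq D_add_eq D_zero_eq D_one_eq)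

section \<open>The right action of functionals and the dual ring\<close>

lemma balI:
  assumes "\<And>x y. \<lbrakk>x \<in> carrier A; y \<in> carrier A\<rbrakk> \<Longrightarrow> f x y \<in> carrier G"
    and "\<And>x x' y. \<lbrakk>x \<in> carrier A; x' \<in> carrier A; y \<in> carrier A\<rbrakk>
      \<Longrightarrow> f (x \<oplus>\<^bsub>A\<^esub> x') y = f x y \<otimes>\<^bsub>G\<^esub> f x' y"
    and "\<And>x y y'. \<lbrakk>x \<in> carrier A; y \<in> carrier A; y' \<in> carrier A\<rbrakk>
      \<Longrightarrow> f x (y \<oplus>\<^bsub>A\<^esub> y') = f x y \<otimes>\<^bsub>G\<^esub> f x y'"
    and "\<And>x l y. \<lbrakk>x \<in> carrier A; l \<in> carrier Bs; y \<in> carrier A\<rbrakk>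
      \<Longrightarrow> f (tgt H l \<otimes>\<^bsub>A\<^esub> x) y = f x (src H l \<otimes>\<^bsub>A\<^esub> y)"
  shows "bal G f"
  by (rule balancedI) (simp_all only: mult_left_def assms)

lemma coassoc_SLL:
  assumes "comm_group G" "\<And>x. x \<in> carrier A \<Longrightarrow> bal G (f x)"
    "\<And>z. z \<in> carrier A \<Longrightarrow> bal G (\<lambda>x y. f x y z)" "a \<in> carrier A"
  shows "SL G a (\<lambda>x y. SL G x (\<lambda>u v. f u v y)) = SL G a (\<lambda>x y. SL G y (\<lambda>u v. f x u v))"
  by (rule SL_coassoc[OF assms(1) _ assms(4)]) (simp add: balanced3_def assms(2,3))

lemmas ring_distr = source.S.l_distr source.S.r_distr source.S.m_assoc

lemma tgt_src_left: "\<lbrakk>l \<in> carrier Bs; m \<in> carrier Bs; x \<in> carrier A\<rbrakk>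
    \<Longrightarrow> tgt H l \<otimes>\<^bsub>A\<^esub> (src H m \<otimes>\<^bsub>A\<^esub> x) = src H m \<otimes>\<^bsub>A\<^esub> (tgt H l \<otimes>\<^bsub>A\<^esub> x)"
  using src_tgt_commute[of m l] by (simp add: source.S.m_assoc[symmetric])

lemma counit_src_left [simp]: "\<lbrakk>l \<in> carrier Bs; x \<in> carrier A\<rbrakk> \<Longrightarrow> counit H (src H l \<otimes>\<^bsub>A\<^esub> x) = l \<otimes>\<^bsub>Bs\<^esub> counit H x"
  and counit_tgt_left [simp]: "\<lbrakk>l \<in> carrier Bs; x \<in> carrier A\<rbrakk> \<Longrightarrow> counit H (tgt H l \<otimes>\<^bsub>A\<^esub> x) = counit H x \<otimes>\<^bsub>Bs\<^esub> l"
  using comonoid.eps_lact[of l x] comonoid.eps_ract[of l x] by (simp_all add: mult_left_def)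

lemma bal_ac: "\<phi> \<in> carrier D \<Longrightarrow> bal addA (\<lambda>x y. src H (\<phi> x) \<otimes>\<^bsub>A\<^esub> y)"
  by (rule balI) (simp_all add: ring_distr)

lemma ac_eq: "\<lbrakk>\<phi> \<in> carrier D; a \<in> carrier A\<rbrakk> \<Longrightarrow> ac a \<phi> = SL addA a (\<lambda>x y. src H (\<phi> x) \<otimes>\<^bsub>A\<^esub> y)"
  unfolding act_lower_star_def addA_def[symmetric] by (rule SL_tlift[OF cg_add(1) bal_ac])

lemma ac_closed [simp]: "\<lbrakk>\<phi> \<in> carrier D; a \<in> carrier A\<rbrakk> \<Longrightarrow> ac a \<phi> \<in> carrier A"
  using SL_closed[of addA a "\<lambda>x y. src H (\<phi> x) \<otimes>\<^bsub>A\<^esub> y"] by (simp add: ac_eq)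

lemma ac_add [simp]: "\<lbrakk>\<phi> \<in> carrier D; a \<in> carrier A; b \<in> carrier A\<rbrakk> \<Longrightarrow> ac (a \<oplus>\<^bsub>A\<^esub> b) \<phi> = ac a \<phi> \<oplus>\<^bsub>A\<^esub> ac b \<phi>"
  using SL_add[OF cg_add(1) bal_ac, of \<phi> a b] by (simp add: ac_eq)

lemma ac_tgt [simp]:
  assumes "\<phi> \<in> carrier D" "l \<in> carrier Bs" "a \<in> carrier A"
  shows "ac (tgt H l \<otimes>\<^bsub>A\<^esub> a) \<phi> = tgt H l \<otimes>\<^bsub>A\<^esub> ac a \<phi>"
proof -
  have "ac (tgt H l \<otimes>\<^bsub>A\<^esub> a) \<phi> = SL addA a (\<lambda>x y. src H (\<phi> x) \<otimes>\<^bsub>A\<^esub> (tgt H l \<otimes>\<^bsub>A\<^esub> y))"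
    using SL_tgt[OF cg_add(1) bal_ac[OF assms(1)] assms(2,3)] assms by (simp add: ac_eq)
  also have "\<dots> = SL addA a (\<lambda>x y. tgt H l \<otimes>\<^bsub>A\<^esub> (src H (\<phi> x) \<otimes>\<^bsub>A\<^esub> y))"
    by (rule SL_cong) (simp_all add: assms tgt_src_left)
  also have "\<dots> = tgt H l \<otimes>\<^bsub>A\<^esub> ac a \<phi>"
    unfolding ac_eq[OF assms(1,3)]
    by (rule SL_push[where h = "\<lambda>w. tgt H l \<otimes>\<^bsub>A\<^esub> w" and G = addA, symmetric]) (simp_all add: assms ring_distr)
  finally show ?thesis .
qed

lemma D_mult_closed: "\<lbrakk>\<phi> \<in> carrier D; \<psi> \<in> carrier D\<rbrakk> \<Longrightarrow> \<phi> \<otimes>\<^bsub>D\<^esub> \<psi> \<in> carrier D"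
  unfolding D_mult_eq by (rule D_I) simp_all

lemma D_add_closed: "\<lbrakk>\<phi> \<in> carrier D; \<psi> \<in> carrier D\<rbrakk> \<Longrightarrow> \<phi> \<oplus>\<^bsub>D\<^esub> \<psi> \<in> carrier D"
  unfolding D_add_eq by (rule D_I) (simp_all add: source.R.add.m_ac source.R.l_distr)

lemma D_zero_closed: "\<zero>\<^bsub>D\<^esub> \<in> carrier D"
  unfolding D_zero_eq by (rule D_I) simp_all

lemma D_one_closed: "\<one>\<^bsub>D\<^esub> \<in> carrier D"
  unfolding D_one_eq by (rule D_I) simp_all

text \<open>Coassociativity, read as the statement that functionals act on \<open>A\<close> from the
  right. Since a product in the dual evaluates its second factor on the action of the first,
  associativity of the dual ring follows.\<close>

lemma ac_ac:
  assumes "\<phi> \<in> carrier D" "\<psi> \<in> carrier D" "a \<in> carrier A"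
  shows "ac (ac a \<phi>) \<psi> = ac a (\<phi> \<otimes>\<^bsub>D\<^esub> \<psi>)"
proof -
  let ?F = "\<lambda>x u v. src H (\<psi> (src H (\<phi> x) \<otimes>\<^bsub>A\<^esub> u)) \<otimes>\<^bsub>A\<^esub> v"
  note bp = bal_ac[OF assms(2)]
  have "ac (ac a \<phi>) \<psi> = SL addA (SL addA a (\<lambda>x y. src H (\<phi> x) \<otimes>\<^bsub>A\<^esub> y)) (\<lambda>u v. src H (\<psi> u) \<otimes>\<^bsub>A\<^esub> v)"
    using ac_eq[OF assms(2) ac_closed[OF assms(1,3)]] by (simp add: ac_eq[OF assms(1,3)])
  also have "\<dots> = SL addA a (\<lambda>x y. SL addA (src H (\<phi> x) \<otimes>\<^bsub>A\<^esub> y) (\<lambda>u v. src H (\<psi> u) \<otimes>\<^bsub>A\<^esub> v))"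
    by (rule SL_push[where h = "\<lambda>w. SL addA w (\<lambda>u v. src H (\<psi> u) \<otimes>\<^bsub>A\<^esub> v)" and G = addA])
      (simp_all add: assms ac_eq[symmetric])
  also have "\<dots> = SL addA a (\<lambda>x y. SL addA y (?F x))"
    by (intro SL_cong SL_src cg_add bp) (simp_all add: assms)
  also have "\<dots> = SL addA a (\<lambda>x y. SL addA x (\<lambda>u v. ?F u v y))"
  proof (rule coassoc_SLL[OF cg_add(1) _ _ assms(3), symmetric])
    show "bal addA (?F x)" if "x \<in> carrier A" for x
      by (rule balI) (use that assms in \<open>simp_all add: ring_distr tgt_src_left[symmetric]\<close>)
    show "bal addA (\<lambda>x u. ?F x u v)" if "v \<in> carrier A" for v
      by (rule balI) (use that assms in \<open>simp_all add: ring_distr\<close>)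
  qed
  also have "\<dots> = SL addA a (\<lambda>x y. src H ((\<phi> \<otimes>\<^bsub>D\<^esub> \<psi>) x) \<otimes>\<^bsub>A\<^esub> y)"
  proof (rule SL_cong[OF assms(3)])
    fix x y assume h: "x \<in> carrier A" "y \<in> carrier A"
    show "SL addA x (\<lambda>u v. ?F u v y) = src H ((\<phi> \<otimes>\<^bsub>D\<^esub> \<psi>) x) \<otimes>\<^bsub>A\<^esub> y"
      unfolding D_apply(1)[OF h(1)] ac_eq[OF assms(1) h(1)]
      by (rule SL_push[where h = "\<lambda>w. src H (\<psi> w) \<otimes>\<^bsub>A\<^esub> y" and G = addA, symmetric])
        (simp_all add: assms h ring_distr)
  qed
  also have "\<dots> = ac a (\<phi> \<otimes>\<^bsub>D\<^esub> \<psi>)"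
    by (rule ac_eq[symmetric]) (simp_all add: assms D_mult_closed)
  finally show ?thesis .
qed

lemma ac_one [simp]: "a \<in> carrier A \<Longrightarrow> ac a \<one>\<^bsub>D\<^esub> = a"
proof -
  assume a: "a \<in> carrier A"
  have "ac a \<one>\<^bsub>D\<^esub> = SL addA a (\<lambda>x y. src H (counit H x) \<otimes>\<^bsub>A\<^esub> y)"
    unfolding ac_eq[OF D_one_closed a] by (rule SL_cong[OF a]) simp
  then show ?thesis using SL_counit1[OF a, folded addA_def] by simp
qed

text \<open>A functional can be recovered from its action. This yields the right unit law of the
  dual ring and the formula for multiplication by \<open>td\<close>.\<close>

lemma counit_ac:
  assumes "\<phi> \<in> carrier D" "a \<in> carrier A"
  shows "counit H (ac a \<phi>) = \<phi> a"
proof -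
  have "counit H (ac a \<phi>) = SL addB a (\<lambda>x y. counit H (src H (\<phi> x) \<otimes>\<^bsub>A\<^esub> y))"
    unfolding ac_eq[OF assms] by (rule SL_push[where G = addA]) (simp_all add: assms)
  also have "\<dots> = SL addB a (\<lambda>x y. \<phi> (tgt H (counit H y) \<otimes>\<^bsub>A\<^esub> x))"
    by (rule SL_cong) (simp_all add: assms)
  also have "\<dots> = \<phi> (SL addA a (\<lambda>x y. tgt H (counit H y) \<otimes>\<^bsub>A\<^esub> x))"
    by (rule SL_push[where h = \<phi> and G = addA, symmetric]) (simp_all add: assms)
  also have "\<dots> = \<phi> a" using SL_counit2[OF assms(2), folded addA_def] by simp
  finally show ?thesis .
qed

lemma ring_D: "ring D"
proof (rule ringI)
  show "abelian_group D"
  proof (rule abelian_groupI)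
    fix \<phi> assume p: "\<phi> \<in> carrier D"
    let ?n = "\<lambda>a\<in>carrier A. \<ominus>\<^bsub>Bs\<^esub> \<phi> a"
    have n: "?n \<in> carrier D"
      by (rule D_I) (simp_all add: p source.R.minus_add source.R.l_minus)
    show "\<exists>y\<in>carrier D. y \<oplus>\<^bsub>D\<^esub> \<phi> = \<zero>\<^bsub>D\<^esub>"
      using n by (intro bexI[of _ ?n] D_eqI) (simp_all add: D_add_closed D_zero_closed p source.R.l_neg)
    show "\<zero>\<^bsub>D\<^esub> \<oplus>\<^bsub>D\<^esub> \<phi> = \<phi>"
      by (rule D_eqI) (simp_all add: D_add_closed D_zero_closed p)
  next
    fix \<phi> \<psi> assume p: "\<phi> \<in> carrier D" "\<psi> \<in> carrier D"
    show "\<phi> \<oplus>\<^bsub>D\<^esub> \<psi> = \<psi> \<oplus>\<^bsub>D\<^esub> \<phi>"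
      by (rule D_eqI) (simp_all add: D_add_closed p source.R.add.m_comm)
    fix \<chi> assume c: "\<chi> \<in> carrier D"
    show "\<phi> \<oplus>\<^bsub>D\<^esub> \<psi> \<oplus>\<^bsub>D\<^esub> \<chi> = \<phi> \<oplus>\<^bsub>D\<^esub> (\<psi> \<oplus>\<^bsub>D\<^esub> \<chi>)"
      by (rule D_eqI) (simp_all add: D_add_closed p c source.R.add.m_assoc)
  qed (simp_all add: D_add_closed D_zero_closed)
  show "monoid D"
  proof (rule monoidI)
    fix \<phi> \<psi> \<chi> assume p: "\<phi> \<in> carrier D" "\<psi> \<in> carrier D" "\<chi> \<in> carrier D"
    show "\<phi> \<otimes>\<^bsub>D\<^esub> \<psi> \<otimes>\<^bsub>D\<^esub> \<chi> = \<phi> \<otimes>\<^bsub>D\<^esub> (\<psi> \<otimes>\<^bsub>D\<^esub> \<chi>)"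
      by (rule D_eqI) (simp_all add: D_mult_closed p ac_ac)
  next
    fix \<phi> assume p: "\<phi> \<in> carrier D"
    show "\<one>\<^bsub>D\<^esub> \<otimes>\<^bsub>D\<^esub> \<phi> = \<phi>" "\<phi> \<otimes>\<^bsub>D\<^esub> \<one>\<^bsub>D\<^esub> = \<phi>"
      by (rule D_eqI; simp add: D_mult_closed D_one_closed p counit_ac)+
  qed (simp_all add: D_mult_closed D_one_closed)
  fix \<phi> \<psi> \<chi> assume p: "\<phi> \<in> carrier D" "\<psi> \<in> carrier D" "\<chi> \<in> carrier D"
  show "\<chi> \<otimes>\<^bsub>D\<^esub> (\<phi> \<oplus>\<^bsub>D\<^esub> \<psi>) = \<chi> \<otimes>\<^bsub>D\<^esub> \<phi> \<oplus>\<^bsub>D\<^esub> \<chi> \<otimes>\<^bsub>D\<^esub> \<psi>"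
    by (rule D_eqI) (simp_all add: D_mult_closed D_add_closed p)
  show "(\<phi> \<oplus>\<^bsub>D\<^esub> \<psi>) \<otimes>\<^bsub>D\<^esub> \<chi> = \<phi> \<otimes>\<^bsub>D\<^esub> \<chi> \<oplus>\<^bsub>D\<^esub> \<psi> \<otimes>\<^bsub>D\<^esub> \<chi>"
  proof (rule D_eqI)
    fix a assume a: "a \<in> carrier A"
    have "ac a (\<phi> \<oplus>\<^bsub>D\<^esub> \<psi>) = SL addA a (\<lambda>x y. src H (\<phi> x) \<otimes>\<^bsub>A\<^esub> y \<oplus>\<^bsub>A\<^esub> src H (\<psi> x) \<otimes>\<^bsub>A\<^esub> y)"
      unfolding ac_eq[OF D_add_closed[OF p(1,2)] a] by (rule SL_cong[OF a]) (simp add: p ring_distr)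
    also have "\<dots> = ac a \<phi> \<oplus>\<^bsub>A\<^esub> ac a \<psi>"
      unfolding ac_eq[OF p(1) a] ac_eq[OF p(2) a]
      using SL_mult[OF cg_add(1) a, of "\<lambda>x y. src H (\<phi> x) \<otimes>\<^bsub>A\<^esub> y" "\<lambda>x y. src H (\<psi> x) \<otimes>\<^bsub>A\<^esub> y"]
      by (simp add: p)
    finally show "((\<phi> \<oplus>\<^bsub>D\<^esub> \<psi>) \<otimes>\<^bsub>D\<^esub> \<chi>) a = (\<phi> \<otimes>\<^bsub>D\<^esub> \<chi> \<oplus>\<^bsub>D\<^esub> \<psi> \<otimes>\<^bsub>D\<^esub> \<chi>) a"
      using a p by simp
  qed (simp_all add: D_mult_closed D_add_closed p)
qed

section \<open>Source and target maps of the dual right bialgebroid\<close>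

definition "sd l = (\<lambda>a\<in>carrier A. counit H (a \<otimes>\<^bsub>A\<^esub> src H l))"
definition "td l = (\<lambda>a\<in>carrier A. l \<otimes>\<^bsub>Bs\<^esub> counit H a)"

lemma dual_right_pre_sels [simp]: "total_ring (dual_right_pre H) = D" "base_ring (dual_right_pre H) = Bs"
  "src (dual_right_pre H) = sd" "tgt (dual_right_pre H) = td" "counit (dual_right_pre H) \<phi> = \<phi> \<one>\<^bsub>A\<^esub>"
  by (simp_all add: dual_right_pre_def sd_def td_def fun_eq_iff)

lemma sd_closed [simp]: "l \<in> carrier Bs \<Longrightarrow> sd l \<in> carrier D"
  unfolding sd_def by (rule D_I) (simp_all add: ring_distr)

lemma td_closed [simp]: "l \<in> carrier Bs \<Longrightarrow> td l \<in> carrier D"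
  unfolding td_def by (rule D_I) (simp_all add: source.R.r_distr source.R.m_assoc)

lemma ac_sd [simp]:
  assumes "l \<in> carrier Bs" "a \<in> carrier A"
  shows "ac a (sd l) = a \<otimes>\<^bsub>A\<^esub> src H l"
proof -
  have b: "bal addA (\<lambda>x y. src H (counit H x) \<otimes>\<^bsub>A\<^esub> y)"
    by (rule balI) (simp_all add: ring_distr)
  have "ac a (sd l) = SL addA a (\<lambda>x y. src H (counit H (x \<otimes>\<^bsub>A\<^esub> src H l)) \<otimes>\<^bsub>A\<^esub> y)"
    unfolding ac_eq[OF sd_closed[OF assms(1)] assms(2)]
    by (rule SL_cong[OF assms(2)]) (simp add: sd_def)
  also have "\<dots> = SL addA (a \<otimes>\<^bsub>A\<^esub> src H l) (\<lambda>x y. src H (counit H x) \<otimes>\<^bsub>A\<^esub> y)"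
    by (rule SL_src'[OF cg_add(1) b assms, symmetric])
  finally show ?thesis using SL_counit1[of "a \<otimes>\<^bsub>A\<^esub> src H l", folded addA_def] assms by simp
qed

lemma ac_td [simp]:
  assumes "l \<in> carrier Bs" "a \<in> carrier A"
  shows "ac a (td l) = src H l \<otimes>\<^bsub>A\<^esub> a"
proof -
  have "ac a (td l) = SL addA a (\<lambda>x y. src H l \<otimes>\<^bsub>A\<^esub> (src H (counit H x) \<otimes>\<^bsub>A\<^esub> y))"
    unfolding ac_eq[OF td_closed[OF assms(1)] assms(2)]
    by (rule SL_cong[OF assms(2)]) (simp add: td_def assms source.S.m_assoc)
  also have "\<dots> = src H l \<otimes>\<^bsub>A\<^esub> SL addA a (\<lambda>x y. src H (counit H x) \<otimes>\<^bsub>A\<^esub> y)"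
    by (rule SL_push[where h = "\<lambda>w. src H l \<otimes>\<^bsub>A\<^esub> w" and G = addA, symmetric]) (simp_all add: assms ring_distr)
  finally show ?thesis using SL_counit1[OF assms(2), folded addA_def] assms by simp
qed

lemma mult_sd_apply [simp]:
  assumes "\<phi> \<in> carrier D" "l \<in> carrier Bs" "a \<in> carrier A"
  shows "(\<phi> \<otimes>\<^bsub>D\<^esub> sd l) a = \<phi> (a \<otimes>\<^bsub>A\<^esub> tgt H l)"
proof -
  have b: "bal addB (\<lambda>x y. counit H (src H (\<phi> x) \<otimes>\<^bsub>A\<^esub> y))"
    by (rule balI) (simp_all add: assms ring_distr source.R.l_distr source.R.r_distr source.R.m_assoc)
  have "(\<phi> \<otimes>\<^bsub>D\<^esub> sd l) a = counit H (ac a \<phi> \<otimes>\<^bsub>A\<^esub> src H l)"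
    using assms by (simp add: sd_def)
  also have "\<dots> = SL addB a (\<lambda>x y. counit H (src H (\<phi> x) \<otimes>\<^bsub>A\<^esub> y \<otimes>\<^bsub>A\<^esub> src H l))"
    unfolding ac_eq[OF assms(1,3)]
    by (rule SL_push[where h = "\<lambda>w. counit H (w \<otimes>\<^bsub>A\<^esub> src H l)" and G = addA]) (simp_all add: assms ring_distr)
  also have "\<dots> = SL addB a (\<lambda>x y. counit H (src H (\<phi> x) \<otimes>\<^bsub>A\<^esub> (y \<otimes>\<^bsub>A\<^esub> src H l)))"
    by (rule SL_cong) (simp_all add: assms source.S.m_assoc)
  also have "\<dots> = SL addB a (\<lambda>x y. counit H (src H (\<phi> (x \<otimes>\<^bsub>A\<^esub> tgt H l)) \<otimes>\<^bsub>A\<^esub> y))"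
    by (rule SL_takeuchi[OF cg_add(2) b assms(2,3), symmetric])
  also have "\<dots> = SL addB a (\<lambda>x y. \<phi> (tgt H (counit H y) \<otimes>\<^bsub>A\<^esub> x \<otimes>\<^bsub>A\<^esub> tgt H l))"
    by (rule SL_cong) (simp_all add: assms source.S.m_assoc)
  also have "\<dots> = \<phi> (SL addA a (\<lambda>x y. tgt H (counit H y) \<otimes>\<^bsub>A\<^esub> x) \<otimes>\<^bsub>A\<^esub> tgt H l)"
    by (rule SL_push[where h = "\<lambda>w. \<phi> (w \<otimes>\<^bsub>A\<^esub> tgt H l)" and G = addA, symmetric]) (simp_all add: assms ring_distr)
  also have "\<dots> = \<phi> (a \<otimes>\<^bsub>A\<^esub> tgt H l)" using SL_counit2[OF assms(3), folded addA_def] by simp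
  finally show ?thesis .
qed

lemma mult_td_apply [simp]:
  "\<lbrakk>\<phi> \<in> carrier D; l \<in> carrier Bs; a \<in> carrier A\<rbrakk> \<Longrightarrow> (\<phi> \<otimes>\<^bsub>D\<^esub> td l) a = l \<otimes>\<^bsub>Bs\<^esub> \<phi> a"
  by (simp add: td_def counit_ac)

lemma sd_hom: "sd \<in> ring_hom Bs D"
  by (rule ring_hom_memI; (rule D_eqI)?)
    (simp_all add: D_mult_closed D_add_closed D_one_closed, simp_all add: sd_def ring_distr)

lemma td_hom: "td \<in> ring_hom (opposite_ring Bs) D"
  by (rule ring_hom_memI; (rule D_eqI)?)
    (simp_all add: D_mult_closed D_add_closed D_one_closed opposite_ring_def,
      simp_all add: td_def source.R.l_distr source.R.m_assoc)

lemma sd_td_commute: "\<lbrakk>l \<in> carrier Bs; m \<in> carrier Bs\<rbrakk> \<Longrightarrow> sd l \<otimes>\<^bsub>D\<^esub> td m = td m \<otimes>\<^bsub>D\<^esub> sd l"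
  by (rule D_eqI) (simp_all add: D_mult_closed, simp_all add: sd_def td_def source.S.m_assoc source.R.m_assoc)

end

section \<open>The dual right bialgebroid\<close>

text \<open>The two facts about the integral on which the dual right bialgebroid rests.
  \<open>basis\<close> says that the first legs of \<open>ell\<close>, with the functionals
  belonging to its second legs, form a dual basis of \<open>A\<close> for the action by
  \<open>tgt\<close>.\<close>

locale left_bialgebroid_dual_basis = left_bialgebroid H for H :: "('a, 'b) bialgebroid" +
  fixes ell :: 'a
  assumes ell [simp]: "ell \<in> carrier A"
    and ell_bij: "bij_betw (ac ell) (carrier D) (carrier A)"
    and basis: "a \<in> carrier A \<Longrightarrow> SL addA ell (\<lambda>x y. tgt H (ell_L_inv H ell y a) \<otimes>\<^bsub>A\<^esub> x) = a"
begin

sublocale D: ring D by (rule ring_D)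

abbreviation "psi \<equiv> ell_L_inv H ell"
abbreviation "hf \<equiv> harpoon_fun A"
abbreviation "ractD \<equiv> mult_right D sd"
abbreviation "lactD \<equiv> (\<lambda>l \<phi>. mult_right D td \<phi> l)"

lemma psi [simp]: "y \<in> carrier A \<Longrightarrow> psi y \<in> carrier D" "y \<in> carrier A \<Longrightarrow> ac ell (psi y) = y"
proof -
  assume y: "y \<in> carrier A"
  have e: "ell_L H ell = ac ell" by (simp add: ell_L_def fun_eq_iff)
  have "y \<in> ac ell ` carrier D" using y bij_betw_imp_surj_on[OF ell_bij] by simp
  then show "psi y \<in> carrier D" "ac ell (psi y) = y"
    unfolding ell_L_inv_def e by (rule inv_into_into, rule f_inv_into_f)
qed

lemma psi_eqI: "\<lbrakk>\<phi> \<in> carrier D; ac ell \<phi> = y\<rbrakk> \<Longrightarrow> psi y = \<phi>"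
  using ell_bij psi[of y] ac_closed[of \<phi> ell] by (auto simp: bij_betw_def inj_on_def)

lemma ac_add_right:
  assumes "\<phi> \<in> carrier D" "\<psi> \<in> carrier D" "a \<in> carrier A"
  shows "ac a (\<phi> \<oplus>\<^bsub>D\<^esub> \<psi>) = ac a \<phi> \<oplus>\<^bsub>A\<^esub> ac a \<psi>"
proof -
  have "ac a (\<phi> \<oplus>\<^bsub>D\<^esub> \<psi>) = SL addA a (\<lambda>x y. src H (\<phi> x) \<otimes>\<^bsub>A\<^esub> y \<oplus>\<^bsub>A\<^esub> src H (\<psi> x) \<otimes>\<^bsub>A\<^esub> y)"
    unfolding ac_eq[OF D_add_closed[OF assms(1,2)] assms(3)]
    by (rule SL_cong[OF assms(3)]) (simp add: assms ring_distr)
  then show ?thesis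
    unfolding ac_eq[OF assms(1,3)] ac_eq[OF assms(2,3)]
    using SL_mult[OF cg_add(1) assms(3), of "\<lambda>x y. src H (\<phi> x) \<otimes>\<^bsub>A\<^esub> y" "\<lambda>x y. src H (\<psi> x) \<otimes>\<^bsub>A\<^esub> y"]
    by (simp add: assms)
qed

lemma psi_add [simp]: "\<lbrakk>y \<in> carrier A; z \<in> carrier A\<rbrakk> \<Longrightarrow> psi (y \<oplus>\<^bsub>A\<^esub> z) = psi y \<oplus>\<^bsub>D\<^esub> psi z"
  by (rule psi_eqI) (simp_all add: D_add_closed ac_add_right)

lemma psi_src: "\<lbrakk>y \<in> carrier A; l \<in> carrier Bs\<rbrakk> \<Longrightarrow> psi (src H l \<otimes>\<^bsub>A\<^esub> y) = psi y \<otimes>\<^bsub>D\<^esub> td l"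
  by (rule psi_eqI) (simp_all add: D_mult_closed ac_ac[symmetric])

lemma hf_closed [simp]: "\<lbrakk>x \<in> carrier A; \<phi> \<in> carrier D\<rbrakk> \<Longrightarrow> hf x \<phi> \<in> carrier D"
  unfolding harpoon_fun_def by (rule D_I) (simp_all add: ring_distr)

lemma hf_apply [simp]: "b \<in> carrier A \<Longrightarrow> hf x \<phi> b = \<phi> (b \<otimes>\<^bsub>A\<^esub> x)"
  by (simp add: harpoon_fun_def)

lemma hf_add [simp]: "\<lbrakk>x \<in> carrier A; x' \<in> carrier A; \<phi> \<in> carrier D\<rbrakk> \<Longrightarrow> hf (x \<oplus>\<^bsub>A\<^esub> x') \<phi> = hf x \<phi> \<oplus>\<^bsub>D\<^esub> hf x' \<phi>"
  by (rule D_eqI) (simp_all add: D_add_closed ring_distr)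

lemma hf_add_right: "\<lbrakk>x \<in> carrier A; \<phi> \<in> carrier D; \<psi> \<in> carrier D\<rbrakk> \<Longrightarrow> hf x (\<phi> \<oplus>\<^bsub>D\<^esub> \<psi>) = hf x \<phi> \<oplus>\<^bsub>D\<^esub> hf x \<psi>"
  by (rule D_eqI) (simp_all add: D_add_closed)

lemma hf_tgt: "\<lbrakk>x \<in> carrier A; l \<in> carrier Bs; \<phi> \<in> carrier D\<rbrakk> \<Longrightarrow> hf (tgt H l \<otimes>\<^bsub>A\<^esub> x) \<phi> = hf x \<phi> \<otimes>\<^bsub>D\<^esub> sd l"
  by (rule D_eqI) (simp_all add: D_mult_closed ring_distr del: D_apply)

lemma hf_td: "\<lbrakk>x \<in> carrier A; l \<in> carrier Bs; \<phi> \<in> carrier D\<rbrakk> \<Longrightarrow> hf x (\<phi> \<otimes>\<^bsub>D\<^esub> td l) = hf x \<phi> \<otimes>\<^bsub>D\<^esub> td l"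
  by (rule D_eqI) (simp_all add: D_mult_closed del: D_apply)

lemma hf_hf: "\<lbrakk>x \<in> carrier A; x' \<in> carrier A; \<phi> \<in> carrier D\<rbrakk> \<Longrightarrow> hf x' (hf x \<phi>) = hf (x' \<otimes>\<^bsub>A\<^esub> x) \<phi>"
  by (rule D_eqI) (simp_all add: ring_distr)

sublocale MD: bimodule Bs D lactD ractD
  by (rule bimodule_right[OF source.R.ring_axioms ring_D sd_hom td_hom sd_td_commute])

sublocale TD: tensor_setting Bs D ractD lactD D
  by unfold_locales (rule MD.ract_closed MD.lact_closed; assumption)+

sublocale TD3: tensor3_setting Bs Bs D ractD lactD D ractD lactD D
  by unfold_locales (rule MD.ract_closed MD.lact_closed; assumption)+

abbreviation "Hd \<equiv> dual_right H ell"

lemma Hd_sels [simp]: "total_ring Hd = D" "base_ring Hd = Bs" "src Hd = sd" "tgt Hd = td" "counit Hd \<phi> = \<phi> \<one>\<^bsub>A\<^esub>"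
  using dual_right_pre_sels by (simp_all add: dual_right_def Let_def)

lemma right_tensor_eq': "right_tensor Hd = TD.T" "right_tensor (dual_right_pre H) = TD.T"
  by (simp_all add: right_tensor_def)

lemma bal_dual:
  assumes "TD.bal G f" "\<phi> \<in> carrier D"
  shows "bal G (\<lambda>x y. f (hf x \<phi>) (psi y))"
proof (rule balI)
  fix x l y assume h: "x \<in> carrier A" "l \<in> carrier Bs" "y \<in> carrier A"
  show "f (hf (tgt H l \<otimes>\<^bsub>A\<^esub> x) \<phi>) (psi y) = f (hf x \<phi>) (psi (src H l \<otimes>\<^bsub>A\<^esub> y))"
    using balancedD(4)[OF assms(1), of "hf x \<phi>" l "psi y"] h assms(2)
    by (simp add: hf_tgt psi_src mult_right_def)
qed (simp_all add: balancedD(1-3)[OF assms(1)] assms(2))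

lemma comult_Hd: "\<phi> \<in> carrier D \<Longrightarrow> comult Hd \<phi> = SL TD.T ell (\<lambda>x y. tens TD.T (hf x \<phi>, psi y))"
  using SL_tlift[OF TD.comm_group_T bal_dual[OF TD.bal_tens] ell, of \<phi>]
  by (simp add: dual_right_def Let_def right_tensor_eq')

lemma comult_Hd_closed: "\<phi> \<in> carrier D \<Longrightarrow> comult Hd \<phi> \<in> carrier TD.T"
  unfolding comult_Hd by (intro SL_closed TD.comm_group_T TD.tens_cl ell) simp_all

lemma tlift_SL_tens:
  assumes "comm_group G" "TD.bal G f" "a \<in> carrier A"
    "\<And>x y. \<lbrakk>x \<in> carrier A; y \<in> carrier A\<rbrakk> \<Longrightarrow> p x y \<in> carrier D"
    "\<And>x y. \<lbrakk>x \<in> carrier A; y \<in> carrier A\<rbrakk> \<Longrightarrow> q x y \<in> carrier D"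
  shows "tlift G (\<lambda>(u, v). f u v) (SL TD.T a (\<lambda>x y. tens TD.T (p x y, q x y))) = SL G a (\<lambda>x y. f (p x y) (q x y))"
proof -
  have "tlift G (\<lambda>(u, v). f u v) (SL TD.T a (\<lambda>x y. tens TD.T (p x y, q x y)))
      = SL G a (\<lambda>x y. tlift G (\<lambda>(u, v). f u v) (tens TD.T (p x y, q x y)))"
    by (rule SL_hom[OF TD.tlift_hom[OF assms(1,2)] TD.comm_group_T assms(1,3)]) (simp add: TD.tens_cl assms(4,5))
  also have "\<dots> = SL G a (\<lambda>x y. f (p x y) (q x y))"
    by (rule SL_cong[OF assms(3)]) (simp add: TD.tlift_tens[OF assms(1,2)] assms(4,5))
  finally show ?thesis .
qed

lemma tlift_Hd:
  assumes "comm_group G" "TD.bal G f" "\<phi> \<in> carrier D"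
  shows "tlift G (\<lambda>(u, v). f u v) (comult Hd \<phi>) = SL G ell (\<lambda>x y. f (hf x \<phi>) (psi y))"
  unfolding comult_Hd[OF assms(3)] by (rule tlift_SL_tens[OF assms(1,2) ell]) (simp_all add: assms(3))

section \<open>Expansion in the dual basis and evaluation of tensors\<close>

definition "addD = add_monoid D"

lemma addD_simps [simp]: "carrier addD = carrier D" "\<phi> \<otimes>\<^bsub>addD\<^esub> \<psi> = \<phi> \<oplus>\<^bsub>D\<^esub> \<psi>"
  by (simp_all add: addD_def)

lemma cg_addD [simp]: "comm_group addD"
  unfolding addD_def by (rule D.a_comm_group)

lemma SL_addD_apply:
  assumes "a \<in> carrier A" "b \<in> carrier A" "\<And>x y. \<lbrakk>x \<in> carrier A; y \<in> carrier A\<rbrakk> \<Longrightarrow> p x y \<in> carrier D"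
  shows "(SL addD a p) b = SL addB a (\<lambda>x y. p x y b)"
  by (rule SL_push[where h = "\<lambda>\<phi>. \<phi> b" and G = addD]) (simp_all add: assms)

text \<open>The transpose of \<open>basis\<close>: evaluated at \<open>a\<close>, the sum is
  \<open>\<chi>\<close> applied to the expansion of \<open>a\<close>.\<close>

lemma expand:
  assumes "\<chi> \<in> carrier D"
  shows "SL addD ell (\<lambda>x y. psi y \<otimes>\<^bsub>D\<^esub> td (\<chi> x)) = \<chi>"
proof (rule D_eqI)
  show "SL addD ell (\<lambda>x y. psi y \<otimes>\<^bsub>D\<^esub> td (\<chi> x)) \<in> carrier D"
    using SL_closed[OF cg_addD ell, of "\<lambda>x y. psi y \<otimes>\<^bsub>D\<^esub> td (\<chi> x)"] assms by (simp add: D_mult_closed)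
  fix a assume a: "a \<in> carrier A"
  have "(SL addD ell (\<lambda>x y. psi y \<otimes>\<^bsub>D\<^esub> td (\<chi> x))) a = SL addB ell (\<lambda>x y. (psi y \<otimes>\<^bsub>D\<^esub> td (\<chi> x)) a)"
    by (rule SL_addD_apply) (simp_all add: a assms D_mult_closed)
  also have "\<dots> = SL addB ell (\<lambda>x y. \<chi> (tgt H (psi y a) \<otimes>\<^bsub>A\<^esub> x))"
    by (rule SL_cong) (simp_all add: a assms del: D_apply)
  also have "\<dots> = \<chi> (SL addA ell (\<lambda>x y. tgt H (psi y a) \<otimes>\<^bsub>A\<^esub> x))"
    by (rule SL_push[where h = \<chi> and G = addA, symmetric]) (simp_all add: a assms)
  finally show "(SL addD ell (\<lambda>x y. psi y \<otimes>\<^bsub>D\<^esub> td (\<chi> x))) a = \<chi> a" by (simp add: basis a)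
qed (rule assms)

text \<open>A normal form for tensors: the second factor is expanded in the dual basis and its
  coefficients are moved across to the first factor.\<close>

lemma bal_expand:
  assumes "comm_group G" "TD.bal G f" "\<phi> \<in> carrier D" "\<chi> \<in> carrier D"
  shows "f \<phi> \<chi> = SL G ell (\<lambda>x y. f (\<phi> \<otimes>\<^bsub>D\<^esub> sd (\<chi> x)) (psi y))"
proof -
  have "f \<phi> (SL addD ell (\<lambda>x y. psi y \<otimes>\<^bsub>D\<^esub> td (\<chi> x))) = SL G ell (\<lambda>x y. f \<phi> (psi y \<otimes>\<^bsub>D\<^esub> td (\<chi> x)))"
    by (rule SL_push[where h = "f \<phi>" and G = addD]) (simp_all add: assms D_mult_closed balancedD(1,3)[OF assms(2)])
  also have "\<dots> = SL G ell (\<lambda>x y. f (\<phi> \<otimes>\<^bsub>D\<^esub> sd (\<chi> x)) (psi y))"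
    by (rule SL_cong) (simp_all add: assms balancedD(4)[OF assms(2), unfolded mult_right_def])
  finally show ?thesis by (simp add: expand assms(4))
qed

lemma bal_ev:
  assumes "a \<in> carrier A" "b \<in> carrier A"
  shows "TD.bal addB (\<lambda>\<phi> \<chi>. \<phi> (a \<otimes>\<^bsub>A\<^esub> tgt H (\<chi> b)))"
  by (rule balancedI)
    (simp_all add: assms mult_right_def D_mult_closed ring_distr del: D_apply(1))

text \<open>
  By the dual basis, elements of the tensor square of the dual are separated by the evaluations
  \<open>\<phi> \<otimes> \<chi> \<mapsto> \<phi> (a t (\<chi> b))\<close>.
\<close>

lemma tensor_eqI:
  assumes W: "W \<in> carrier TD.T" and W': "W' \<in> carrier TD.T"
    and eq: "\<And>a b. \<lbrakk>a \<in> carrier A; b \<in> carrier A\<rbrakk> \<Longrightarrow>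
      tlift addB (\<lambda>(\<phi>, \<chi>). \<phi> (a \<otimes>\<^bsub>A\<^esub> tgt H (\<chi> b))) W = tlift addB (\<lambda>(\<phi>, \<chi>). \<phi> (a \<otimes>\<^bsub>A\<^esub> tgt H (\<chi> b))) W'"
  shows "W = W'"
proof -
  \<comment> \<open>\<open>E W x\<close> evaluates the second tensor factor at \<open>x\<close> and
    lets the result act on the first factor through \<open>sd\<close>. By \<open>bal_expand\<close>
    the tensors of \<open>E W x\<close> with \<open>psi y\<close>, summed over the coproduct of
    \<open>ell\<close>, give back \<open>W\<close>.\<close>
  define E where "E W x = (\<lambda>a\<in>carrier A. tlift addB (\<lambda>(\<phi>, \<chi>). \<phi> (a \<otimes>\<^bsub>A\<^esub> tgt H (\<chi> x))) W)"
    for W :: "(('a \<Rightarrow> 'b) \<times> ('a \<Rightarrow> 'b) \<Rightarrow>\<^sub>0 int) set" and x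
  have *: "SL TD.T ell (\<lambda>x y. tens TD.T (E W x, psi y)) = W" if W: "W \<in> carrier TD.T" for W
  proof -
    obtain xs where xs: "set xs \<subseteq> carrier D \<times> carrier D" "W = lsum TD.T (tens TD.T) xs"
      using TD.rep[OF W] by blast
    interpret T: comm_group TD.T by (rule TD.comm_group_T)
    interpret addD: comm_group addD by (rule cg_addD)
    have EW: "E W x = lsum addD (\<lambda>(\<phi>, \<chi>). \<phi> \<otimes>\<^bsub>D\<^esub> sd (\<chi> x)) xs" (is "_ = ?l") if x: "x \<in> carrier A" for x
    proof -
      have cl: "?l \<in> carrier D"
        using addD.lsum_closed[of xs "\<lambda>(\<phi>, \<chi>). \<phi> \<otimes>\<^bsub>D\<^esub> sd (\<chi> x)"] xs(1) x
        by (auto simp: D_mult_closed subset_iff)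
      have "E W x a = ?l a" if a: "a \<in> carrier A" for a
      proof -
        have "?l a = lsum addB (\<lambda>p. (case p of (\<phi>, \<chi>) \<Rightarrow> \<phi> \<otimes>\<^bsub>D\<^esub> sd (\<chi> x)) a) xs"
          by (rule hom_lsum[where h = "\<lambda>\<phi>. \<phi> a"])
            (use xs(1) a x in \<open>auto simp: hom_def D_mult_closed subset_iff
              intro!: comm_group.axioms(2) cg_addD cg_add simp del: D_apply(1)\<close>)
        also have "\<dots> = lsum addB (\<lambda>(\<phi>, \<chi>). \<phi> (a \<otimes>\<^bsub>A\<^esub> tgt H (\<chi> x))) xs"
          by (rule lsum_cong) (use xs(1) a x in \<open>auto simp del: D_apply(1)\<close>)
        also have "\<dots> = E W x a"
          using TD.tlift_lsum[OF cg_add(2) bal_ev[OF a x] xs(1)] a by (simp add: E_def xs(2))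
        finally show ?thesis by (rule sym)
      qed
      then show ?thesis
        by (intro extensionalityI[of _ "carrier A"])
          (use cl in \<open>auto simp: E_def lower_star_def right_dual_def\<close>)
    qed
    have "SL TD.T ell (\<lambda>x y. tens TD.T (E W x, psi y))
        = SL TD.T ell (\<lambda>x y. lsum TD.T (\<lambda>(\<phi>, \<chi>). tens TD.T (\<phi> \<otimes>\<^bsub>D\<^esub> sd (\<chi> x), psi y)) xs)"
    proof (rule SL_cong[OF ell])
      fix x y assume h: "x \<in> carrier A" "y \<in> carrier A"
      have "tens TD.T (lsum addD (\<lambda>(\<phi>, \<chi>). \<phi> \<otimes>\<^bsub>D\<^esub> sd (\<chi> x)) xs, psi y)
          = lsum TD.T (\<lambda>p. tens TD.T (case p of (\<phi>, \<chi>) \<Rightarrow> \<phi> \<otimes>\<^bsub>D\<^esub> sd (\<chi> x), psi y)) xs"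
        by (rule hom_lsum[where h = "\<lambda>\<phi>. tens TD.T (\<phi>, psi y)"])
          (use xs(1) h in \<open>auto simp: hom_def D_mult_closed subset_iff TD.tens_cl balancedD(2)[OF TD.bal_tens]
            intro!: comm_group.axioms(2) cg_addD TD.comm_group_T\<close>)
      also have "\<dots> = lsum TD.T (\<lambda>(\<phi>, \<chi>). tens TD.T (\<phi> \<otimes>\<^bsub>D\<^esub> sd (\<chi> x), psi y)) xs"
        by (rule lsum_cong) auto
      finally show "tens TD.T (E W x, psi y) = \<dots>" by (simp add: EW h)
    qed
    also have "\<dots> = lsum TD.T (\<lambda>p. SL TD.T ell (\<lambda>x y. case p of (\<phi>, \<chi>) \<Rightarrow> tens TD.T (\<phi> \<otimes>\<^bsub>D\<^esub> sd (\<chi> x), psi y))) xs"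
      by (rule SL_swap[OF TD.comm_group_T ell])
        (use xs(1) in \<open>auto simp: subset_iff D_mult_closed intro!: TD.tens_cl\<close>)
    also have "\<dots> = lsum TD.T (tens TD.T) xs"
    proof (rule lsum_cong)
      fix p assume "p \<in> set xs"
      then obtain \<phi> \<chi> where p: "p = (\<phi>, \<chi>)" "\<phi> \<in> carrier D" "\<chi> \<in> carrier D" using xs(1) by blast
      show "SL TD.T ell (\<lambda>x y. case p of (\<phi>, \<chi>) \<Rightarrow> tens TD.T (\<phi> \<otimes>\<^bsub>D\<^esub> sd (\<chi> x), psi y)) = tens TD.T p"
        using bal_expand[OF TD.comm_group_T TD.bal_tens p(2,3)] by (simp add: p(1))
    qed
    finally show ?thesis by (simp add: xs(2))
  qed
  have "E W x = E W' x" if "x \<in> carrier A" for x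
    unfolding E_def by (rule restrict_ext) (rule eq, assumption, rule that)
  then have "SL TD.T ell (\<lambda>x y. tens TD.T (E W x, psi y)) = SL TD.T ell (\<lambda>x y. tens TD.T (E W' x, psi y))"
    by (intro SL_cong ell) simp
  then show ?thesis by (simp add: * W W')
qed

text \<open>The sum stands to the right of \<open>a\<close> inside \<open>\<phi>\<close>, where
  \<open>basis\<close> rebuilds \<open>b\<close>.\<close>

lemma ev_comult:
  assumes "\<phi> \<in> carrier D" "a \<in> carrier A" "b \<in> carrier A"
  shows "SL addB ell (\<lambda>x y. hf x \<phi> (a \<otimes>\<^bsub>A\<^esub> tgt H (psi y b))) = \<phi> (a \<otimes>\<^bsub>A\<^esub> b)"
proof -
  have "SL addB ell (\<lambda>x y. hf x \<phi> (a \<otimes>\<^bsub>A\<^esub> tgt H (psi y b))) = SL addB ell (\<lambda>x y. \<phi> (a \<otimes>\<^bsub>A\<^esub> (tgt H (psi y b) \<otimes>\<^bsub>A\<^esub> x)))"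
    by (rule SL_cong) (simp_all add: assms ring_distr)
  also have "\<dots> = \<phi> (a \<otimes>\<^bsub>A\<^esub> SL addA ell (\<lambda>x y. tgt H (psi y b) \<otimes>\<^bsub>A\<^esub> x))"
    by (rule SL_push[where h = "\<lambda>w. \<phi> (a \<otimes>\<^bsub>A\<^esub> w)" and G = addA, symmetric]) (simp_all add: assms ring_distr)
  finally show ?thesis by (simp add: basis assms)
qed

text \<open>Linearity of the comultiplication on its second leg, compared by evaluation, where it
  amounts to associativity of the product of \<open>a\<close>, \<open>b\<close> and
  \<open>tgt H l\<close>.\<close>

lemma SL_ract:
  assumes "comm_group G" "TD.bal G f" "\<phi> \<in> carrier D" "l \<in> carrier Bs"
  shows "SL G ell (\<lambda>x y. f (hf x (\<phi> \<otimes>\<^bsub>D\<^esub> sd l)) (psi y)) = SL G ell (\<lambda>x y. f (hf x \<phi>) (psi y \<otimes>\<^bsub>D\<^esub> sd l))"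
proof -
  let ?W = "SL TD.T ell (\<lambda>x y. tens TD.T (hf x (\<phi> \<otimes>\<^bsub>D\<^esub> sd l), psi y))"
  let ?W' = "SL TD.T ell (\<lambda>x y. tens TD.T (hf x \<phi>, psi y \<otimes>\<^bsub>D\<^esub> sd l))"
  have "?W = ?W'"
  proof (rule tensor_eqI)
    fix a b assume ab: "a \<in> carrier A" "b \<in> carrier A"
    have "tlift addB (\<lambda>(\<phi>, \<chi>). \<phi> (a \<otimes>\<^bsub>A\<^esub> tgt H (\<chi> b))) ?W
        = SL addB ell (\<lambda>x y. hf x (\<phi> \<otimes>\<^bsub>D\<^esub> sd l) (a \<otimes>\<^bsub>A\<^esub> tgt H (psi y b)))"
      by (rule tlift_SL_tens[OF cg_add(2) bal_ev[OF ab] ell]) (simp_all add: assms D_mult_closed)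
    also have "\<dots> = (\<phi> \<otimes>\<^bsub>D\<^esub> sd l) (a \<otimes>\<^bsub>A\<^esub> b)"
      by (rule ev_comult) (simp_all add: assms ab D_mult_closed)
    also have "\<dots> = \<phi> (a \<otimes>\<^bsub>A\<^esub> (b \<otimes>\<^bsub>A\<^esub> tgt H l))"
      using assms ab by (simp add: source.S.m_assoc del: D_apply(1))
    also have "\<dots> = SL addB ell (\<lambda>x y. hf x \<phi> (a \<otimes>\<^bsub>A\<^esub> tgt H (psi y (b \<otimes>\<^bsub>A\<^esub> tgt H l))))"
      by (rule ev_comult[symmetric]) (simp_all add: assms ab)
    also have "\<dots> = SL addB ell (\<lambda>x y. hf x \<phi> (a \<otimes>\<^bsub>A\<^esub> tgt H ((psi y \<otimes>\<^bsub>D\<^esub> sd l) b)))"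
      by (rule SL_cong) (simp_all add: assms ab del: D_apply(1))
    also have "\<dots> = tlift addB (\<lambda>(\<phi>, \<chi>). \<phi> (a \<otimes>\<^bsub>A\<^esub> tgt H (\<chi> b))) ?W'"
      by (rule tlift_SL_tens[OF cg_add(2) bal_ev[OF ab] ell, symmetric]) (simp_all add: assms D_mult_closed)
    finally show "tlift addB (\<lambda>(\<phi>, \<chi>). \<phi> (a \<otimes>\<^bsub>A\<^esub> tgt H (\<chi> b))) ?W = tlift addB (\<lambda>(\<phi>, \<chi>). \<phi> (a \<otimes>\<^bsub>A\<^esub> tgt H (\<chi> b))) ?W'" .
  qed (intro SL_closed TD.comm_group_T TD.tens_cl ell; simp add: assms D_mult_closed)+
  then have "tlift G (\<lambda>(u, v). f u v) ?W = tlift G (\<lambda>(u, v). f u v) ?W'" by simp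
  then show ?thesis
    using tlift_SL_tens[OF assms(1,2) ell, of "\<lambda>x y. hf x (\<phi> \<otimes>\<^bsub>D\<^esub> sd l)" "\<lambda>x y. psi y"]
      tlift_SL_tens[OF assms(1,2) ell, of "\<lambda>x y. hf x \<phi>" "\<lambda>x y. psi y \<otimes>\<^bsub>D\<^esub> sd l"]
    by (simp add: assms D_mult_closed)
qed

text \<open>Evaluated at \<open>a\<close> and \<open>b\<close>, both sides are \<open>\<phi>\<close>
  at the product of \<open>a\<close>, \<open>src H l\<close> and \<open>b\<close>.\<close>

lemma SL_takeuchi_dual:
  assumes "comm_group G" "TD.bal G f" "\<phi> \<in> carrier D" "l \<in> carrier Bs"
  shows "SL G ell (\<lambda>x y. f (sd l \<otimes>\<^bsub>D\<^esub> hf x \<phi>) (psi y)) = SL G ell (\<lambda>x y. f (hf x \<phi>) (td l \<otimes>\<^bsub>D\<^esub> psi y))"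
proof -
  let ?W = "SL TD.T ell (\<lambda>x y. tens TD.T (sd l \<otimes>\<^bsub>D\<^esub> hf x \<phi>, psi y))"
  let ?W' = "SL TD.T ell (\<lambda>x y. tens TD.T (hf x \<phi>, td l \<otimes>\<^bsub>D\<^esub> psi y))"
  have "?W = ?W'"
  proof (rule tensor_eqI)
    fix a b assume ab: "a \<in> carrier A" "b \<in> carrier A"
    have "tlift addB (\<lambda>(\<phi>, \<chi>). \<phi> (a \<otimes>\<^bsub>A\<^esub> tgt H (\<chi> b))) ?W
        = SL addB ell (\<lambda>x y. (sd l \<otimes>\<^bsub>D\<^esub> hf x \<phi>) (a \<otimes>\<^bsub>A\<^esub> tgt H (psi y b)))"
      by (rule tlift_SL_tens[OF cg_add(2) bal_ev[OF ab] ell]) (simp_all add: assms D_mult_closed)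
    also have "\<dots> = SL addB ell (\<lambda>x y. hf x \<phi> ((a \<otimes>\<^bsub>A\<^esub> src H l) \<otimes>\<^bsub>A\<^esub> tgt H (psi y b)))"
      by (rule SL_cong) (simp_all add: assms ab source.S.m_assoc src_tgt_commute)
    also have "\<dots> = \<phi> ((a \<otimes>\<^bsub>A\<^esub> src H l) \<otimes>\<^bsub>A\<^esub> b)"
      by (rule ev_comult) (simp_all add: assms ab)
    also have "\<dots> = \<phi> (a \<otimes>\<^bsub>A\<^esub> (src H l \<otimes>\<^bsub>A\<^esub> b))"
      using assms ab by (simp add: source.S.m_assoc)
    also have "\<dots> = SL addB ell (\<lambda>x y. hf x \<phi> (a \<otimes>\<^bsub>A\<^esub> tgt H (psi y (src H l \<otimes>\<^bsub>A\<^esub> b))))"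
      by (rule ev_comult[symmetric]) (simp_all add: assms ab)
    also have "\<dots> = SL addB ell (\<lambda>x y. hf x \<phi> (a \<otimes>\<^bsub>A\<^esub> tgt H ((td l \<otimes>\<^bsub>D\<^esub> psi y) b)))"
      by (rule SL_cong) (simp_all add: assms ab)
    also have "\<dots> = tlift addB (\<lambda>(\<phi>, \<chi>). \<phi> (a \<otimes>\<^bsub>A\<^esub> tgt H (\<chi> b))) ?W'"
      by (rule tlift_SL_tens[OF cg_add(2) bal_ev[OF ab] ell, symmetric]) (simp_all add: assms D_mult_closed)
    finally show "tlift addB (\<lambda>(\<phi>, \<chi>). \<phi> (a \<otimes>\<^bsub>A\<^esub> tgt H (\<chi> b))) ?W = tlift addB (\<lambda>(\<phi>, \<chi>). \<phi> (a \<otimes>\<^bsub>A\<^esub> tgt H (\<chi> b))) ?W'" .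
  qed (intro SL_closed TD.comm_group_T TD.tens_cl ell; simp add: assms D_mult_closed)+
  then have "tlift G (\<lambda>(u, v). f u v) ?W = tlift G (\<lambda>(u, v). f u v) ?W'" by simp
  then show ?thesis
    using tlift_SL_tens[OF assms(1,2) ell, of "\<lambda>x y. sd l \<otimes>\<^bsub>D\<^esub> hf x \<phi>" "\<lambda>x y. psi y"]
      tlift_SL_tens[OF assms(1,2) ell, of "\<lambda>x y. hf x \<phi>" "\<lambda>x y. td l \<otimes>\<^bsub>D\<^esub> psi y"]
    by (simp add: assms D_mult_closed)
qed

section \<open>The comonoid structure of the dual\<close>

lemma TD_bal_cong:
  assumes "TD.bal G g" "\<And>x y. \<lbrakk>x \<in> carrier D; y \<in> carrier D\<rbrakk> \<Longrightarrow> f x y = g x y"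
  shows "TD.bal G f"
  by (rule balancedI) (simp_all add: assms(2) balancedD[OF assms(1)] MD.lact_closed MD.ract_closed D_add_closed)

lemma TD_bal_map:
  assumes "TD.bal G f" "\<And>x. x \<in> carrier D \<Longrightarrow> g x \<in> carrier D" "\<And>x. x \<in> carrier D \<Longrightarrow> h x \<in> carrier D"
    "\<And>x y. \<lbrakk>x \<in> carrier D; y \<in> carrier D\<rbrakk> \<Longrightarrow> g (x \<oplus>\<^bsub>D\<^esub> y) = g x \<oplus>\<^bsub>D\<^esub> g y"
    "\<And>x y. \<lbrakk>x \<in> carrier D; y \<in> carrier D\<rbrakk> \<Longrightarrow> h (x \<oplus>\<^bsub>D\<^esub> y) = h x \<oplus>\<^bsub>D\<^esub> h y"
    "\<And>x b. \<lbrakk>x \<in> carrier D; b \<in> carrier Bs\<rbrakk> \<Longrightarrow> g (x \<otimes>\<^bsub>D\<^esub> sd b) = g x \<otimes>\<^bsub>D\<^esub> sd b"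
    "\<And>x b. \<lbrakk>x \<in> carrier D; b \<in> carrier Bs\<rbrakk> \<Longrightarrow> h (x \<otimes>\<^bsub>D\<^esub> td b) = h x \<otimes>\<^bsub>D\<^esub> td b"
  shows "TD.bal G (\<lambda>x y. f (g x) (h y))"
  by (rule balancedI)
    (use assms(2-) in \<open>simp_all add: mult_right_def balancedD(1-3)[OF assms(1)]
      balancedD(4)[OF assms(1), unfolded mult_right_def]\<close>)

lemmas D_distr = D.l_distr D.r_distr D.m_assoc

lemma td_mult: "\<lbrakk>l \<in> carrier Bs; m \<in> carrier Bs\<rbrakk> \<Longrightarrow> td (l \<otimes>\<^bsub>Bs\<^esub> m) = td m \<otimes>\<^bsub>D\<^esub> td l"
  and td_add: "\<lbrakk>l \<in> carrier Bs; m \<in> carrier Bs\<rbrakk> \<Longrightarrow> td (l \<oplus>\<^bsub>Bs\<^esub> m) = td l \<oplus>\<^bsub>D\<^esub> td m"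
  using ring_hom_mult[OF td_hom, of m l] ring_hom_add[OF td_hom, of l m]
  by (simp_all add: opposite_ring_def)

lemma sd_mult: "\<lbrakk>l \<in> carrier Bs; m \<in> carrier Bs\<rbrakk> \<Longrightarrow> sd (l \<otimes>\<^bsub>Bs\<^esub> m) = sd l \<otimes>\<^bsub>D\<^esub> sd m"
  and sd_add: "\<lbrakk>l \<in> carrier Bs; m \<in> carrier Bs\<rbrakk> \<Longrightarrow> sd (l \<oplus>\<^bsub>Bs\<^esub> m) = sd l \<oplus>\<^bsub>D\<^esub> sd m"
  using ring_hom_mult[OF sd_hom, of l m] ring_hom_add[OF sd_hom, of l m] by simp_all

lemma D_tgt_one [simp]: "\<lbrakk>\<phi> \<in> carrier D; l \<in> carrier Bs\<rbrakk> \<Longrightarrow> \<phi> (tgt H l) = \<phi> \<one>\<^bsub>A\<^esub> \<otimes>\<^bsub>Bs\<^esub> l"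
  using D_simps(3)[of \<phi> "\<one>\<^bsub>A\<^esub>" l] by simp

lemma hf_td': "\<lbrakk>x \<in> carrier A; l \<in> carrier Bs; \<phi> \<in> carrier D\<rbrakk> \<Longrightarrow> hf x (lactD l \<phi>) = lactD l (hf x \<phi>)"
  by (simp add: mult_right_def hf_td)

lemma bal_eps_left: "TD.bal addD (\<lambda>\<phi> \<psi>. lactD (\<phi> \<one>\<^bsub>A\<^esub>) \<psi>)"
proof (rule balancedI)
  fix \<phi> l \<psi> assume h: "\<phi> \<in> carrier D" "l \<in> carrier Bs" "\<psi> \<in> carrier D"
  show "lactD (ractD \<phi> l \<one>\<^bsub>A\<^esub>) \<psi> = lactD (\<phi> \<one>\<^bsub>A\<^esub>) (lactD l \<psi>)"
    using h by (simp add: mult_right_def td_mult D.m_assoc del: D_apply(1))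
qed (simp_all add: mult_right_def td_add D_distr)

lemma bal_eps_right: "TD.bal addD (\<lambda>\<phi> \<psi>. ractD \<phi> (\<psi> \<one>\<^bsub>A\<^esub>))"
  by (rule balancedI) (simp_all add: mult_right_def sd_add sd_mult D_distr del: D_apply(1))

lemma bal_T3_left:
  assumes "v \<in> carrier D"
  shows "TD.bal TD3.T3 (\<lambda>x y. tens TD3.T3 (x, y, v))"
  using TD3.bal3_tens assms unfolding balanced3_def by blast

lemma bal_T3_right:
  assumes "u \<in> carrier D"
  shows "TD.bal TD3.T3 (\<lambda>x y. tens TD3.T3 (u, x, y))"
  using TD3.bal3_tens assms unfolding balanced3_def by blast

text \<open>The middle factor \<open>hf x' (psi y)\<close> is expanded in the dual basis and its
  coefficients are moved into the first factor. There the sum over \<open>x\<close> and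
  \<open>y\<close> is an instance of \<open>basis\<close> and collapses, leaving the other
  bracketing.\<close>

lemma coassoc_dual:
  assumes "\<phi> \<in> carrier D"
  shows "SL TD3.T3 ell (\<lambda>x y. SL TD3.T3 ell (\<lambda>x' y'. tens TD3.T3 (hf x' (hf x \<phi>), psi y', psi y)))
    = SL TD3.T3 ell (\<lambda>x y. SL TD3.T3 ell (\<lambda>x' y'. tens TD3.T3 (hf x \<phi>, hf x' (psi y), psi y')))"
proof -
  let ?T = TD3.T3
  note cg = TD3.comm_group_T3
  have "SL ?T ell (\<lambda>x y. SL ?T ell (\<lambda>x' y'. tens ?T (hf x \<phi>, hf x' (psi y), psi y')))
      = SL ?T ell (\<lambda>x' y'. SL ?T ell (\<lambda>x y. tens ?T (hf x \<phi>, hf x' (psi y), psi y')))"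
    by (rule SL_SL_swap[OF cg ell ell]) (simp add: assms TD3.tens3_cl)
  also have "\<dots> = SL ?T ell (\<lambda>x' y'. SL ?T ell (\<lambda>u v. tens ?T (hf u (hf x' \<phi>), psi v, psi y')))"
  proof (rule SL_cong[OF ell])
    fix x' y' assume h: "x' \<in> carrier A" "y' \<in> carrier A"
    have "SL ?T ell (\<lambda>x y. tens ?T (hf x \<phi>, hf x' (psi y), psi y'))
        = SL ?T ell (\<lambda>x y. SL ?T ell (\<lambda>u v. tens ?T (hf (tgt H (psi y (u \<otimes>\<^bsub>A\<^esub> x')) \<otimes>\<^bsub>A\<^esub> x) \<phi>, psi v, psi y')))"
    proof (rule SL_cong[OF ell])
      fix x y assume g: "x \<in> carrier A" "y \<in> carrier A"
      have "tens ?T (hf x \<phi>, hf x' (psi y), psi y')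
          = SL ?T ell (\<lambda>u v. tens ?T (hf x \<phi> \<otimes>\<^bsub>D\<^esub> sd (hf x' (psi y) u), psi v, psi y'))"
        by (rule bal_expand[OF cg bal_T3_left]) (simp_all add: g h assms)
      also have "\<dots> = SL ?T ell (\<lambda>u v. tens ?T (hf (tgt H (psi y (u \<otimes>\<^bsub>A\<^esub> x')) \<otimes>\<^bsub>A\<^esub> x) \<phi>, psi v, psi y'))"
        by (rule SL_cong[OF ell]) (simp add: g h assms hf_tgt)
      finally show "tens ?T (hf x \<phi>, hf x' (psi y), psi y') = \<dots>" .
    qed
    also have "\<dots> = SL ?T ell (\<lambda>u v. SL ?T ell (\<lambda>x y. tens ?T (hf (tgt H (psi y (u \<otimes>\<^bsub>A\<^esub> x')) \<otimes>\<^bsub>A\<^esub> x) \<phi>, psi v, psi y')))"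
      by (rule SL_SL_swap[OF cg ell ell]) (simp add: assms h TD3.tens3_cl)
    also have "\<dots> = SL ?T ell (\<lambda>u v. tens ?T (hf u (hf x' \<phi>), psi v, psi y'))"
    proof (rule SL_cong[OF ell])
      fix u v assume g: "u \<in> carrier A" "v \<in> carrier A"
      have "SL ?T ell (\<lambda>x y. tens ?T (hf (tgt H (psi y (u \<otimes>\<^bsub>A\<^esub> x')) \<otimes>\<^bsub>A\<^esub> x) \<phi>, psi v, psi y'))
          = tens ?T (hf (SL addA ell (\<lambda>x y. tgt H (psi y (u \<otimes>\<^bsub>A\<^esub> x')) \<otimes>\<^bsub>A\<^esub> x)) \<phi>, psi v, psi y')"
        by (rule SL_push[where h = "\<lambda>w. tens ?T (hf w \<phi>, psi v, psi y')" and G = addA, symmetric])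
          (simp_all add: cg g h assms TD3.tens3_cl balancedD(2)[OF bal_T3_left])
      then show "SL ?T ell (\<lambda>x y. tens ?T (hf (tgt H (psi y (u \<otimes>\<^bsub>A\<^esub> x')) \<otimes>\<^bsub>A\<^esub> x) \<phi>, psi v, psi y'))
          = tens ?T (hf u (hf x' \<phi>), psi v, psi y')"
        by (simp add: basis g h assms hf_hf)
    qed
    finally show "SL ?T ell (\<lambda>x y. tens ?T (hf x \<phi>, hf x' (psi y), psi y'))
        = SL ?T ell (\<lambda>u v. tens ?T (hf u (hf x' \<phi>), psi v, psi y'))" .
  qed
  finally show ?thesis by (rule sym)
qed

lemma bal_coassoc1: "TD.bal TD3.T3 (\<lambda>u v. SL TD3.T3 ell (\<lambda>x y. tens TD3.T3 (hf x u, psi y, v)))"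
proof (rule balancedI)
  note cg = TD3.comm_group_T3
  fix u l v assume h: "u \<in> carrier D" "l \<in> carrier Bs" "v \<in> carrier D"
  have "SL TD3.T3 ell (\<lambda>x y. tens TD3.T3 (hf x (ractD u l), psi y, v))
      = SL TD3.T3 ell (\<lambda>x y. tens TD3.T3 (hf x u, ractD (psi y) l, v))"
    using SL_ract[OF cg bal_T3_left[OF h(3)] h(1,2)] by (simp only: mult_right_def[symmetric])
  also have "\<dots> = SL TD3.T3 ell (\<lambda>x y. tens TD3.T3 (hf x u, psi y, lactD l v))"
    by (rule SL_cong[OF ell]) (rule balancedD(4)[OF bal_T3_right]; simp add: h)
  finally show "SL TD3.T3 ell (\<lambda>x y. tens TD3.T3 (hf x (ractD u l), psi y, v))
      = SL TD3.T3 ell (\<lambda>x y. tens TD3.T3 (hf x u, psi y, lactD l v))" .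
next
  fix u u' v assume h: "u \<in> carrier D" "u' \<in> carrier D" "v \<in> carrier D"
  show "SL TD3.T3 ell (\<lambda>x y. tens TD3.T3 (hf x (u \<oplus>\<^bsub>D\<^esub> u'), psi y, v))
    = SL TD3.T3 ell (\<lambda>x y. tens TD3.T3 (hf x u, psi y, v)) \<otimes>\<^bsub>TD3.T3\<^esub> SL TD3.T3 ell (\<lambda>x y. tens TD3.T3 (hf x u', psi y, v))"
    by (subst SL_mult[OF TD3.comm_group_T3 ell, symmetric])
      (auto simp: h TD3.tens3_cl hf_add_right balancedD(2)[OF bal_T3_left] intro!: SL_cong[OF ell])
next
  fix u v v' assume h: "u \<in> carrier D" "v \<in> carrier D" "v' \<in> carrier D"
  show "SL TD3.T3 ell (\<lambda>x y. tens TD3.T3 (hf x u, psi y, v \<oplus>\<^bsub>D\<^esub> v'))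
    = SL TD3.T3 ell (\<lambda>x y. tens TD3.T3 (hf x u, psi y, v)) \<otimes>\<^bsub>TD3.T3\<^esub> SL TD3.T3 ell (\<lambda>x y. tens TD3.T3 (hf x u, psi y, v'))"
    by (subst SL_mult[OF TD3.comm_group_T3 ell, symmetric])
      (auto simp: h TD3.tens3_cl balancedD(3)[OF bal_T3_right] intro!: SL_cong[OF ell])
qed (intro SL_closed TD3.comm_group_T3 ell TD3.tens3_cl; simp)

lemma bal_coassoc2: "TD.bal TD3.T3 (\<lambda>u v. SL TD3.T3 ell (\<lambda>x y. tens TD3.T3 (u, hf x v, psi y)))"
proof (rule balancedI)
  fix u l v assume h: "u \<in> carrier D" "l \<in> carrier Bs" "v \<in> carrier D"
  show "SL TD3.T3 ell (\<lambda>x y. tens TD3.T3 (ractD u l, hf x v, psi y))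
      = SL TD3.T3 ell (\<lambda>x y. tens TD3.T3 (u, hf x (lactD l v), psi y))"
    by (rule SL_cong[OF ell], subst hf_td'; (rule balancedD(4)[OF bal_T3_left])?) (simp_all add: h)
next
  fix u u' v assume h: "u \<in> carrier D" "u' \<in> carrier D" "v \<in> carrier D"
  show "SL TD3.T3 ell (\<lambda>x y. tens TD3.T3 (u \<oplus>\<^bsub>D\<^esub> u', hf x v, psi y))
    = SL TD3.T3 ell (\<lambda>x y. tens TD3.T3 (u, hf x v, psi y)) \<otimes>\<^bsub>TD3.T3\<^esub> SL TD3.T3 ell (\<lambda>x y. tens TD3.T3 (u', hf x v, psi y))"
    by (subst SL_mult[OF TD3.comm_group_T3 ell, symmetric])
      (auto simp: h TD3.tens3_cl balancedD(2)[OF bal_T3_left] intro!: SL_cong[OF ell])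
next
  fix u v v' assume h: "u \<in> carrier D" "v \<in> carrier D" "v' \<in> carrier D"
  show "SL TD3.T3 ell (\<lambda>x y. tens TD3.T3 (u, hf x (v \<oplus>\<^bsub>D\<^esub> v'), psi y))
    = SL TD3.T3 ell (\<lambda>x y. tens TD3.T3 (u, hf x v, psi y)) \<otimes>\<^bsub>TD3.T3\<^esub> SL TD3.T3 ell (\<lambda>x y. tens TD3.T3 (u, hf x v', psi y))"
    by (subst SL_mult[OF TD3.comm_group_T3 ell, symmetric])
      (auto simp: h TD3.tens3_cl hf_add_right balancedD(2)[OF bal_T3_right] intro!: SL_cong[OF ell])
qed (intro SL_closed TD3.comm_group_T3 ell TD3.tens3_cl; simp)

lemma comonoid_dual: "bimodule_comonoid Bs D lactD ractD (comult Hd) (counit Hd)"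
proof (intro bimodule_comonoid.intro bimodule_comonoid_axioms.intro MD.bimodule_axioms)
  note cg = TD.comm_group_T
  show "comult Hd \<in> hom (add_monoid D) TD.T"
  proof (rule homI; simp add: comult_Hd_closed)
    fix \<phi> \<psi> assume h: "\<phi> \<in> carrier D" "\<psi> \<in> carrier D"
    show "comult Hd (\<phi> \<oplus>\<^bsub>D\<^esub> \<psi>) = comult Hd \<phi> \<otimes>\<^bsub>TD.T\<^esub> comult Hd \<psi>"
      unfolding comult_Hd[OF h(1)] comult_Hd[OF h(2)] comult_Hd[OF D_add_closed[OF h]]
      by (subst SL_mult[OF cg ell, symmetric])
        (auto simp: h TD.tens_cl hf_add_right balancedD(2)[OF TD.bal_tens] intro!: SL_cong[OF ell])
  qed
  show "counit Hd \<in> hom (add_monoid D) (add_monoid Bs)"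
    by (simp add: hom_def Pi_iff)
  fix b \<phi> assume h: "b \<in> carrier Bs" "\<phi> \<in> carrier D"
  have b1: "TD.bal TD.T (\<lambda>u v. tens TD.T (lactD b u, v))"
    by (rule TD_bal_map[OF TD.bal_tens])
      (simp_all add: h mult_right_def D_mult_closed D_distr sd_td_commute)
  show "comult Hd (lactD b \<phi>) = tlift TD.T (\<lambda>(u, v). tens TD.T (lactD b u, v)) (comult Hd \<phi>)"
    unfolding tlift_Hd[OF cg b1 h(2)] comult_Hd[OF MD.lact_closed[OF h]]
    by (rule SL_cong[OF ell]) (simp add: h mult_right_def hf_td)
  have b2: "TD.bal TD.T (\<lambda>u v. tens TD.T (u, ractD v b))"
    by (rule TD_bal_map[OF TD.bal_tens])
      (simp_all add: h mult_right_def D_mult_closed D_distr sd_td_commute)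
  show "comult Hd (ractD \<phi> b) = tlift TD.T (\<lambda>(u, v). tens TD.T (u, ractD v b)) (comult Hd \<phi>)"
    unfolding tlift_Hd[OF cg b2 h(2)] comult_Hd[OF MD.ract_closed[OF h]]
    using SL_ract[OF cg TD.bal_tens h(2,1)] by (simp add: mult_right_def)
  show "counit Hd (lactD b \<phi>) = b \<otimes>\<^bsub>Bs\<^esub> counit Hd \<phi>"
    using h by (simp add: mult_right_def del: D_apply(1))
  show "counit Hd (ractD \<phi> b) = counit Hd \<phi> \<otimes>\<^bsub>Bs\<^esub> b"
    using h by (simp add: mult_right_def del: D_apply(1))
next
  fix \<phi> assume h: "\<phi> \<in> carrier D"
  let ?T = TD3.T3
  note cg = TD3.comm_group_T3
  have e1: "tlift ?T (\<lambda>(u', u''). tens ?T (u', u'', v)) (comult Hd u) = SL ?T ell (\<lambda>x y. tens ?T (hf x u, psi y, v))"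
    if "u \<in> carrier D" "v \<in> carrier D" for u v
    by (rule tlift_Hd[OF cg bal_T3_left[OF that(2)] that(1)])
  have e2: "tlift ?T (\<lambda>(v', v''). tens ?T (u, v', v'')) (comult Hd v) = SL ?T ell (\<lambda>x y. tens ?T (u, hf x v, psi y))"
    if "u \<in> carrier D" "v \<in> carrier D" for u v
    by (rule tlift_Hd[OF cg bal_T3_right[OF that(1)] that(2)])
  have "tlift ?T (\<lambda>(u, v). tlift ?T (\<lambda>(u', u''). tens ?T (u', u'', v)) (comult Hd u)) (comult Hd \<phi>)
      = SL ?T ell (\<lambda>x y. tlift ?T (\<lambda>(u', u''). tens ?T (u', u'', psi y)) (comult Hd (hf x \<phi>)))"
    by (rule tlift_Hd[OF cg TD_bal_cong[OF bal_coassoc1 e1] h])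
  also have "\<dots> = SL ?T ell (\<lambda>x y. SL ?T ell (\<lambda>x' y'. tens ?T (hf x' (hf x \<phi>), psi y', psi y)))"
    by (rule SL_cong[OF ell]) (simp add: h e1)
  also have "\<dots> = SL ?T ell (\<lambda>x y. SL ?T ell (\<lambda>x' y'. tens ?T (hf x \<phi>, hf x' (psi y), psi y')))"
    by (rule coassoc_dual[OF h])
  also have "\<dots> = SL ?T ell (\<lambda>x y. tlift ?T (\<lambda>(v', v''). tens ?T (hf x \<phi>, v', v'')) (comult Hd (psi y)))"
    by (rule SL_cong[OF ell]) (simp add: h e2)
  also have "\<dots> = tlift ?T (\<lambda>(u, v). tlift ?T (\<lambda>(v', v''). tens ?T (u, v', v'')) (comult Hd v)) (comult Hd \<phi>)"
    by (rule tlift_Hd[OF cg TD_bal_cong[OF bal_coassoc2 e2] h, symmetric])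
  finally show "let T3 = ?T
     in tlift T3 (\<lambda>(u, v). tlift T3 (\<lambda>(u', u''). tens T3 (u', u'', v)) (comult Hd u)) (comult Hd \<phi>)
      = tlift T3 (\<lambda>(u, v). tlift T3 (\<lambda>(v', v''). tens T3 (u, v', v'')) (comult Hd v)) (comult Hd \<phi>)"
    by (simp only: Let_def)
  have "tlift addD (\<lambda>(u, v). lactD (u \<one>\<^bsub>A\<^esub>) v) (comult Hd \<phi>) = SL addD ell (\<lambda>x y. lactD (hf x \<phi> \<one>\<^bsub>A\<^esub>) (psi y))"
    by (rule tlift_Hd[OF cg_addD bal_eps_left h])
  also have "\<dots> = SL addD ell (\<lambda>x y. psi y \<otimes>\<^bsub>D\<^esub> td (\<phi> x))"
    by (rule SL_cong[OF ell]) (simp add: h mult_right_def)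
  finally show "tlift (add_monoid D) (\<lambda>(u, v). lactD (counit Hd u) v) (comult Hd \<phi>) = \<phi>"
    by (simp only: expand[OF h] addD_def[symmetric] Hd_sels)
  have "tlift addD (\<lambda>(u, v). ractD u (v \<one>\<^bsub>A\<^esub>)) (comult Hd \<phi>) = SL addD ell (\<lambda>x y. ractD (hf x \<phi>) (psi y \<one>\<^bsub>A\<^esub>))"
    by (rule tlift_Hd[OF cg_addD bal_eps_right h])
  also have "\<dots> = \<phi>"
  proof (rule D_eqI[OF _ h])
    show "SL addD ell (\<lambda>x y. ractD (hf x \<phi>) (psi y \<one>\<^bsub>A\<^esub>)) \<in> carrier D"
      using SL_closed[OF cg_addD ell, of "\<lambda>x y. ractD (hf x \<phi>) (psi y \<one>\<^bsub>A\<^esub>)"] h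
      by (simp add: MD.ract_closed)
    fix a assume a: "a \<in> carrier A"
    have "(SL addD ell (\<lambda>x y. ractD (hf x \<phi>) (psi y \<one>\<^bsub>A\<^esub>))) a = SL addB ell (\<lambda>x y. (ractD (hf x \<phi>) (psi y \<one>\<^bsub>A\<^esub>)) a)"
      by (rule SL_addD_apply) (simp_all add: a h MD.ract_closed)
    also have "\<dots> = SL addB ell (\<lambda>x y. hf x \<phi> (a \<otimes>\<^bsub>A\<^esub> tgt H (psi y \<one>\<^bsub>A\<^esub>)))"
      by (rule SL_cong[OF ell]) (simp add: a h mult_right_def del: D_apply(1))
    finally show "(SL addD ell (\<lambda>x y. ractD (hf x \<phi>) (psi y \<one>\<^bsub>A\<^esub>))) a = \<phi> a"
      by (simp add: ev_comult a h)
  qed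
  finally show "tlift (add_monoid D) (\<lambda>(u, v). ractD u (counit Hd v)) (comult Hd \<phi>) = \<phi>"
    by (simp only: addD_def[symmetric] Hd_sels)
qed

section \<open>Multiplicativity of the dual comultiplication\<close>

lemma ac_tgt':
  assumes "\<phi> \<in> carrier D" "l \<in> carrier Bs" "a \<in> carrier A"
  shows "ac (a \<otimes>\<^bsub>A\<^esub> tgt H l) \<phi> = ac a \<phi> \<otimes>\<^bsub>A\<^esub> tgt H l"
proof -
  have "ac (a \<otimes>\<^bsub>A\<^esub> tgt H l) \<phi> = SL addA a (\<lambda>x y. src H (\<phi> x) \<otimes>\<^bsub>A\<^esub> (y \<otimes>\<^bsub>A\<^esub> tgt H l))"
    using SL_tgt'[OF cg_add(1) bal_ac[OF assms(1)] assms(2,3)] assms by (simp add: ac_eq)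
  also have "\<dots> = SL addA a (\<lambda>x y. src H (\<phi> x) \<otimes>\<^bsub>A\<^esub> y \<otimes>\<^bsub>A\<^esub> tgt H l)"
    by (rule SL_cong) (simp_all add: assms source.S.m_assoc)
  also have "\<dots> = ac a \<phi> \<otimes>\<^bsub>A\<^esub> tgt H l"
    unfolding ac_eq[OF assms(1,3)]
    by (rule SL_push[where h = "\<lambda>w. w \<otimes>\<^bsub>A\<^esub> tgt H l" and G = addA, symmetric]) (simp_all add: assms ring_distr)
  finally show ?thesis .
qed

text \<open>A functional acts on a product through its two legs. The value of \<open>psi y\<close>
  on the first leg of \<open>b\<close> is moved by the Takeuchi condition into the argument of
  \<open>\<phi>\<close>, where \<open>basis\<close> rebuilds that leg; what results is the action
  over the coproduct of \<open>a b\<close>.\<close>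

lemma ac_times:
  assumes "\<phi> \<in> carrier D" "a \<in> carrier A" "b \<in> carrier A"
  shows "SL addA ell (\<lambda>x y. ac a (hf x \<phi>) \<otimes>\<^bsub>A\<^esub> ac b (psi y)) = ac (a \<otimes>\<^bsub>A\<^esub> b) \<phi>"
proof -
  let ?G = addA
  have "SL ?G ell (\<lambda>x y. ac a (hf x \<phi>) \<otimes>\<^bsub>A\<^esub> ac b (psi y))
    = SL ?G ell (\<lambda>x y. SL ?G b (\<lambda>r s. SL ?G a (\<lambda>p q.
        src H (\<phi> (p \<otimes>\<^bsub>A\<^esub> (tgt H (psi y r) \<otimes>\<^bsub>A\<^esub> x))) \<otimes>\<^bsub>A\<^esub> (q \<otimes>\<^bsub>A\<^esub> s))))"
  proof (rule SL_cong[OF ell])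
    fix x y assume h: "x \<in> carrier A" "y \<in> carrier A"
    have "ac a (hf x \<phi>) \<otimes>\<^bsub>A\<^esub> ac b (psi y) = SL ?G b (\<lambda>r s. ac a (hf x \<phi>) \<otimes>\<^bsub>A\<^esub> (src H (psi y r) \<otimes>\<^bsub>A\<^esub> s))"
      unfolding ac_eq[OF psi(1)[OF h(2)] assms(3)]
      by (rule SL_push[where h = "\<lambda>w. ac a (hf x \<phi>) \<otimes>\<^bsub>A\<^esub> w" and G = ?G]) (simp_all add: assms h ring_distr)
    also have "\<dots> = SL ?G b (\<lambda>r s. SL ?G a (\<lambda>p q.
        src H (\<phi> (p \<otimes>\<^bsub>A\<^esub> (tgt H (psi y r) \<otimes>\<^bsub>A\<^esub> x))) \<otimes>\<^bsub>A\<^esub> (q \<otimes>\<^bsub>A\<^esub> s)))"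
    proof (rule SL_cong[OF assms(3)])
      fix r s assume g: "r \<in> carrier A" "s \<in> carrier A"
      have b: "bal ?G (\<lambda>p q. src H (\<phi> (p \<otimes>\<^bsub>A\<^esub> x)) \<otimes>\<^bsub>A\<^esub> (q \<otimes>\<^bsub>A\<^esub> s))"
        by (rule balI) (simp_all add: assms h g ring_distr)
      have "ac a (hf x \<phi>) \<otimes>\<^bsub>A\<^esub> (src H (psi y r) \<otimes>\<^bsub>A\<^esub> s)
          = SL ?G a (\<lambda>p q. src H (hf x \<phi> p) \<otimes>\<^bsub>A\<^esub> q \<otimes>\<^bsub>A\<^esub> (src H (psi y r) \<otimes>\<^bsub>A\<^esub> s))"
        unfolding ac_eq[OF hf_closed[OF h(1) assms(1)] assms(2)]
        by (rule SL_push[where h = "\<lambda>w. w \<otimes>\<^bsub>A\<^esub> (src H (psi y r) \<otimes>\<^bsub>A\<^esub> s)" and G = ?G])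
          (simp_all add: assms h g ring_distr)
      also have "\<dots> = SL ?G a (\<lambda>p q. src H (\<phi> (p \<otimes>\<^bsub>A\<^esub> x)) \<otimes>\<^bsub>A\<^esub> (q \<otimes>\<^bsub>A\<^esub> src H (psi y r) \<otimes>\<^bsub>A\<^esub> s))"
        by (rule SL_cong[OF assms(2)]) (simp add: assms h g ring_distr)
      also have "\<dots> = SL ?G a (\<lambda>p q. src H (\<phi> (p \<otimes>\<^bsub>A\<^esub> tgt H (psi y r) \<otimes>\<^bsub>A\<^esub> x)) \<otimes>\<^bsub>A\<^esub> (q \<otimes>\<^bsub>A\<^esub> s))"
        by (rule SL_takeuchi[OF cg_add(1) b, symmetric]) (simp_all add: assms h g)
      also have "\<dots> = SL ?G a (\<lambda>p q. src H (\<phi> (p \<otimes>\<^bsub>A\<^esub> (tgt H (psi y r) \<otimes>\<^bsub>A\<^esub> x))) \<otimes>\<^bsub>A\<^esub> (q \<otimes>\<^bsub>A\<^esub> s))"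
        by (rule SL_cong[OF assms(2)]) (simp add: assms h g ring_distr)
      finally show "ac a (hf x \<phi>) \<otimes>\<^bsub>A\<^esub> (src H (psi y r) \<otimes>\<^bsub>A\<^esub> s) = \<dots>" .
    qed
    finally show "ac a (hf x \<phi>) \<otimes>\<^bsub>A\<^esub> ac b (psi y) = \<dots>" .
  qed
  also have "\<dots> = SL ?G b (\<lambda>r s. SL ?G ell (\<lambda>x y. SL ?G a (\<lambda>p q.
        src H (\<phi> (p \<otimes>\<^bsub>A\<^esub> (tgt H (psi y r) \<otimes>\<^bsub>A\<^esub> x))) \<otimes>\<^bsub>A\<^esub> (q \<otimes>\<^bsub>A\<^esub> s))))"
    by (rule SL_SL_swap) (intro cg_add ell assms SL_closed; simp add: assms)+
  also have "\<dots> = SL ?G b (\<lambda>r s. SL ?G a (\<lambda>p q. src H (\<phi> (p \<otimes>\<^bsub>A\<^esub> r)) \<otimes>\<^bsub>A\<^esub> (q \<otimes>\<^bsub>A\<^esub> s)))"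
  proof (rule SL_cong[OF assms(3)])
    fix r s assume g: "r \<in> carrier A" "s \<in> carrier A"
    have "SL ?G ell (\<lambda>x y. SL ?G a (\<lambda>p q. src H (\<phi> (p \<otimes>\<^bsub>A\<^esub> (tgt H (psi y r) \<otimes>\<^bsub>A\<^esub> x))) \<otimes>\<^bsub>A\<^esub> (q \<otimes>\<^bsub>A\<^esub> s)))
        = SL ?G a (\<lambda>p q. SL ?G ell (\<lambda>x y. src H (\<phi> (p \<otimes>\<^bsub>A\<^esub> (tgt H (psi y r) \<otimes>\<^bsub>A\<^esub> x))) \<otimes>\<^bsub>A\<^esub> (q \<otimes>\<^bsub>A\<^esub> s)))"
      by (rule SL_SL_swap) (simp_all add: assms g)
    also have "\<dots> = SL ?G a (\<lambda>p q. src H (\<phi> (p \<otimes>\<^bsub>A\<^esub> r)) \<otimes>\<^bsub>A\<^esub> (q \<otimes>\<^bsub>A\<^esub> s))"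
    proof (rule SL_cong[OF assms(2)])
      fix p q assume f: "p \<in> carrier A" "q \<in> carrier A"
      have "SL ?G ell (\<lambda>x y. src H (\<phi> (p \<otimes>\<^bsub>A\<^esub> (tgt H (psi y r) \<otimes>\<^bsub>A\<^esub> x))) \<otimes>\<^bsub>A\<^esub> (q \<otimes>\<^bsub>A\<^esub> s))
          = src H (\<phi> (p \<otimes>\<^bsub>A\<^esub> SL ?G ell (\<lambda>x y. tgt H (psi y r) \<otimes>\<^bsub>A\<^esub> x))) \<otimes>\<^bsub>A\<^esub> (q \<otimes>\<^bsub>A\<^esub> s)"
        by (rule SL_push[where h = "\<lambda>w. src H (\<phi> (p \<otimes>\<^bsub>A\<^esub> w)) \<otimes>\<^bsub>A\<^esub> (q \<otimes>\<^bsub>A\<^esub> s)" and G = ?G, symmetric])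
          (simp_all add: assms f g ring_distr)
      then show "SL ?G ell (\<lambda>x y. src H (\<phi> (p \<otimes>\<^bsub>A\<^esub> (tgt H (psi y r) \<otimes>\<^bsub>A\<^esub> x))) \<otimes>\<^bsub>A\<^esub> (q \<otimes>\<^bsub>A\<^esub> s))
          = src H (\<phi> (p \<otimes>\<^bsub>A\<^esub> r)) \<otimes>\<^bsub>A\<^esub> (q \<otimes>\<^bsub>A\<^esub> s)" by (simp add: basis g)
    qed
    finally show "SL ?G ell (\<lambda>x y. SL ?G a (\<lambda>p q. src H (\<phi> (p \<otimes>\<^bsub>A\<^esub> (tgt H (psi y r) \<otimes>\<^bsub>A\<^esub> x))) \<otimes>\<^bsub>A\<^esub> (q \<otimes>\<^bsub>A\<^esub> s)))
        = SL ?G a (\<lambda>p q. src H (\<phi> (p \<otimes>\<^bsub>A\<^esub> r)) \<otimes>\<^bsub>A\<^esub> (q \<otimes>\<^bsub>A\<^esub> s))" .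
  qed
  also have "\<dots> = ac (a \<otimes>\<^bsub>A\<^esub> b) \<phi>"
    using SL_times[OF cg_add(1) bal_ac[OF assms(1)] assms(2,3)] assms by (simp add: ac_eq)
  finally show ?thesis .
qed

lemma bal_mult_inner:
  assumes "x \<in> carrier D" "y \<in> carrier D"
  shows "TD.bal TD.T (\<lambda>u v. tens TD.T (x \<otimes>\<^bsub>D\<^esub> u, y \<otimes>\<^bsub>D\<^esub> v))"
  by (rule TD_bal_map[OF TD.bal_tens]) (simp_all add: assms D_mult_closed D_distr)

lemma bal_mult_outer:
  assumes "\<psi> \<in> carrier D"
  shows "TD.bal TD.T (\<lambda>x y. SL TD.T ell (\<lambda>u v. tens TD.T (x \<otimes>\<^bsub>D\<^esub> hf u \<psi>, y \<otimes>\<^bsub>D\<^esub> psi v)))"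
proof (rule balancedI)
  note cg = TD.comm_group_T
  fix x l y assume h: "x \<in> carrier D" "l \<in> carrier Bs" "y \<in> carrier D"
  have "SL TD.T ell (\<lambda>u v. tens TD.T (ractD x l \<otimes>\<^bsub>D\<^esub> hf u \<psi>, y \<otimes>\<^bsub>D\<^esub> psi v))
      = SL TD.T ell (\<lambda>u v. tens TD.T (x \<otimes>\<^bsub>D\<^esub> (sd l \<otimes>\<^bsub>D\<^esub> hf u \<psi>), y \<otimes>\<^bsub>D\<^esub> psi v))"
    by (rule SL_cong[OF ell]) (simp add: assms h mult_right_def D.m_assoc)
  also have "\<dots> = SL TD.T ell (\<lambda>u v. tens TD.T (x \<otimes>\<^bsub>D\<^esub> hf u \<psi>, y \<otimes>\<^bsub>D\<^esub> (td l \<otimes>\<^bsub>D\<^esub> psi v)))"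
    by (rule SL_takeuchi_dual[OF cg bal_mult_inner]) (simp_all add: h assms)
  also have "\<dots> = SL TD.T ell (\<lambda>u v. tens TD.T (x \<otimes>\<^bsub>D\<^esub> hf u \<psi>, lactD l y \<otimes>\<^bsub>D\<^esub> psi v))"
    by (rule SL_cong[OF ell]) (simp add: assms h mult_right_def D.m_assoc)
  finally show "SL TD.T ell (\<lambda>u v. tens TD.T (ractD x l \<otimes>\<^bsub>D\<^esub> hf u \<psi>, y \<otimes>\<^bsub>D\<^esub> psi v)) = \<dots>" .
next
  fix x x' y assume h: "x \<in> carrier D" "x' \<in> carrier D" "y \<in> carrier D"
  show "SL TD.T ell (\<lambda>u v. tens TD.T ((x \<oplus>\<^bsub>D\<^esub> x') \<otimes>\<^bsub>D\<^esub> hf u \<psi>, y \<otimes>\<^bsub>D\<^esub> psi v))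
    = SL TD.T ell (\<lambda>u v. tens TD.T (x \<otimes>\<^bsub>D\<^esub> hf u \<psi>, y \<otimes>\<^bsub>D\<^esub> psi v)) \<otimes>\<^bsub>TD.T\<^esub>
      SL TD.T ell (\<lambda>u v. tens TD.T (x' \<otimes>\<^bsub>D\<^esub> hf u \<psi>, y \<otimes>\<^bsub>D\<^esub> psi v))"
    by (subst SL_mult[OF TD.comm_group_T ell, symmetric])
      (auto simp: assms h TD.tens_cl D_mult_closed D_distr balancedD(2)[OF TD.bal_tens] intro!: SL_cong[OF ell])
next
  fix x y y' assume h: "x \<in> carrier D" "y \<in> carrier D" "y' \<in> carrier D"
  show "SL TD.T ell (\<lambda>u v. tens TD.T (x \<otimes>\<^bsub>D\<^esub> hf u \<psi>, (y \<oplus>\<^bsub>D\<^esub> y') \<otimes>\<^bsub>D\<^esub> psi v))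
    = SL TD.T ell (\<lambda>u v. tens TD.T (x \<otimes>\<^bsub>D\<^esub> hf u \<psi>, y \<otimes>\<^bsub>D\<^esub> psi v)) \<otimes>\<^bsub>TD.T\<^esub>
      SL TD.T ell (\<lambda>u v. tens TD.T (x \<otimes>\<^bsub>D\<^esub> hf u \<psi>, y' \<otimes>\<^bsub>D\<^esub> psi v))"
    by (subst SL_mult[OF TD.comm_group_T ell, symmetric])
      (auto simp: assms h TD.tens_cl D_mult_closed D_distr balancedD(3)[OF TD.bal_tens] intro!: SL_cong[OF ell])
qed (intro SL_closed TD.comm_group_T ell TD.tens_cl; simp add: assms D_mult_closed)

text \<open>Evaluated at \<open>a\<close> and \<open>b\<close>, the left side is
  \<open>\<psi>\<close> at the action of \<open>\<phi>\<close> on \<open>a b\<close>. The inner sum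
  on the right is, by \<open>ev_comult\<close>, \<open>\<psi>\<close> at a product of two actions,
  and \<open>ac_times\<close> sums these products.\<close>

lemma comult_Hd_mult:
  assumes "\<phi> \<in> carrier D" "\<psi> \<in> carrier D"
  shows "comult Hd (\<phi> \<otimes>\<^bsub>D\<^esub> \<psi>)
    = SL TD.T ell (\<lambda>x y. SL TD.T ell (\<lambda>u v. tens TD.T (hf x \<phi> \<otimes>\<^bsub>D\<^esub> hf u \<psi>, psi y \<otimes>\<^bsub>D\<^esub> psi v)))"
    (is "_ = SL TD.T ell (\<lambda>x y. ?in x y)")
proof (rule tensor_eqI)
  have icl: "?in x y \<in> carrier TD.T" if "x \<in> carrier A" "y \<in> carrier A" for x y
    by (intro SL_closed TD.comm_group_T ell TD.tens_cl) (simp_all add: assms that D_mult_closed)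
  show "SL TD.T ell (\<lambda>x y. ?in x y) \<in> carrier TD.T"
    by (intro SL_closed TD.comm_group_T ell icl)
  fix a b assume ab: "a \<in> carrier A" "b \<in> carrier A"
  let ?ev = "\<lambda>\<phi> \<chi>. \<phi> (a \<otimes>\<^bsub>A\<^esub> tgt H (\<chi> b))"
  note ev = bal_ev[OF ab]
  have "tlift addB (\<lambda>(\<phi>, \<chi>). ?ev \<phi> \<chi>) (comult Hd (\<phi> \<otimes>\<^bsub>D\<^esub> \<psi>))
      = SL addB ell (\<lambda>x y. hf x (\<phi> \<otimes>\<^bsub>D\<^esub> \<psi>) (a \<otimes>\<^bsub>A\<^esub> tgt H (psi y b)))"
    by (rule tlift_Hd[OF cg_add(2) ev]) (simp add: assms D_mult_closed)
  also have "\<dots> = (\<phi> \<otimes>\<^bsub>D\<^esub> \<psi>) (a \<otimes>\<^bsub>A\<^esub> b)"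
    by (rule ev_comult) (simp_all add: assms ab D_mult_closed)
  also have "\<dots> = \<psi> (SL addA ell (\<lambda>x y. ac a (hf x \<phi>) \<otimes>\<^bsub>A\<^esub> ac b (psi y)))"
    by (simp add: ac_times ab assms)
  also have "\<dots> = SL addB ell (\<lambda>x y. \<psi> (ac a (hf x \<phi>) \<otimes>\<^bsub>A\<^esub> ac b (psi y)))"
    by (rule SL_push[where h = \<psi> and G = addA]) (simp_all add: ab assms)
  also have "\<dots> = SL addB ell (\<lambda>x y. tlift addB (\<lambda>(\<phi>, \<chi>). ?ev \<phi> \<chi>) (?in x y))"
  proof (rule SL_cong[OF ell])
    fix x y assume h: "x \<in> carrier A" "y \<in> carrier A"
    have "tlift addB (\<lambda>(\<phi>, \<chi>). ?ev \<phi> \<chi>) (?in x y)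
        = SL addB ell (\<lambda>u v. ?ev (hf x \<phi> \<otimes>\<^bsub>D\<^esub> hf u \<psi>) (psi y \<otimes>\<^bsub>D\<^esub> psi v))"
      by (rule tlift_SL_tens[OF cg_add(2) ev ell]) (simp_all add: h assms D_mult_closed)
    also have "\<dots> = SL addB ell (\<lambda>u v. hf u \<psi> (ac a (hf x \<phi>) \<otimes>\<^bsub>A\<^esub> tgt H (psi v (ac b (psi y)))))"
      by (rule SL_cong[OF ell]) (simp add: h assms ab ac_tgt')
    also have "\<dots> = \<psi> (ac a (hf x \<phi>) \<otimes>\<^bsub>A\<^esub> ac b (psi y))"
      by (rule ev_comult) (simp_all add: h assms ab)
    finally show "\<psi> (ac a (hf x \<phi>) \<otimes>\<^bsub>A\<^esub> ac b (psi y)) = tlift addB (\<lambda>(\<phi>, \<chi>). ?ev \<phi> \<chi>) (?in x y)" by (rule sym)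
  qed
  also have "\<dots> = tlift addB (\<lambda>(\<phi>, \<chi>). ?ev \<phi> \<chi>) (SL TD.T ell (\<lambda>x y. ?in x y))"
    by (rule SL_hom[OF TD.tlift_hom[OF cg_add(2) ev] TD.comm_group_T cg_add(2) ell icl, symmetric])
  finally show "tlift addB (\<lambda>(\<phi>, \<chi>). ?ev \<phi> \<chi>) (comult Hd (\<phi> \<otimes>\<^bsub>D\<^esub> \<psi>))
      = tlift addB (\<lambda>(\<phi>, \<chi>). ?ev \<phi> \<chi>) (SL TD.T ell (\<lambda>x y. ?in x y))" .
qed (simp add: assms comult_Hd_closed D_mult_closed)

lemma ac_one_left: "\<phi> \<in> carrier D \<Longrightarrow> ac \<one>\<^bsub>A\<^esub> \<phi> = src H (\<phi> \<one>\<^bsub>A\<^esub>)"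
  using SL_one[OF cg_add(1) bal_ac, of \<phi>] by (simp add: ac_eq)

theorem right_bialgebroid_dual: "right_bialgebroid Hd"
proof (rule right_bialgebroid.intro)
  show "ring_hom_ring (base_ring Hd) (total_ring Hd) (src Hd)"
    using ring_hom_ringI2[OF source.R.ring_axioms ring_D sd_hom] by simp
  show "ring_hom_ring (opposite_ring (base_ring Hd)) (total_ring Hd) (tgt Hd)"
    using ring_hom_ringI2[OF ring_opposite[OF source.R.ring_axioms] ring_D td_hom] by simp
  show "bimodule_comonoid (base_ring Hd) (total_ring Hd) (R_lact Hd) (R_ract Hd) (comult Hd) (counit Hd)"
    using comonoid_dual by simp
  note cg = TD.comm_group_T
  show "right_bialgebroid_axioms Hd"
  proof (rule right_bialgebroid_axioms.intro; unfold Hd_sels right_tensor_eq')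
    show "sd r \<otimes>\<^bsub>D\<^esub> td r' = td r' \<otimes>\<^bsub>D\<^esub> sd r" if "r \<in> carrier Bs" "r' \<in> carrier Bs" for r r'
      by (rule sd_td_commute[OF that])
    show "tlift TD.T (\<lambda>(x, y). tens TD.T (sd r \<otimes>\<^bsub>D\<^esub> x, y)) (comult Hd \<phi>)
        = tlift TD.T (\<lambda>(x, y). tens TD.T (x, td r \<otimes>\<^bsub>D\<^esub> y)) (comult Hd \<phi>)"
      if h: "r \<in> carrier Bs" "\<phi> \<in> carrier D" for r \<phi>
    proof -
      have b1: "TD.bal TD.T (\<lambda>u v. tens TD.T (sd r \<otimes>\<^bsub>D\<^esub> u, v))"
        and b2: "TD.bal TD.T (\<lambda>u v. tens TD.T (u, td r \<otimes>\<^bsub>D\<^esub> v))"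
        by (rule TD_bal_map[OF TD.bal_tens]; simp add: h D_mult_closed D_distr)+
      show ?thesis unfolding tlift_Hd[OF cg b1 h(2)] tlift_Hd[OF cg b2 h(2)]
        by (rule SL_takeuchi_dual[OF cg TD.bal_tens h(2,1)])
    qed
    show "comult Hd \<one>\<^bsub>D\<^esub> = tens TD.T (\<one>\<^bsub>D\<^esub>, \<one>\<^bsub>D\<^esub>)"
    proof (rule tensor_eqI)
      fix a b assume ab: "a \<in> carrier A" "b \<in> carrier A"
      have "tlift addB (\<lambda>(\<phi>, \<chi>). \<phi> (a \<otimes>\<^bsub>A\<^esub> tgt H (\<chi> b))) (comult Hd \<one>\<^bsub>D\<^esub>)
          = SL addB ell (\<lambda>x y. hf x \<one>\<^bsub>D\<^esub> (a \<otimes>\<^bsub>A\<^esub> tgt H (psi y b)))"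
        by (rule tlift_Hd[OF cg_add(2) bal_ev[OF ab] D_one_closed])
      also have "\<dots> = \<one>\<^bsub>D\<^esub> (a \<otimes>\<^bsub>A\<^esub> b)" by (rule ev_comult[OF D_one_closed ab])
      also have "\<dots> = \<one>\<^bsub>D\<^esub> (a \<otimes>\<^bsub>A\<^esub> tgt H (\<one>\<^bsub>D\<^esub> b))" using ab by (simp add: counit_tgt)
      also have "\<dots> = tlift addB (\<lambda>(\<phi>, \<chi>). \<phi> (a \<otimes>\<^bsub>A\<^esub> tgt H (\<chi> b))) (tens TD.T (\<one>\<^bsub>D\<^esub>, \<one>\<^bsub>D\<^esub>))"
        by (rule TD.tlift_tens[OF cg_add(2) bal_ev[OF ab] D_one_closed D_one_closed, symmetric])
      finally show "tlift addB (\<lambda>(\<phi>, \<chi>). \<phi> (a \<otimes>\<^bsub>A\<^esub> tgt H (\<chi> b))) (comult Hd \<one>\<^bsub>D\<^esub>) = \<dots>" .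
    qed (simp_all add: comult_Hd_closed D_one_closed TD.tens_cl)
    show "comult Hd (\<phi> \<otimes>\<^bsub>D\<^esub> \<psi>) = tlift TD.T (\<lambda>(x, y). tlift TD.T
        (\<lambda>(u, v). tens TD.T (x \<otimes>\<^bsub>D\<^esub> u, y \<otimes>\<^bsub>D\<^esub> v)) (comult Hd \<psi>)) (comult Hd \<phi>)"
      if h: "\<phi> \<in> carrier D" "\<psi> \<in> carrier D" for \<phi> \<psi>
    proof -
      have e: "tlift TD.T (\<lambda>(u, v). tens TD.T (x \<otimes>\<^bsub>D\<^esub> u, y \<otimes>\<^bsub>D\<^esub> v)) (comult Hd \<psi>)
          = SL TD.T ell (\<lambda>u v. tens TD.T (x \<otimes>\<^bsub>D\<^esub> hf u \<psi>, y \<otimes>\<^bsub>D\<^esub> psi v))"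
        if "x \<in> carrier D" "y \<in> carrier D" for x y
        by (rule tlift_Hd[OF cg bal_mult_inner[OF that] h(2)])
      have "comult Hd (\<phi> \<otimes>\<^bsub>D\<^esub> \<psi>) = SL TD.T ell (\<lambda>x y. tlift TD.T
          (\<lambda>(u, v). tens TD.T (hf x \<phi> \<otimes>\<^bsub>D\<^esub> u, psi y \<otimes>\<^bsub>D\<^esub> v)) (comult Hd \<psi>))"
        unfolding comult_Hd_mult[OF h] by (rule SL_cong[OF ell]) (simp add: e h)
      also have "\<dots> = tlift TD.T (\<lambda>(x, y). tlift TD.T
          (\<lambda>(u, v). tens TD.T (x \<otimes>\<^bsub>D\<^esub> u, y \<otimes>\<^bsub>D\<^esub> v)) (comult Hd \<psi>)) (comult Hd \<phi>)"
        by (rule tlift_Hd[OF cg TD_bal_cong[OF bal_mult_outer[OF h(2)] e] h(1), symmetric])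
      finally show ?thesis .
    qed
    show "\<one>\<^bsub>D\<^esub> \<one>\<^bsub>A\<^esub> = \<one>\<^bsub>Bs\<^esub>" by (simp add: counit_one)
    show "(sd (\<phi> \<one>\<^bsub>A\<^esub>) \<otimes>\<^bsub>D\<^esub> \<psi>) \<one>\<^bsub>A\<^esub> = (\<phi> \<otimes>\<^bsub>D\<^esub> \<psi>) \<one>\<^bsub>A\<^esub>" "(td (\<phi> \<one>\<^bsub>A\<^esub>) \<otimes>\<^bsub>D\<^esub> \<psi>) \<one>\<^bsub>A\<^esub> = (\<phi> \<otimes>\<^bsub>D\<^esub> \<psi>) \<one>\<^bsub>A\<^esub>"
      if "\<phi> \<in> carrier D" "\<psi> \<in> carrier D" for \<phi> \<psi>
      using that by (simp_all add: ac_one_left)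
  qed
qed

sublocale Rd: right_bialgebroid Hd by (rule right_bialgebroid_dual)

lemma SR_dual:
  assumes "comm_group G" "TD.bal G f" "\<phi> \<in> carrier D"
  shows "Rd.SR G \<phi> f = SL G ell (\<lambda>x y. f (hf x \<phi>) (psi y))"
  using Rd.SR_tlift[of G f \<phi>] assms tlift_Hd[OF assms] by simp

end

context nondegenerate_integral
begin

subsection \<open>The base rings\<close>

lemma counit_base [simp]: "r \<in> carrier BR \<Longrightarrow> counit HR (src HR r) = r"
  "l \<in> carrier BL \<Longrightarrow> counit HL (src HL l) = l" "l \<in> carrier BL \<Longrightarrow> counit HL (tgt HL l) = l"
  using R.comonoid.eps_ract[of r "\<one>\<^bsub>A\<^esub>", unfolded mult_right_def] R.counit_one
    L.counit_src_left[of l "\<one>\<^bsub>A\<^esub>"] L.counit_tgt_left[of l "\<one>\<^bsub>A\<^esub>"] L.counit_one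
  by (simp_all add: total_eq)

lemma src_R_inj: "\<lbrakk>src HR r = src HR r'; r \<in> carrier BR; r' \<in> carrier BR\<rbrakk> \<Longrightarrow> r = r'"
  by (metis counit_base(1))

lemma tgt_L_inj: "\<lbrakk>tgt HL l = tgt HL l'; l \<in> carrier BL; l' \<in> carrier BL\<rbrakk> \<Longrightarrow> l = l'"
  by (metis counit_base(3))

abbreviation "\<mu> \<equiv> mu HL HR"
abbreviation "\<kappa> \<equiv> kappa HR ell"

lemma mu_closed [simp]: "l \<in> carrier BL \<Longrightarrow> \<mu> l \<in> carrier BR"
  by (simp add: mu_def)

lemma src_mu [simp]: "l \<in> carrier BL \<Longrightarrow> src HR (\<mu> l) = tgt HL l"
  using qr_BC(1)[of "tgt HL l"] by (simp add: mu_def qr_def)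

lemma mu_cases:
  assumes "r \<in> carrier BR"
  obtains l where "l \<in> carrier BL" "r = \<mu> l"
proof -
  have "src HR r \<in> tgt HL ` carrier BL" using assms by (simp add: tgt_L_image)
  then obtain l where l: "l \<in> carrier BL" "src HR r = tgt HL l" by blast
  then have "r = \<mu> l" using assms by (intro src_R_inj) simp_all
  with l show ?thesis by (intro that)
qed

lemma mu_bij: "bij_betw \<mu> (carrier BL) (carrier BR)"
proof (rule bij_betw_imageI)
  show "inj_on \<mu> (carrier BL)"
    by (rule inj_onI) (metis src_mu tgt_L_inj)
  show "\<mu> ` carrier BL = carrier BR"
    by (auto elim: mu_cases)
qed

text \<open>Each equation is checked after the injective map \<open>src HR\<close>, under which
  \<open>\<mu>\<close> becomes \<open>tgt HL\<close>.\<close>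

lemma mu_add: "\<lbrakk>l \<in> carrier BL; m \<in> carrier BL\<rbrakk> \<Longrightarrow> \<mu> (l \<oplus>\<^bsub>BL\<^esub> m) = \<mu> l \<oplus>\<^bsub>BR\<^esub> \<mu> m"
  and mu_mult: "\<lbrakk>l \<in> carrier BL; m \<in> carrier BL\<rbrakk> \<Longrightarrow> \<mu> (l \<otimes>\<^bsub>BL\<^esub> m) = \<mu> m \<otimes>\<^bsub>BR\<^esub> \<mu> l"
  and mu_one: "\<mu> \<one>\<^bsub>BL\<^esub> = \<one>\<^bsub>BR\<^esub>"
  by (rule src_R_inj; simp)+

lemma mu_iso: "\<mu> \<in> ring_iso (opposite_ring BL) BR"
  unfolding ring_iso_def using mu_bij
  by (auto intro!: ring_hom_memI simp: opposite_ring_def mu_add mu_mult mu_one)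

lemma kappa_closed [simp]: "r \<in> carrier BR \<Longrightarrow> \<kappa> r \<in> carrier BR"
  by (simp add: kappa_def)

text \<open>Identifies \<open>\<kappa>\<close> with the restriction of \<open>\<xi>\<close> to
  \<open>B\<close>, read through \<open>tgt HR\<close> and \<open>src HR\<close>. Both
  \<open>\<xi>\<close> and \<open>tgt HR\<close> reverse products, so \<open>\<kappa>\<close>
  preserves them.\<close>

lemma src_kappa [simp]: "r \<in> carrier BR \<Longrightarrow> src HR (\<kappa> r) = \<xi> (tgt HR r)"
  using xi_B[of "tgt HR r"] by (simp add: kappa_def Lam_def)

lemma xi_inj: "\<lbrakk>\<xi> a = \<xi> b; a \<in> carrier A; b \<in> carrier A\<rbrakk> \<Longrightarrow> a = b"
  using xi_bij by (auto simp: bij_betw_def inj_on_def)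

lemma kappa_iso: "\<kappa> \<in> ring_iso BR BR"
proof -
  have hom: "\<kappa> \<in> ring_hom BR BR"
    by (rule ring_hom_memI; (rule src_R_inj)?; simp add: xi_mult)
  have "bij_betw \<kappa> (carrier BR) (carrier BR)"
  proof (rule bij_betw_imageI)
    show "inj_on \<kappa> (carrier BR)"
    proof (rule inj_onI)
      fix r r' assume h: "r \<in> carrier BR" "r' \<in> carrier BR" "\<kappa> r = \<kappa> r'"
      have e: "\<xi> (tgt HR r) = \<xi> (tgt HR r')" using arg_cong[OF h(3), of "src HR"] h(1,2) by simp
      have "tgt HR r = tgt HR r'" by (intro xi_inj[OF e]) (simp_all add: h)
      then have "S (tgt HR r) = S (tgt HR r')" by simp
      then show "r = r'" using h by (intro src_R_inj) simp_all
    qed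
    show "\<kappa> ` carrier BR = carrier BR"
    proof (intro equalityI subsetI)
      fix r assume r: "r \<in> carrier BR"
      \<comment> \<open>By \<open>ell_Lam'\<close> the element \<open>Lam' (S (ell c))\<close> of
        \<open>B\<close> multiplies \<open>ell\<close> to the same product as \<open>c\<close>; for
        \<open>c = src HR r\<close> the form then returns \<open>c\<close>.\<close>
      let ?r = "lam (S (ell \<otimes>\<^bsub>A\<^esub> src HR r))"
      have "src HR (\<kappa> ?r) = Lam (ell \<otimes>\<^bsub>A\<^esub> Lam' (S (ell \<otimes>\<^bsub>A\<^esub> src HR r)))"
        using r by (simp add: kappa_def Lam_def Lam'_def)
      then have "src HR (\<kappa> ?r) = src HR r"
        using r by (simp add: ell_Lam' ell_C_inj)
      then have "r = \<kappa> ?r" using r by (intro src_R_inj) simp_all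
      then show "r \<in> \<kappa> ` carrier BR" using r by (intro image_eqI[of _ _ ?r]) simp_all
    qed auto
  qed
  with hom show ?thesis by (simp add: ring_iso_def)
qed

lemma xi_iso: "\<xi> \<in> ring_iso (opposite_ring A) A"
  unfolding ring_iso_def using xi_bij
  by (auto intro!: ring_hom_memI simp: opposite_ring_def xi_mult)

subsection \<open>Coordinates on the dual\<close>

abbreviation "\<eta> \<equiv> inv_into (carrier A) \<xi>"

lemma eta [simp]: "a \<in> carrier A \<Longrightarrow> \<eta> a \<in> carrier A" "a \<in> carrier A \<Longrightarrow> \<xi> (\<eta> a) = a"
  "a \<in> carrier A \<Longrightarrow> \<eta> (\<xi> a) = a"
proof -
  assume a: "a \<in> carrier A"
  have "a \<in> \<xi> ` carrier A" using a bij_betw_imp_surj_on[OF xi_bij] by simp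
  then show "\<eta> a \<in> carrier A" "\<xi> (\<eta> a) = a" by (rule inv_into_into, rule f_inv_into_f)
  show "\<eta> (\<xi> a) = a" by (rule inv_into_f_f[OF bij_betw_imp_inj_on[OF xi_bij] a])
qed

lemma eta_add [simp]: "\<lbrakk>a \<in> carrier A; b \<in> carrier A\<rbrakk> \<Longrightarrow> \<eta> (a \<oplus>\<^bsub>A\<^esub> b) = \<eta> a \<oplus>\<^bsub>A\<^esub> \<eta> b"
  and eta_mult: "\<lbrakk>a \<in> carrier A; b \<in> carrier A\<rbrakk> \<Longrightarrow> \<eta> (a \<otimes>\<^bsub>A\<^esub> b) = \<eta> b \<otimes>\<^bsub>A\<^esub> \<eta> a"
  by (rule xi_inj; simp add: xi_mult)+

lemma eta_ell [simp]: "\<eta> ell = ell"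
  by (rule xi_inj) (simp_all add: xi_ell)

abbreviation "D \<equiv> L.D"
abbreviation "ac \<equiv> L.ac"

text \<open>
  The functionals \<open>phi b\<close> exhaust the lower dual.  In the coordinate \<open>b\<close> the map \<open>\<ell>\<^sub>L\<close> is \<open>\<xi>\<close>, the
  antipode of the dual is \<open>\<xi>\<close> again, and \<open>x \<rightharpoonup> phi b\<close> is \<open>phi (x b)\<close>.
\<close>

definition "phi b = (\<lambda>a\<in>carrier A. counit HL (Lam (a \<otimes>\<^bsub>A\<^esub> b)))"

lemma tgt_phi: "\<lbrakk>a \<in> carrier A; b \<in> carrier A\<rbrakk> \<Longrightarrow> tgt HL (phi b a) = Lam (a \<otimes>\<^bsub>A\<^esub> b)"
  and src_phi: "\<lbrakk>a \<in> carrier A; b \<in> carrier A\<rbrakk> \<Longrightarrow> src HL (phi b a) = S (Lam (a \<otimes>\<^bsub>A\<^esub> b))"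
  using pr_BC(2,3)[of "Lam (a \<otimes>\<^bsub>A\<^esub> b)"] by (simp_all add: phi_def pr_def pr'_def)

lemma phi_closed [simp]: "b \<in> carrier A \<Longrightarrow> phi b \<in> carrier D"
  unfolding phi_def
  by (rule L.D_I) (simp_all add: distr Lam_left)

lemma addA_eq: "L.addA = AG"
  by (simp add: L.addA_def AG_def)

lemma ac_phi [simp]: "\<lbrakk>w \<in> carrier A; b \<in> carrier A\<rbrakk> \<Longrightarrow> ac w (phi b) = act w b"
  unfolding act_def L.ac_eq[OF phi_closed] addA_eq by (rule SL_cong) (simp_all add: src_phi)

lemma dual_is_phi:
  assumes c: "\<chi> \<in> carrier D"
  shows "\<exists>b\<in>carrier A. \<chi> = phi b"
proof (intro bexI L.D_eqI[OF c])
  \<comment> \<open>Found by applying \<open>\<chi>\<close> to the expansion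
    \<open>frobenius1\<close> of \<open>a\<close>: the coefficients \<open>Lam (a x)\<close> come
    out of \<open>\<chi>\<close>, and its values are taken into the form next to
    \<open>x\<close>.\<close>
  let ?b = "SR AG ell (\<lambda>x z. x \<otimes>\<^bsub>A\<^esub> tgt HL (\<chi> (S z)))"
  show b: "?b \<in> carrier A" using c by simp
  then show "phi ?b \<in> carrier D" by simp
  fix a assume a: "a \<in> carrier A"
  have "tgt HL (\<chi> a) = tgt HL (\<chi> (SR AG ell (\<lambda>x z. Lam (a \<otimes>\<^bsub>A\<^esub> x) \<otimes>\<^bsub>A\<^esub> S z)))"
    by (simp add: frobenius1 a)
  also have "\<dots> = SR AG ell (\<lambda>x z. tgt HL (\<chi> (Lam (a \<otimes>\<^bsub>A\<^esub> x) \<otimes>\<^bsub>A\<^esub> S z)))"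
    by (rule SR_push[where h = "\<lambda>w. tgt HL (\<chi> w)"]) (simp_all add: a c)
  also have "\<dots> = SR AG ell (\<lambda>x z. Lam (a \<otimes>\<^bsub>A\<^esub> (x \<otimes>\<^bsub>A\<^esub> tgt HL (\<chi> (S z)))))"
  proof (rule SR_cong[OF ell_closed])
    fix x z assume h: "x \<in> carrier A" "z \<in> carrier A"
    have "Lam (a \<otimes>\<^bsub>A\<^esub> (x \<otimes>\<^bsub>A\<^esub> tgt HL (\<chi> (S z)))) = Lam (a \<otimes>\<^bsub>A\<^esub> x) \<otimes>\<^bsub>A\<^esub> tgt HL (\<chi> (S z))"
      using Lam_C[of "a \<otimes>\<^bsub>A\<^esub> x" "tgt HL (\<chi> (S z))"] a h c by (simp add: m_assoc)
    moreover have "Lam (a \<otimes>\<^bsub>A\<^esub> x) = tgt HL (phi x a)" using a h by (simp add: tgt_phi)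
    ultimately show "tgt HL (\<chi> (Lam (a \<otimes>\<^bsub>A\<^esub> x) \<otimes>\<^bsub>A\<^esub> S z)) = Lam (a \<otimes>\<^bsub>A\<^esub> (x \<otimes>\<^bsub>A\<^esub> tgt HL (\<chi> (S z))))"
      using a h c by simp
  qed
  also have "\<dots> = Lam (a \<otimes>\<^bsub>A\<^esub> ?b)"
    by (rule SR_push[where h = "\<lambda>w. Lam (a \<otimes>\<^bsub>A\<^esub> w)", symmetric]) (simp_all add: a c distr)
  also have "\<dots> = tgt HL (phi ?b a)" by (rule tgt_phi[OF a b, symmetric])
  finally show "\<chi> a = phi ?b a" by (rule tgt_L_inj) (simp_all add: a b c)
qed

lemma ell_L_bij: "bij_betw (ac ell) (carrier D) (carrier A)"
proof (rule bij_betw_imageI)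
  show "inj_on (ac ell) (carrier D)"
    by (rule inj_onI) (metis ac_phi dual_is_phi ell_closed xi_act xi_inj)
  have "y = ac ell (phi (\<eta> y))" if "y \<in> carrier A" for y
    using that by (simp flip: xi_act)
  then have "carrier A \<subseteq> ac ell ` carrier D" using phi_closed[OF eta(1)] by (blast intro: image_eqI)
  then show "ac ell ` carrier D = carrier A" by auto
qed

lemma ell_L_inv_phi: "y \<in> carrier A \<Longrightarrow> ell_L_inv HL ell y = phi (\<eta> y)"
proof -
  assume y: "y \<in> carrier A"
  have e: "ell_L HL ell = ac ell" by (simp add: ell_L_def fun_eq_iff)
  show ?thesis unfolding ell_L_inv_def e
    by (rule inv_into_f_eq[OF bij_betw_imp_inj_on[OF ell_L_bij]]) (simp_all add: y flip: xi_act)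
qed

sublocale LD: left_bialgebroid_dual_basis HL ell
proof (unfold_locales, fact ell_closed, fact ell_L_bij)
  fix a assume a: "a \<in> carrier A"
  have "SL L.addA ell (\<lambda>x y. tgt HL (ell_L_inv HL ell y a) \<otimes>\<^bsub>A\<^esub> x) = SL AG ell (\<lambda>x y. Lam (a \<otimes>\<^bsub>A\<^esub> \<eta> y) \<otimes>\<^bsub>A\<^esub> x)"
    unfolding addA_eq by (rule SL_cong) (simp_all add: ell_L_inv_phi tgt_phi a)
  then show "SL L.addA ell (\<lambda>x y. tgt HL (ell_L_inv HL ell y a) \<otimes>\<^bsub>A\<^esub> x) = a"
    by (simp add: dual_basis a)
qed

abbreviation "co \<phi> \<equiv> \<eta> (ac ell \<phi>)"

lemma co_phi [simp]: "b \<in> carrier A \<Longrightarrow> co (phi b) = b"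
  by (simp flip: xi_act)

lemma phi_co [simp]: "\<phi> \<in> carrier D \<Longrightarrow> phi (co \<phi>) = \<phi>"
  using dual_is_phi[of \<phi>] by (auto simp flip: xi_act)

lemma dual_cases:
  assumes "\<phi> \<in> carrier D"
  obtains b where "b \<in> carrier A" "\<phi> = phi b"
  using dual_is_phi[OF assms] by blast

lemma phi_add [simp]: "\<lbrakk>a \<in> carrier A; b \<in> carrier A\<rbrakk> \<Longrightarrow> phi (a \<oplus>\<^bsub>A\<^esub> b) = phi a \<oplus>\<^bsub>D\<^esub> phi b"
  by (rule L.D_eqI) (simp_all add: L.D_add_closed, simp add: phi_def distr)

lemma hf_phi [simp]: "\<lbrakk>x \<in> carrier A; b \<in> carrier A\<rbrakk> \<Longrightarrow> harpoon_fun A x (phi b) = phi (x \<otimes>\<^bsub>A\<^esub> b)"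
  by (rule L.D_eqI) (simp_all, simp add: phi_def m_assoc)

text \<open>Acting on \<open>ell\<close>, the product acts first by \<open>phi a\<close>, which
  gives \<open>\<xi> a\<close>, and then by \<open>phi b\<close>; \<open>\<eta>\<close> returns to
  the coordinate.\<close>

lemma phi_mult: "\<lbrakk>a \<in> carrier A; b \<in> carrier A\<rbrakk> \<Longrightarrow> phi a \<otimes>\<^bsub>D\<^esub> phi b = phi (\<eta> (act (\<xi> a) b))"
  using phi_co[of "phi a \<otimes>\<^bsub>D\<^esub> phi b"] L.ac_ac[of "phi a" "phi b" ell]
  by (simp add: L.D_mult_closed flip: xi_act)

lemma phi_ell: "phi ell = \<one>\<^bsub>D\<^esub>"
  using phi_co[of "\<one>\<^bsub>D\<^esub>"] by (simp add: L.D_one_closed)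

text \<open>\<open>V\<close> is the antipode of the dual and \<open>W\<close> its inverse.\<close>

definition "V \<phi> = phi (\<xi> (co \<phi>))"
definition "W \<phi> = phi (\<eta> (co \<phi>))"

lemma V_phi [simp]: "b \<in> carrier A \<Longrightarrow> V (phi b) = phi (\<xi> b)"
  and W_phi [simp]: "b \<in> carrier A \<Longrightarrow> W (phi b) = phi (\<eta> b)"
  by (simp_all only: V_def W_def co_phi)

lemma VW_closed [simp]: "\<phi> \<in> carrier D \<Longrightarrow> V \<phi> \<in> carrier D" "\<phi> \<in> carrier D \<Longrightarrow> W \<phi> \<in> carrier D"
  by (simp_all add: V_def W_def)

lemma V_W [simp]: "\<phi> \<in> carrier D \<Longrightarrow> V (W \<phi>) = \<phi>"
  and W_V [simp]: "\<phi> \<in> carrier D \<Longrightarrow> W (V \<phi>) = \<phi>"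
  by (erule dual_cases; simp)+

lemma V_add: "\<lbrakk>\<phi> \<in> carrier D; \<psi> \<in> carrier D\<rbrakk> \<Longrightarrow> V (\<phi> \<oplus>\<^bsub>D\<^esub> \<psi>) = V \<phi> \<oplus>\<^bsub>D\<^esub> V \<psi>"
  and W_add: "\<lbrakk>\<phi> \<in> carrier D; \<psi> \<in> carrier D\<rbrakk> \<Longrightarrow> W (\<phi> \<oplus>\<^bsub>D\<^esub> \<psi>) = W \<phi> \<oplus>\<^bsub>D\<^esub> W \<psi>"
  by (erule dual_cases, erule dual_cases, simp flip: phi_add)+

lemma V_mult:
  assumes "\<phi> \<in> carrier D" "\<psi> \<in> carrier D"
  shows "V (\<phi> \<otimes>\<^bsub>D\<^esub> \<psi>) = V \<psi> \<otimes>\<^bsub>D\<^esub> V \<phi>"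
proof -
  obtain a b where "a \<in> carrier A" "\<phi> = phi a" "b \<in> carrier A" "\<psi> = phi b"
    using assms by (meson dual_cases)
  then show ?thesis using xi_act_flip[of "\<xi> a" b] by (simp add: phi_mult) (simp flip: xi_act_flip)
qed

lemma W_mult: "\<lbrakk>\<phi> \<in> carrier D; \<psi> \<in> carrier D\<rbrakk> \<Longrightarrow> W (\<phi> \<otimes>\<^bsub>D\<^esub> \<psi>) = W \<psi> \<otimes>\<^bsub>D\<^esub> W \<phi>"
  using V_mult[of "W \<psi>" "W \<phi>"] W_V[of "W \<psi> \<otimes>\<^bsub>D\<^esub> W \<phi>"] by (simp add: L.D_mult_closed)

lemma V_one: "V \<one>\<^bsub>D\<^esub> = \<one>\<^bsub>D\<^esub>"
  using V_phi[OF ell_closed] by (simp add: phi_ell xi_ell)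

lemma eta_src [simp]: "l \<in> carrier BL \<Longrightarrow> \<eta> (src HL l) = tgt HL l"
  by (rule xi_inj) (simp_all add: xi_C)

lemma phi_td: "l \<in> carrier BL \<Longrightarrow> phi (ell \<otimes>\<^bsub>A\<^esub> tgt HL l) = L.td l"
  and phi_sd: "l \<in> carrier BL \<Longrightarrow> phi (tgt HL l \<otimes>\<^bsub>A\<^esub> ell) = L.sd l"
  using phi_co[of "L.td l"] phi_co[of "L.sd l"] by (simp_all add: eta_mult)

text \<open>In coordinates \<open>ell tgt HL l\<close> is sent to \<open>src HL l ell\<close>, and
  in front of the integral \<open>src HL l\<close> may be exchanged for
  \<open>tgt HL l\<close>.\<close>

lemma V_td [simp]: "l \<in> carrier BL \<Longrightarrow> V (L.td l) = L.sd l"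
  using V_phi[of "ell \<otimes>\<^bsub>A\<^esub> tgt HL l"] ell_integral[of "tgt HL l"] pr_BC(2)[of "tgt HL l"]
  by (simp add: phi_td phi_sd[symmetric] xi_mult xi_ell xi_C)

text \<open>On source values the antipode acts through \<open>\<xi>\<close> on \<open>B\<close>; the
  element \<open>m\<close> names the result, an element of \<open>C\<close>, in the left base
  ring.\<close>

lemma V_sd:
  assumes "l \<in> carrier BL" "m \<in> carrier BL" "tgt HL m = \<xi> (src HL l)"
  shows "V (L.sd l) = L.td m"
proof -
  have e: "tgt HL l \<otimes>\<^bsub>A\<^esub> ell = src HL l \<otimes>\<^bsub>A\<^esub> ell"
    using ell_integral[of "tgt HL l"] pr_BC(2)[of "tgt HL l"] assms(1) by simp
  have "V (L.sd l) = V (phi (tgt HL l \<otimes>\<^bsub>A\<^esub> ell))" by (simp add: phi_sd assms(1))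
  also have "\<dots> = phi (ell \<otimes>\<^bsub>A\<^esub> tgt HL m)" using assms by (simp add: e xi_mult xi_ell)
  also have "\<dots> = L.td m" by (rule phi_td[OF assms(2)])
  finally show ?thesis .
qed

subsection \<open>The dual left bialgebroid\<close>

abbreviation "Hl \<equiv> dual_left HL HR S ell"
abbreviation "Hd \<equiv> dual_right HL ell"
abbreviation "psi \<equiv> LD.psi"
abbreviation "hf \<equiv> harpoon_fun A"

lemma psi_phi: "y \<in> carrier A \<Longrightarrow> psi y = phi (\<eta> y)"
  by (rule ell_L_inv_phi)

lemma Hl_sels [simp]: "total_ring Hl = D" "base_ring Hl = BR" "counit Hl \<phi> = lam (ac ell \<phi>)"
  by (simp_all add: dual_left_def dual_left_pre_def Let_def)

lemma pre_sels: "total_ring (dual_left_pre HL HR ell) = D" "base_ring (dual_left_pre HL HR ell) = BR"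
  "src (dual_left_pre HL HR ell) = src Hl" "tgt (dual_left_pre HL HR ell) = tgt Hl"
  by (simp_all add: dual_left_def dual_left_pre_def Let_def)

lemma src_Hl [simp]: "l \<in> carrier BL \<Longrightarrow> src Hl (\<mu> l) = L.td l"
  using inv_into_f_f[OF bij_betw_imp_inj_on[OF mu_bij], of l]
  by (simp add: dual_left_def dual_left_pre_def Let_def L.td_def)

text \<open>The inverse of \<open>\<kappa>\<close> in the definition of the target map serves
  exactly this purpose: \<open>\<kappa>\<close> is \<open>\<xi>\<close> on \<open>B\<close>, so
  undoing it picks the source value \<open>L.sd m\<close> which the antipode sends to
  \<open>L.td l\<close>.\<close>

lemma tgt_Hl [simp]:
  assumes l: "l \<in> carrier BL"
  shows "tgt Hl (\<mu> l) = W (L.td l)"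
proof -
  define r where "r = inv_into (carrier BR) \<kappa> (\<mu> l)"
  have "\<mu> l \<in> \<kappa> ` carrier BR"
    using kappa_iso l by (auto simp: ring_iso_def bij_betw_def)
  then have r: "r \<in> carrier BR" "\<kappa> r = \<mu> l"
    unfolding r_def by (rule inv_into_into, rule f_inv_into_f)
  then have "tgt HR r \<in> src HL ` carrier BL" by (simp add: src_L_image)
  then obtain m where m: "m \<in> carrier BL" "src HL m = tgt HR r" by (metis imageE)
  have "tgt Hl (\<mu> l) = L.sd m"
    by (simp add: dual_left_def dual_left_pre_def Let_def L.sd_def m(2) flip: r_def)
  moreover have "tgt HL l = \<xi> (src HL m)"
    using src_kappa[OF r(1)] r l by (simp add: m(2))
  ultimately show ?thesis
    using V_sd[OF m(1) l] W_V[of "L.sd m"] m(1) by simp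
qed

lemma src_tgt_Hl_closed [simp]: "r \<in> carrier BR \<Longrightarrow> src Hl r \<in> carrier D" "r \<in> carrier BR \<Longrightarrow> tgt Hl r \<in> carrier D"
  by (erule mu_cases; simp)+

sublocale TL: tensor_setting BR D "\<lambda>a b. mult_left D (tgt Hl) b a" "mult_left D (src Hl)" D
  by unfold_locales (simp_all add: mult_left_def L.D_mult_closed)

lemma left_tensor_Hl: "left_tensor Hl = TL.T" "left_tensor (dual_left_pre HL HR ell) = TL.T"
  by (simp_all add: left_tensor_def pre_sels)

lemma TL_balI:
  assumes "\<And>x y. \<lbrakk>x \<in> carrier D; y \<in> carrier D\<rbrakk> \<Longrightarrow> f x y \<in> carrier G"
    and "\<And>x x' y. \<lbrakk>x \<in> carrier D; x' \<in> carrier D; y \<in> carrier D\<rbrakk> \<Longrightarrow> f (x \<oplus>\<^bsub>D\<^esub> x') y = f x y \<otimes>\<^bsub>G\<^esub> f x' y"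
    and "\<And>x y y'. \<lbrakk>x \<in> carrier D; y \<in> carrier D; y' \<in> carrier D\<rbrakk> \<Longrightarrow> f x (y \<oplus>\<^bsub>D\<^esub> y') = f x y \<otimes>\<^bsub>G\<^esub> f x y'"
    and "\<And>x l y. \<lbrakk>x \<in> carrier D; l \<in> carrier BL; y \<in> carrier D\<rbrakk>
      \<Longrightarrow> f (W (L.td l) \<otimes>\<^bsub>D\<^esub> x) y = f x (L.td l \<otimes>\<^bsub>D\<^esub> y)"
  shows "TL.bal G f"
proof (rule balancedI)
  fix x r y assume h: "x \<in> carrier D" "r \<in> carrier BR" "y \<in> carrier D"
  obtain l where "l \<in> carrier BL" "r = \<mu> l" using h(2) by (rule mu_cases)
  then show "f (mult_left D (tgt Hl) r x) y = f x (mult_left D (src Hl) r y)"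
    by (simp add: mult_left_def assms(4) h)
qed (simp_all add: assms(1-3))

lemma TL_balD:
  assumes "TL.bal G f" "x \<in> carrier D" "l \<in> carrier BL" "y \<in> carrier D"
  shows "f (W (L.td l) \<otimes>\<^bsub>D\<^esub> x) y = f x (L.td l \<otimes>\<^bsub>D\<^esub> y)"
  using balancedD(4)[OF assms(1,2) _ assms(4), of "\<mu> l"] assms(3) by (simp add: mult_left_def)

lemma phi_mult_base:
  assumes "w \<in> carrier A" "l \<in> carrier BL"
  shows "phi w \<otimes>\<^bsub>D\<^esub> L.td l = phi (w \<otimes>\<^bsub>A\<^esub> tgt HL l)" "phi w \<otimes>\<^bsub>D\<^esub> L.sd l = phi (tgt HL l \<otimes>\<^bsub>A\<^esub> w)"
proof -
  have "ac ell (phi w \<otimes>\<^bsub>D\<^esub> L.td l) = src HL l \<otimes>\<^bsub>A\<^esub> \<xi> w" "ac ell (phi w \<otimes>\<^bsub>D\<^esub> L.sd l) = \<xi> w \<otimes>\<^bsub>A\<^esub> src HL l"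
    using assms by (simp_all add: L.ac_ac[symmetric] xi_act[symmetric])
  then show "phi w \<otimes>\<^bsub>D\<^esub> L.td l = phi (w \<otimes>\<^bsub>A\<^esub> tgt HL l)" "phi w \<otimes>\<^bsub>D\<^esub> L.sd l = phi (tgt HL l \<otimes>\<^bsub>A\<^esub> w)"
    using phi_co[of "phi w \<otimes>\<^bsub>D\<^esub> L.td l"] phi_co[of "phi w \<otimes>\<^bsub>D\<^esub> L.sd l"] assms
    by (simp_all add: L.D_mult_closed eta_mult)
qed

text \<open>Left multiplications in the dual are obtained from the right ones of
  \<open>phi_mult_base\<close> through the anti-automorphism \<open>W\<close>.\<close>

lemma base_mult_phi:
  assumes "w \<in> carrier A" "l \<in> carrier BL"
  shows "L.td l \<otimes>\<^bsub>D\<^esub> phi w = phi (w \<otimes>\<^bsub>A\<^esub> \<eta> (tgt HL l))"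
    "W (L.td l) \<otimes>\<^bsub>D\<^esub> phi w = phi (\<eta> (tgt HL l) \<otimes>\<^bsub>A\<^esub> w)"
  using W_mult[of "phi (\<xi> w)" "L.sd l"] W_mult[of "phi (\<xi> w)" "L.td l"] W_V[of "L.td l"] assms
  by (simp_all add: phi_mult_base eta_mult)

text \<open>Two applications of \<open>\<eta>\<close> turn a left factor \<open>src HL l\<close> of
  \<open>y\<close> into a left factor \<open>\<eta> (tgt HL l)\<close>. In coordinates this is left
  multiplication by \<open>W (L.td l)\<close>, the target value of the dual left
  bialgebroid.\<close>

lemma bal_dual_left:
  assumes f: "TL.bal G f" and p: "\<phi> \<in> carrier D"
  shows "balL G (\<lambda>x y. f (hf (\<eta> (\<eta> y)) \<phi>) (psi x))"
proof (rule L.balI)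
  obtain b where b: "b \<in> carrier A" "\<phi> = phi b" using p by (rule dual_cases)
  fix x l y assume h: "x \<in> carrier A" "l \<in> carrier BL" "y \<in> carrier A"
  show "f (hf (\<eta> (\<eta> y)) \<phi>) (psi (tgt HL l \<otimes>\<^bsub>A\<^esub> x)) = f (hf (\<eta> (\<eta> (src HL l \<otimes>\<^bsub>A\<^esub> y))) \<phi>) (psi x)"
  proof -
    have e1: "psi (tgt HL l \<otimes>\<^bsub>A\<^esub> x) = L.td l \<otimes>\<^bsub>D\<^esub> psi x"
      unfolding psi_phi[OF h(1)] base_mult_phi(1)[OF eta(1)[OF h(1)] h(2)]
      by (simp add: psi_phi eta_mult h)
    have e2: "hf (\<eta> (\<eta> (src HL l \<otimes>\<^bsub>A\<^esub> y))) \<phi> = W (L.td l) \<otimes>\<^bsub>D\<^esub> hf (\<eta> (\<eta> y)) \<phi>"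
      using base_mult_phi(2)[of "\<eta> (\<eta> y) \<otimes>\<^bsub>A\<^esub> b" l] b h by (simp add: eta_mult m_assoc)
    show ?thesis
      unfolding e1 e2 by (rule TL_balD[OF f, symmetric]) (simp_all add: h p)
  qed
qed (simp_all add: p balancedD(1-3)[OF f])

lemma comult_Hl:
  assumes "\<phi> \<in> carrier D"
  shows "comult Hl \<phi> = SL TL.T ell (\<lambda>x y. tens TL.T (hf (\<eta> (\<eta> y)) \<phi>, psi x))"
proof -
  let ?T = "left_tensor (dual_left_pre HL HR ell)"
  have "comult Hl \<phi> = tlift ?T (\<lambda>(x, y). tens ?T (hf (\<eta> (\<eta> y)) \<phi>, psi x)) (comult HL ell)"
    by (simp add: dual_left_def Let_def)
  then show ?thesis
    unfolding left_tensor_Hl SL_tlift[OF TL.comm_group_T bal_dual_left[OF TL.bal_tens assms] ell_closed] .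
qed

lemma tlift_Hl:
  assumes "comm_group G" "TL.bal G f" "\<phi> \<in> carrier D"
  shows "tlift G (\<lambda>(u, v). f u v) (comult Hl \<phi>) = SL G ell (\<lambda>x y. f (hf (\<eta> (\<eta> y)) \<phi>) (psi x))"
proof -
  have "tlift G (\<lambda>(u, v). f u v) (comult Hl \<phi>)
      = SL G ell (\<lambda>x y. tlift G (\<lambda>(u, v). f u v) (tens TL.T (hf (\<eta> (\<eta> y)) \<phi>, psi x)))"
    unfolding comult_Hl[OF assms(3)]
    by (rule SL_hom[OF TL.tlift_hom[OF assms(1,2)] TL.comm_group_T assms(1) ell_closed])
      (simp add: TL.tens_cl assms(3))
  also have "\<dots> = SL G ell (\<lambda>x y. f (hf (\<eta> (\<eta> y)) \<phi>) (psi x))"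
    by (rule SL_cong) (simp_all add: TL.tlift_tens[OF assms(1,2)] assms(3))
  finally show ?thesis .
qed

lemma bal_flip:
  assumes f: "TL.bal G f"
  shows "LD.TD.bal G (\<lambda>x y. f (W y) (W x))"
proof (rule balancedI)
  fix x l y assume h: "x \<in> carrier D" "l \<in> carrier BL" "y \<in> carrier D"
  have "W (x \<otimes>\<^bsub>D\<^esub> L.sd l) = L.td l \<otimes>\<^bsub>D\<^esub> W x"
    using W_mult[of x "L.sd l"] W_V[of "L.td l"] h by simp
  moreover have "W (y \<otimes>\<^bsub>D\<^esub> L.td l) = W (L.td l) \<otimes>\<^bsub>D\<^esub> W y"
    by (rule W_mult) (simp_all add: h)
  ultimately show "f (W y) (W (LD.ractD x l)) = f (W (LD.lactD l y)) (W x)"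
    using TL_balD[OF f, of "W y" l "W x"] h by (simp add: mult_right_def)
qed (simp_all add: W_add balancedD(1-3)[OF f])

text \<open>
  Applying \<open>ell_right_xi\<close> once more identifies the comultiplication with the flip of the one of
  the dual right bialgebroid, transported along the antipode.
\<close>

lemma SL_flip:
  assumes G: "comm_group G" and f: "TL.bal G f" and p: "\<phi> \<in> carrier D"
  shows "SL G ell (\<lambda>x y. f (hf (\<eta> (\<eta> y)) \<phi>) (psi x)) = LD.Rd.SR G (V \<phi>) (\<lambda>x y. f (W y) (W x))"
proof -
  obtain b where b: "b \<in> carrier A" "\<phi> = phi b" using p by (rule dual_cases)
  have bal: "balL G (\<lambda>x y. f (phi (\<eta> (\<eta> y))) (phi (\<eta> x)))"
    by (rule balL_cong[OF bal_dual_left[OF f phi_closed[OF L.source.S.one_closed]]]) (simp add: psi_phi)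
  have "LD.Rd.SR G (V \<phi>) (\<lambda>x y. f (W y) (W x)) = SL G ell (\<lambda>x y. f (W (psi y)) (W (hf x (V \<phi>))))"
    by (rule LD.SR_dual[OF G bal_flip[OF f]]) (simp add: p)
  also have "\<dots> = SL G ell (\<lambda>x y. f (phi (\<eta> (\<eta> y))) (phi (\<eta> (x \<otimes>\<^bsub>A\<^esub> \<xi> b))))"
    by (rule SL_cong) (simp_all add: b psi_phi)
  also have "\<dots> = SL G ell (\<lambda>x y. f (phi (\<eta> (\<eta> (y \<otimes>\<^bsub>A\<^esub> \<xi> (\<xi> b))))) (phi (\<eta> x)))"
    by (rule ell_right_xi[OF G bal]) (simp add: b)
  also have "\<dots> = SL G ell (\<lambda>x y. f (hf (\<eta> (\<eta> y)) \<phi>) (psi x))"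
    by (rule SL_cong) (simp_all add: b psi_phi eta_mult)
  finally show ?thesis by (rule sym)
qed

lemma W_sd [simp]: "l \<in> carrier BL \<Longrightarrow> W (L.sd l) = L.td l"
  using W_V[of "L.td l"] by simp

text \<open>With the twist available, only the explicit structure maps of \<open>Hl\<close> have to
  be recognised as the transported ones: source and target by \<open>src_Hl\<close> and
  \<open>tgt_Hl\<close>, the comultiplication by \<open>SL_flip\<close>, and the counit by comparing
  images under \<open>src HR\<close>.\<close>

sublocale TW: bialgebroid_twist Hd Hl V W \<mu>
proof (intro bialgebroid_twist.intro bialgebroid_twist_axioms.intro LD.right_bialgebroid_dual)
  show "ring (base_ring Hl)" by (simp add: R.source.R.ring_axioms)
  show "bij_betw \<mu> (carrier (base_ring Hd)) (carrier (base_ring Hl))" by (simp add: mu_bij)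
  show "counit Hl \<phi> = \<mu> (counit Hd (V \<phi>))" if "\<phi> \<in> carrier (total_ring Hd)" for \<phi>
  proof -
    obtain b where b: "b \<in> carrier A" "\<phi> = phi b" using \<open>\<phi> \<in> carrier (total_ring Hd)\<close> by (auto elim: dual_cases)
    have "src HR (counit Hl \<phi>) = src HR (\<mu> (counit Hd (V \<phi>)))"
      using b by (simp add: tgt_phi flip: xi_act Lam_def)
    then show ?thesis by (rule src_R_inj) (simp_all add: b flip: xi_act)
  qed
  show "comult Hl \<phi> = LD.Rd.SR (left_tensor Hl) (V \<phi>) (\<lambda>x y. tens (left_tensor Hl) (W y, W x))"
    if "\<phi> \<in> carrier (total_ring Hd)" for \<phi>
    using that SL_flip[OF TL.comm_group_T TL.bal_tens, of \<phi>] by (simp add: comult_Hl left_tensor_Hl)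
qed (simp_all add: mu_add mu_mult mu_one V_add V_mult V_one)

sublocale Ld: left_bialgebroid Hl
  by (rule TW.left_bialgebroid_twist)

lemma SL_dual:
  assumes "comm_group G" "TL.bal G f" "\<phi> \<in> carrier D"
  shows "Ld.SL G \<phi> f = SL G ell (\<lambda>x y. f (hf (\<eta> (\<eta> y)) \<phi>) (psi x))"
  using Ld.SL_tlift[of G f \<phi>] assms tlift_Hl[OF assms] by simp

text \<open>\<open>\<xi>\<close> carries \<open>B\<close> into \<open>C\<close>, which supplies the
  element \<open>m\<close> required by \<open>V_sd\<close>.\<close>

lemma sd_image:
  assumes "l \<in> carrier BL"
  obtains m where "m \<in> carrier BL" "L.sd l = W (L.td m)"
proof -
  have "\<xi> (src HL l) \<in> C" using xi_B[of "src HL l"] assms by simp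
  then obtain m where m: "m \<in> carrier BL" "tgt HL m = \<xi> (src HL l)" by (auto simp: C_def)
  then have "L.sd l = W (L.td m)"
    using V_sd[OF assms m] W_V[of "L.sd l"] assms by simp
  with m(1) show ?thesis by (rule that)
qed

lemma images_dual: "src Hl ` carrier (base_ring Hl) = tgt Hd ` carrier (base_ring Hd)"
  "tgt Hl ` carrier (base_ring Hl) = src Hd ` carrier (base_ring Hd)"
proof -
  have e: "\<mu> ` carrier BL = carrier BR" by (rule bij_betw_imp_surj_on[OF mu_bij])
  have "src Hl ` carrier BR = L.td ` carrier BL"
    unfolding e[symmetric] image_image by (rule image_cong) simp_all
  moreover have "tgt Hl ` carrier BR = L.sd ` carrier BL"
  proof (intro equalityI subsetI)
    fix x assume "x \<in> tgt Hl ` carrier BR"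
    then obtain l where l: "l \<in> carrier BL" "x = W (L.td l)" by (auto elim: mu_cases)
    have "\<mu> l \<in> \<kappa> ` carrier BR"
      using kappa_iso l by (auto simp: ring_iso_def bij_betw_def)
    then obtain r where r: "r \<in> carrier BR" "\<mu> l = \<kappa> r" by blast
    then have "tgt HR r \<in> src HL ` carrier BL" by (simp add: src_L_image)
    then obtain m where m: "m \<in> carrier BL" "src HL m = tgt HR r" by (metis imageE)
    have "tgt HL l = \<xi> (src HL m)"
      using src_kappa[OF r(1)] l by (simp add: m(2) r(2)[symmetric])
    then have "x = L.sd m" using V_sd[OF m(1) l(1)] W_V[of "L.sd m"] m(1) l(2) by simp
    then show "x \<in> L.sd ` carrier BL" using m(1) by blast
  next
    fix x assume "x \<in> L.sd ` carrier BL"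
    then obtain l where "l \<in> carrier BL" "x = L.sd l" by blast
    then obtain m where "m \<in> carrier BL" "x = W (L.td m)" by (metis sd_image)
    then show "x \<in> tgt Hl ` carrier BR" by (intro image_eqI[of _ _ "\<mu> m"]) simp_all
  qed
  ultimately show "src Hl ` carrier (base_ring Hl) = tgt Hd ` carrier (base_ring Hd)"
    "tgt Hl ` carrier (base_ring Hl) = src Hd ` carrier (base_ring Hd)" by simp_all
qed

section \<open>Mixed coassociativity of the dual\<close>

sublocale Pd: bialgebroid_pair Hl Hd
  by unfold_locales (simp, fact images_dual(1), fact images_dual(2))

lemma b3LR_dual:
  assumes "Pd.b3LR G f"
  shows "\<phi> \<in> carrier D \<Longrightarrow> LD.TD.bal G (f \<phi>)" "\<phi> \<in> carrier D \<Longrightarrow> TL.bal G (\<lambda>\<psi> \<chi>. f \<psi> \<chi> \<phi>)"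
  using assms by (simp_all add: Pd.b3LR_def)

lemma b3RL_dual:
  assumes "Pd.b3RL G f"
  shows "\<phi> \<in> carrier D \<Longrightarrow> TL.bal G (f \<phi>)" "\<phi> \<in> carrier D \<Longrightarrow> LD.TD.bal G (\<lambda>\<psi> \<chi>. f \<psi> \<chi> \<phi>)"
  using assms by (simp_all add: Pd.b3RL_def)

text \<open>Both sides are double sums over two copies of the coproduct of \<open>ell\<close>. The
  key identity on the inner copy transfers the action of \<open>x\<close> from the first factor to
  \<open>psi u\<close>, and an interchange of the two sums finishes.\<close>

lemma coassoc_LR_dual:
  assumes G: "comm_group G" and f: "Pd.b3LR G f" and p: "\<phi> \<in> carrier D"
  shows "LD.Rd.SR G \<phi> (\<lambda>x y. Ld.SL G x (\<lambda>u v. f u v y)) = Ld.SL G \<phi> (\<lambda>x y. LD.Rd.SR G y (f x))"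
proof -
  note b = b3LR_dual[OF f]
  have b1: "LD.TD.bal G (\<lambda>x y. Ld.SL G x (\<lambda>u v. f u v y))" using Pd.b3LRD1[OF G f] by simp
  have b2: "TL.bal G (\<lambda>x y. LD.Rd.SR G y (f x))" using Pd.b3LRD2[OF G f] by simp
  have fc: "f x y z \<in> carrier G" if "x \<in> carrier D" "y \<in> carrier D" "z \<in> carrier D" for x y z
    using balancedD(1)[OF b(1)] that by blast
  have "LD.Rd.SR G \<phi> (\<lambda>x y. Ld.SL G x (\<lambda>u v. f u v y))
      = SL G ell (\<lambda>x y. Ld.SL G (hf x \<phi>) (\<lambda>u v. f u v (psi y)))"
    by (rule LD.SR_dual[OF G b1 p])
  also have "\<dots> = SL G ell (\<lambda>x y. SL G ell (\<lambda>u v. f (hf (\<eta> (\<eta> v)) \<phi>) (hf x (psi u)) (psi y)))"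
  proof (rule SL_cong[OF ell_closed])
    fix x y assume h: "x \<in> carrier A" "y \<in> carrier A"
    have "Ld.SL G (hf x \<phi>) (\<lambda>u v. f u v (psi y))
        = SL G ell (\<lambda>u v. f (hf (\<eta> (\<eta> v)) (hf x \<phi>)) (psi u) (psi y))"
      by (rule SL_dual[OF G b(2)]) (simp_all add: h p)
    \<comment> \<open>\<open>x\<close> is written as
      \<open>\<eta> (\<eta> (\<xi> (\<xi> x)))\<close> so that it joins \<open>v\<close> under the
      two inverses; only then does the key identity apply to it.\<close>
    also have "\<dots> = SL G ell (\<lambda>u v. f (hf (\<eta> (\<eta> (v \<otimes>\<^bsub>A\<^esub> \<xi> (\<xi> x)))) \<phi>) (psi u) (psi y))"
      by (rule SL_cong) (simp_all add: h p eta_mult LD.hf_hf)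
    also have "\<dots> = SL G ell (\<lambda>u v. f (hf (\<eta> (\<eta> v)) \<phi>) (psi (u \<otimes>\<^bsub>A\<^esub> \<xi> x)) (psi y))"
      by (rule ell_right_xi[OF G bal_dual_left[OF b(2) p], symmetric]) (simp_all add: h)
    also have "\<dots> = SL G ell (\<lambda>u v. f (hf (\<eta> (\<eta> v)) \<phi>) (hf x (psi u)) (psi y))"
      by (rule SL_cong) (simp_all add: h psi_phi eta_mult)
    finally show "Ld.SL G (hf x \<phi>) (\<lambda>u v. f u v (psi y)) = \<dots>" .
  qed
  also have "\<dots> = SL G ell (\<lambda>u v. SL G ell (\<lambda>x y. f (hf (\<eta> (\<eta> v)) \<phi>) (hf x (psi u)) (psi y)))"
    by (rule SL_SL_swap[OF G]) (simp_all add: fc p)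
  also have "\<dots> = SL G ell (\<lambda>u v. LD.Rd.SR G (psi u) (f (hf (\<eta> (\<eta> v)) \<phi>)))"
    by (rule SL_cong) (simp_all add: LD.SR_dual[OF G b(1)] p)
  also have "\<dots> = Ld.SL G \<phi> (\<lambda>x y. LD.Rd.SR G y (f x))"
    by (rule SL_dual[OF G b2 p, symmetric])
  finally show ?thesis .
qed

text \<open>The same transfer in the other direction: the action of \<open>\<eta> (\<eta> v)\<close>
  on \<open>\<phi>\<close> is moved by the key identity to \<open>psi y\<close>.\<close>

lemma coassoc_RL_dual:
  assumes G: "comm_group G" and f: "Pd.b3RL G f" and p: "\<phi> \<in> carrier D"
  shows "Ld.SL G \<phi> (\<lambda>x y. LD.Rd.SR G x (\<lambda>u v. f u v y)) = LD.Rd.SR G \<phi> (\<lambda>x y. Ld.SL G y (f x))"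
proof -
  note b = b3RL_dual[OF f]
  have b1: "TL.bal G (\<lambda>x y. LD.Rd.SR G x (\<lambda>u v. f u v y))" using Pd.b3RLD1[OF G f] by simp
  have b2: "LD.TD.bal G (\<lambda>x y. Ld.SL G y (f x))" using Pd.b3RLD2[OF G f] by simp
  have fc: "f x y z \<in> carrier G" if "x \<in> carrier D" "y \<in> carrier D" "z \<in> carrier D" for x y z
    using balancedD(1)[OF b(1)] that by blast
  have "Ld.SL G \<phi> (\<lambda>x y. LD.Rd.SR G x (\<lambda>u v. f u v y))
      = SL G ell (\<lambda>u v. LD.Rd.SR G (hf (\<eta> (\<eta> v)) \<phi>) (\<lambda>x y. f x y (psi u)))"
    by (rule SL_dual[OF G b1 p])
  also have "\<dots> = SL G ell (\<lambda>u v. SL G ell (\<lambda>x y. f (hf x \<phi>) (hf (\<eta> (\<eta> v)) (psi y)) (psi u)))"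
  proof (rule SL_cong[OF ell_closed])
    fix u v assume h: "u \<in> carrier A" "v \<in> carrier A"
    have "LD.Rd.SR G (hf (\<eta> (\<eta> v)) \<phi>) (\<lambda>x y. f x y (psi u))
        = SL G ell (\<lambda>x y. f (hf x (hf (\<eta> (\<eta> v)) \<phi>)) (psi y) (psi u))"
      by (rule LD.SR_dual[OF G b(2)]) (simp_all add: h p)
    also have "\<dots> = SL G ell (\<lambda>x y. f (hf (x \<otimes>\<^bsub>A\<^esub> \<eta> (\<eta> v)) \<phi>) (psi y) (psi u))"
      by (rule SL_cong) (simp_all add: h p LD.hf_hf)
    also have "\<dots> = SL G ell (\<lambda>x y. f (hf x \<phi>) (psi (y \<otimes>\<^bsub>A\<^esub> \<xi> (\<eta> (\<eta> v)))) (psi u))"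
      by (rule ell_right_xi[OF G LD.bal_dual[OF b(2) p]]) (simp_all add: h)
    also have "\<dots> = SL G ell (\<lambda>x y. f (hf x \<phi>) (hf (\<eta> (\<eta> v)) (psi y)) (psi u))"
      by (rule SL_cong) (simp_all add: h psi_phi eta_mult)
    finally show "LD.Rd.SR G (hf (\<eta> (\<eta> v)) \<phi>) (\<lambda>x y. f x y (psi u)) = \<dots>" .
  qed
  also have "\<dots> = SL G ell (\<lambda>x y. SL G ell (\<lambda>u v. f (hf x \<phi>) (hf (\<eta> (\<eta> v)) (psi y)) (psi u)))"
    by (rule SL_SL_swap[OF G]) (simp_all add: fc p)
  also have "\<dots> = SL G ell (\<lambda>x y. Ld.SL G (psi y) (f (hf x \<phi>)))"
    by (rule SL_cong) (simp_all add: SL_dual[OF G b(1)] p)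
  also have "\<dots> = LD.Rd.SR G \<phi> (\<lambda>x y. Ld.SL G y (f x))"
    by (rule LD.SR_dual[OF G b2 p, symmetric])
  finally show ?thesis .
qed

subsection \<open>The antipode of the dual\<close>

lemma dual_antipode_eq: "\<phi> \<in> carrier D \<Longrightarrow> dual_antipode HL HR S ell \<phi> = V \<phi>"
  by (simp add: dual_antipode_def V_def ell_L_def psi_phi)

lemma bal_antipode_right: "LD.TD.bal LD.addD (\<lambda>\<phi> \<psi>. \<phi> \<otimes>\<^bsub>D\<^esub> V \<psi>)"
  by (rule balancedI) (simp_all add: mult_right_def L.D_mult_closed V_add V_mult LD.D_distr)

lemma bal_antipode_left: "TL.bal LD.addD (\<lambda>\<phi> \<psi>. V \<phi> \<otimes>\<^bsub>D\<^esub> \<psi>)"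
  by (rule TL_balI) (simp_all add: L.D_mult_closed V_add V_mult LD.D_distr)

text \<open>The antipode cancels the inverse of \<open>\<xi>\<close> contained in
  \<open>psi y\<close>, which leaves the products of \<open>phi (x b)\<close> and
  \<open>phi y\<close>. Evaluated at \<open>a\<close>, multiplicativity of the left coproduct
  assembles the legs into the action of \<open>phi b\<close> on \<open>a ell\<close>, and the
  integral property reduces this to a multiple of \<open>\<xi> b\<close>.\<close>

lemma antipode_right_dual:
  assumes p: "\<phi> \<in> carrier D"
  shows "LD.Rd.SR LD.addD \<phi> (\<lambda>x y. x \<otimes>\<^bsub>D\<^esub> V y) = L.td (V \<phi> \<one>\<^bsub>A\<^esub>)"
proof -
  obtain b where b: "b \<in> carrier A" "\<phi> = phi b" using p by (rule dual_cases)
  have "LD.Rd.SR LD.addD \<phi> (\<lambda>x y. x \<otimes>\<^bsub>D\<^esub> V y) = SL LD.addD ell (\<lambda>x y. hf x \<phi> \<otimes>\<^bsub>D\<^esub> V (psi y))"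
    by (rule LD.SR_dual[OF LD.cg_addD bal_antipode_right p])
  also have "\<dots> = SL LD.addD ell (\<lambda>x y. phi (x \<otimes>\<^bsub>A\<^esub> b) \<otimes>\<^bsub>D\<^esub> phi y)"
    by (rule SL_cong) (simp_all add: b psi_phi)
  also have "\<dots> = L.td (V \<phi> \<one>\<^bsub>A\<^esub>)"
  proof (rule L.D_eqI)
    show "SL LD.addD ell (\<lambda>x y. phi (x \<otimes>\<^bsub>A\<^esub> b) \<otimes>\<^bsub>D\<^esub> phi y) \<in> carrier D"
      using SL_closed[OF LD.cg_addD ell_closed, of "\<lambda>x y. phi (x \<otimes>\<^bsub>A\<^esub> b) \<otimes>\<^bsub>D\<^esub> phi y"] b
      by (simp add: L.D_mult_closed)
    fix a assume a: "a \<in> carrier A"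
    have "(SL LD.addD ell (\<lambda>x y. phi (x \<otimes>\<^bsub>A\<^esub> b) \<otimes>\<^bsub>D\<^esub> phi y)) a
        = SL L.addB ell (\<lambda>x y. (phi (x \<otimes>\<^bsub>A\<^esub> b) \<otimes>\<^bsub>D\<^esub> phi y) a)"
      by (rule LD.SL_addD_apply) (simp_all add: a b L.D_mult_closed)
    \<comment> \<open>From here on the images under the injective map \<open>tgt HL\<close> are
      compared, because there values of \<open>phi\<close> become values of
      \<open>Lam\<close>.\<close>
    also have "tgt HL \<dots> = SL AG ell (\<lambda>x y. tgt HL ((phi (x \<otimes>\<^bsub>A\<^esub> b) \<otimes>\<^bsub>D\<^esub> phi y) a))"
      by (rule L.SL_push[where G = L.addB]) (simp_all add: a b L.D_mult_closed)
    also have "\<dots> = SL AG ell (\<lambda>x y. SL AG a (\<lambda>u v. Lam (S (Lam (u \<otimes>\<^bsub>A\<^esub> x \<otimes>\<^bsub>A\<^esub> b)) \<otimes>\<^bsub>A\<^esub> (v \<otimes>\<^bsub>A\<^esub> y))))"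
    proof (rule SL_cong[OF ell_closed])
      fix x y assume h: "x \<in> carrier A" "y \<in> carrier A"
      have "tgt HL ((phi (x \<otimes>\<^bsub>A\<^esub> b) \<otimes>\<^bsub>D\<^esub> phi y) a) = Lam (act a (x \<otimes>\<^bsub>A\<^esub> b) \<otimes>\<^bsub>A\<^esub> y)"
        by (simp add: a b h tgt_phi)
      also have "\<dots> = SL AG a (\<lambda>u v. Lam (S (Lam (u \<otimes>\<^bsub>A\<^esub> (x \<otimes>\<^bsub>A\<^esub> b))) \<otimes>\<^bsub>A\<^esub> v \<otimes>\<^bsub>A\<^esub> y))"
        unfolding act_def
        by (rule SL_push[where h = "\<lambda>w. Lam (w \<otimes>\<^bsub>A\<^esub> y)"]) (simp_all add: a b h distr)
      also have "\<dots> = SL AG a (\<lambda>u v. Lam (S (Lam (u \<otimes>\<^bsub>A\<^esub> x \<otimes>\<^bsub>A\<^esub> b)) \<otimes>\<^bsub>A\<^esub> (v \<otimes>\<^bsub>A\<^esub> y)))"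
        by (rule SL_cong) (simp_all add: a b h m_assoc)
      finally show "tgt HL ((phi (x \<otimes>\<^bsub>A\<^esub> b) \<otimes>\<^bsub>D\<^esub> phi y) a) = \<dots>" .
    qed
    also have "\<dots> = SL AG ell (\<lambda>x y. Lam (SL AG a (\<lambda>u v. S (Lam (u \<otimes>\<^bsub>A\<^esub> x \<otimes>\<^bsub>A\<^esub> b)) \<otimes>\<^bsub>A\<^esub> (v \<otimes>\<^bsub>A\<^esub> y))))"
      by (rule SL_cong[OF ell_closed], rule SL_push[where h = Lam, symmetric]) (simp_all add: a b)
    also have "\<dots> = Lam (SL AG ell (\<lambda>x y. SL AG a (\<lambda>u v. S (Lam (u \<otimes>\<^bsub>A\<^esub> x \<otimes>\<^bsub>A\<^esub> b)) \<otimes>\<^bsub>A\<^esub> (v \<otimes>\<^bsub>A\<^esub> y))))"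
      by (rule SL_push[where h = Lam, symmetric]) (simp_all add: a b)
    also have "\<dots> = Lam (act (a \<otimes>\<^bsub>A\<^esub> ell) b)"
      unfolding act_def by (subst SL_times[OF cgA bal_act[OF b(1)] a ell_closed]) simp
    \<comment> \<open>\<open>a ell = pr' a ell\<close> by \<open>integral_C\<close>, and the action
      commutes with the left factor \<open>pr' a\<close>, a target value.\<close>
    also have "\<dots> = Lam (pr' a \<otimes>\<^bsub>A\<^esub> \<xi> b)"
      using L.ac_tgt[of "phi b" "counit HL a" ell] a b integral_C[OF ell_closed ell_integral a]
      by (simp add: pr'_def flip: xi_act)
    also have "\<dots> = tgt HL (L.td (V \<phi> \<one>\<^bsub>A\<^esub>) a)"
      using a b by (simp add: L.td_def tgt_phi Lam_left pr'_def)
    finally show "(SL LD.addD ell (\<lambda>x y. phi (x \<otimes>\<^bsub>A\<^esub> b) \<otimes>\<^bsub>D\<^esub> phi y)) a = L.td (V \<phi> \<one>\<^bsub>A\<^esub>) a"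
    proof (rule tgt_L_inj)
      show "SL LD.addD ell (\<lambda>x y. phi (x \<otimes>\<^bsub>A\<^esub> b) \<otimes>\<^bsub>D\<^esub> phi y) a \<in> carrier BL"
        using SL_closed[OF LD.cg_addD ell_closed, of "\<lambda>x y. phi (x \<otimes>\<^bsub>A\<^esub> b) \<otimes>\<^bsub>D\<^esub> phi y"] a b
        by (simp add: L.D_mult_closed)
    qed (simp add: a p)
  qed (simp add: p)
  finally show ?thesis .
qed

lemma V_inj: "\<lbrakk>V \<phi> = V \<psi>; \<phi> \<in> carrier D; \<psi> \<in> carrier D\<rbrakk> \<Longrightarrow> \<phi> = \<psi>"
  by (metis W_V)

text \<open>After applying the injective anti-automorphism \<open>V\<close>, the sum becomes the
  right antipode sum of \<open>V \<phi>\<close>, which is already known.\<close>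

lemma antipode_left_dual:
  assumes p: "\<phi> \<in> carrier D"
  shows "LD.Rd.SR LD.addD (V \<phi>) (\<lambda>x y. V (W y) \<otimes>\<^bsub>D\<^esub> W x) = L.sd (\<phi> \<one>\<^bsub>A\<^esub>)"
proof (rule V_inj)
  note SR_closed_dual = LD.Rd.SR_closed[unfolded LD.Hd_sels]
  obtain b where b: "b \<in> carrier A" "\<phi> = phi b" using p by (rule dual_cases)
  show "LD.Rd.SR LD.addD (V \<phi>) (\<lambda>x y. V (W y) \<otimes>\<^bsub>D\<^esub> W x) \<in> carrier D"
    using SR_closed_dual[OF LD.cg_addD, of "V \<phi>" "\<lambda>x y. V (W y) \<otimes>\<^bsub>D\<^esub> W x"] p
    by (simp add: L.D_mult_closed)
  have "V (LD.Rd.SR LD.addD (V \<phi>) (\<lambda>x y. V (W y) \<otimes>\<^bsub>D\<^esub> W x))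
      = LD.Rd.SR LD.addD (V \<phi>) (\<lambda>x y. V (V (W y) \<otimes>\<^bsub>D\<^esub> W x))"
    by (rule LD.Rd.SR_hom[OF _ LD.cg_addD LD.cg_addD])
      (simp_all add: hom_def V_add L.D_mult_closed p Pi_iff)
  also have "\<dots> = LD.Rd.SR LD.addD (V \<phi>) (\<lambda>x y. x \<otimes>\<^bsub>D\<^esub> V y)"
    by (rule LD.Rd.SR_cong) (simp_all add: V_mult p)
  also have "\<dots> = L.td (V (V \<phi>) \<one>\<^bsub>A\<^esub>)"
    by (rule antipode_right_dual) (simp add: p)
  \<comment> \<open>The side condition of \<open>V_sd\<close> amounts to
    \<open>Lam (\<xi> (\<xi> b)) = \<xi> (S (Lam b))\<close>, which follows from
    \<open>Lam_xi_xi\<close> and \<open>xi_B\<close>.\<close>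
  also have "\<dots> = V (L.sd (\<phi> \<one>\<^bsub>A\<^esub>))"
    by (rule V_sd[symmetric]) (simp_all add: b tgt_phi src_phi Lam_xi_xi xi_B)
  finally show "V (LD.Rd.SR LD.addD (V \<phi>) (\<lambda>x y. V (W y) \<otimes>\<^bsub>D\<^esub> W x)) = V (L.sd (\<phi> \<one>\<^bsub>A\<^esub>))" .
qed (simp add: p)

theorem symmetrized_hopf_algebroid_dual:
  "symmetrized_hopf_algebroid Hl Hd (dual_antipode HL HR S ell)"
proof (intro symmetrized_hopf_algebroid.intro symmetrized_hopf_algebroid_axioms.intro
    Ld.left_bialgebroid_axioms LD.right_bialgebroid_dual)
  let ?V = "dual_antipode HL HR S ell"
  note V_eq = dual_antipode_eq
  show "total_ring Hd = total_ring Hl" by simp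
  show "src Hl ` carrier (base_ring Hl) = tgt Hd ` carrier (base_ring Hd)"
    "tgt Hl ` carrier (base_ring Hl) = src Hd ` carrier (base_ring Hd)" by (fact images_dual)+
  \<comment> \<open>In the dual the base rings have changed sides, so \<open>\<mu>\<close> is used
    with the opposite ring as its codomain.\<close>
  have "\<mu> \<in> ring_iso BL (opposite_ring BR)"
    unfolding ring_iso_def using mu_bij
    by (auto intro!: ring_hom_memI simp: opposite_ring_def mu_add mu_mult mu_one)
  then show "base_ring Hd \<simeq> opposite_ring (base_ring Hl)"
    by (auto simp: is_ring_iso_def)
  have "bij_betw ?V (carrier D) (carrier D)"
    by (rule bij_betw_byWitness[where f' = W]) (auto simp: V_eq)
  then show "?V \<in> iso (add_monoid (total_ring Hl)) (add_monoid (total_ring Hl))"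
    by (auto simp: iso_def hom_def V_eq V_add L.D_add_closed)
  fix \<phi> assume p': "\<phi> \<in> carrier (total_ring Hl)"
  then have p: "\<phi> \<in> carrier D" by simp
  let ?T = Pd.T3LR.T3
  have "tlift ?T (\<lambda>(x, y). tlift ?T (\<lambda>(u, v). tens ?T (u, v, y)) (comult Hl x)) (comult Hd \<phi>)
      = LD.Rd.SR ?T \<phi> (\<lambda>x y. Ld.SL ?T x (\<lambda>u v. tens ?T (u, v, y)))"
    by (rule Pd.b3LR_tlift(1)[OF Pd.T3LR.comm_group_T3 Pd.b3LR_tens p'])
  also have "\<dots> = Ld.SL ?T \<phi> (\<lambda>x y. LD.Rd.SR ?T y (\<lambda>u v. tens ?T (x, u, v)))"
    by (rule coassoc_LR_dual[OF Pd.T3LR.comm_group_T3 Pd.b3LR_tens p])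
  also have "\<dots> = tlift ?T (\<lambda>(x, y). tlift ?T (\<lambda>(u, v). tens ?T (x, u, v)) (comult Hd y)) (comult Hl \<phi>)"
    by (rule Pd.b3LR_tlift(2)[OF Pd.T3LR.comm_group_T3 Pd.b3LR_tens p', symmetric])
  finally show "let T3 = tensor3 (base_ring Hl) (base_ring Hd) (total_ring Hl) (L_ract Hl) (L_lact Hl)
        (total_ring Hl) (R_ract Hd) (R_lact Hd) (total_ring Hl)
      in tlift T3 (\<lambda>(x, y). tlift T3 (\<lambda>(u, v). tens T3 (u, v, y)) (comult Hl x)) (comult Hd \<phi>)
       = tlift T3 (\<lambda>(x, y). tlift T3 (\<lambda>(u, v). tens T3 (x, u, v)) (comult Hd y)) (comult Hl \<phi>)"
    unfolding Let_def Pd.total_rings .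
  let ?T = Pd.T3RL.T3
  have "tlift ?T (\<lambda>(x, y). tlift ?T (\<lambda>(u, v). tens ?T (u, v, y)) (comult Hd x)) (comult Hl \<phi>)
      = Ld.SL ?T \<phi> (\<lambda>x y. LD.Rd.SR ?T x (\<lambda>u v. tens ?T (u, v, y)))"
    by (rule Pd.b3RL_tlift(1)[OF Pd.T3RL.comm_group_T3 Pd.b3RL_tens p'])
  also have "\<dots> = LD.Rd.SR ?T \<phi> (\<lambda>x y. Ld.SL ?T y (\<lambda>u v. tens ?T (x, u, v)))"
    by (rule coassoc_RL_dual[OF Pd.T3RL.comm_group_T3 Pd.b3RL_tens p])
  also have "\<dots> = tlift ?T (\<lambda>(x, y). tlift ?T (\<lambda>(u, v). tens ?T (x, u, v)) (comult Hl y)) (comult Hd \<phi>)"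
    by (rule Pd.b3RL_tlift(2)[OF Pd.T3RL.comm_group_T3 Pd.b3RL_tens p', symmetric])
  finally show "let T3 = tensor3 (base_ring Hd) (base_ring Hl) (total_ring Hl) (R_ract Hd) (R_lact Hd)
        (total_ring Hl) (L_ract Hl) (L_lact Hl) (total_ring Hl)
      in tlift T3 (\<lambda>(x, y). tlift T3 (\<lambda>(u, v). tens T3 (u, v, y)) (comult Hd x)) (comult Hl \<phi>)
       = tlift T3 (\<lambda>(x, y). tlift T3 (\<lambda>(u, v). tens T3 (x, u, v)) (comult Hl y)) (comult Hd \<phi>)"
    unfolding Let_def Pd.total_rings .
  show "?V (tgt Hl r \<otimes>\<^bsub>total_ring Hl\<^esub> \<phi> \<otimes>\<^bsub>total_ring Hl\<^esub> tgt Hl r')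
      = src Hl r' \<otimes>\<^bsub>total_ring Hl\<^esub> ?V \<phi> \<otimes>\<^bsub>total_ring Hl\<^esub> src Hl r"
    if r: "r \<in> carrier (base_ring Hl)" "r' \<in> carrier (base_ring Hl)" for r r'
  proof -
    obtain l l' where "l \<in> carrier BL" "r = \<mu> l" "l' \<in> carrier BL" "r' = \<mu> l'"
      using r by (metis Hl_sels(2) mu_cases)
    then show ?thesis using p by (simp add: V_eq V_mult L.D_mult_closed LD.D.m_assoc)
  qed
  show "?V (tgt Hd l' \<otimes>\<^bsub>total_ring Hl\<^esub> \<phi> \<otimes>\<^bsub>total_ring Hl\<^esub> tgt Hd l)
      = src Hd l \<otimes>\<^bsub>total_ring Hl\<^esub> ?V \<phi> \<otimes>\<^bsub>total_ring Hl\<^esub> src Hd l'"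
    if "l \<in> carrier (base_ring Hd)" "l' \<in> carrier (base_ring Hd)" for l l'
    using that p by (simp add: V_eq V_mult L.D_mult_closed LD.D.m_assoc)
  have b1: "TL.bal LD.addD (\<lambda>x y. ?V x \<otimes>\<^bsub>D\<^esub> y)"
    by (rule TL_balI) (simp_all add: V_eq L.D_mult_closed L.D_add_closed balancedD(2,3)[OF bal_antipode_left, unfolded LD.addD_simps] TL_balD[OF bal_antipode_left])
  \<comment> \<open>\<open>SL_flip\<close> rewrites the sum over the left coproduct of
    \<open>\<phi>\<close> as one over the right coproduct of \<open>V \<phi>\<close>, the form
    treated in \<open>antipode_left_dual\<close>.\<close>
  have "tlift LD.addD (\<lambda>(x, y). ?V x \<otimes>\<^bsub>D\<^esub> y) (comult Hl \<phi>)
      = LD.Rd.SR LD.addD (V \<phi>) (\<lambda>x y. ?V (W y) \<otimes>\<^bsub>D\<^esub> W x)"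
    unfolding tlift_Hl[OF LD.cg_addD b1 p] by (rule SL_flip[OF LD.cg_addD b1 p])
  also have "\<dots> = LD.Rd.SR LD.addD (V \<phi>) (\<lambda>x y. V (W y) \<otimes>\<^bsub>D\<^esub> W x)"
    by (rule LD.Rd.SR_cong) (simp_all add: V_eq p)
  finally show "tlift (add_monoid (total_ring Hl)) (\<lambda>(x, y). ?V x \<otimes>\<^bsub>total_ring Hl\<^esub> y) (comult Hl \<phi>)
      = src Hd (counit Hd \<phi>)"
    by (simp only: Hl_sels LD.Hd_sels antipode_left_dual[OF p] LD.addD_def[symmetric])
  have b2: "LD.TD.bal LD.addD (\<lambda>x y. x \<otimes>\<^bsub>D\<^esub> ?V y)"
    by (rule LD.TD_bal_cong[OF bal_antipode_right]) (simp add: V_eq)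
  have "tlift LD.addD (\<lambda>(x, y). x \<otimes>\<^bsub>D\<^esub> ?V y) (comult Hd \<phi>) = LD.Rd.SR LD.addD \<phi> (\<lambda>x y. x \<otimes>\<^bsub>D\<^esub> ?V y)"
    unfolding LD.tlift_Hd[OF LD.cg_addD b2 p] by (rule LD.SR_dual[OF LD.cg_addD b2 p, symmetric])
  also have "\<dots> = LD.Rd.SR LD.addD \<phi> (\<lambda>x y. x \<otimes>\<^bsub>D\<^esub> V y)"
    by (rule LD.Rd.SR_cong) (simp_all add: V_eq p)
  also have "\<dots> = L.td (V \<phi> \<one>\<^bsub>A\<^esub>)" by (rule antipode_right_dual[OF p])
  also have "\<dots> = src Hl (counit Hl \<phi>)"
    using TW.counit'[of \<phi>] p by (simp del: Hl_sels(3))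
  finally show "tlift (add_monoid (total_ring Hl)) (\<lambda>(x, y). x \<otimes>\<^bsub>total_ring Hl\<^esub> ?V y) (comult Hd \<phi>)
      = src Hl (counit Hl \<phi>)"
    by (simp only: Hl_sels(1) LD.addD_def[symmetric])
qed

end

theorem theorem5p17:
  fixes HL :: "('a, 'l) bialgebroid" and HR :: "('a, 'r) bialgebroid"
    and S :: "'a \<Rightarrow> 'a" and ell :: 'a
  assumes "symmetrized_hopf_algebroid HL HR S"
    and "nondegenerate_left_integral HL HR ell"
  shows "xi HR S ell \<in> ring_iso (opposite_ring (total_ring HL)) (total_ring HL) \<and>
    mu HL HR \<in> ring_iso (opposite_ring (base_ring HL)) (base_ring HR) \<and>
    kappa HR ell \<in> ring_iso (base_ring HR) (base_ring HR) \<and>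
    left_bialgebroid (dual_left HL HR S ell) \<and>
    symmetrized_hopf_algebroid (dual_left HL HR S ell) (dual_right HL ell)
      (dual_antipode HL HR S ell)"
proof -
  interpret symmetrized_hopf_algebroid HL HR S by fact
  interpret nondegenerate_integral HL HR S ell
    by unfold_locales fact
  show ?thesis
    using xi_iso mu_iso kappa_iso Ld.left_bialgebroid_axioms symmetrized_hopf_algebroid_dual by blast
qed

end
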